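(* Let $\Omega\subset\mathbb{R}^n$ be a bounded and connected open set, let $1<p<\infty$, and let $X=(X_1,\dots,X_m)$ satisfy (LIC) on $\Omega$ and conditions (H1), (H2), (H3). Let $f_h,f\in I_{m,p}(\Omega,c_0,c_1,a_0,a_1)$ ($h\in\mathbb{N}$). Let $g:\Omega\times\mathbb{R}\to\mathbb{R}$ be a Carathéodory function for which there are constants $d_0,d_1$ and nonnegative $b_0,b_1\in L^1(\Omega)$ with $$d_0|s|^p-b_0(x)\le g(x,s)\le d_1|s|^p+b_1(x)\quad\text{for a.e. }x\in\Omega\text{ and every }s\in\mathbb{R},$$ $$d_1>0\quad\text{and}\quad -c_0\,c_{p,\Omega}<d_0\le d_1 .$$ Define $F_h,F:L^p(\Omega)\to\mathbb{R}\cup\{\infty\}$ by $F_h(u)=\int_\Omega f_h(x,Xu(x))\,dx$ and $F(u)=\int_\Omega f(x,Xu(x))\,dx$ if $u\in W^{1,p}_X(\Omega)$, and $F_h(u)=F(u)=\infty$ otherwise; and $G(u)=\int_\Omega g(x,u(x))\,dx$ for $u\in L^p(\Omega)$. Fix $\varphi\in W^{1,p}_X(\Omega)$ and define $\Xi_h^\varphi,\Xi^\varphi:L^p(\Omega)\to\mathbb{R}\cup\{\infty\}$ by $$\Xi_h^\varphi:=F_h+G+\mathbb{1}_\varphi,\qquad \Xi^\varphi:=F+G+\mathbb{1}_\varphi .$$ If $(F_h)_h$ $\Gamma$-converges to $F$ in the strong topology of $L^p(\Omega)$, then: (i) for each $h\in\mathbb{N}$, both $\Xi_h^\varphi$ and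 $\Xi^\varphi$ attain their minima in $L^p(\Omega)$, and $$\min_{u\in L^p(\Omega)}\Xi^\varphi(u)=\lim_{h\to\infty}\min_{u\in L^p(\Omega)}\Xi_h^\varphi(u);$$ (ii) if $(u_h)_h$ is a sequence of minimizers of $(\Xi_h^\varphi)_h$, that is, $\Xi_h^\varphi(u_h)=\min_{u\in L^p(\Omega)}\Xi_h^\varphi(u)$ for every $h\in\mathbb{N}$, then there exists $\bar u\in W^{1,p}_{X,\varphi}(\Omega)$ such that, up to subsequences, $u_h\to\bar u$ weakly in $W^{1,p}_X(\Omega)$ and strongly in $L^p(\Omega)$, and $$\Xi^\varphi(\bar u)=\min_{u\in L^p(\Omega)}\Xi^\varphi(u).$$
   Context: Vector fields. $X=(X_1,\dots,X_m)$ is a family of first-order operators $X_j(x)=\sum_{i=1}^n c_{ji}(x)\partial_i$, with $X_j$ identified with the vector field $(c_{j1},\dots,c_{jn})$. It is defined and Lipschitz continuous on an open neighborhood $\Omega_0$ of $\overline\Omega$ (coefficients being extended to locally Lipschitz functions on $\mathbb{R}^n$). (LIC) on $\Omega$: there is a set $\mathcal N_X\subset\Omega$, closed in the topology of $\Omega$, with Lebesgue measure $|\mathcal N_X|=0$, such that $X_1(x),\dots,X_m(x)$ are linearly independent vectors of $\mathbb{R}^n$ for every $x\in\Omega\setminus\mathcal N_X$. Carnot–Carathéodory distance: an absolutely continuous curve $\gamma:[0,T]\to\mathbb{R}^n$ is subunit if for a.e. $t$, $\langle\dot\gamma(t),\xi\rangle^2\le\sum_{j=1}^m\langle X_j(\gamma(t)),\xi\rangle^2$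 for all $\xi\in\mathbb{R}^n$; $d(x,y)\in[0,\infty]$ is the infimum of the $T\ge 0$ such that some subunit $\gamma:[0,T]\to\mathbb{R}^n$ joins $x$ to $y$ ($\inf\emptyset=\infty$). $B_d(x,r):=\{y\in\Omega_0: d(x,y)<r\}$. (H1) $d(x,y)<\infty$ for all $x,y\in\Omega_0$, so $d$ is a distance on $\Omega_0$, and $d$ is continuous with respect to the usual topology of $\mathbb{R}^n$. (H2) For every compact $K\subset\Omega_0$ there are $r_K>0$, $C_K>0$ with $|B_d(x,2r)|\le C_K|B_d(x,r)|$ for all $x\in K$, $r<r_K$. (H3) There are geometric constants $c,C>0$ such that for every ball $B=B_d(\bar x,r)$ with $cB:=B_d(\bar x,cr)\subseteq\Omega_0$, every $u\in\mathrm{Lip}(c\overline B)$ and every $x\in\overline B$, $$\Big|u(x)-\frac1{|B|}\int_B u(y)\,dy\Big|\le C\int_{cB}|Xu(y)|\frac{d(x,y)}{|B_d(x,d(x,y))|}\,dy .$$ Sobolev spaces. For $u\in L^1(\Omega)$, $X_ju$ is the distribution $\psi\mapsto-\int_\Omega u\sum_{i=1}^n\partial_i(c_{ji}\psi)\,dx$, $\psi\in C_c^\infty(\Omega)$, and $Xu=(X_1u,\dots,X_mu)$. $W^{1,p}_X(\Omega)=\{u\in L^p(\Omega): X_ju\in L^p(\Omega),\ j=1,\dots,m\}$ with norm $(\int_\Omega|u|^p+\int_\Omega|Xu|^p)^{1/p}$; $W^{1,p}_{X,0}(\Omega)$ is the closure of $C^1_c(\Omega)\cap W^{1,p}_X(\Omega)$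 in $W^{1,p}_X(\Omega)$; $W^{1,p}_{X,\varphi}(\Omega):=\varphi+W^{1,p}_{X,0}(\Omega)$. $\mathbb{1}_\varphi:L^p(\Omega)\to\{0,\infty\}$ equals $0$ on $W^{1,p}_{X,\varphi}(\Omega)$ and $\infty$ elsewhere. $c_{p,\Omega}>0$ denotes the best (largest) constant in the Poincaré inequality $c_{p,\Omega}\int_\Omega|u|^p\,dx\le\int_\Omega|Xu|^p\,dx$ for all $u\in W^{1,p}_{X,0}(\Omega)$. Integrands. For constants $0<c_0\le c_1$ and nonnegative $a_0,a_1\in L^1(\Omega)$, $I_{m,p}(\Omega,c_0,c_1,a_0,a_1)$ is the class of functions $f:\Omega\times\mathbb{R}^m\to\mathbb{R}$ that are Borel measurable, with $f(x,\cdot)$ convex for a.e. $x\in\Omega$, and $c_0|\eta|^p-a_0(x)\le f(x,\eta)\le c_1|\eta|^p+a_1(x)$ for a.e. $x\in\Omega$ and each $\eta\in\mathbb{R}^m$. $\Gamma$-convergence of $F_h$ to $F$ in the strong topology of $L^p(\Omega)$: for every $u\in L^p(\Omega)$, $F(u)\le\liminf_hF_h(u_h)$ for every $u_h\to u$ in $L^p(\Omega)$, and there exists $u_h\to u$ in $L^p(\Omega)$ with $F(u)=\lim_hF_h(u_h)$. *)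

theory Defs
  imports "HOL-Analysis.Analysis"
begin

section \<open>Vector fields and the Carnot--Caratheodory distance\<close>

text \<open>
  A family of vector fields is a map from points to \<open>m \<times> n\<close> matrices: \<open>X x $ j $ i\<close> is the
  coefficient \<open>c\<^sub>j\<^sub>i(x)\<close>, so that \<open>X x $ j\<close> is the vector \<open>X\<^sub>j(x)\<close>.
\<close>

type_synonym ('n, 'm) vfields = "real^'n \<Rightarrow> real^'n^'m"

definition loc_lipschitz :: "('n::finite, 'm::finite) vfields \<Rightarrow> bool" where
  "loc_lipschitz X \<longleftrightarrow> (\<forall>x. \<exists>e>0. \<exists>L. L-lipschitz_on (ball x e) X)"

text \<open>Linear independence of a family: injectivity excludes repeated vectors.\<close>

definition LIC :: "('n::finite, 'm::finite) vfields \<Rightarrow> (real^'n) set \<Rightarrow> bool" where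
  "LIC X \<Omega> \<longleftrightarrow> (\<exists>N\<subseteq>\<Omega>. closedin (top_of_set \<Omega>) N \<and> negligible N \<and>
     (\<forall>x\<in>\<Omega> - N. inj (\<lambda>j. X x $ j) \<and> independent (range (\<lambda>j. X x $ j))))"

definition absolutely_continuous_on :: "real set \<Rightarrow> (real \<Rightarrow> 'a::real_normed_vector) \<Rightarrow> bool" where
  "absolutely_continuous_on S f \<longleftrightarrow>
     (\<forall>e>0. \<exists>\<delta>>0. \<forall>D T. D division_of T \<and> T \<subseteq> S \<and> (\<Sum>k\<in>D. Sup k - Inf k) < \<delta> \<longrightarrow>
        (\<Sum>k\<in>D. norm (f (Sup k) - f (Inf k))) < e)"

definition subunit :: "('n::finite, 'm::finite) vfields \<Rightarrow> real \<Rightarrow> (real \<Rightarrow> real^'n) \<Rightarrow> bool" where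
  "subunit X T \<gamma> \<longleftrightarrow> absolutely_continuous_on {0..T} \<gamma> \<and>
     (AE t in lebesgue_on {0..T}. \<exists>v. (\<gamma> has_vector_derivative v) (at t within {0..T}) \<and>
        (\<forall>\<xi>. (v \<bullet> \<xi>)\<^sup>2 \<le> (\<Sum>j\<in>UNIV. (X (\<gamma> t) $ j \<bullet> \<xi>)\<^sup>2)))"

definition cc_dist :: "('n::finite, 'm::finite) vfields \<Rightarrow> real^'n \<Rightarrow> real^'n \<Rightarrow> ennreal" where
  "cc_dist X x y = (INF T\<in>{T. 0 \<le> T \<and> (\<exists>\<gamma>. subunit X T \<gamma> \<and> \<gamma> 0 = x \<and> \<gamma> T = y)}. ennreal T)"

definition cc_ball :: "('n::finite, 'm::finite) vfields \<Rightarrow> (real^'n) set \<Rightarrow> real^'n \<Rightarrow> ennreal \<Rightarrow> (real^'n) set"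
  where "cc_ball X \<Omega>0 x r = {y\<in>\<Omega>0. cc_dist X x y < r}"

definition H1 :: "('n::finite, 'm::finite) vfields \<Rightarrow> (real^'n) set \<Rightarrow> bool" where
  "H1 X \<Omega>0 \<longleftrightarrow> (\<forall>x\<in>\<Omega>0. \<forall>y\<in>\<Omega>0. cc_dist X x y < \<infinity>) \<and>
     continuous_on (\<Omega>0 \<times> \<Omega>0) (\<lambda>(x, y). cc_dist X x y)"

definition H2 :: "('n::finite, 'm::finite) vfields \<Rightarrow> (real^'n) set \<Rightarrow> bool" where
  "H2 X \<Omega>0 \<longleftrightarrow> (\<forall>K. compact K \<and> K \<subseteq> \<Omega>0 \<longrightarrow>
     (\<exists>rK>0. \<exists>CK>0. \<forall>x\<in>K. \<forall>r. 0 < r \<and> r < rK \<longrightarrow>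
        emeasure lebesgue (cc_ball X \<Omega>0 x (ennreal (2 * r)))
          \<le> ennreal CK * emeasure lebesgue (cc_ball X \<Omega>0 x (ennreal r))))"

definition partial_deriv :: "'n::finite \<Rightarrow> (real^'n \<Rightarrow> real) \<Rightarrow> real^'n \<Rightarrow> real" where
  "partial_deriv i u x = deriv (\<lambda>t. u (x + t *\<^sub>R axis i 1)) 0"

text \<open>
  The pointwise \<open>Xu = (\<Sum>\<^sub>i c\<^sub>j\<^sub>i \<partial>\<^sub>iu)\<^sub>j\<close>; for a Lipschitz function \<open>u\<close> on an open set the partial
  derivatives exist almost everywhere.
\<close>

definition X_pointwise :: "('n::finite, 'm::finite) vfields \<Rightarrow> (real^'n \<Rightarrow> real) \<Rightarrow> real^'n \<Rightarrow> real^'m" where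
  "X_pointwise X u x = (\<chi> j. \<Sum>i\<in>UNIV. X x $ j $ i * partial_deriv i u x)"

text \<open>
  The side condition \<open>cB \<subseteq> \<Omega>\<^sub>0\<close> is imposed on the ball of the whole space: \<^const>\<open>cc_ball\<close> is cut
  down to \<open>\<Omega>\<^sub>0\<close>, so for it the inclusion would hold trivially. When it holds, both descriptions of
  \<open>cB\<close> agree. The closed ball \<open>B\<close> is the closure relative to \<open>\<Omega>\<^sub>0\<close>, where the distance is finite.
\<close>

definition H3 :: "('n::finite, 'm::finite) vfields \<Rightarrow> (real^'n) set \<Rightarrow> bool" where
  "H3 X \<Omega>0 \<longleftrightarrow> (\<exists>c>0. \<exists>C>0. \<forall>z\<in>\<Omega>0. \<forall>r>0.
     {y. cc_dist X z y < ennreal (c * r)} \<subseteq> \<Omega>0 \<longrightarrow>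
     (let B = cc_ball X \<Omega>0 z (ennreal r); cB = cc_ball X \<Omega>0 z (ennreal (c * r)) in
      \<forall>u. (\<exists>L. L-lipschitz_on (closure cB) u) \<longrightarrow>
        (\<forall>x\<in>closure B \<inter> \<Omega>0.
           ennreal \<bar>u x - (1 / measure lebesgue B) * (LINT y|lebesgue_on B. u y)\<bar>
             \<le> ennreal C * (\<integral>\<^sup>+ y. ennreal (norm (X_pointwise X u y)) *
                  (cc_dist X x y / emeasure lebesgue (cc_ball X \<Omega>0 x (cc_dist X x y)))
                  \<partial>(lebesgue_on cB)))))"


section \<open>Function spaces\<close>

text \<open>
  Elements of the function spaces on \<open>\<Omega>\<close> are represented by functions on the whole space, of which
  only the values on \<open>\<Omega>\<close> matter, up to null sets.
\<close>

definition Lp :: "(real^'n::finite) set \<Rightarrow> real \<Rightarrow> (real^'n \<Rightarrow> real) set" where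
  "Lp \<Omega> p = {u. u \<in> borel_measurable (lebesgue_on \<Omega>) \<and>
                integrable (lebesgue_on \<Omega>) (\<lambda>x. \<bar>u x\<bar> powr p)}"

definition Lp_norm :: "(real^'n::finite) set \<Rightarrow> real \<Rightarrow> (real^'n \<Rightarrow> real) \<Rightarrow> real" where
  "Lp_norm \<Omega> p u = (LINT x|lebesgue_on \<Omega>. \<bar>u x\<bar> powr p) powr (1 / p)"

definition Lp_converges ::
  "(real^'n::finite) set \<Rightarrow> real \<Rightarrow> (nat \<Rightarrow> real^'n \<Rightarrow> real) \<Rightarrow> (real^'n \<Rightarrow> real) \<Rightarrow> bool" where
  "Lp_converges \<Omega> p us u \<longleftrightarrow> (\<forall>h. us h \<in> Lp \<Omega> p) \<and> u \<in> Lp \<Omega> p \<and>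
     (\<lambda>h. Lp_norm \<Omega> p (\<lambda>x. us h x - u x)) \<longlonglongrightarrow> 0"

primrec Ck :: "nat \<Rightarrow> (real^'n::finite \<Rightarrow> real) \<Rightarrow> bool" where
  "Ck 0 u \<longleftrightarrow> continuous_on UNIV u"
| "Ck (Suc k) u \<longleftrightarrow> (\<forall>x. u differentiable (at x)) \<and> (\<forall>i. Ck k (partial_deriv i u))"

definition compactly_supported :: "(real^'n::finite) set \<Rightarrow> (real^'n \<Rightarrow> real) \<Rightarrow> bool" where
  "compactly_supported \<Omega> u \<longleftrightarrow> compact (closure {x. u x \<noteq> 0}) \<and> closure {x. u x \<noteq> 0} \<subseteq> \<Omega>"

definition C1c :: "(real^'n::finite) set \<Rightarrow> (real^'n \<Rightarrow> real) set" where
  "C1c \<Omega> = {u. Ck 1 u \<and> compactly_supported \<Omega> u}"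

definition test_functions :: "(real^'n::finite) set \<Rightarrow> (real^'n \<Rightarrow> real) set" where
  "test_functions \<Omega> = {\<psi>. (\<forall>k. Ck k \<psi>) \<and> compactly_supported \<Omega> \<psi>}"

text \<open>
  The distribution \<open>Xu\<close> on \<open>\<Omega>\<close> is represented by the locally integrable function \<open>V\<close>. The partial
  derivatives of \<open>c\<^sub>j\<^sub>i \<psi>\<close> exist almost everywhere because the coefficients are locally Lipschitz.
\<close>

definition is_Xgrad ::
  "('n::finite, 'm::finite) vfields \<Rightarrow> (real^'n) set \<Rightarrow> (real^'n \<Rightarrow> real) \<Rightarrow> (real^'n \<Rightarrow> real^'m) \<Rightarrow> bool" where
  "is_Xgrad X \<Omega> u V \<longleftrightarrow>
     (\<forall>K. compact K \<and> K \<subseteq> \<Omega> \<longrightarrow> integrable (lebesgue_on K) V) \<and>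
     (\<forall>j. \<forall>\<psi>\<in>test_functions \<Omega>.
        (LINT x|lebesgue_on \<Omega>. V x $ j * \<psi> x) =
        - (LINT x|lebesgue_on \<Omega>. u x * (\<Sum>i\<in>UNIV. partial_deriv i (\<lambda>y. X y $ j $ i * \<psi> y) x)))"

text \<open>Unique up to null sets when it exists.\<close>

definition Xgrad ::
  "('n::finite, 'm::finite) vfields \<Rightarrow> (real^'n) set \<Rightarrow> (real^'n \<Rightarrow> real) \<Rightarrow> real^'n \<Rightarrow> real^'m" where
  "Xgrad X \<Omega> u = (SOME V. is_Xgrad X \<Omega> u V)"

definition W1p ::
  "('n::finite, 'm::finite) vfields \<Rightarrow> (real^'n) set \<Rightarrow> real \<Rightarrow> (real^'n \<Rightarrow> real) set" where
  "W1p X \<Omega> p = {u \<in> Lp \<Omega> p. \<exists>V. is_Xgrad X \<Omega> u V \<and> (\<forall>j. (\<lambda>x. V x $ j) \<in> Lp \<Omega> p)}"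

definition W1p_norm ::
  "('n::finite, 'm::finite) vfields \<Rightarrow> (real^'n) set \<Rightarrow> real \<Rightarrow> (real^'n \<Rightarrow> real) \<Rightarrow> real" where
  "W1p_norm X \<Omega> p u = ((LINT x|lebesgue_on \<Omega>. \<bar>u x\<bar> powr p) +
     (LINT x|lebesgue_on \<Omega>. norm (Xgrad X \<Omega> u x) powr p)) powr (1 / p)"

definition W1p0 ::
  "('n::finite, 'm::finite) vfields \<Rightarrow> (real^'n) set \<Rightarrow> real \<Rightarrow> (real^'n \<Rightarrow> real) set" where
  "W1p0 X \<Omega> p = {u \<in> W1p X \<Omega> p. \<forall>e>0. \<exists>\<psi>\<in>C1c \<Omega> \<inter> W1p X \<Omega> p. W1p_norm X \<Omega> p (\<lambda>x. u x - \<psi> x) < e}"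

definition W1p_bdry ::
  "('n::finite, 'm::finite) vfields \<Rightarrow> (real^'n) set \<Rightarrow> real \<Rightarrow> (real^'n \<Rightarrow> real) \<Rightarrow> (real^'n \<Rightarrow> real) set" where
  "W1p_bdry X \<Omega> p \<phi> = (\<lambda>w x. \<phi> x + w x) ` W1p0 X \<Omega> p"

text \<open>
  Bounded linear functionals on \<open>W\<^sup>1\<^sup>,\<^sup>p\<^sub>X(\<Omega>)\<close>. Boundedness makes their values independent of the
  representative.
\<close>

definition W1p_dual ::
  "('n::finite, 'm::finite) vfields \<Rightarrow> (real^'n) set \<Rightarrow> real \<Rightarrow> ((real^'n \<Rightarrow> real) \<Rightarrow> real) set" where
  "W1p_dual X \<Omega> p = {L.
     (\<forall>u\<in>W1p X \<Omega> p. \<forall>v\<in>W1p X \<Omega> p. \<forall>a b. L (\<lambda>x. a * u x + b * v x) = a * L u + b * L v) \<and>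
     (\<exists>K. \<forall>u\<in>W1p X \<Omega> p. \<bar>L u\<bar> \<le> K * W1p_norm X \<Omega> p u)}"

definition W1p_converges_weakly ::
  "('n::finite, 'm::finite) vfields \<Rightarrow> (real^'n) set \<Rightarrow> real \<Rightarrow> (nat \<Rightarrow> real^'n \<Rightarrow> real) \<Rightarrow> (real^'n \<Rightarrow> real) \<Rightarrow> bool"
  where
  "W1p_converges_weakly X \<Omega> p us u \<longleftrightarrow> (\<forall>h. us h \<in> W1p X \<Omega> p) \<and> u \<in> W1p X \<Omega> p \<and>
     (\<forall>L\<in>W1p_dual X \<Omega> p. (\<lambda>h. L (us h)) \<longlonglongrightarrow> L u)"

text \<open>
  For nonempty \<open>\<Omega>\<close> the supremum is finite and attained. It is infinite for empty \<open>\<Omega>\<close>.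
\<close>

definition poincare_const :: "('n::finite, 'm::finite) vfields \<Rightarrow> (real^'n) set \<Rightarrow> real \<Rightarrow> ereal" where
  "poincare_const X \<Omega> p = (SUP c\<in>{c. 0 \<le> c \<and> (\<forall>u\<in>W1p0 X \<Omega> p.
     c * (LINT x|lebesgue_on \<Omega>. \<bar>u x\<bar> powr p) \<le> (LINT x|lebesgue_on \<Omega>. norm (Xgrad X \<Omega> u x) powr p))}.
     ereal c)"


section \<open>Integrands and functionals\<close>

definition nonneg_L1 :: "(real^'n::finite) set \<Rightarrow> (real^'n \<Rightarrow> real) \<Rightarrow> bool" where
  "nonneg_L1 \<Omega> a \<longleftrightarrow> integrable (lebesgue_on \<Omega>) a \<and> (AE x in lebesgue_on \<Omega>. 0 \<le> a x)"

definition integrands :: "(real^'n::finite) set \<Rightarrow> real \<Rightarrow> real \<Rightarrow> real \<Rightarrow> (real^'n \<Rightarrow> real) \<Rightarrow> (real^'n \<Rightarrow> real)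
    \<Rightarrow> (real^'n \<Rightarrow> real^'m::finite \<Rightarrow> real) set" where
  "integrands \<Omega> p c0 c1 a0 a1 = {f.
     (\<lambda>(x, \<eta>). f x \<eta>) \<in> borel_measurable (restrict_space borel (\<Omega> \<times> UNIV)) \<and>
     (AE x in lebesgue_on \<Omega>. convex_on UNIV (f x)) \<and>
     (AE x in lebesgue_on \<Omega>. \<forall>\<eta>. c0 * norm \<eta> powr p - a0 x \<le> f x \<eta> \<and> f x \<eta> \<le> c1 * norm \<eta> powr p + a1 x)}"

definition caratheodory :: "(real^'n::finite) set \<Rightarrow> (real^'n \<Rightarrow> real \<Rightarrow> real) \<Rightarrow> bool" where
  "caratheodory \<Omega> g \<longleftrightarrow> (\<forall>s. (\<lambda>x. g x s) \<in> borel_measurable (lebesgue_on \<Omega>)) \<and>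
     (AE x in lebesgue_on \<Omega>. continuous_on UNIV (g x))"

definition X_functional :: "('n::finite, 'm::finite) vfields \<Rightarrow> (real^'n) set \<Rightarrow> real
    \<Rightarrow> (real^'n \<Rightarrow> real^'m \<Rightarrow> real) \<Rightarrow> (real^'n \<Rightarrow> real) \<Rightarrow> ereal" where
  "X_functional X \<Omega> p f u =
     (if u \<in> W1p X \<Omega> p then ereal (LINT x|lebesgue_on \<Omega>. f x (Xgrad X \<Omega> u x)) else \<infinity>)"

definition lower_order_functional ::
  "(real^'n::finite) set \<Rightarrow> (real^'n \<Rightarrow> real \<Rightarrow> real) \<Rightarrow> (real^'n \<Rightarrow> real) \<Rightarrow> ereal" where
  "lower_order_functional \<Omega> g u = ereal (LINT x|lebesgue_on \<Omega>. g x (u x))"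

definition bdry_indicator :: "('n::finite, 'm::finite) vfields \<Rightarrow> (real^'n) set \<Rightarrow> real
    \<Rightarrow> (real^'n \<Rightarrow> real) \<Rightarrow> (real^'n \<Rightarrow> real) \<Rightarrow> ereal" where
  "bdry_indicator X \<Omega> p \<phi> u = (if u \<in> W1p_bdry X \<Omega> p \<phi> then 0 else \<infinity>)"

definition \<Xi> :: "('n::finite, 'm::finite) vfields \<Rightarrow> (real^'n) set \<Rightarrow> real
    \<Rightarrow> (real^'n \<Rightarrow> real^'m \<Rightarrow> real) \<Rightarrow> (real^'n \<Rightarrow> real \<Rightarrow> real) \<Rightarrow> (real^'n \<Rightarrow> real)
    \<Rightarrow> (real^'n \<Rightarrow> real) \<Rightarrow> ereal" where
  "\<Xi> X \<Omega> p f g \<phi> u =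
     X_functional X \<Omega> p f u + lower_order_functional \<Omega> g u + bdry_indicator X \<Omega> p \<phi> u"

definition gamma_converges_Lp :: "(real^'n::finite) set \<Rightarrow> real
    \<Rightarrow> (nat \<Rightarrow> (real^'n \<Rightarrow> real) \<Rightarrow> ereal) \<Rightarrow> ((real^'n \<Rightarrow> real) \<Rightarrow> ereal) \<Rightarrow> bool" where
  "gamma_converges_Lp \<Omega> p Fh F \<longleftrightarrow> (\<forall>u\<in>Lp \<Omega> p.
     (\<forall>us. Lp_converges \<Omega> p us u \<longrightarrow> F u \<le> liminf (\<lambda>h. Fh h (us h))) \<and>
     (\<exists>us. Lp_converges \<Omega> p us u \<and> (\<lambda>h. Fh h (us h)) \<longlonglongrightarrow> F u))"

definition minimizer_Lp :: "(real^'n::finite) set \<Rightarrow> real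
    \<Rightarrow> ((real^'n \<Rightarrow> real) \<Rightarrow> ereal) \<Rightarrow> (real^'n \<Rightarrow> real) \<Rightarrow> bool" where
  "minimizer_Lp \<Omega> p J u \<longleftrightarrow> is_arg_min J (\<lambda>v. v \<in> Lp \<Omega> p) u"

end

theory Submission
  imports Defs "HOL-Complex_Analysis.Great_Picard"
begin

text \<open>
  By the Poincare inequality the functionals are coercive, so minimizers are bounded in
  \<open>W\<^sup>1\<^sup>,\<^sup>p\<^sub>X\<close>. Bounded sets of \<open>W\<^sup>1\<^sup>,\<^sup>p\<^sub>X\<^sub>,\<^sub>0\<close> are precompact in \<open>L\<^sup>p\<close>: (H3) bounds the oscillation
  of a function on a small ball by a potential of its gradient, and by doubling the Schur norm of the
  truncated kernel is of the order of the radius. Weak limits need no duality theory, because uniform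
  convexity of \<open>L\<^sup>p\<close> produces strongly convergent sequences from nested midpoint-convex sets.
  The boundary datum is imposed on a recovery sequence \<open>u\<^sub>h\<close> of \<open>u\<close> by the cut-off
  \<open>u + \<zeta> (u\<^sub>h - u)\<close>. Friedrichs mollification puts \<open>\<zeta> (u\<^sub>h - u)\<close> in \<open>W\<^sup>1\<^sup>,\<^sup>p\<^sub>X\<^sub>,\<^sub>0\<close>, convexity of the
  integrands absorbs the error \<open>(u\<^sub>h - u) X\<zeta>\<close>, and the cost of the region where \<open>\<zeta> < 1\<close> is
  arbitrarily small. Gamma-convergence then gives the limit of the minima in the usual way.
\<close>

section \<open>Spaces of p-integrable functions\<close>

text \<open>Gamma-convergence of the principal parts says nothing about boundary values: a recovery
  sequence need not lie in the boundary class and has to be modified near the boundary at a cost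
  that vanishes uniformly in the integrands. The product of a cut-off with a Sobolev function has
  compact support, but it is not yet a limit of \<open>C1c\<close> functions. Mollifying it commutes
  with the vector fields up to an error that is bounded independently of the scale, because
  Lipschitz coefficients vary by the order of the scale while derivatives of the mollifier grow like
  its inverse. Such a bound suffices: a bounded sequence in a midpoint-stable class that converges
  in L^p can be exchanged for one in the same class whose gradients converge strongly. The same
  exchange gives lower semicontinuity and closedness of the boundary class. The side condition of
  (H3) concerns balls of the whole space; a speed bound for subunit curves keeps small balls centred
  in the closure of \<open>\<Omega>\<close> inside \<open>\<Omega>0\<close>. The strict inequality
  for \<open>d0\<close> pays for the loss in the triangle inequality when the Poincare inequality is
  applied to \<open>u - \<phi>\<close>.\<close>

definition LpV :: "'a measure \<Rightarrow> real \<Rightarrow> ('a \<Rightarrow> 'b::euclidean_space) set" where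
  "LpV M p = {f \<in> borel_measurable M. integrable M (\<lambda>x. norm (f x) powr p)}"

text \<open>The p-th power of the L^p norm. Without the root every quantity stays an integral, and
  the factor \<open>2 powr p\<close> takes the part of the triangle inequality. The Euclidean
  codomain serves functions and gradients at once.\<close>

definition pint :: "'a measure \<Rightarrow> real \<Rightarrow> ('a \<Rightarrow> 'b::euclidean_space) \<Rightarrow> real" where
  "pint M p f = (LINT x|M. norm (f x) powr p)"

lemma LpV_measurable: "f \<in> LpV M p \<Longrightarrow> f \<in> borel_measurable M"
  by (simp add: LpV_def)

lemma LpV_integrable: "f \<in> LpV M p \<Longrightarrow> integrable M (\<lambda>x. norm (f x) powr p)"
  by (simp add: LpV_def)

lemma pint_nonneg: "0 \<le> pint M p f"
  unfolding pint_def by (rule integral_nonneg_AE) simp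

section \<open>Convexity of powers of the norm\<close>

lemma norm_powr_add_le:
  fixes a b :: "'b::real_normed_vector"
  assumes "0 \<le> p"
  shows "norm (a + b) powr p \<le> 2 powr p * (norm a powr p + norm b powr p)"
proof -
  let ?m = "max (norm a) (norm b)"
  have "norm (a + b) \<le> 2 * ?m"
    using norm_triangle_ineq[of a b] by linarith
  then have "norm (a + b) powr p \<le> (2 * ?m) powr p"
    by (intro powr_mono2) (use assms in auto)
  also have "\<dots> = 2 powr p * ?m powr p"
    by (simp add: powr_mult)
  also have "?m powr p \<le> norm a powr p + norm b powr p"
    by (simp add: max_def)
  finally show ?thesis by simp
qed

text \<open>A convex function lies above its tangent at \<open>l\<close>. The derivative is
  available on the open half-line only, so \<open>s = 0\<close> is computed by hand. The same
  inequality serves as a pointwise form of Hoelder's inequality in the Schur test.\<close>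

lemma powr_tangent_le:
  fixes s l p :: real
  assumes "1 \<le> p" "0 \<le> s" "0 < l"
  shows "l powr p + p * l powr (p - 1) * (s - l) \<le> s powr p"
proof (cases "s = 0")
  case True
  have "l powr p = l powr (p - 1) * l"
    using assms by (simp add: powr_diff)
  then have "l powr p + p * l powr (p - 1) * (s - l) = (1 - p) * l powr p"
    using True by (simp add: algebra_simps)
  then show ?thesis using True assms by (simp add: mult_nonpos_nonneg)
next
  case False
  have "(\<lambda>x. p * x powr (p - 1)) l * (s - l) \<le> s powr p - l powr p"
  proof (rule convex_on_imp_above_tangent[where A = "{0<..}"])
    show "convex_on {0<..} (\<lambda>x. x powr p)" by (rule powr_convex) fact
    have "((\<lambda>x. x powr p) has_real_derivative p * l powr (p - 1)) (at l)"
      using assms by (auto intro!: derivative_eq_intros)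
    then show "((\<lambda>x. x powr p) has_real_derivative p * l powr (p - 1)) (at l within {0<..})"
      by (rule has_field_derivative_at_within)
  qed (use assms False in \<open>auto simp: interior_open\<close>)
  then show ?thesis by simp
qed

text \<open>Averaging the tangent inequalities at the convex combination cancels their linear
  terms.\<close>

lemma convex_powr_nonneg:
  fixes s t a p :: real
  assumes "1 \<le> p" "0 \<le> s" "0 \<le> t" "0 \<le> a" "a \<le> 1"
  shows "(a * s + (1 - a) * t) powr p \<le> a * s powr p + (1 - a) * t powr p"
proof -
  let ?l = "a * s + (1 - a) * t"
  have l0: "0 \<le> ?l" using assms by simp
  show ?thesis
  proof (cases "?l = 0")
    case True
    then show ?thesis using assms by simp
  next
    case False
    then have l: "0 < ?l" using l0 by simp
    have 1: "a * (?l powr p + p * ?l powr (p - 1) * (s - ?l)) \<le> a * s powr p"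
      using powr_tangent_le[OF assms(1,2) l] assms by (intro mult_left_mono) auto
    have 2: "(1 - a) * (?l powr p + p * ?l powr (p - 1) * (t - ?l)) \<le> (1 - a) * t powr p"
      using powr_tangent_le[OF assms(1,3) l] assms by (intro mult_left_mono) auto
    have "a * (?l powr p + p * ?l powr (p - 1) * (s - ?l)) + (1 - a) * (?l powr p + p * ?l powr (p - 1) * (t - ?l))
        = ?l powr p + p * ?l powr (p - 1) * (a * s + (1 - a) * t - ?l)"
      by (simp add: algebra_simps)
    also have "\<dots> = ?l powr p" by simp
    finally show ?thesis using 1 2 by linarith
  qed
qed

lemma convex_on_norm_powr:
  assumes "1 \<le> p"
  shows "convex_on UNIV (\<lambda>x::'b::real_normed_vector. norm x powr p)"
proof (rule convex_onI)
  fix t :: real and x y :: 'b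
  assume t: "0 < t" "t < 1"
  have "norm ((1 - t) *\<^sub>R x + t *\<^sub>R y) \<le> (1 - t) * norm x + (1 - (1 - t)) * norm y"
    using t norm_triangle_ineq[of "(1 - t) *\<^sub>R x" "t *\<^sub>R y"] by simp
  then have "norm ((1 - t) *\<^sub>R x + t *\<^sub>R y) powr p \<le> ((1 - t) * norm x + (1 - (1 - t)) * norm y) powr p"
    by (intro powr_mono2) (use assms in auto)
  also have "\<dots> \<le> (1 - t) * norm x powr p + (1 - (1 - t)) * norm y powr p"
    by (rule convex_powr_nonneg) (use t assms in auto)
  finally show "norm ((1 - t) *\<^sub>R x + t *\<^sub>R y) powr p \<le> (1 - t) * norm x powr p + t * norm y powr p"
    by simp
qed simp

lemma convex_norm_powr_midpoint:
  fixes a b :: "'b::real_normed_vector"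
  assumes "1 \<le> p"
  shows "norm ((1/2) *\<^sub>R (a + b)) powr p \<le> (norm a powr p + norm b powr p) / 2"
  using convex_onD[OF convex_on_norm_powr[OF assms, where 'b = 'b], of "1/2" a b]
  by (simp add: scaleR_add_right)

text \<open>For equal norms the parallelogram law makes the midpoint strictly shorter. For different
  norms the triangle inequality reduces the claim to strict convexity of the real power: mean value
  theorem above the centre, tangent line below it.\<close>

lemma strict_convex_norm_powr_midpoint:
  fixes a b :: "'b::real_inner"
  assumes p: "1 < p" and ab: "a \<noteq> b"
  shows "norm ((1/2) *\<^sub>R (a + b)) powr p < (norm a powr p + norm b powr p) / 2"
proof -
  have key: "((s + t) / 2) powr p < (s powr p + t powr p) / 2" if "0 \<le> s" "s < t" for s t :: real
  proof -
    let ?l = "(s + t) / 2"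
    have lt: "?l < t" "0 < ?l" using that by auto
    have "\<exists>z>?l. z < t \<and> t powr p - ?l powr p = (t - ?l) * (p * z powr (p - 1))"
      using lt by (intro MVT2) (auto intro!: derivative_eq_intros)
    then obtain z where z: "z > ?l" "z < t" "t powr p - ?l powr p = (t - ?l) * (p * z powr (p - 1))"
      by blast
    have "?l powr (p - 1) < z powr (p - 1)"
      using z lt p by (intro powr_less_mono2) auto
    then have "(t - ?l) * (p * ?l powr (p - 1)) < (t - ?l) * (p * z powr (p - 1))"
      using lt p by (intro mult_strict_left_mono) auto
    then have 1: "(t - ?l) * (p * ?l powr (p - 1)) < t powr p - ?l powr p" using z by simp
    have 2: "?l powr p + p * ?l powr (p - 1) * (s - ?l) \<le> s powr p"
      using that lt p by (intro powr_tangent_le) auto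
    have "p * ?l powr (p - 1) * (s - ?l) = - ((t - ?l) * (p * ?l powr (p - 1)))"
      by (simp add: field_simps)
    then show ?thesis using 1 2 by (simp add: field_simps)
  qed
  have le: "norm ((1/2) *\<^sub>R (a + b)) \<le> (norm a + norm b) / 2"
    using norm_triangle_ineq[of a b] by simp
  consider "norm a = norm b" | "norm a < norm b" | "norm b < norm a" by linarith
  then show ?thesis
  proof cases
    case 1
    have "(norm (a + b))\<^sup>2 + (norm (a - b))\<^sup>2 = 2 * (norm a)\<^sup>2 + 2 * (norm b)\<^sup>2"
      by (simp add: power2_norm_eq_inner inner_add_left inner_diff_left inner_add_right inner_diff_right inner_commute)
    moreover have "0 < (norm (a - b))\<^sup>2" using ab by simp
    ultimately have "(norm (a + b))\<^sup>2 < (2 * norm a)\<^sup>2" using 1 by (simp add: power2_eq_square)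
    then have "norm (a + b) < 2 * norm a" by (rule power2_less_imp_less) simp
    then have "norm ((1/2) *\<^sub>R (a + b)) < norm a" by simp
    then have "norm ((1/2) *\<^sub>R (a + b)) powr p < norm a powr p"
      using p by (intro powr_less_mono2) auto
    then show ?thesis using 1 by simp
  next
    case 2
    have "norm ((1/2) *\<^sub>R (a + b)) powr p \<le> ((norm a + norm b) / 2) powr p"
      by (intro powr_mono2 le) (use p in auto)
    with key[OF _ 2] show ?thesis by fastforce
  next
    case 3
    have "norm ((1/2) *\<^sub>R (a + b)) powr p \<le> ((norm b + norm a) / 2) powr p"
      by (intro powr_mono2) (use p le in auto)
    with key[OF _ 3] show ?thesis by fastforce
  qed
qed

lemma continuous_on_norm_powr:
  fixes f :: "'a::topological_space \<Rightarrow> 'b::real_normed_vector"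
  assumes "continuous_on S f" "0 < p"
  shows "continuous_on S (\<lambda>x. norm (f x) powr p)"
  by (rule continuous_on_powr') (use assms in \<open>auto intro: continuous_intros\<close>)

text \<open>Everything is homogeneous of degree \<open>p\<close> in the pair, so it suffices to look
  at pairs with \<open>N z = 1\<close>, a compact set. Where the distance term is at least
  \<open>e\<close>, the convexity defect \<open>D\<close> has a positive minimum by strict
  convexity; elsewhere the term with \<open>e\<close> alone is enough.\<close>

lemma uniform_convexity_pointwise:
  assumes p: "1 < p" and e: "0 < e"
  obtains C where "0 \<le> C"
    "\<And>a b::'b::euclidean_space. norm (a - b) powr p \<le> e * (norm a powr p + norm b powr p)
       + C * ((norm a powr p + norm b powr p) / 2 - norm ((1/2) *\<^sub>R (a + b)) powr p)"
proof -
  define N where "N = (\<lambda>z::'b\<times>'b. norm (fst z) powr p + norm (snd z) powr p)"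
  define D where "D = (\<lambda>z::'b\<times>'b. N z / 2 - norm ((1/2) *\<^sub>R (fst z + snd z)) powr p)"
  define E where "E = (\<lambda>z::'b\<times>'b. norm (fst z - snd z) powr p)"
  define K where "K = {z. N z = 1 \<and> e \<le> E z}"
  have cont: "continuous_on UNIV N" "continuous_on UNIV D" "continuous_on UNIV E"
    unfolding N_def D_def E_def using p
    by (intro continuous_intros continuous_on_norm_powr; simp)+
  have le1: "s \<le> 1" if "s powr p \<le> 1" "0 \<le> s" for s :: real
  proof (rule ccontr)
    assume "\<not> s \<le> 1"
    then have "1 powr p < s powr p" using p by (intro powr_less_mono2) auto
    then show False using that by simp
  qed
  have Dnn: "0 \<le> D z" for z
    using convex_norm_powr_midpoint[of p "fst z" "snd z"] p by (simp add: D_def N_def)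
  have "closed K"
    unfolding K_def Collect_conj_eq
    by (intro closed_Int closed_Collect_eq closed_Collect_le cont continuous_on_const)
  moreover have "bounded K"
  proof (rule boundedI)
    fix z assume "z \<in> K"
    then have "norm (fst z) powr p + norm (snd z) powr p = 1" by (simp add: K_def N_def)
    then have "norm (fst z) powr p \<le> 1" "norm (snd z) powr p \<le> 1"
      using powr_ge_zero[of "norm (fst z)" p] powr_ge_zero[of "norm (snd z)" p] by linarith+
    then have "norm (fst z) \<le> 1" "norm (snd z) \<le> 1"
      using le1 by auto
    then show "norm z \<le> 2" using norm_Pair_le[of "fst z" "snd z"] by simp
  qed
  ultimately have cK: "compact K" by (simp add: compact_eq_bounded_closed)
  have "\<exists>d>0. \<forall>z\<in>K. d \<le> D z"
  proof (cases "K = {}")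
    case False
    then obtain z0 where z0: "z0 \<in> K" "\<forall>z\<in>K. D z0 \<le> D z"
      using continuous_attains_inf[OF cK False, of D] cont continuous_on_subset by blast
    have "fst z0 \<noteq> snd z0" using z0 e by (auto simp: K_def E_def)
    then have "0 < D z0"
      using strict_convex_norm_powr_midpoint[OF p] by (simp add: D_def N_def)
    then show ?thesis using z0 by blast
  qed (use zero_less_one in blast)
  then obtain d where d: "d > 0" "\<And>z. z \<in> K \<Longrightarrow> d \<le> D z" by blast
  \<comment> \<open>On \<open>K\<close> the left side is at most \<open>2 powr p\<close>, while the
    defect is at least \<open>d\<close>.\<close>
  define C where "C = 2 powr p / d"
  have C0: "0 \<le> C" using d by (simp add: C_def)
  have main: "E z \<le> e * N z + C * D z" for z
  proof (cases "N z = 0")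
    case True
    have "0 \<le> norm (fst z) powr p" "0 \<le> norm (snd z) powr p" by auto
    with True have "norm (fst z) powr p = 0" "norm (snd z) powr p = 0"
      unfolding N_def by linarith+
    then have "z = 0" by (simp add: prod_eq_iff)
    then show ?thesis using p by (simp add: E_def D_def N_def)
  next
    case False
    then have Npos: "0 < N z" unfolding N_def using powr_ge_zero
      by (smt (verit))
    \<comment> \<open>Scaling factor that brings \<open>z\<close> to the level
      \<open>N = 1\<close>.\<close>
    define r where "r = N z powr (1 / p)"
    have r: "0 < r" "r powr p = N z" using Npos p by (auto simp: r_def powr_powr)
    define w where "w = (1 / r) *\<^sub>R z"
    have zw: "z = r *\<^sub>R w" using r by (simp add: w_def)
    have hN: "N z = r powr p * N w" unfolding zw N_def using r
      by (simp add: powr_mult distrib_left)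
    have hE: "E z = r powr p * E w" unfolding zw E_def using r
      by (simp add: powr_mult flip: scaleR_diff_right)
    have m: "norm ((1/2) *\<^sub>R (fst z + snd z)) powr p = r powr p * norm ((1/2) *\<^sub>R (fst w + snd w)) powr p"
    proof -
      have "(1/2) *\<^sub>R (fst z + snd z) = r *\<^sub>R ((1/2) *\<^sub>R (fst w + snd w))"
        unfolding zw by (simp add: scaleR_add_right)
      then have "norm ((1/2) *\<^sub>R (fst z + snd z)) = r * norm ((1/2) *\<^sub>R (fst w + snd w))"
        using r by (simp del: scaleR_scaleR)
      then show ?thesis using r by (simp only: powr_mult less_imp_le norm_ge_zero)
    qed
    have hD: "D z = r powr p * D w" unfolding D_def m hN by (simp add: algebra_simps)
    have N1: "N w = 1" using hN r Npos by simp
    have "E w \<le> e * N w + C * D w"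
    proof (cases "e \<le> E w")
      case True
      then have "w \<in> K" using N1 by (simp add: K_def)
      have "E w \<le> 2 powr p * N w"
        using norm_powr_add_le[of p "fst w" "- snd w"] p by (simp add: E_def N_def)
      also have "\<dots> \<le> C * D w"
        using d(2)[OF \<open>w \<in> K\<close>] d(1) N1 by (simp add: C_def field_simps)
      finally show ?thesis using e N1 by simp
    next
      case False
      then show ?thesis using N1 mult_nonneg_nonneg[OF C0 Dnn[of w]] by simp
    qed
    then have "r powr p * E w \<le> r powr p * (e * N w + C * D w)"
      by (intro mult_left_mono) auto
    then show ?thesis unfolding hE hD hN by (simp add: algebra_simps)
  qed
  show ?thesis
    by (rule that[OF C0]) (use main in \<open>auto simp: E_def N_def D_def dest: spec[of _ "(_, _)"]\<close>)
qed

section \<open>Linear structure and completeness of L^p\<close>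

lemma LpV_add:
  assumes "f \<in> LpV M p" "g \<in> LpV M p" "0 \<le> p"
  shows "(\<lambda>x. f x + g x) \<in> LpV M p"
proof -
  have [measurable]: "f \<in> borel_measurable M" "g \<in> borel_measurable M"
    using assms by (auto simp: LpV_def)
  have "integrable M (\<lambda>x. 2 powr p * (norm (f x) powr p + norm (g x) powr p))"
    using assms by (auto simp: LpV_def)
  then have "integrable M (\<lambda>x. norm (f x + g x) powr p)"
    by (rule Bochner_Integration.integrable_bound) (use norm_powr_add_le[OF assms(3)] in auto)
  then show ?thesis by (simp add: LpV_def)
qed

lemma LpV_scaleR:
  assumes "f \<in> LpV M p"
  shows "(\<lambda>x. c *\<^sub>R f x) \<in> LpV M p"
  using assms by (auto simp: LpV_def powr_mult)

lemma LpV_diff: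
  assumes "f \<in> LpV M p" "g \<in> LpV M p" "0 \<le> p"
  shows "(\<lambda>x. f x - g x) \<in> LpV M p"
  using LpV_add[OF assms(1) LpV_scaleR[OF assms(2), of "-1"] assms(3)] by simp

lemma pint_add_le:
  assumes "f \<in> LpV M p" "g \<in> LpV M p" "0 \<le> p"
  shows "pint M p (\<lambda>x. f x + g x) \<le> 2 powr p * (pint M p f + pint M p g)"
proof -
  have "pint M p (\<lambda>x. f x + g x) \<le> (LINT x|M. 2 powr p * (norm (f x) powr p + norm (g x) powr p))"
    unfolding pint_def using assms LpV_add[OF assms]
    by (intro integral_mono norm_powr_add_le) (auto simp: LpV_def)
  also have "\<dots> = 2 powr p * (pint M p f + pint M p g)"
    using assms by (simp add: pint_def LpV_def)
  finally show ?thesis .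
qed

lemma pint_minus: "pint M p (\<lambda>x. f x - g x) = pint M p (\<lambda>x. g x - f x)"
  unfolding pint_def by (simp add: norm_minus_commute)

lemma pint_scaleR: "pint M p (\<lambda>x. c *\<^sub>R f x) = \<bar>c\<bar> powr p * pint M p f"
  by (simp add: pint_def powr_mult)

lemma pint_diff_le:
  assumes "f \<in> LpV M p" "g \<in> LpV M p" "0 \<le> p"
  shows "pint M p (\<lambda>x. f x - g x) \<le> 2 powr p * (pint M p f + pint M p g)"
  using pint_add_le[OF assms(1) LpV_scaleR[OF assms(2), of "-1"] assms(3)]
  by (simp add: pint_def)

lemma nn_integral_pint:
  assumes "f \<in> LpV M p"
  shows "(\<integral>\<^sup>+x. ennreal (norm (f x) powr p) \<partial>M) = ennreal (pint M p f)"
  unfolding pint_def by (rule nn_integral_eq_integral) (use assms in \<open>auto simp: LpV_def\<close>)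

lemma LpV_AE_subseq:
  assumes "\<And>k. f k \<in> LpV M p" "g \<in> LpV M p" "(\<lambda>k. pint M p (\<lambda>x. f k x - g x)) \<longlonglongrightarrow> 0" "0 < p"
  obtains r where "strict_mono r" "AE x in M. (\<lambda>k. f (r k) x) \<longlonglongrightarrow> g x"
proof -
  have "\<exists>r::nat\<Rightarrow>nat. strict_mono r \<and> (AE x in M. (\<lambda>n. norm (f (r n) x - g x) powr p) \<longlonglongrightarrow> 0)"
  proof (rule tendsto_L1_AE_subseq)
    show "integrable M (\<lambda>x. norm (f n x - g x) powr p)" for n
      using LpV_diff[OF assms(1,2)] assms(4) by (auto simp: LpV_def)
    show "(\<lambda>n. LINT x|M. norm (norm (f n x - g x) powr p)) \<longlonglongrightarrow> 0"
      using assms(3) by (simp add: pint_def)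
  qed
  then obtain r :: "nat \<Rightarrow> nat" where r: "strict_mono r" "AE x in M. (\<lambda>n. norm (f (r n) x - g x) powr p) \<longlonglongrightarrow> 0"
    by blast
  have "AE x in M. (\<lambda>k. f (r k) x) \<longlonglongrightarrow> g x"
    using r(2)
  proof eventually_elim
    case (elim x)
    have "(\<lambda>n. (norm (f (r n) x - g x) powr p) powr (1/p)) \<longlonglongrightarrow> 0 powr (1/p)"
      by (rule tendsto_powr2[OF elim tendsto_const]) (use assms(4) in auto)
    then have "(\<lambda>n. norm (f (r n) x - g x)) \<longlonglongrightarrow> 0"
      using assms(4) by (simp add: powr_powr)
    then show ?case
      by (simp add: LIM_zero_iff tendsto_norm_zero_iff)
  qed
  then show ?thesis using r that by blast
qed

text \<open>A subsequence with rapidly decaying increments converges almost everywhere. Fatou's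
  lemma along it turns the Cauchy bound for \<open>f k - f l\<close> into a bound for
  \<open>f k - g\<close>, which puts \<open>g\<close> into the space and gives convergence of the
  whole sequence.\<close>

lemma LpV_complete:
  fixes f :: "nat \<Rightarrow> 'a \<Rightarrow> 'b::euclidean_space"
  assumes f: "\<And>k. f k \<in> LpV M p" and p: "1 \<le> p"
    and cauchy: "\<And>e. 0 < e \<Longrightarrow> \<exists>N. \<forall>k\<ge>N. \<forall>l\<ge>N. pint M p (\<lambda>x. f k x - f l x) < e"
  obtains g where "g \<in> LpV M p" "(\<lambda>k. pint M p (\<lambda>x. f k x - g x)) \<longlonglongrightarrow> 0"
proof -
  have [measurable]: "f k \<in> borel_measurable M" for k using f by (auto simp: LpV_def)
  \<comment> \<open>Increments have p-integrals at most \<open>(1 / q^2)^k\<close>, so even the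
    series of \<open>q^k * u k\<close> has finite integral. As \<open>q^k = (2^k) powr p\<close>, a
    bound \<open>c\<close> for its terms makes the increments at most
    \<open>c powr (1/p) * (1/2)^k\<close>, hence summable.\<close>
  define q where "q = 2 powr p"
  have q: "2 \<le> q" using powr_mono[of 1 p 2] p by (simp add: q_def)
  have "\<forall>k. \<exists>N. \<forall>i\<ge>N. \<forall>j\<ge>N. pint M p (\<lambda>x. f i x - f j x) < (1 / q^2)^k"
    using cauchy q by auto
  then obtain N where N: "\<And>k i j. N k \<le> i \<Longrightarrow> N k \<le> j \<Longrightarrow> pint M p (\<lambda>x. f i x - f j x) < (1 / q^2)^k"
    by metis
  define r where "r = rec_nat (N 0) (\<lambda>k n. max (Suc n) (N (Suc k)))"
  have rS: "r (Suc k) = max (Suc (r k)) (N (Suc k))" for k by (simp add: r_def)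
  have sm: "strict_mono r" by (rule strict_mono_Suc_iff[THEN iffD2]) (simp add: rS less_max_iff_disj)
  have rN: "N k \<le> r k" for k by (cases k) (auto simp: r_def)
  define u where "u = (\<lambda>k x. norm (f (r (Suc k)) x - f (r k) x) powr p)"
  have uint: "integrable M (u k)" for k
    unfolding u_def using LpV_diff[OF f f] p by (auto simp: LpV_def)
  have ub: "integral\<^sup>L M (u k) \<le> (1 / q^2)^k" for k
  proof -
    have "N k \<le> r (Suc k)" using rN[of k] strict_monoD[OF sm, of k "Suc k"] by simp
    from N[OF this rN] show ?thesis by (simp add: u_def pint_def)
  qed
  have "(\<integral>\<^sup>+x. (\<Sum>k. ennreal (q^k * u k x)) \<partial>M) = (\<Sum>k. (\<integral>\<^sup>+x. ennreal (q^k * u k x) \<partial>M))"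
    by (rule nn_integral_suminf) (simp add: u_def)
  also have "\<dots> \<le> (\<Sum>k. ennreal ((1/q)^k))"
  proof (rule suminf_le)
    fix k
    have "(\<integral>\<^sup>+x. ennreal (q^k * u k x) \<partial>M) = ennreal (q^k * integral\<^sup>L M (u k))"
      using uint q by (subst nn_integral_eq_integral) (auto simp: u_def)
    also have "\<dots> \<le> ennreal (q^k * (1 / q^2)^k)"
      using ub q by (intro ennreal_leI mult_left_mono) auto
    also have "q^k * (1 / q^2)^k = (1/q)^k"
      using q by (simp add: power_mult_distrib[symmetric] power2_eq_square)
    finally show "(\<integral>\<^sup>+x. ennreal (q^k * u k x) \<partial>M) \<le> ennreal ((1/q)^k)" .
  qed auto
  also have "\<dots> < \<infinity>"
  proof -
    have "summable (\<lambda>k. (1/q)^k)" using q by (intro summable_geometric) auto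
    then show ?thesis using q by (subst suminf_ennreal2) auto
  qed
  finally have fin: "(\<integral>\<^sup>+x. (\<Sum>k. ennreal (q^k * u k x)) \<partial>M) < \<infinity>" .
  have "AE x in M. (\<Sum>k. ennreal (q^k * u k x)) \<noteq> \<infinity>"
    by (rule nn_integral_PInf_AE) (use fin in \<open>auto simp: u_def\<close>)
  then have conv: "AE x in M. convergent (\<lambda>k. f (r k) x)"
  proof eventually_elim
    case (elim x)
    obtain c where c: "0 \<le> c" "(\<Sum>k. ennreal (q^k * u k x)) = ennreal c"
      using elim by (metis ennreal_cases infinity_ennreal_def)
    have b1: "q^k * u k x \<le> c" for k
    proof -
      have "(\<Sum>k\<in>{k}. ennreal (q^k * u k x)) \<le> (\<Sum>k. ennreal (q^k * u k x))"
        by (rule sum_le_suminf) auto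
      then show ?thesis using c by (simp add: ennreal_le_iff)
    qed
    have "norm (f (r (Suc k)) x - f (r k) x) \<le> c powr (1/p) * (1/2)^k" for k
    proof -
      have "(q^k * u k x) powr (1/p) \<le> c powr (1/p)"
        by (intro powr_mono2 b1) (use p q in \<open>auto simp: u_def\<close>)
      moreover have "(q^k * u k x) powr (1/p) = 2^k * norm (f (r (Suc k)) x - f (r k) x)"
      proof -
        have "q^k = (2^k) powr p" unfolding q_def
          by (simp add: powr_realpow[symmetric] powr_powr mult.commute)
        then show ?thesis using p by (simp add: u_def powr_mult powr_powr)
      qed
      ultimately show ?thesis by (simp add: field_simps)
    qed
    then have "summable (\<lambda>k. f (r (Suc k)) x - f (r k) x)"
      by (intro summable_comparison_test[OF _ summable_mult[OF summable_geometric[of "1/2::real"]]]) auto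
    then have "convergent (\<lambda>n. f (r n) x - f (r 0) x)"
      by (simp add: summable_iff_convergent sum_lessThan_telescope[of "\<lambda>k. f (r k) x"])
    then show ?case by (simp only: convergent_diff_const_right_iff)
  qed
  define g where "g = (\<lambda>x. lim (\<lambda>k. f (r k) x))"
  have [measurable]: "g \<in> borel_measurable M" unfolding g_def by (rule borel_measurable_lim_metric) simp
  have lim: "AE x in M. (\<lambda>k. f (r k) x) \<longlonglongrightarrow> g x"
    using conv by eventually_elim (simp add: g_def convergent_LIMSEQ_iff)
  have fatou: "(\<integral>\<^sup>+x. ennreal (norm (f k x - g x) powr p) \<partial>M) \<le> ennreal e"
    if e: "0 < e" and N: "\<forall>k\<ge>N. \<forall>l\<ge>N. pint M p (\<lambda>x. f k x - f l x) < e" and k: "N \<le> k" for N k e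
  proof -
    have "(\<integral>\<^sup>+x. ennreal (norm (f k x - g x) powr p) \<partial>M)
        = (\<integral>\<^sup>+x. liminf (\<lambda>l. ennreal (norm (f k x - f (r l) x) powr p)) \<partial>M)"
    proof (rule nn_integral_cong_AE)
      show "AE x in M. ennreal (norm (f k x - g x) powr p) = liminf (\<lambda>l. ennreal (norm (f k x - f (r l) x) powr p))"
        using lim
      proof eventually_elim
        case (elim x)
        have "(\<lambda>l. ennreal (norm (f k x - f (r l) x) powr p)) \<longlonglongrightarrow> ennreal (norm (f k x - g x) powr p)"
          using p by (intro tendsto_ennrealI tendsto_powr2 tendsto_intros elim) auto
        then show ?case by (metis lim_imp_Liminf trivial_limit_sequentially tendsto_ennrealI)
      qed
    qed
    also have "\<dots> \<le> liminf (\<lambda>l. \<integral>\<^sup>+x. ennreal (norm (f k x - f (r l) x) powr p) \<partial>M)"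
      by (rule nn_integral_liminf) simp
    also have "\<dots> \<le> ennreal e"
    proof (rule Liminf_le)
      show "\<forall>\<^sub>F l in sequentially. (\<integral>\<^sup>+x. ennreal (norm (f k x - f (r l) x) powr p) \<partial>M) \<le> ennreal e"
        unfolding eventually_sequentially
      proof (intro exI[of _ N] allI impI)
        fix l assume "N \<le> l"
        then have "N \<le> r l" using seq_suble[OF sm, of l] by simp
        have "pint M p (\<lambda>x. f k x - f (r l) x) < e" using N k \<open>N \<le> r l\<close> by blast
        then show "(\<integral>\<^sup>+x. ennreal (norm (f k x - f (r l) x) powr p) \<partial>M) \<le> ennreal e"
          using nn_integral_pint[OF LpV_diff[OF f f], of k "r l"] p by (simp add: ennreal_leI)
      qed
    qed simp
    finally show ?thesis .
  qed
  have mem: "(\<lambda>x. f k x - g x) \<in> LpV M p \<and> pint M p (\<lambda>x. f k x - g x) \<le> e"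
    if "0 < e" "\<forall>k\<ge>N. \<forall>l\<ge>N. pint M p (\<lambda>x. f k x - f l x) < e" "N \<le> k" for N k e
  proof -
    note le = fatou[OF that]
    have "integrable M (\<lambda>x. norm (f k x - g x) powr p)"
      by (rule integrableI_bounded) (use le in \<open>auto simp: less_top[symmetric] top_unique\<close>)
    then have 1: "(\<lambda>x. f k x - g x) \<in> LpV M p" by (simp add: LpV_def)
    then show ?thesis using le nn_integral_pint[OF 1] that(1) pint_nonneg by (simp add: ennreal_le_iff)
  qed
  obtain N1 where N1: "\<forall>k\<ge>N1. \<forall>l\<ge>N1. pint M p (\<lambda>x. f k x - f l x) < 1"
    using cauchy[of 1] by auto
  have "(\<lambda>x. f N1 x - g x) \<in> LpV M p"
    using mem[OF _ N1, of N1] by simp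
  from LpV_diff[OF f[of N1] this] p have g: "g \<in> LpV M p" by simp
  have "(\<lambda>k. pint M p (\<lambda>x. f k x - g x)) \<longlonglongrightarrow> 0"
  proof (rule LIMSEQ_I)
    fix e :: real assume e: "0 < e"
    obtain N where N: "\<forall>k\<ge>N. \<forall>l\<ge>N. pint M p (\<lambda>x. f k x - f l x) < e/2"
      using cauchy[of "e/2"] e by auto
    show "\<exists>no. \<forall>n\<ge>no. norm (pint M p (\<lambda>x. f n x - g x) - 0) < e"
    proof (intro exI[of _ N] allI impI)
      fix n assume "N \<le> n"
      then have "pint M p (\<lambda>x. f n x - g x) \<le> e / 2" using mem[OF _ N] e by simp
      then show "norm (pint M p (\<lambda>x. f n x - g x) - 0) < e"
        using e pint_nonneg[of M p "\<lambda>x. f n x - g x"] by simp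
    qed
  qed
  with g that show ?thesis by blast
qed

text \<open>
  Strong-convergence substitute for Mazur's lemma: by uniform convexity, almost minimal elements of
  the nested sets form a Cauchy sequence.
\<close>

lemma midpoint_convex_sets_converge:
  fixes A :: "nat \<Rightarrow> ('a \<Rightarrow> 'b::euclidean_space) set"
  assumes p: "1 < p"
    and ne: "\<And>k. A k \<noteq> {}" and dec: "\<And>k. A (Suc k) \<subseteq> A k"
    and sub: "\<And>k. A k \<subseteq> LpV M p"
    and bd: "\<And>k v. v \<in> A k \<Longrightarrow> pint M p v \<le> K"
    and mid: "\<And>k v w. v \<in> A k \<Longrightarrow> w \<in> A k \<Longrightarrow> (\<lambda>x. (1/2) *\<^sub>R (v x + w x)) \<in> A k"
  obtains v w where "\<And>k. v k \<in> A k" "w \<in> LpV M p" "(\<lambda>k. pint M p (\<lambda>x. v k x - w x)) \<longlonglongrightarrow> 0"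
proof -
  define d where "d k = Inf (pint M p ` A k)" for k
  have bb: "bdd_below (pint M p ` A k)" for k by (rule bdd_belowI2[of _ 0]) (simp add: pint_nonneg)
  have decle: "A l \<subseteq> A k" if "k \<le> l" for k l
    using that by (rule lift_Suc_antimono_le[of A, OF dec])
  have dle: "d k \<le> pint M p v" if "v \<in> A k" for k v
    unfolding d_def by (rule cInf_lower) (use that bb in auto)
  have dmono: "incseq d"
    unfolding d_def by (intro incseq_SucI cInf_superset_mono bb image_mono dec) (use ne in auto)
  have dK: "d k \<le> K" for k
  proof -
    obtain v where v: "v \<in> A k" using ne by blast
    then show ?thesis using dle[OF v] bd[OF v] by simp
  qed
  obtain D where D: "d \<longlonglongrightarrow> D" using incseq_convergent[OF dmono] dK by blast
  have dD: "d k \<le> D" for k using incseq_le[OF dmono D] .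
  have "\<exists>v\<in>A k. pint M p v < d k + 1 / Suc k" for k
  proof -
    have "\<exists>y\<in>pint M p ` A k. y < d k + 1 / Suc k"
      by (rule cInf_lessD) (use ne in \<open>auto simp: d_def\<close>)
    then show ?thesis by auto
  qed
  then obtain v where v: "\<And>k. v k \<in> A k" "\<And>k. pint M p (v k) < d k + 1 / Suc k" by metis
  have vL: "v k \<in> LpV M p" for k using v sub by blast
  have K0: "0 \<le> K" using bd[OF v(1)[of 0]] pint_nonneg[of M p "v 0"] by simp
  have "\<exists>N. \<forall>k\<ge>N. \<forall>l\<ge>N. pint M p (\<lambda>x. v k x - v l x) < e" if e: "0 < e" for e
  proof -
    \<comment> \<open>The two energies are at most \<open>K\<close> each, so this weight contributes
      at most \<open>e / 2\<close>.\<close>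
    define e' where "e' = e / (4 * (K + 1))"
    have e': "0 < e'" using e K0 by (simp add: e'_def)
    obtain C where C: "0 \<le> C" "\<And>a b::'b. norm (a - b) powr p \<le> e' * (norm a powr p + norm b powr p)
       + C * ((norm a powr p + norm b powr p) / 2 - norm ((1/2) *\<^sub>R (a + b)) powr p)"
      using uniform_convexity_pointwise[OF p e'] by metis
    \<comment> \<open>For \<open>k \<le> l\<close> both almost minimal elements have energy at most
      \<open>D + 1 / Suc k\<close>, and their midpoint, lying in \<open>A k\<close>, has energy at
      least \<open>d k\<close>. The bracket therefore bounds the convexity defect, and it tends to
      zero.\<close>
    have "(\<lambda>k. C * (D - d k + 1 / Suc k)) \<longlonglongrightarrow> C * (D - D + 0)"
      by (intro tendsto_intros D LIMSEQ_Suc[OF lim_1_over_n])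
    then have "\<forall>\<^sub>F k in sequentially. C * (D - d k + 1 / Suc k) < e / 2"
      using e by (intro order_tendstoD) auto
    then obtain N where N: "\<And>k. N \<le> k \<Longrightarrow> C * (D - d k + 1 / Suc k) < e / 2"
      by (auto simp: eventually_sequentially)
    have half: "pint M p (\<lambda>x. v k x - v l x) < e" if kl: "N \<le> k" "k \<le> l" for k l
    proof -
      let ?m = "\<lambda>x. (1/2) *\<^sub>R (v k x + v l x)"
      have m: "?m \<in> A k" using mid v(1) decle[OF kl(2)] by blast
      then have mL: "?m \<in> LpV M p" using sub by blast
      have I: "integrable M (\<lambda>x. norm (v k x) powr p)" "integrable M (\<lambda>x. norm (v l x) powr p)"
        "integrable M (\<lambda>x. norm (?m x) powr p)" "integrable M (\<lambda>x. norm (v k x - v l x) powr p)"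
        using vL mL LpV_diff[OF vL vL] p unfolding LpV_def by auto
      have "pint M p (\<lambda>x. v k x - v l x) \<le> (LINT x|M. e' * (norm (v k x) powr p + norm (v l x) powr p)
         + C * ((norm (v k x) powr p + norm (v l x) powr p) / 2 - norm (?m x) powr p))"
        unfolding pint_def using I by (intro integral_mono C(2)) auto
      also have "\<dots> = e' * (pint M p (v k) + pint M p (v l)) + C * ((pint M p (v k) + pint M p (v l)) / 2 - pint M p ?m)"
        unfolding pint_def using I by simp
      also have "\<dots> \<le> e' * (2 * K) + C * (D - d k + 1 / Suc k)"
      proof (intro add_mono mult_left_mono)
        show "pint M p (v k) + pint M p (v l) \<le> 2 * K" using bd[OF v(1)[of k]] bd[OF v(1)[of l]] by simp
        have "1 / real (Suc l) \<le> 1 / real (Suc k)" using kl by (simp add: frac_le)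
        then show "(pint M p (v k) + pint M p (v l)) / 2 - pint M p ?m \<le> D - d k + 1 / Suc k"
          using v(2)[of k] v(2)[of l] dle[OF m] dD[of k] dD[of l] by argo
      qed (use C e' in auto)
      also have "e' * (2 * K) \<le> e / 2" using e K0 by (simp add: e'_def field_simps)
      finally show ?thesis using N[OF kl(1)] by linarith
    qed
    show ?thesis
    proof (intro exI[of _ N] allI impI)
      fix k l assume "N \<le> k" "N \<le> l"
      then show "pint M p (\<lambda>x. v k x - v l x) < e"
        using half[of k l] half[of l k] by (cases "k \<le> l") (auto simp: pint_minus[of M p "v k"])
    qed
  qed
  then have cauchy: "\<And>e. 0 < e \<Longrightarrow> \<exists>N. \<forall>k\<ge>N. \<forall>l\<ge>N. pint M p (\<lambda>x. v k x - v l x) < e" .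
  show ?thesis
    by (rule LpV_complete[OF vL less_imp_le[OF p] cauchy]) (use that v(1) in blast)+
qed

text \<open>The tangent of the p-th power, at a point depending on \<open>x\<close>, turns the
  linear bound for \<open>F x\<close> into \<open>F x powr p \<le> A powr (p - 1) * J x\<close>,
  where \<open>J\<close> is the potential of \<open>v powr p\<close>. Integrating in
  \<open>x\<close> and exchanging the integrals brings in the second kernel bound.\<close>

lemma schur_test:
  fixes k :: "'a \<Rightarrow> 'b \<Rightarrow> ennreal" and F :: "'a \<Rightarrow> real" and v :: "'b \<Rightarrow> real"
  assumes sf: "sigma_finite_measure M1" "sigma_finite_measure M2"
    and [measurable]: "case_prod k \<in> borel_measurable (M1 \<Otimes>\<^sub>M M2)" "v \<in> borel_measurable M2"
    and p: "1 < p" and A: "0 < A" and B: "0 \<le> B"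
    and kA: "\<And>x. x \<in> space M1 \<Longrightarrow> (\<integral>\<^sup>+y. k x y \<partial>M2) \<le> ennreal A"
    and kB: "\<And>y. y \<in> space M2 \<Longrightarrow> (\<integral>\<^sup>+x. k x y \<partial>M1) \<le> ennreal B"
    and v: "\<And>y. 0 \<le> v y"
    and F: "\<And>x. x \<in> space M1 \<Longrightarrow> ennreal (F x) \<le> (\<integral>\<^sup>+y. k x y * ennreal (v y) \<partial>M2)" "\<And>x. 0 \<le> F x"
  shows "(\<integral>\<^sup>+x. ennreal (F x powr p) \<partial>M1) \<le> ennreal (A powr (p - 1) * B) * (\<integral>\<^sup>+y. ennreal (v y powr p) \<partial>M2)"
proof -
  interpret sigma_finite_measure M1 by fact
  interpret M2: sigma_finite_measure M2 by fact
  interpret pair_sigma_finite M1 M2 by standard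
  define J where "J = (\<lambda>x. \<integral>\<^sup>+y. k x y * ennreal (v y powr p) \<partial>M2)"
  have point: "ennreal (F x powr p) \<le> ennreal (A powr (p - 1)) * J x" if x: "x \<in> space M1" for x
  proof (cases "F x = 0 \<or> J x = \<infinity>")
    case True
    then show ?thesis using A by (auto simp: ennreal_mult_top)
  next
    case False
    then have F0: "0 < F x" and J: "J x \<noteq> \<infinity>" using F(2)[of x] by auto
    then obtain j where j: "0 \<le> j" "J x = ennreal j" by (metis ennreal_cases infinity_ennreal_def)
    \<comment> \<open>With this point of tangency the constant term integrates to at most
      \<open>F x - F x / p\<close>, which is absorbed on the left and leaves
      \<open>F x / p\<close>.\<close>
    define l where "l = F x / A"
    have l: "0 < l" using F0 A by (simp add: l_def)
    define c where "c = l powr (1 - p) / p"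
    have c: "0 < c" using l p by (simp add: c_def)
    have tang: "v y \<le> c * v y powr p + l * (1 - 1/p)" for y
    proof -
      have "l powr p + p * l powr (p - 1) * (v y - l) \<le> v y powr p"
        by (rule powr_tangent_le) (use p v l in auto)
      then have "c * (l powr p + p * l powr (p - 1) * (v y - l)) \<le> c * v y powr p"
        using c by (intro mult_left_mono) auto
      also have "c * (l powr p + p * l powr (p - 1) * (v y - l)) = l / p + (v y - l)"
      proof -
        have "l powr (1 - p) * l powr p = l" "l powr (1 - p) * l powr (p - 1) = 1"
          using l by (auto simp: powr_add[symmetric])
        then show ?thesis using p unfolding c_def by (simp add: field_simps)
      qed
      finally show ?thesis by (simp add: algebra_simps)
    qed
    have "ennreal (F x) \<le> (\<integral>\<^sup>+y. k x y * ennreal (v y) \<partial>M2)" by (rule F) fact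
    also have "\<dots> \<le> (\<integral>\<^sup>+y. ennreal c * (k x y * ennreal (v y powr p)) + ennreal (l * (1 - 1/p)) * k x y \<partial>M2)"
    proof (rule nn_integral_mono)
      fix y
      have "k x y * ennreal (v y) \<le> k x y * ennreal (c * v y powr p + l * (1 - 1/p))"
        by (intro mult_left_mono ennreal_leI tang) auto
      also have "\<dots> = ennreal c * (k x y * ennreal (v y powr p)) + ennreal (l * (1 - 1/p)) * k x y"
        using c l p by (simp add: ennreal_plus ennreal_mult distrib_left ac_simps)
      finally show "k x y * ennreal (v y) \<le> ennreal c * (k x y * ennreal (v y powr p)) + ennreal (l * (1 - 1/p)) * k x y" .
    qed
    also have "\<dots> = ennreal c * J x + ennreal (l * (1 - 1/p)) * (\<integral>\<^sup>+y. k x y \<partial>M2)"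
      unfolding J_def using x by (subst nn_integral_add) (auto simp: nn_integral_cmult)
    also have "\<dots> \<le> ennreal c * J x + ennreal (l * (1 - 1/p)) * ennreal A"
      by (intro add_left_mono mult_left_mono kA x) auto
    also have "\<dots> = ennreal (c * j + l * (1 - 1/p) * A)"
      using c j l p A by (simp add: ennreal_mult ennreal_plus)
    finally have "F x \<le> c * j + l * (1 - 1/p) * A"
      using c j l p A by (subst (asm) ennreal_le_iff) auto
    then have "F x \<le> c * j + F x - F x / p"
      using A by (simp add: l_def algebra_simps)
    then have "F x / p \<le> c * j" by simp
    then have "F x \<le> l powr (1 - p) * j" using p by (simp add: c_def field_simps)
    then have "F x * F x powr (p - 1) \<le> l powr (1 - p) * j * F x powr (p - 1)"
      by (rule mult_right_mono) simp
    moreover have "F x * F x powr (p - 1) = F x powr p" using F0 by (simp add: powr_diff)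
    moreover have "l powr (1 - p) * F x powr (p - 1) = A powr (p - 1)"
    proof -
      have "l powr (1 - p) = F x powr (1 - p) * A powr (p - 1)"
        using F0 A by (simp add: l_def powr_divide powr_diff field_simps)
      then show ?thesis using F0 by (simp add: powr_add[symmetric] mult.commute mult.left_commute)
    qed
    ultimately have "F x powr p \<le> A powr (p - 1) * j" by (simp add: ac_simps)
    then show ?thesis using j by (simp add: ennreal_mult[symmetric] ennreal_leI)
  qed
  have "(\<integral>\<^sup>+x. ennreal (F x powr p) \<partial>M1) \<le> (\<integral>\<^sup>+x. ennreal (A powr (p - 1)) * J x \<partial>M1)"
    by (intro nn_integral_mono point)
  also have "\<dots> = ennreal (A powr (p - 1)) * (\<integral>\<^sup>+x. J x \<partial>M1)"
    unfolding J_def by (subst nn_integral_cmult) auto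
  also have "(\<integral>\<^sup>+x. J x \<partial>M1) = (\<integral>\<^sup>+y. (\<integral>\<^sup>+x. k x y * ennreal (v y powr p) \<partial>M1) \<partial>M2)"
    unfolding J_def by (rule Fubini'[symmetric]) simp
  also have "\<dots> \<le> (\<integral>\<^sup>+y. ennreal B * ennreal (v y powr p) \<partial>M2)"
    by (intro nn_integral_mono) (auto simp: nn_integral_multc intro!: mult_right_mono kB)
  also have "\<dots> = ennreal B * (\<integral>\<^sup>+y. ennreal (v y powr p) \<partial>M2)"
    by (rule nn_integral_cmult) simp
  finally show ?thesis using A B by (simp add: ennreal_mult mult.assoc mult_left_mono)
qed

section \<open>Partial derivatives of Lipschitz functions\<close>

text \<open>
  The image of Lebesgue measure under the inverse of the bi-Lipschitz map \<open>t \<mapsto> f t + (L + 1) t\<close>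
  is absolutely continuous; its Radon--Nikodym density is the derivative at every Lebesgue point.
\<close>

lemma lipschitz_AE_differentiable_real:
  fixes f :: "real \<Rightarrow> real"
  assumes lip: "L-lipschitz_on UNIV f"
  obtains N where "negligible N" "\<And>x. x \<notin> N \<Longrightarrow> f differentiable (at x)"
proof -
  have L0: "0 \<le> L" using lipschitz_on_nonneg[OF lip] .
  have fl: "\<bar>f b - f a\<bar> \<le> L * \<bar>b - a\<bar>" for a b
    using lipschitz_onD[OF lip, of b a] by (simp add: dist_real_def)
  \<comment> \<open>The added slope makes \<open>S\<close> grow at least as fast as the identity;
    hence \<open>S\<close> is a bijection whose inverse is 1-Lipschitz.\<close>
  define S where "S = (\<lambda>t. f t + (L + 1) * t)"
  have Sge: "b - a \<le> S b - S a" if "a \<le> b" for a b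
    using fl[of b a] that unfolding S_def by (simp add: algebra_simps abs_le_iff)
  have Smono: "S a \<le> S b \<longleftrightarrow> a \<le> b" for a b
    using Sge[of a b] Sge[of b a] by linarith
  have Scont: "continuous_on UNIV S"
    using lipschitz_on_continuous_on[OF lip] unfolding S_def by (intro continuous_intros)
  have Slip: "\<bar>S b - S a\<bar> \<le> (2 * L + 1) * \<bar>b - a\<bar>" for a b
  proof -
    have "S b - S a = (f b - f a) + (L + 1) * (b - a)" by (simp add: S_def algebra_simps)
    then have "\<bar>S b - S a\<bar> \<le> \<bar>f b - f a\<bar> + \<bar>(L + 1) * (b - a)\<bar>" by linarith
    also have "\<bar>(L + 1) * (b - a)\<bar> = (L + 1) * \<bar>b - a\<bar>" using L0 by (simp add: abs_mult)
    finally show ?thesis using fl[of b a] by (simp add: algebra_simps)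
  qed
  have surjS: "\<exists>x. S x = y" for y
  proof -
    have "\<exists>x\<ge>- (\<bar>y\<bar> + \<bar>S 0\<bar>). x \<le> \<bar>y\<bar> + \<bar>S 0\<bar> \<and> S x = y"
    proof (rule IVT')
      show "S (- (\<bar>y\<bar> + \<bar>S 0\<bar>)) \<le> y" using Sge[of "- (\<bar>y\<bar> + \<bar>S 0\<bar>)" 0] by linarith
      show "y \<le> S (\<bar>y\<bar> + \<bar>S 0\<bar>)" using Sge[of 0 "\<bar>y\<bar> + \<bar>S 0\<bar>"] by linarith
    qed (auto intro: continuous_on_subset[OF Scont])
    then show ?thesis by blast
  qed
  then obtain T where ST: "\<And>y. S (T y) = y" by metis
  have TS: "T (S x) = x" for x
    using Smono[of "T (S x)" x] Smono[of x "T (S x)"] ST[of "S x"] by simp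
  have Tcont: "continuous_on UNIV T"
  proof (rule lipschitz_on_continuous_on[of 1])
    show "1-lipschitz_on UNIV T"
    proof (rule lipschitz_onI)
      fix a b
      show "dist (T a) (T b) \<le> 1 * dist a b"
        using Sge[of "T a" "T b"] Sge[of "T b" "T a"] unfolding dist_real_def ST
        by (cases "T a \<le> T b") auto
    qed simp
  qed
  have [measurable]: "T \<in> borel_measurable borel" using Tcont by (rule borel_measurable_continuous_onI)
  have [measurable]: "S \<in> borel_measurable borel" using Scont by (rule borel_measurable_continuous_onI)
  define M where "M = distr lborel borel T"
  have MIcc: "emeasure M {a..b} = ennreal (S b - S a)" if "a \<le> b" for a b
  proof -
    have "T -` {a..b} = {S a..S b}" using Smono ST by auto (metis Smono ST)+
    then show ?thesis using that Smono unfolding M_def by (simp add: emeasure_distr)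
  qed
  have "absolutely_continuous lborel M"
    unfolding absolutely_continuous_def
  proof
    fix A assume A: "A \<in> null_sets (lborel :: real measure)"
    then have Ab: "A \<in> sets borel" by auto
    have "A \<in> null_sets lebesgue" using A by (rule null_sets_completionI)
    then have "negligible A" by (simp add: negligible_iff_null_sets)
    then have neg: "negligible (S ` A)"
    proof (rule negligible_locally_Lipschitz_image[rotated])
      show "\<exists>T B. open T \<and> x \<in> T \<and> (\<forall>y\<in>A \<inter> T. norm (S y - S x) \<le> B * norm (y - x))" for x
        using Slip by (intro exI[of _ UNIV] exI[of _ "2 * L + 1"]) simp
    qed simp
    have eq: "T -` A = S ` A" using ST TS by (auto simp: image_iff) (metis ST)
    have "T -` A \<in> sets borel" using measurable_sets[of T borel borel A] Ab by simp
    then have "emeasure lborel (T -` A) = emeasure lebesgue (T -` A)" by simp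
    also have "\<dots> = 0" using neg eq by (simp add: negligible_iff_null_sets null_setsD1)
    finally show "A \<in> null_sets M"
      using Ab unfolding M_def by (simp add: null_sets_def emeasure_distr)
  qed
  then obtain d where d[measurable]: "d \<in> borel_measurable lborel" and dM: "density lborel d = M"
    using sigma_finite_measure.Radon_Nikodym[OF sigma_finite_lborel, of M] by (auto simp: M_def)
  have dint: "(\<integral>\<^sup>+x. d x * indicator {a..b} x \<partial>lborel) = ennreal (S b - S a)" if "a \<le> b" for a b
    using MIcc[OF that] by (simp add: dM[symmetric] emeasure_density)
  have fin: "AE x in lborel. d x \<noteq> \<infinity>"
  proof -
    have "AE x in lborel. d x * indicator {- real n..real n} x \<noteq> \<infinity>" for n
      by (rule nn_integral_PInf_AE) (auto simp: dint)
    then have "AE x in lborel. \<forall>n. d x * indicator {- real n..real n} x \<noteq> \<infinity>"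
      by (simp add: AE_all_countable)
    then show ?thesis
    proof eventually_elim
      case (elim x)
      obtain n where "\<bar>x\<bar> \<le> real n" using real_arch_simple by blast
      then have "x \<in> {- real n..real n}" by auto
      then show ?case using elim[rule_format, of n] by (simp del: atLeastAtMost_iff)
    qed
  qed
  define g where "g = (\<lambda>x. enn2real (d x))"
  have [measurable]: "g \<in> borel_measurable lborel" unfolding g_def by measurable
  have gint: "(g has_integral (S b - S a)) {a..b}" if ab: "a \<le> b" for a b
  proof -
    have "((\<lambda>x. g x * indicator {a..b} x) has_integral (S b - S a)) UNIV"
    proof (rule nn_integral_has_integral)
      show "(\<integral>\<^sup>+x. ennreal (g x * indicator {a..b} x) \<partial>lborel) = ennreal (S b - S a)"
        unfolding dint[OF ab, symmetric]
        by (rule nn_integral_cong_AE, use fin in eventually_elim)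
          (auto simp: g_def indicator_def ennreal_enn2real less_top)
    qed (use ab Smono in \<open>auto simp: g_def\<close>)
    moreover have "(\<lambda>x. g x * indicator {a..b} x) = (\<lambda>x. if x \<in> {a..b} then g x else 0)"
      by (auto simp: indicator_def)
    ultimately show ?thesis by (simp only: has_integral_restrict_UNIV)
  qed
  have intg: "g integrable_on cbox a b" for a b :: real
    using gint[of a b] by (cases "a \<le> b") auto
  \<comment> \<open>Lebesgue points are provided with intervals to the right of the point; the
    reflected density supplies those to the left, and both one-sided quotients are needed for the
    derivative.\<close>
  have intg': "(\<lambda>x. g (- x)) integrable_on cbox a b" for a b :: real
    using intg[of "-b" "-a"] Henstock_Kurzweil_Integration.integrable_reflect_real[where f = g and a = "-b" and b = "-a"] by auto
  obtain N1 where N1: "negligible N1" "\<And>x e. x \<notin> N1 \<Longrightarrow> 0 < e \<Longrightarrow> \<exists>\<delta>>0. \<forall>h. 0 < h \<and> h < \<delta> \<longrightarrow>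
      norm (integral (cbox x (x + h *\<^sub>R One)) g /\<^sub>R h ^ DIM(real) - g x) < e"
    using integrable_ccontinuous_explicit[of g] intg by metis
  obtain N2 where N2: "negligible N2" "\<And>x e. x \<notin> N2 \<Longrightarrow> 0 < e \<Longrightarrow> \<exists>\<delta>>0. \<forall>h. 0 < h \<and> h < \<delta> \<longrightarrow>
      norm (integral (cbox x (x + h *\<^sub>R One)) (\<lambda>x. g (- x)) /\<^sub>R h ^ DIM(real) - g (- x)) < e"
    using integrable_ccontinuous_explicit[of "\<lambda>x. g (- x)"] intg' by metis
  have Sder: "(S has_real_derivative g x) (at x)" if x: "x \<notin> N1 \<union> uminus ` N2" for x
    unfolding DERIV_def LIM_def
  proof (intro allI impI)
    fix e :: real assume e: "0 < e"
    have x2: "- x \<notin> N2" using x by force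
    obtain \<delta>1 where d1: "0 < \<delta>1" "\<And>h. 0 < h \<Longrightarrow> h < \<delta>1 \<Longrightarrow> \<bar>integral {x..x + h} g / h - g x\<bar> < e"
      using N1(2)[of x e] x e by (auto simp: divide_inverse mult.commute)
    obtain \<delta>2 where d2: "0 < \<delta>2" "\<And>h. 0 < h \<Longrightarrow> h < \<delta>2 \<Longrightarrow> \<bar>integral {-x..-x + h} (\<lambda>x. g (- x)) / h - g x\<bar> < e"
      using N2(2)[OF x2 e] by (auto simp: divide_inverse mult.commute)
    show "\<exists>s>0. \<forall>h. h \<noteq> 0 \<and> dist h 0 < s \<longrightarrow> dist ((S (x + h) - S x) / h) (g x) < e"
    proof (intro exI[of _ "min \<delta>1 \<delta>2"] conjI allI impI)
      fix h :: real assume h: "h \<noteq> 0 \<and> dist h 0 < min \<delta>1 \<delta>2"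
      show "dist ((S (x + h) - S x) / h) (g x) < e"
      proof (cases "0 < h")
        case True
        then show ?thesis using d1(2)[of h] h integral_unique[OF gint[of x "x + h"]]
          by (simp add: dist_real_def)
      next
        case False
        then have h': "0 < - h" "- h < \<delta>2" using h by (auto simp: dist_real_def)
        have "integral {-x..-x + (-h)} (\<lambda>x. g (- x)) = integral {x + h..x} g"
          using Henstock_Kurzweil_Integration.integral_reflect_real[where f = g and a = "x + h" and b = x] by (simp add: add.commute)
        also have "\<dots> = S x - S (x + h)" using h' by (intro integral_unique gint) auto
        finally have "\<bar>(S x - S (x + h)) / (- h) - g x\<bar> < e" using d2(2)[OF h'] by simp
        moreover have "(S x - S (x + h)) / (- h) = (S (x + h) - S x) / h"
          by (simp add: minus_divide_left[symmetric] diff_divide_distrib)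
        ultimately show ?thesis by (simp add: dist_real_def)
      qed
    qed (use d1 d2 in auto)
  qed
  have "f differentiable (at x)" if "x \<notin> N1 \<union> uminus ` N2" for x
  proof -
    have "((\<lambda>t. S t - (L + 1) * t) has_real_derivative g x - (L + 1)) (at x)"
      by (rule derivative_eq_intros Sder[OF that] refl | simp)+
    moreover have "(\<lambda>t. S t - (L + 1) * t) = f" by (auto simp: S_def)
    ultimately show ?thesis by (auto simp: real_differentiable_def)
  qed
  moreover have "negligible (N1 \<union> uminus ` N2)"
  proof (rule negligible_Un[OF N1(1) negligible_locally_Lipschitz_image[OF _ N2(1)]])
    show "\<exists>T B. open T \<and> x \<in> T \<and> (\<forall>y\<in>N2 \<inter> T. norm (- y - - x) \<le> B * norm (y - x))" for x
      by (intro exI[of _ UNIV] exI[of _ 1]) (simp add: abs_minus_commute)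
  qed simp
  ultimately show ?thesis using that by blast
qed

abbreviation partially_differentiable :: "'n::finite \<Rightarrow> (real^'n \<Rightarrow> real) \<Rightarrow> real^'n \<Rightarrow> bool" where
  "partially_differentiable i u x \<equiv> (\<lambda>t. u (x + t *\<^sub>R axis i 1)) differentiable (at 0)"

lemma partial_deriv_DERIV:
  "partially_differentiable i u x \<Longrightarrow>
    ((\<lambda>t. u (x + t *\<^sub>R axis i 1)) has_real_derivative partial_deriv i u x) (at 0)"
  unfolding partial_deriv_def by (simp add: DERIV_deriv_iff_real_differentiable)

lemma partial_deriv_eqI:
  "((\<lambda>t. u (x + t *\<^sub>R axis i 1)) has_real_derivative D) (at 0) \<Longrightarrow> partial_deriv i u x = D"
  unfolding partial_deriv_def by (rule DERIV_imp_deriv)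

lemma partially_differentiableI:
  "((\<lambda>t. u (x + t *\<^sub>R axis i 1)) has_real_derivative D) (at 0) \<Longrightarrow> partially_differentiable i u x"
  by (auto simp: real_differentiable_def)

lemma partial_deriv_LIMSEQ:
  fixes u :: "real^'n::finite \<Rightarrow> real"
  assumes "partially_differentiable i u x"
  shows "(\<lambda>k. (u (x + (1 / Suc k) *\<^sub>R axis i 1) - u x) * Suc k) \<longlonglongrightarrow> partial_deriv i u x"
proof -
  have "(\<lambda>h. (u (x + (0 + h) *\<^sub>R axis i 1) - u (x + 0 *\<^sub>R axis i 1)) / h) \<midarrow>0\<rightarrow> partial_deriv i u x"
    using partial_deriv_DERIV[OF assms] unfolding DERIV_def .
  moreover have "filterlim (\<lambda>k. 1 / real (Suc k)) (at 0) sequentially"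
    by (simp add: filterlim_at LIMSEQ_Suc[OF lim_1_over_n] del: of_nat_Suc)
  ultimately have "(\<lambda>k. (u (x + (0 + 1 / Suc k) *\<^sub>R axis i 1) - u (x + 0 *\<^sub>R axis i 1)) / (1 / Suc k)) \<longlonglongrightarrow> partial_deriv i u x"
    by (rule filterlim_compose)
  then show ?thesis by simp
qed

text \<open>Completeness of the reals eliminates the unknown derivative. With \<open>n\<close> and
  \<open>k\<close> ranging over the naturals, differentiability becomes a countable combination of
  conditions on increments of \<open>u\<close>, ready for measurability.\<close>

lemma partially_differentiable_cauchy:
  fixes u :: "real^'n::finite \<Rightarrow> real"
  shows "partially_differentiable i u x \<longleftrightarrow> (\<forall>n. \<exists>k. \<forall>h h'. h \<noteq> 0 \<and> h' \<noteq> 0 \<and> \<bar>h\<bar> < 1 / Suc k \<and> \<bar>h'\<bar> < 1 / Suc k \<longrightarrow>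
     \<bar>(u (x + h *\<^sub>R axis i 1) - u x) / h - (u (x + h' *\<^sub>R axis i 1) - u x) / h'\<bar> \<le> 1 / Suc n)"
proof -
  let ?n = "\<lambda>k h h'. h \<noteq> 0 \<and> h' \<noteq> 0 \<and> \<bar>h\<bar> < 1 / real (Suc k) \<and> \<bar>h'\<bar> < 1 / real (Suc k)"
  let ?q = "\<lambda>h. (u (x + h *\<^sub>R axis i 1) - u x) / h"
  have "partially_differentiable i u x \<longleftrightarrow> (\<exists>D. (?q \<longlongrightarrow> D) (at 0))"
    by (simp add: real_differentiable_def DERIV_def)
  also have "\<dots> \<longleftrightarrow> cauchy_filter (filtermap ?q (at 0))"
  proof
    assume "\<exists>D. (?q \<longlongrightarrow> D) (at 0)"
    then show "cauchy_filter (filtermap ?q (at 0))" by (auto simp: filterlim_def intro: nhds_imp_cauchy_filter)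
  next
    assume "cauchy_filter (filtermap ?q (at 0))"
    then show "\<exists>D. (?q \<longlongrightarrow> D) (at 0)"
      using cauchy_filter_complete_converges[of "filtermap ?q (at 0)" UNIV] complete_UNIV
      by (auto simp: filterlim_def filtermap_bot_iff)
  qed
  also have "\<dots> \<longleftrightarrow> (\<forall>n. \<exists>k. \<forall>h h'. ?n k h h' \<longrightarrow> \<bar>?q h - ?q h'\<bar> \<le> 1 / Suc n)"
    unfolding cauchy_filter_metric_filtermap
  proof (intro iffI allI impI)
    fix n
    assume "\<forall>e>0. \<exists>P. eventually P (at 0) \<and> (\<forall>h h'. P h \<and> P h' \<longrightarrow> dist (?q h) (?q h') < e)"
    from this[rule_format, of "1 / real (Suc n)"] obtain P where P: "eventually P (at 0)"
      "\<And>h h'. P h \<Longrightarrow> P h' \<Longrightarrow> dist (?q h) (?q h') < 1 / real (Suc n)" by auto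
    obtain d where d: "0 < d" "\<And>h. h \<noteq> 0 \<Longrightarrow> \<bar>h\<bar> < d \<Longrightarrow> P h"
      using P(1) by (auto simp: eventually_at dist_real_def)
    obtain k where "1 / real (Suc k) < d" using d(1) nat_approx_posE by blast
    then show "\<exists>k. \<forall>h h'. ?n k h h' \<longrightarrow> \<bar>?q h - ?q h'\<bar> \<le> 1 / Suc n"
      using P(2)[OF d(2) d(2)] by (intro exI[of _ k] allI impI) (simp add: dist_real_def less_imp_le del: of_nat_Suc)
  next
    fix e :: real
    assume c: "\<forall>n. \<exists>k. \<forall>h h'. ?n k h h' \<longrightarrow> \<bar>?q h - ?q h'\<bar> \<le> 1 / Suc n" and "0 < e"
    then obtain n where n: "1 / real (Suc n) < e" using nat_approx_posE by blast
    obtain k where k: "\<forall>h h'. ?n k h h' \<longrightarrow> \<bar>?q h - ?q h'\<bar> \<le> 1 / Suc n"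
      using c by blast
    have "eventually (\<lambda>h::real. h \<noteq> 0 \<and> \<bar>h\<bar> < 1 / Suc k) (at 0)"
      unfolding eventually_at by (intro exI[of _ "1 / real (Suc k)"]) (simp add: dist_real_def)
    moreover have "dist (?q h) (?q h') < e" if "(h \<noteq> 0 \<and> \<bar>h\<bar> < 1 / Suc k) \<and> h' \<noteq> 0 \<and> \<bar>h'\<bar> < 1 / Suc k" for h h'
      using k[rule_format, of h h'] that n unfolding dist_real_def by linarith
    ultimately show "\<exists>P. eventually P (at 0) \<and> (\<forall>h h'. P h \<and> P h' \<longrightarrow> dist (?q h) (?q h') < e)" by blast
  qed
  finally show ?thesis .
qed

text \<open>For fixed \<open>n\<close> and \<open>k\<close> the Cauchy condition is an intersection
  over all \<open>h\<close> and \<open>h'\<close> of sets that are closed by continuity of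
  \<open>u\<close>. It is again closed, so only countable operations on Borel sets remain.\<close>

lemma sets_partially_differentiable:
  assumes u: "continuous_on UNIV u"
  shows "{x. partially_differentiable i u x} \<in> sets borel"
proof -
  have cu: "continuous_on UNIV (\<lambda>x. u (x + h *\<^sub>R axis i 1))" for h
    by (rule continuous_on_compose2[OF u]) (auto intro!: continuous_intros)
  define P where "P = (\<lambda>n k. {x. \<forall>h h'. h \<noteq> 0 \<and> h' \<noteq> 0 \<and> \<bar>h\<bar> < 1 / Suc k \<and> \<bar>h'\<bar> < 1 / Suc k \<longrightarrow>
     \<bar>(u (x + h *\<^sub>R axis i 1) - u x) / h - (u (x + h' *\<^sub>R axis i 1) - u x) / h'\<bar> \<le> 1 / Suc n})"
  have "closed (P n k)" for n k
    unfolding P_def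
  proof (intro closed_Collect_all closed_Collect_imp open_Collect_const closed_Collect_le)
    show "continuous_on UNIV (\<lambda>x. \<bar>(u (x + h *\<^sub>R axis i 1) - u x) / h - (u (x + h' *\<^sub>R axis i 1) - u x) / h'\<bar>)" for h h'
      unfolding divide_inverse by (intro continuous_intros cu u)
  qed auto
  then have "(\<Inter>n. \<Union>k. P n k) \<in> sets borel" by (intro sets.countable_INT'' sets.countable_UN'' ) auto
  moreover have "(\<Inter>n. \<Union>k. P n k) = {x. partially_differentiable i u x}"
    unfolding partially_differentiable_cauchy P_def by blast
  ultimately show ?thesis by simp
qed

text \<open>Off the set of partial differentiability, the underlying choice takes a value independent of the point.\<close>

lemma partial_deriv_not_differentiable:
  assumes "\<not> partially_differentiable i u x"
  shows "partial_deriv i u x = (SOME D. False)"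
proof -
  have "\<And>D. \<not> ((\<lambda>t. u (x + t *\<^sub>R axis i 1)) has_real_derivative D) (at 0)"
    using assms by (auto simp: real_differentiable_def)
  then show ?thesis by (simp add: partial_deriv_def deriv_def)
qed

text \<open>A limit of difference quotients on a Borel set and a constant default off it: the
  function is Borel as it stands, without changing it on a null set.\<close>

lemma partial_deriv_measurable:
  assumes u: "continuous_on UNIV u"
  shows "partial_deriv i u \<in> borel_measurable borel"
proof -
  have [measurable]: "(\<lambda>x. u (x + h *\<^sub>R axis i 1)) \<in> borel_measurable borel" for h
    by (intro borel_measurable_continuous_onI continuous_on_compose2[OF u]) (auto intro!: continuous_intros)
  have [measurable]: "u \<in> borel_measurable borel" using u by (rule borel_measurable_continuous_onI)
  have "partial_deriv i u = (\<lambda>x. if partially_differentiable i u x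
      then lim (\<lambda>k. (u (x + (1 / Suc k) *\<^sub>R axis i 1) - u x) * Suc k) else (SOME D. False))"
    using partial_deriv_not_differentiable limI[OF partial_deriv_LIMSEQ] by fastforce
  also have "\<dots> \<in> borel_measurable borel"
    by (intro measurable_If borel_measurable_lim_metric) (auto simp: sets_partially_differentiable[OF u])
  finally show ?thesis .
qed

text \<open>The one-dimensional result applies on every line parallel to the axis. Averaging the
  measure of the exceptional set over its translates by \<open>t\<close> in the unit interval and
  exchanging the integrals shows that it is null in space.\<close>

lemma lipschitz_AE_partially_differentiable:
  fixes u :: "real^'n::finite \<Rightarrow> real"
  assumes u: "L-lipschitz_on UNIV u"
  shows "AE x in lborel. partially_differentiable i u x"
proof -
  define N where "N = - {x. partially_differentiable i u x}"
  have N[measurable]: "N \<in> sets borel"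
    using sets_partially_differentiable[OF lipschitz_on_continuous_on[OF u]] by (auto simp: N_def)
  let ?I = "\<lambda>x t. indicator N (x + t *\<^sub>R axis i 1) * indicator {0..1::real} t :: ennreal"
  have line: "(\<integral>\<^sup>+t. ?I x t \<partial>lborel) = (0::ennreal)" for x
  proof -
    have "L-lipschitz_on UNIV (\<lambda>t. u (x + t *\<^sub>R axis i 1))"
    proof (rule lipschitz_onI)
      fix s t :: real
      show "dist (u (x + s *\<^sub>R axis i 1)) (u (x + t *\<^sub>R axis i 1)) \<le> L * dist s t"
        using lipschitz_onD[OF u, of "x + s *\<^sub>R axis i 1" "x + t *\<^sub>R axis i 1"]
        by (simp add: dist_norm scaleR_diff_left[symmetric])
    qed (rule lipschitz_on_nonneg[OF u])
    then obtain Z where Z: "negligible Z" "\<And>t. t \<notin> Z \<Longrightarrow> (\<lambda>t. u (x + t *\<^sub>R axis i 1)) differentiable (at t)"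
      using lipschitz_AE_differentiable_real by blast
    have "x + t *\<^sub>R axis i 1 \<notin> N" if "t \<notin> Z" for t
    proof -
      have "(\<lambda>t. u (x + t *\<^sub>R axis i 1)) \<circ> (\<lambda>s. t + s) differentiable (at 0)"
        using Z(2)[OF that] by (intro differentiable_chain_at) auto
      then show ?thesis by (simp add: N_def o_def algebra_simps)
    qed
    then have "AE t in lebesgue. ?I x t = (0::ennreal)"
      using Z(1) by (intro AE_I'[of Z]) (auto simp: negligible_iff_null_sets indicator_def)
    then have "AE t in lborel. ?I x t = (0::ennreal)"
      by (rule AE_completion_iff[THEN iffD1])
    then show ?thesis by (simp add: nn_integral_0_iff_AE)
  qed
  have trans: "(\<integral>\<^sup>+x. indicator N (x + c) \<partial>lborel) = emeasure lborel N" for c :: "real^'n"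
  proof -
    have "(\<integral>\<^sup>+x. indicator N (x + c) \<partial>lborel) = (\<integral>\<^sup>+x. indicator N x \<partial>distr lborel borel ((+) c))"
      by (subst nn_integral_distr) (auto simp: add.commute)
    then show ?thesis by (simp add: lborel_distr_plus)
  qed
  have "emeasure lborel N = (\<integral>\<^sup>+t. emeasure lborel N * indicator {0..1} t \<partial>(lborel::real measure))"
    by (simp add: nn_integral_cmult)
  also have "\<dots> = (\<integral>\<^sup>+t. (\<integral>\<^sup>+x. ?I x t \<partial>lborel) \<partial>lborel)"
    by (subst nn_integral_multc) (auto simp: trans)
  also have "\<dots> = (\<integral>\<^sup>+x. (\<integral>\<^sup>+t. ?I x t \<partial>lborel) \<partial>lborel)"
    by (rule lborel_pair.Fubini') measurable
  also have "\<dots> = 0" by (simp add: line)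
  finally have "emeasure lborel N = 0" .
  then show ?thesis
    by (rule AE_I[where N = N, rotated]) (use N in \<open>simp_all add: N_def Collect_neg_eq\<close>)
qed

text \<open>Only increments based at \<open>x\<close> and close to \<open>x\<close> enter, so a
  Lipschitz condition at the single point suffices. The commutator estimate uses it in this
  way.\<close>

lemma partial_deriv_abs_le:
  assumes d: "partially_differentiable i u x"
    and le: "\<And>y. y \<in> ball x e \<Longrightarrow> \<bar>u y - u x\<bar> \<le> L * norm (y - x)" and e: "0 < e"
  shows "\<bar>partial_deriv i u x\<bar> \<le> L"
proof (rule LIMSEQ_le_const2)
  show "(\<lambda>k. \<bar>(u (x + (1 / Suc k) *\<^sub>R axis i 1) - u x) * Suc k\<bar>) \<longlonglongrightarrow> \<bar>partial_deriv i u x\<bar>"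
    by (rule tendsto_rabs[OF partial_deriv_LIMSEQ[OF d]])
  obtain N where N: "1 / real (Suc N) < e" using e nat_approx_posE by blast
  have "\<bar>(u (x + (1 / Suc k) *\<^sub>R axis i 1) - u x) * Suc k\<bar> \<le> L" if k: "N \<le> k" for k
  proof -
    have "1 / real (Suc k) \<le> 1 / real (Suc N)" using k by (simp add: frac_le)
    then have "x + (1 / Suc k) *\<^sub>R axis i 1 \<in> ball x e" using N by (simp add: dist_norm)
    from le[OF this] have "\<bar>u (x + (1 / Suc k) *\<^sub>R axis i 1) - u x\<bar> * Suc k \<le> L * (1 / Suc k) * Suc k"
      by (intro mult_right_mono) auto
    then show ?thesis by (simp add: abs_mult)
  qed
  then show "\<exists>N. \<forall>n\<ge>N. \<bar>(u (x + (1 / Suc n) *\<^sub>R axis i 1) - u x) * Suc n\<bar> \<le> L" by blast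
qed

lemma partial_deriv_mult:
  assumes "partially_differentiable i u x" "partially_differentiable i v x"
  shows "partially_differentiable i (\<lambda>y. u y * v y) x"
    "partial_deriv i (\<lambda>y. u y * v y) x = partial_deriv i u x * v x + u x * partial_deriv i v x"
proof -
  have "((\<lambda>t. u (x + t *\<^sub>R axis i 1) * v (x + t *\<^sub>R axis i 1)) has_real_derivative
      partial_deriv i u x * v (x + 0 *\<^sub>R axis i 1) + partial_deriv i v x * u (x + 0 *\<^sub>R axis i 1)) (at 0)"
    by (intro DERIV_mult partial_deriv_DERIV assms)
  then have D: "((\<lambda>t. u (x + t *\<^sub>R axis i 1) * v (x + t *\<^sub>R axis i 1)) has_real_derivative
      partial_deriv i u x * v x + u x * partial_deriv i v x) (at 0)"
    by (simp add: mult.commute)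
  show "partially_differentiable i (\<lambda>y. u y * v y) x"
    by (rule partially_differentiableI[OF D])
  show "partial_deriv i (\<lambda>y. u y * v y) x = partial_deriv i u x * v x + u x * partial_deriv i v x"
    by (rule partial_deriv_eqI[OF D])
qed

lemma partial_deriv_add:
  assumes "partially_differentiable i u x" "partially_differentiable i v x"
  shows "partially_differentiable i (\<lambda>y. u y + v y) x"
    "partial_deriv i (\<lambda>y. u y + v y) x = partial_deriv i u x + partial_deriv i v x"
  using DERIV_add[OF assms[THEN partial_deriv_DERIV]]
  by (auto intro: partial_deriv_eqI partially_differentiableI)

lemma eventually_line_mem:
  fixes x :: "real^'n::finite"
  assumes "open U" "x \<in> U"
  shows "\<forall>\<^sub>F t in nhds 0. x + t *\<^sub>R axis i 1 \<in> U"
proof -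
  have "open ((\<lambda>t. x + t *\<^sub>R axis i 1) -` U)"
    by (intro open_vimage assms(1) continuous_intros)
  then show ?thesis
    unfolding eventually_nhds using assms(2) by (intro exI[of _ "(\<lambda>t. x + t *\<^sub>R axis i 1) -` U"]) auto
qed

lemma partial_deriv_cong_open:
  assumes "open U" "x \<in> U" "\<And>y. y \<in> U \<Longrightarrow> u y = v y"
  shows "partial_deriv i u x = partial_deriv i v x"
    "partially_differentiable i u x \<longleftrightarrow> partially_differentiable i v x"
proof -
  have ev: "\<forall>\<^sub>F t in nhds 0. u (x + t *\<^sub>R axis i 1) = v (x + t *\<^sub>R axis i 1)"
    using eventually_line_mem[OF assms(1,2)] by eventually_elim (use assms in auto)
  show "partial_deriv i u x = partial_deriv i v x"
    unfolding partial_deriv_def by (rule deriv_cong_ev[OF ev refl])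
  show "partially_differentiable i u x \<longleftrightarrow> partially_differentiable i v x"
    unfolding real_differentiable_def by (simp only: DERIV_cong_ev[OF refl ev refl])
qed

lemma partial_deriv_zero_open:
  assumes "open U" "x \<in> U" "\<And>y. y \<in> U \<Longrightarrow> u y = 0"
  shows "partial_deriv i u x = 0" "partially_differentiable i u x"
  using partial_deriv_cong_open[OF assms(1,2), of u "\<lambda>_. 0"] assms(3)
  by (auto simp: partial_deriv_def)

lemma partial_deriv_outside_support:
  assumes "x \<notin> closure {x. u x \<noteq> 0}"
  shows "partial_deriv i u x = 0" "partially_differentiable i u x"
proof -
  have "open (- closure {x. u x \<noteq> 0})" "x \<in> - closure {x. u x \<noteq> 0}" using assms by auto
  moreover have "u y = 0" if "y \<in> - closure {x. u x \<noteq> 0}" for y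
    using that closure_subset[of "{x. u x \<noteq> 0}"] by auto
  ultimately show "partial_deriv i u x = 0" "partially_differentiable i u x"
    using partial_deriv_zero_open by blast+
qed

text \<open>By translation invariance every difference quotient has integral zero, and the quotients
  are bounded by \<open>L\<close> on a fixed ball, so dominated convergence applies. This is the
  source of all integrations by parts below.\<close>

lemma integral_partial_deriv_eq_0:
  fixes u :: "real^'n::finite \<Rightarrow> real"
  assumes u: "L-lipschitz_on UNIV u" and supp: "bounded {x. u x \<noteq> 0}"
  shows "integrable lborel (partial_deriv i u)" "integral\<^sup>L lborel (partial_deriv i u) = 0"
proof -
  let ?h = "\<lambda>k::nat. (1 / real (Suc k)) *\<^sub>R axis i 1 :: real^'n"
  have L0: "0 \<le> L" using lipschitz_on_nonneg[OF u] .
  have cont: "continuous_on UNIV u" by (rule lipschitz_on_continuous_on[OF u])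
  have [measurable]: "u \<in> borel_measurable borel" using cont by (rule borel_measurable_continuous_onI)
  obtain R where R: "\<And>x. u x \<noteq> 0 \<Longrightarrow> norm x \<le> R" using supp by (auto simp: bounded_iff)
  have trans_m[measurable]: "(\<lambda>x. u (x + c)) \<in> borel_measurable borel" for c
    by (intro borel_measurable_continuous_onI continuous_on_compose2[OF cont]) (auto intro!: continuous_intros)
  have intu: "integrable lborel u"
  proof -
    have "integrable lborel (\<lambda>x. indicator (cball 0 R) x *\<^sub>R u x)"
      using borel_integrable_compact[of "cball 0 R" u] continuous_on_subset[OF cont]
      by (simp add: set_integrable_def)
    moreover have "(\<lambda>x. indicator (cball 0 R) x *\<^sub>R u x) = u"
      using R by (auto simp: indicator_def fun_eq_iff)
    ultimately show ?thesis by simp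
  qed
  have dist: "lborel = distr lborel borel ((+) c)" for c :: "real^'n" by (simp add: lborel_distr_plus)
  have trans: "integrable lborel (\<lambda>x. u (x + c))" "(LINT x|lborel. u (x + c)) = (LINT x|lborel. u x)" for c
  proof -
    have "integrable (distr lborel borel ((+) c)) u" using intu dist[of c] by simp
    then show "integrable lborel (\<lambda>x. u (x + c))" by (subst (asm) integrable_distr_eq) (auto simp: add.commute)
    have "(LINT x|lborel. u x) = (LINT x|distr lborel borel ((+) c). u x)" using dist[of c] by simp
    also have "\<dots> = (LINT x|lborel. u (x + c))" by (subst integral_distr) (auto simp: add.commute)
    finally show "(LINT x|lborel. u (x + c)) = (LINT x|lborel. u x)" ..
  qed
  define q where "q = (\<lambda>k x. (u (x + ?h k) - u x) * Suc k)"
  have [measurable]: "q k \<in> borel_measurable lborel" for k unfolding q_def by measurable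
  have [measurable]: "partial_deriv i u \<in> borel_measurable lborel" using partial_deriv_measurable[OF cont] by simp
  have lim: "AE x in lborel. (\<lambda>k. q k x) \<longlonglongrightarrow> partial_deriv i u x"
    using lipschitz_AE_partially_differentiable[OF u, of i] by eventually_elim (unfold q_def, rule partial_deriv_LIMSEQ)
  \<comment> \<open>The radius is \<open>R + 1\<close> because the shifts have length at most
    1.\<close>
  have w: "integrable lborel (\<lambda>x. L * indicator (cball 0 (R + 1)) x :: real)"
    by (intro integrable_mult_right integrable_real_indicator) (auto simp: emeasure_bounded_finite[unfolded infinity_ennreal_def])
  have bound: "norm (q k x) \<le> L * indicator (cball 0 (R + 1)) x" for k x
  proof (cases "norm x \<le> R + 1")
    case True
    have "\<bar>u (x + ?h k) - u x\<bar> \<le> L * (1 / Suc k)"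
      using lipschitz_onD[OF u, of "x + ?h k" x] by (simp add: dist_norm)
    then have "\<bar>u (x + ?h k) - u x\<bar> * Suc k \<le> L * (1 / Suc k) * Suc k"
      by (rule mult_right_mono) simp
    then show ?thesis using True by (simp add: q_def abs_mult)
  next
    case False
    have "norm x \<le> norm (x + ?h k) + norm (?h k :: real^'n)"
      using norm_triangle_ineq4[of "x + ?h k" "?h k"] by simp
    moreover have "norm (?h k :: real^'n) \<le> 1" by simp
    ultimately have "u (x + ?h k) = 0" "u x = 0" using False R[of x] R[of "x + ?h k"] by argo+
    then show ?thesis using L0 by (simp add: q_def)
  qed
  have b: "AE x in lborel. norm (q k x) \<le> L * indicator (cball 0 (R + 1)) x" for k
    using bound by simp
  have m1: "partial_deriv i u \<in> borel_measurable lborel" and m2: "q k \<in> borel_measurable lborel" for k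
    by measurable
  show "integrable lborel (partial_deriv i u)"
    by (rule integrable_dominated_convergence[OF m1 m2 w lim b])
  have "(\<lambda>k. integral\<^sup>L lborel (q k)) \<longlonglongrightarrow> integral\<^sup>L lborel (partial_deriv i u)"
    by (rule integral_dominated_convergence[OF m1 m2 w lim b])
  moreover have "integral\<^sup>L lborel (q k) = 0" for k
  proof -
    have "(LINT x|lborel. u (x + ?h k) - u x) = 0"
      using Bochner_Integration.integral_diff[OF trans(1)[of "?h k"] intu]
        trans(2)[of "?h k"] by (simp only: diff_self)
    then show ?thesis unfolding q_def by (simp only: integral_mult_left_zero mult_zero_left)
  qed
  ultimately show "integral\<^sup>L lborel (partial_deriv i u) = 0" by (simp add: LIMSEQ_const_iff)
qed

section \<open>Smooth functions\<close>

lemma has_derivative_partial_deriv: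
  fixes u :: "real^'n::finite \<Rightarrow> real"
  assumes "u differentiable (at x)"
  shows "(u has_derivative (\<lambda>h. \<Sum>i\<in>UNIV. h $ i * partial_deriv i u x)) (at x)"
    and "partially_differentiable i u x"
proof -
  obtain D where D: "(u has_derivative D) (at x)" using assms by (auto simp: differentiable_def)
  have line: "((\<lambda>t. u (x + t *\<^sub>R axis j 1)) has_real_derivative D (axis j 1)) (at 0)" for j
  proof -
    have "((\<lambda>t::real. x + t *\<^sub>R axis j 1) has_derivative (\<lambda>t. t *\<^sub>R axis j 1)) (at 0)"
      by (auto intro!: derivative_eq_intros)
    from has_derivative_compose[OF this, of u D] D
    have "((\<lambda>t. u (x + t *\<^sub>R axis j 1)) has_derivative (\<lambda>t. D (t *\<^sub>R axis j 1))) (at 0)" by simp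
    moreover have "(\<lambda>t. D (t *\<^sub>R axis j 1)) = (*) (D (axis j 1))"
      using linear_scale[OF has_derivative_linear[OF D]] by (auto simp: mult.commute)
    ultimately show ?thesis by (simp add: has_field_derivative_def)
  qed
  have pd: "partial_deriv j u x = D (axis j 1)" for j by (rule partial_deriv_eqI[OF line])
  have "D h = (\<Sum>i\<in>UNIV. h $ i * partial_deriv i u x)" for h
  proof -
    have "D h = D (\<Sum>i\<in>UNIV. h $ i *\<^sub>R axis i 1)" by (simp add: basis_expansion[of h, unfolded scalar_mult_eq_scaleR])
    then show ?thesis
      using has_derivative_linear[OF D] by (simp add: linear_sum linear_scale pd)
  qed
  then show "(u has_derivative (\<lambda>h. \<Sum>i\<in>UNIV. h $ i * partial_deriv i u x)) (at x)"
    using D by (metis (no_types, lifting) ext)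
  show "partially_differentiable i u x" by (rule partially_differentiableI[OF line])
qed

section \<open>Closure properties of C^k and smooth bumps\<close>

lemma Ck_SucD: "Ck (Suc k) u \<Longrightarrow> Ck k u"
proof (induction k arbitrary: u)
  case 0
  then show ?case
    by (auto simp: continuous_on_eq_continuous_at intro: differentiable_imp_continuous_within)
qed (auto simp del: Ck.simps(1))

lemma Ck_continuous: "Ck k u \<Longrightarrow> continuous_on UNIV u"
  by (induction k) (simp, blast dest: Ck_SucD)

lemma Ck_Suc_differentiable: "Ck (Suc k) u \<Longrightarrow> u differentiable (at x)"
  by simp

lemma Ck_Suc_partially_differentiable: "Ck (Suc k) u \<Longrightarrow> partially_differentiable i u x"
  by (rule has_derivative_partial_deriv(2)) simp

lemma partial_deriv_const [simp]: "partial_deriv i (\<lambda>_. c) = (\<lambda>_. 0)"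
  by (auto simp: partial_deriv_def)

lemma Ck_const: "Ck k (\<lambda>_. c)"
  by (induction k arbitrary: c) auto

lemma Ck_add:
  assumes "Ck k u" "Ck k v"
  shows "Ck k (\<lambda>x. u x + v x)"
  using assms
proof (induction k arbitrary: u v)
  case (Suc k)
  have "partial_deriv i (\<lambda>x. u x + v x) = (\<lambda>x. partial_deriv i u x + partial_deriv i v x)" for i
    using Suc.prems by (intro ext partial_deriv_add(2) Ck_Suc_partially_differentiable)
  then show ?case using Suc by auto
qed (auto intro: continuous_intros)

lemma Ck_mult:
  assumes "Ck k u" "Ck k v"
  shows "Ck k (\<lambda>x. u x * v x)"
  using assms
proof (induction k arbitrary: u v)
  case (Suc k)
  have "partial_deriv i (\<lambda>x. u x * v x) = (\<lambda>x. partial_deriv i u x * v x + u x * partial_deriv i v x)" for i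
    using Suc.prems by (intro ext partial_deriv_mult(2) Ck_Suc_partially_differentiable)
  moreover have "Ck k (\<lambda>x. partial_deriv i u x * v x + u x * partial_deriv i v x)" for i
    using Suc.prems Ck_SucD[OF Suc.prems(1)] Ck_SucD[OF Suc.prems(2)] by (intro Ck_add Suc.IH) auto
  ultimately show ?case using Suc.prems by auto
qed (auto intro: continuous_intros)

lemma Ck_prod:
  assumes "finite I" "\<And>i. i \<in> I \<Longrightarrow> Ck k (u i)"
  shows "Ck k (\<lambda>x. \<Prod>i\<in>I. u i x)"
  using assms by (induction I rule: finite_induct) (auto intro: Ck_const Ck_mult)

text \<open>For \<open>P = 1\<close> this is the classical smooth function
  \<open>exp (- 1 / t)\<close> extended by zero. Polynomials in \<open>1 / t\<close> as coefficients
  make the family closed under differentiation, so that smoothness follows by one induction.\<close>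

definition flat :: "real poly \<Rightarrow> real \<Rightarrow> real" where
  "flat P t = (if 0 < t then poly P (1 / t) * exp (- 1 / t) else 0)"

lemma tendsto_poly_exp_neg: "((\<lambda>s. poly R s * exp (- s)) \<longlongrightarrow> (0::real)) at_top"
proof -
  have "((\<lambda>s. \<Sum>i\<le>degree R. coeff R i * (s ^ i / exp s)) \<longlongrightarrow> (\<Sum>i\<le>degree R. coeff R i * 0)) at_top"
    by (intro tendsto_sum tendsto_mult tendsto_const tendsto_power_div_exp_0)
  moreover have "(\<lambda>s. \<Sum>i\<le>degree R. coeff R i * (s ^ i / exp s)) = (\<lambda>s. poly R s * exp (- s))"
    by (simp add: poly_altdef sum_distrib_right exp_minus divide_inverse mult.assoc)
  ultimately show ?thesis by simp
qed

text \<open>The derivative of \<open>1 / t\<close> is minus its square, so differentiation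
  multiplies by the square of the variable and replaces \<open>P\<close> by
  \<open>P - pderiv P\<close>. At the origin the exponential decay beats the polynomial in the
  difference quotient.\<close>

lemma DERIV_flat: "(flat P has_real_derivative flat ([:0, 0, 1:] * (P - pderiv P)) t) (at t)"
proof -
  let ?Q = "[:0, 0, 1:] * (P - pderiv P)"
  consider "0 < t" | "t < 0" | "t = 0" by linarith
  then show ?thesis
  proof cases
    case 1
    have "((\<lambda>t. poly P (1 / t) * exp (- 1 / t)) has_real_derivative poly ?Q (1 / t) * exp (- 1 / t)) (at t)"
      using 1 by (auto intro!: derivative_eq_intros simp: field_simps power2_eq_square)
    moreover have "\<forall>\<^sub>F x in nhds t. flat P x = poly P (1 / x) * exp (- 1 / x)"
      using eventually_nhds_in_open[of "{0<..}" t] 1 by (auto simp: flat_def elim: eventually_mono)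
    ultimately show ?thesis
      using 1 by (subst DERIV_cong_ev[OF refl _ refl]) (auto simp: flat_def)
  next
    case 2
    have "\<forall>\<^sub>F x in nhds t. flat P x = 0"
      using eventually_nhds_in_open[of "{..<0}" t] 2 by (auto simp: flat_def elim: eventually_mono)
    then show ?thesis
      using 2 by (subst DERIV_cong_ev[OF refl _ refl]) (auto simp: flat_def)
  next
    case 3
    have "((\<lambda>h. (flat P (0 + h) - flat P 0) / h) \<longlongrightarrow> 0) (at 0)"
    proof (rule filterlim_split_at)
      show "((\<lambda>h. (flat P (0 + h) - flat P 0) / h) \<longlongrightarrow> 0) (at_left 0)"
        by (rule tendsto_eventually) (auto simp: eventually_at_left_field flat_def intro!: exI[of _ "-1"])
      have "((\<lambda>h. poly ([:0, 1:] * P) (inverse h) * exp (- inverse h)) \<longlongrightarrow> 0) (at_right (0::real))"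
        by (rule filterlim_compose[OF tendsto_poly_exp_neg filterlim_inverse_at_top_right])
      then show "((\<lambda>h. (flat P (0 + h) - flat P 0) / h) \<longlongrightarrow> 0) (at_right 0)"
        by (rule Lim_transform_eventually)
          (auto simp: eventually_at_right_field flat_def divide_inverse intro!: exI[of _ 1])
    qed
    then show ?thesis using 3 by (simp add: DERIV_def flat_def)
  qed
qed

lemma Ck_flat_coordinate: "Ck k (\<lambda>x::real^'n::finite. flat P (a * x $ i + b))"
proof (induction k arbitrary: P)
  case 0
  have "continuous_on UNIV (flat P)"
    by (rule DERIV_continuous_on) (rule has_field_derivative_at_within[OF DERIV_flat])
  then have "continuous_on UNIV (\<lambda>x::real^'n. flat P (a * x $ i + b))"
    by (rule continuous_on_compose2) (auto intro!: continuous_intros)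
  then show ?case by simp
next
  case (Suc k)
  let ?Q = "[:0, 0, 1:] * (P - pderiv P)"
  have lin: "((\<lambda>x::real^'n. a * x $ i + b) has_derivative (\<lambda>h. a * h $ i)) (at x)" for x
    by (auto intro!: derivative_eq_intros bounded_linear.has_derivative[OF bounded_linear_vec_nth])
  have der: "((\<lambda>x::real^'n. flat P (a * x $ i + b)) has_derivative (\<lambda>h. flat ?Q (a * x $ i + b) * (a * h $ i))) (at x)" for x
    using has_derivative_compose[OF lin DERIV_flat[unfolded has_field_derivative_def]] .
  have "partial_deriv j (\<lambda>x. flat P (a * x $ i + b)) = (\<lambda>x. (if j = i then a else 0) * flat ?Q (a * x $ i + b))" for j
  proof
    fix x :: "real^'n"
    have "((\<lambda>t. flat P (a * (x + t *\<^sub>R axis j 1) $ i + b)) has_real_derivative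
        flat ?Q (a * (x + 0 *\<^sub>R axis j 1) $ i + b) * (a * axis j 1 $ i)) (at 0)"
      by (rule DERIV_chain2[OF DERIV_flat]) (auto intro!: derivative_eq_intros)
    then show "partial_deriv j (\<lambda>x. flat P (a * x $ i + b)) x = (if j = i then a else 0) * flat ?Q (a * x $ i + b)"
      by (intro partial_deriv_eqI) (auto simp: axis_def mult.commute)
  qed
  then show ?case using der Suc by (auto simp: differentiable_def intro: Ck_mult Ck_const)
qed

text \<open>For positive \<open>m\<close> it is nonzero exactly on \<open>box a b\<close>. Large
  \<open>m\<close> makes it steep, with the indicator of the open box as limit; this serves the
  fundamental lemma and the cut-off functions. With \<open>m = 1 / e\<close> on a cube of size
  \<open>e\<close> it is a scaled mollifier.\<close>

definition bump :: "real^'n::finite \<Rightarrow> real^'n \<Rightarrow> real \<Rightarrow> real^'n \<Rightarrow> real" where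
  "bump a b m x = (\<Prod>i\<in>UNIV. flat 1 (m * (x $ i - a $ i)) * flat 1 (m * (b $ i - x $ i)))"

lemma flat_1_bounds: "0 \<le> flat 1 t" "flat 1 t \<le> 1" "flat 1 t \<noteq> 0 \<longleftrightarrow> 0 < t"
  by (auto simp: flat_def)

lemma Ck_bump: "Ck k (bump a b m)"
proof -
  have "bump a b m = (\<lambda>x. \<Prod>i\<in>UNIV. flat 1 (m * x $ i + (- (m * a $ i))) * flat 1 ((- m) * x $ i + m * b $ i))"
    by (auto simp: bump_def fun_eq_iff algebra_simps)
  then show ?thesis by (simp only:) (intro Ck_prod Ck_mult Ck_flat_coordinate, simp_all)
qed

lemma bump_bounds: "0 \<le> bump a b m x" "bump a b m x \<le> 1"
  unfolding bump_def by (auto intro!: prod_nonneg prod_le_1 mult_le_one simp: flat_1_bounds)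

lemma bump_eq_0_iff: "0 < m \<Longrightarrow> bump a b m x \<noteq> 0 \<longleftrightarrow> x \<in> box a b"
  unfolding bump_def by (auto simp: flat_1_bounds(3)[simplified] mem_box_cart zero_less_mult_iff)

lemma compactly_supportedI:
  assumes "compact K" "K \<subseteq> \<Omega>" "\<And>x. x \<notin> K \<Longrightarrow> u x = 0"
  shows "compactly_supported \<Omega> u"
proof -
  have "{x. u x \<noteq> 0} \<subseteq> K" using assms by auto
  then have "closure {x. u x \<noteq> 0} \<subseteq> K" by (simp add: assms(1) closure_minimal compact_imp_closed)
  then show ?thesis
    unfolding compactly_supported_def using assms(1,2)
    by (meson closed_closure compact_Int_closed compact_closure bounded_subset closure_subset compact_imp_bounded order_trans)
qed

lemma bump_test_function:
  assumes "0 < m" "cbox a b \<subseteq> \<Omega>"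
  shows "bump a b m \<in> test_functions \<Omega>"
proof -
  have "bump a b m x = 0" if "x \<notin> cbox a b" for x
    using that bump_eq_0_iff[OF assms(1), of a b x] box_subset_cbox[of a b] by auto
  then show ?thesis
    unfolding test_functions_def using assms(2)
    by (auto simp: Ck_bump intro!: compactly_supportedI[of "cbox a b"])
qed

lemma bump_tendsto_indicator:
  "(\<lambda>k. bump a b (real (Suc k)) x) \<longlonglongrightarrow> indicator (box a b) x"
proof (cases "x \<in> box a b")
  case True
  have flat1: "(\<lambda>k. flat 1 (real (Suc k) * t)) \<longlonglongrightarrow> 1" if t: "0 < t" for t
  proof -
    have "(\<lambda>k. exp (- (1 / real (Suc k)) * (1 / t))) \<longlonglongrightarrow> exp (- 0 * (1 / t))"
      by (intro tendsto_intros LIMSEQ_Suc[OF lim_1_over_n])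
    then show ?thesis using t by (simp add: flat_def)
  qed
  have "(\<lambda>k. bump a b (real (Suc k)) x) \<longlonglongrightarrow> (\<Prod>i\<in>(UNIV::'a set). 1 * 1)"
    unfolding bump_def by (intro tendsto_prod tendsto_mult flat1) (use True in \<open>auto simp: mem_box_cart\<close>)
  then show ?thesis using True by simp
next
  case False
  then have "bump a b (real (Suc k)) x = 0" for k using bump_eq_0_iff[of "real (Suc k)" a b x] by simp
  then show ?thesis using False by simp
qed

lemma C1_lipschitz:
  fixes u :: "real^'n::finite \<Rightarrow> real"
  assumes u: "Ck 1 u" and supp: "compactly_supported \<Omega> u"
  obtains L where "L-lipschitz_on UNIV u"
proof -
  have u1: "Ck (Suc 0) u" using u by simp
  let ?K = "closure {x. u x \<noteq> 0}"
  have K: "compact ?K" using supp by (simp add: compactly_supported_def)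
  have "\<exists>B. \<forall>x. \<bar>partial_deriv i u x\<bar> \<le> B" for i
  proof -
    have "continuous_on UNIV (partial_deriv i u)" using u1 by simp
    then have "compact (partial_deriv i u ` ?K)"
      using K by (intro compact_continuous_image) (auto intro: continuous_on_subset)
    then obtain B where B: "\<And>x. x \<in> ?K \<Longrightarrow> \<bar>partial_deriv i u x\<bar> \<le> B"
      by (force dest!: compact_imp_bounded simp: bounded_iff)
    have "\<bar>partial_deriv i u x\<bar> \<le> max B 0" for x
      using B[of x] partial_deriv_outside_support(1)[of x u i] by (cases "x \<in> ?K") auto
    then show ?thesis by blast
  qed
  then obtain B where B: "\<And>i x. \<bar>partial_deriv i u x\<bar> \<le> B i" by metis
  have "norm (u x - u y) \<le> (\<Sum>i\<in>UNIV. B i) * norm (x - y)" for x y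
  proof (rule differentiable_bound[of UNIV u "\<lambda>x h. \<Sum>i\<in>UNIV. h $ i * partial_deriv i u x"])
    show "(u has_derivative (\<lambda>h. \<Sum>i\<in>UNIV. h $ i * partial_deriv i u x)) (at x within UNIV)" for x
      using has_derivative_partial_deriv(1)[OF Ck_Suc_differentiable[OF u1]] by simp
    show "onorm (\<lambda>h. \<Sum>i\<in>UNIV. h $ i * partial_deriv i u x) \<le> (\<Sum>i\<in>UNIV. B i)" for x
    proof (rule onorm_le)
      fix h :: "real^'n"
      have "norm (\<Sum>i\<in>UNIV. h $ i * partial_deriv i u x) \<le> (\<Sum>i\<in>UNIV. norm (h $ i * partial_deriv i u x))"
        by (rule norm_sum)
      also have "\<dots> \<le> (\<Sum>i\<in>UNIV. norm h * B i)"
        by (intro sum_mono) (auto simp: abs_mult intro!: mult_mono B component_le_norm_cart)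
      finally show "norm (\<Sum>i\<in>UNIV. h $ i * partial_deriv i u x) \<le> (\<Sum>i\<in>UNIV. B i) * norm h"
        by (simp only: sum_distrib_right mult.commute[of "norm h"])
    qed
  qed auto
  moreover have "0 \<le> (\<Sum>i\<in>UNIV. B i)" by (rule sum_nonneg) (use B abs_ge_zero order_trans in blast)
  ultimately show ?thesis using that[of "\<Sum>i\<in>UNIV. B i"] by (auto simp: lipschitz_on_def dist_norm)
qed

section \<open>Weak gradients\<close>

lemma measurable_lebesgue_on_borel: "f \<in> borel_measurable borel \<Longrightarrow> f \<in> borel_measurable (lebesgue_on S)"
  by (simp add: measurable_completion measurable_restrict_space1)

lemma measurable_lebesgue_borel: "f \<in> borel_measurable borel \<Longrightarrow> f \<in> borel_measurable lebesgue"
  by (simp add: measurable_completion)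

text \<open>Vector field coefficients are Lipschitz and bounded on compact sets only. If one of the
  two points lies outside \<open>K\<close>, then \<open>g\<close> vanishes there and the increment
  of \<open>g\<close> alone controls the product.\<close>

lemma lipschitz_mult_supported:
  fixes f g :: "'a::metric_space \<Rightarrow> real"
  assumes f: "L1-lipschitz_on K f" "\<And>x. x \<in> K \<Longrightarrow> \<bar>f x\<bar> \<le> B1"
    and g: "L2-lipschitz_on UNIV g" "\<And>x. \<bar>g x\<bar> \<le> B2" "\<And>x. x \<notin> K \<Longrightarrow> g x = 0" and B1: "0 \<le> B1"
  shows "(B1 * L2 + L1 * B2)-lipschitz_on UNIV (\<lambda>x. f x * g x)"
proof -
  have nn: "0 \<le> L1" "0 \<le> L2" "0 \<le> B2"
    using lipschitz_on_nonneg[OF f(1)] lipschitz_on_nonneg[OF g(1)] g(2)[of undefined] by auto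
  have one: "\<bar>f x * g x - f y * g y\<bar> \<le> (B1 * L2 + L1 * B2) * dist x y" if x: "x \<in> K" for x y
  proof (cases "y \<in> K")
    case True
    have "f x * g x - f y * g y = f x * (g x - g y) + (f x - f y) * g y" by (simp add: algebra_simps)
    then have "\<bar>f x * g x - f y * g y\<bar> \<le> \<bar>f x\<bar> * \<bar>g x - g y\<bar> + \<bar>f x - f y\<bar> * \<bar>g y\<bar>"
      by (metis abs_mult abs_triangle_ineq)
    also have "\<dots> \<le> B1 * (L2 * dist x y) + (L1 * dist x y) * B2"
      using f(2)[OF x] g(2)[of y] lipschitz_onD[OF f(1) x True] lipschitz_onD[OF g(1), of x y] nn B1
      by (intro add_mono mult_mono) (auto simp: dist_real_def)
    finally show ?thesis by (simp add: algebra_simps)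
  next
    case False
    have "\<bar>f x * g x - f y * g y\<bar> = \<bar>f x\<bar> * \<bar>g x - g y\<bar>" using g(3)[OF False] by (simp add: abs_mult)
    also have "\<dots> \<le> B1 * (L2 * dist x y)"
      using f(2)[OF x] lipschitz_onD[OF g(1), of x y] B1 by (intro mult_mono) (auto simp: dist_real_def)
    also have "\<dots> \<le> (B1 * L2 + L1 * B2) * dist x y" using nn by (simp add: algebra_simps)
    finally show ?thesis .
  qed
  show ?thesis
  proof (rule lipschitz_onI)
    fix x y
    show "dist (f x * g x) (f y * g y) \<le> (B1 * L2 + L1 * B2) * dist x y"
      using one[of x y] one[of y x] g(3)[of x] g(3)[of y] nn B1
      by (cases "x \<in> K"; cases "y \<in> K") (auto simp: dist_real_def dist_commute abs_minus_commute)
  qed (use nn B1 in simp)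
qed

lemma loc_lipschitz_compact:
  assumes X: "loc_lipschitz X" and K: "compact K"
  obtains L where "L-lipschitz_on K X"
proof -
  \<comment> \<open>A dummy time parameter gives access to the compactness result for
    \<open>local_lipschitz\<close>.\<close>
  have "local_lipschitz {0::real} UNIV (\<lambda>_. X)"
  proof (rule local_lipschitzI)
    fix t :: real and x
    obtain e L where e: "e > 0" "L-lipschitz_on (ball x e) X" using X unfolding loc_lipschitz_def by blast
    then have "L-lipschitz_on (cball x (e/2) \<inter> UNIV) X" by (auto intro: lipschitz_on_subset)
    then show "\<exists>u>0. \<exists>L. \<forall>t\<in>cball t u \<inter> {0}. L-lipschitz_on (cball x u \<inter> UNIV) X"
      using e(1) by (intro exI[of _ "e/2"]) auto
  qed
  then have "local_lipschitz {0::real} K (\<lambda>_. X)" by (rule local_lipschitz_subset) auto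
  from local_lipschitz_compact_implies_lipschitz[OF this K] that show ?thesis by auto
qed

lemma loc_lipschitz_continuous:
  assumes "loc_lipschitz X"
  shows "continuous_on UNIV X"
  unfolding continuous_on_eq_continuous_at[OF open_UNIV]
proof
  fix x
  obtain e L where "e > 0" "L-lipschitz_on (ball x e) X" using assms unfolding loc_lipschitz_def by blast
  then show "continuous (at x) X"
    using lipschitz_on_continuous_on[of L "ball x e" X] by (simp add: continuous_on_eq_continuous_at)
qed

lemma lipschitz_component:
  assumes "L-lipschitz_on S X"
  shows "L-lipschitz_on S (\<lambda>y. X y $ j $ i)"
proof (rule lipschitz_onI)
  fix x y assume "x \<in> S" "y \<in> S"
  have "dist (X x $ j $ i) (X y $ j $ i) \<le> dist (X x) (X y)"
    by (meson dist_vec_nth_le order_trans)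
  also have "\<dots> \<le> L * dist x y" using assms \<open>x \<in> S\<close> \<open>y \<in> S\<close> by (rule lipschitz_onD)
  finally show "dist (X x $ j $ i) (X y $ j $ i) \<le> L * dist x y" .
qed (rule lipschitz_on_nonneg[OF assms])

lemma compact_support_bounded:
  fixes \<psi> :: "real^'n::finite \<Rightarrow> real"
  assumes "continuous_on UNIV \<psi>" "compactly_supported \<Omega> \<psi>"
  obtains B where "0 \<le> B" "\<And>x. \<bar>\<psi> x\<bar> \<le> B"
proof -
  let ?K = "closure {x. \<psi> x \<noteq> 0}"
  have "compact (\<psi> ` ?K)"
    using assms by (intro compact_continuous_image) (auto simp: compactly_supported_def intro: continuous_on_subset)
  then obtain B where B: "\<And>x. x \<in> ?K \<Longrightarrow> \<bar>\<psi> x\<bar> \<le> B"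
    by (force dest!: compact_imp_bounded simp: bounded_iff)
  have "\<bar>\<psi> x\<bar> \<le> max B 0" for x
    using B[of x] closure_subset[of "{x. \<psi> x \<noteq> 0}"] by (cases "\<psi> x = 0") auto
  then show ?thesis using that[of "max B 0"] by simp
qed

lemma coefficient_mult_lipschitz:
  fixes \<psi> :: "real^'n::finite \<Rightarrow> real"
  assumes X: "loc_lipschitz X" and \<psi>: "L-lipschitz_on UNIV \<psi>" "compactly_supported \<Omega> \<psi>"
  obtains L' where "L'-lipschitz_on UNIV (\<lambda>y. X y $ j $ i * \<psi> y)"
proof -
  let ?K = "closure {x. \<psi> x \<noteq> 0}"
  have K: "compact ?K" using \<psi>(2) by (simp add: compactly_supported_def)
  obtain L1 where L1: "L1-lipschitz_on ?K X" using loc_lipschitz_compact[OF X K] .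
  note c = lipschitz_component[OF L1, of j i]
  have "compact ((\<lambda>y. X y $ j $ i) ` ?K)"
    by (intro compact_continuous_image K lipschitz_on_continuous_on[OF c])
  then obtain B1 where B1: "\<And>x. x \<in> ?K \<Longrightarrow> \<bar>X x $ j $ i\<bar> \<le> B1"
    by (force dest!: compact_imp_bounded simp: bounded_iff)
  obtain B2 where B2: "\<And>x. \<bar>\<psi> x\<bar> \<le> B2"
    using compact_support_bounded[OF lipschitz_on_continuous_on[OF \<psi>(1)] \<psi>(2)] by blast
  have "(max B1 0 * L + L1 * B2)-lipschitz_on UNIV (\<lambda>y. X y $ j $ i * \<psi> y)"
  proof (rule lipschitz_mult_supported[OF c _ \<psi>(1) B2])
    show "\<bar>X x $ j $ i\<bar> \<le> max B1 0" if "x \<in> ?K" for x using B1[OF that] by simp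
    show "\<psi> x = 0" if "x \<notin> ?K" for x using that closure_subset[of "{x. \<psi> x \<noteq> 0}"] by blast
  qed simp
  then show ?thesis by (rule that)
qed

text \<open>Minus the formal adjoint of the j-th vector field; the sign is left to the weak
  identity.\<close>

definition Xadj :: "('n::finite, 'm::finite) vfields \<Rightarrow> 'm \<Rightarrow> (real^'n \<Rightarrow> real) \<Rightarrow> real^'n \<Rightarrow> real" where
  "Xadj X j \<psi> x = (\<Sum>i\<in>UNIV. partial_deriv i (\<lambda>y. X y $ j $ i * \<psi> y) x)"

lemma Xadj_outside:
  assumes "x \<notin> closure {x. \<psi> x \<noteq> 0}"
  shows "Xadj X j \<psi> x = 0"
proof -
  have "closure {x. X x $ j $ i * \<psi> x \<noteq> 0} \<subseteq> closure {x. \<psi> x \<noteq> 0}" for i by (rule closure_mono) auto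
  then have "partial_deriv i (\<lambda>y. X y $ j $ i * \<psi> y) x = 0" for i
    using assms by (intro partial_deriv_outside_support) blast
  then show ?thesis by (simp add: Xadj_def)
qed

text \<open>Each product of a coefficient with \<open>\<psi>\<close> is Lipschitz, which bounds its
  derivative where it exists. Elsewhere \<open>partial_deriv\<close> has the fixed value
  \<open>SOME D. False\<close>, which the bound includes in order to hold at every point.\<close>

lemma Xadj_bounded_measurable:
  fixes \<psi> :: "real^'n::finite \<Rightarrow> real"
  assumes X: "loc_lipschitz X" and \<psi>: "L-lipschitz_on UNIV \<psi>" "compactly_supported \<Omega> \<psi>"
  shows "Xadj X j \<psi> \<in> borel_measurable borel" and "\<exists>B\<ge>0. \<forall>x. \<bar>Xadj X j \<psi> x\<bar> \<le> B"
proof -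
  have "\<exists>L'. L'-lipschitz_on UNIV (\<lambda>y. X y $ j $ i * \<psi> y)" for i
    using coefficient_mult_lipschitz[OF X \<psi>] by blast
  then obtain l where l: "\<And>i. (l i)-lipschitz_on UNIV (\<lambda>y. X y $ j $ i * \<psi> y)" by metis
  show "Xadj X j \<psi> \<in> borel_measurable borel"
    unfolding Xadj_def
    by (intro borel_measurable_sum partial_deriv_measurable lipschitz_on_continuous_on[OF l])
  have b: "\<bar>partial_deriv i (\<lambda>y. X y $ j $ i * \<psi> y) x\<bar> \<le> max (l i) \<bar>SOME D. False\<bar>" for i x
  proof (cases "partially_differentiable i (\<lambda>y. X y $ j $ i * \<psi> y) x")
    case True
    have "\<bar>partial_deriv i (\<lambda>y. X y $ j $ i * \<psi> y) x\<bar> \<le> l i"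
      by (rule partial_deriv_abs_le[OF True, of 1])
        (use lipschitz_onD[OF l[of i], of _ x] in \<open>auto simp: dist_norm\<close>)
    then show ?thesis by simp
  qed (simp add: partial_deriv_not_differentiable)
  show "\<exists>B\<ge>0. \<forall>x. \<bar>Xadj X j \<psi> x\<bar> \<le> B"
  proof (intro exI[of _ "\<Sum>i\<in>UNIV. max (l i) \<bar>SOME D. False\<bar>"] conjI allI)
    show "0 \<le> (\<Sum>i\<in>UNIV. max (l i) \<bar>SOME D. False\<bar>)" by (rule sum_nonneg) simp
    show "\<bar>Xadj X j \<psi> x\<bar> \<le> (\<Sum>i\<in>UNIV. max (l i) \<bar>SOME D. False\<bar>)" for x
      unfolding Xadj_def by (rule order_trans[OF sum_abs sum_mono[OF b]])
  qed
qed

lemma test_functionD: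
  assumes "\<psi> \<in> test_functions \<Omega>"
  shows "Ck k \<psi>" "compactly_supported \<Omega> \<psi>" "\<psi> \<in> borel_measurable borel" "\<exists>L. L-lipschitz_on UNIV \<psi>"
    "\<exists>B\<ge>0. \<forall>x. \<bar>\<psi> x\<bar> \<le> B"
proof -
  show 1: "Ck k \<psi>" "compactly_supported \<Omega> \<psi>" for k using assms by (auto simp: test_functions_def)
  then show "\<psi> \<in> borel_measurable borel" by (intro borel_measurable_continuous_onI Ck_continuous)
  obtain L where "L-lipschitz_on UNIV \<psi>" by (rule C1_lipschitz[OF 1]) (rule that)
  then show "\<exists>L. L-lipschitz_on UNIV \<psi>" ..
  obtain B where "0 \<le> B" "\<And>x. \<bar>\<psi> x\<bar> \<le> B"
    by (rule compact_support_bounded[OF Ck_continuous[OF 1(1)] 1(2)]) (rule that)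
  then show "\<exists>B\<ge>0. \<forall>x. \<bar>\<psi> x\<bar> \<le> B" by blast
qed

lemma is_XgradI:
  assumes "\<And>K. compact K \<Longrightarrow> K \<subseteq> \<Omega> \<Longrightarrow> integrable (lebesgue_on K) V"
    and "\<And>j \<psi>. \<psi> \<in> test_functions \<Omega> \<Longrightarrow>
       (LINT x|lebesgue_on \<Omega>. V x $ j * \<psi> x) = - (LINT x|lebesgue_on \<Omega>. u x * Xadj X j \<psi> x)"
  shows "is_Xgrad X \<Omega> u V"
  using assms unfolding is_Xgrad_def Xadj_def by blast

lemma is_XgradD:
  assumes "is_Xgrad X \<Omega> u V"
  shows "compact K \<Longrightarrow> K \<subseteq> \<Omega> \<Longrightarrow> integrable (lebesgue_on K) V"
    and "\<psi> \<in> test_functions \<Omega> \<Longrightarrow>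
       (LINT x|lebesgue_on \<Omega>. V x $ j * \<psi> x) = - (LINT x|lebesgue_on \<Omega>. u x * Xadj X j \<psi> x)"
  using assms unfolding is_Xgrad_def Xadj_def by blast+

lemma Lp_eq_LpV: "Lp \<Omega> p = LpV (lebesgue_on \<Omega>) p"
  by (simp add: Lp_def LpV_def)

lemma finite_measure_lebesgue_on_bounded:
  assumes "bounded \<Omega>" "\<Omega> \<in> sets lebesgue"
  shows "finite_measure (lebesgue_on \<Omega>)"
proof
  have "\<Omega> \<in> lmeasurable" using assms by (rule bounded_set_imp_lmeasurable)
  then show "emeasure (lebesgue_on \<Omega>) (space (lebesgue_on \<Omega>)) \<noteq> \<infinity>"
    using assms(2) by (simp add: emeasure_restrict_space fmeasurable_def less_top[symmetric] top_unique)
qed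

section \<open>Limit theorems with moving bounds\<close>

lemma abs_le_1_powr: "1 \<le> p \<Longrightarrow> norm x \<le> 1 + norm x powr p"
proof (cases "norm x \<le> 1")
  case False
  assume "1 \<le> p"
  then have "norm x powr 1 \<le> norm x powr p" using False by (intro powr_mono) auto
  then show ?thesis using False by simp
qed (simp add: add_increasing2)

lemma LpV_imp_integrable:
  assumes "u \<in> LpV M p" "finite_measure M" "1 \<le> p"
  shows "integrable M u"
proof -
  interpret finite_measure M by fact
  have "integrable M (\<lambda>x. 1 + norm (u x) powr p)" using assms(1) by (auto simp: LpV_def)
  then show ?thesis
    by (rule Bochner_Integration.integrable_bound)
      (use assms(1) abs_le_1_powr[OF assms(3)] in \<open>auto simp: LpV_def\<close>)
qed

lemma LpV_integrable_mult_bounded: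
  fixes u :: "'a \<Rightarrow> real"
  assumes "u \<in> LpV M p" "finite_measure M" "1 \<le> p" "g \<in> borel_measurable M" "\<And>x. \<bar>g x\<bar> \<le> B"
  shows "integrable M (\<lambda>x. u x * g x)"
proof -
  have u: "integrable M u" by (rule LpV_imp_integrable[OF assms(1-3)])
  then have "integrable M (\<lambda>x. \<bar>u x\<bar> * B)" by simp
  moreover have "\<bar>g x\<bar> \<le> \<bar>B\<bar>" for x using assms(5)[of x] by linarith
  ultimately show ?thesis
    by (elim Bochner_Integration.integrable_bound)
      (use u assms(4) in \<open>auto simp: abs_mult intro!: mult_left_mono AE_I2\<close>)
qed

text \<open>Fatou's lemma for \<open>h k - l k\<close>, where the minorants may vary as long as
  their integrals converge to that of their limit. Constant minorants give lower semicontinuity,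
  minorants containing the p-th power of a vanishing difference give dominated convergence in
  L^p.\<close>

lemma fatou_le:
  fixes h l :: "nat \<Rightarrow> 'a \<Rightarrow> real"
  assumes int: "\<And>k. integrable M (h k)" "integrable M h'" "\<And>k. integrable M (l k)" "integrable M l'"
    and lim: "AE x in M. (\<lambda>k. h k x) \<longlonglongrightarrow> h' x" "AE x in M. (\<lambda>k. l k x) \<longlonglongrightarrow> l' x"
      "(\<lambda>k. LINT x|M. l k x) \<longlonglongrightarrow> (LINT x|M. l' x)"
    and le: "\<And>k. AE x in M. l k x \<le> h k x" "\<And>k. (LINT x|M. h k x) \<le> b"
  shows "(LINT x|M. h' x) \<le> b"
proof -
  have ae: "AE x in M. \<forall>k. l k x \<le> h k x" by (simp add: AE_all_countable le)
  have nn: "AE x in M. 0 \<le> h' x - l' x"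
    using ae lim(1,2)
  proof eventually_elim
    case (elim x)
    from LIMSEQ_le[OF elim(3,2)] elim(1) show ?case by auto
  qed
  have lk: "(LINT x|M. l k x) \<le> (LINT x|M. h k x)" for k by (rule integral_mono_AE[OF int(3,1) le(1)])
  have "ennreal ((LINT x|M. h' x) - (LINT x|M. l' x)) = (\<integral>\<^sup>+x. ennreal (h' x - l' x) \<partial>M)"
    using nn_integral_eq_integral[OF Bochner_Integration.integrable_diff[OF int(2,4)] nn] int by simp
  also have "\<dots> = (\<integral>\<^sup>+x. liminf (\<lambda>k. ennreal (h k x - l k x)) \<partial>M)"
  proof (rule nn_integral_cong_AE)
    show "AE x in M. ennreal (h' x - l' x) = liminf (\<lambda>k. ennreal (h k x - l k x))"
      using lim(1,2)
    proof eventually_elim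
      case (elim x)
      have "(\<lambda>k. ennreal (h k x - l k x)) \<longlonglongrightarrow> ennreal (h' x - l' x)"
        by (intro tendsto_ennrealI tendsto_diff elim)
      then show ?case by (rule lim_imp_Liminf[OF sequentially_bot, symmetric])
    qed
  qed
  also have "\<dots> \<le> liminf (\<lambda>k. \<integral>\<^sup>+x. ennreal (h k x - l k x) \<partial>M)"
    using int by (intro nn_integral_liminf) simp
  also have "\<dots> = liminf (\<lambda>k. ennreal ((LINT x|M. h k x) - (LINT x|M. l k x)))"
  proof -
    have "(\<integral>\<^sup>+x. ennreal (h k x - l k x) \<partial>M) = ennreal ((LINT x|M. h k x) - (LINT x|M. l k x))" for k
      using nn_integral_eq_integral[OF Bochner_Integration.integrable_diff[OF int(1,3)], of k k] le(1)[of k] int by simp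
    then show ?thesis by simp
  qed
  also have "\<dots> \<le> liminf (\<lambda>k. ennreal (b - (LINT x|M. l k x)))"
    by (intro Liminf_mono always_eventually allI ennreal_leI) (simp add: le(2))
  also have "\<dots> = ennreal (b - (LINT x|M. l' x))"
    by (intro lim_imp_Liminf[OF sequentially_bot] tendsto_ennrealI tendsto_diff lim(3) tendsto_const)
  finally have 1: "ennreal ((LINT x|M. h' x) - (LINT x|M. l' x)) \<le> ennreal (b - (LINT x|M. l' x))" .
  have "0 \<le> b - (LINT x|M. l' x)"
    by (rule LIMSEQ_le_const[OF tendsto_diff[OF tendsto_const lim(3)]]) (use lk le(2) in \<open>auto intro: order_trans\<close>)
  with 1 show ?thesis by (simp add: ennreal_le_iff)
qed

lemma not_eventually_subseq:
  assumes "\<not> eventually P sequentially"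
  obtains r :: "nat \<Rightarrow> nat" where "strict_mono r" "\<And>k. \<not> P (r k)"
proof -
  have "infinite {n. \<not> P n}"
    using assms by (simp add: cofinite_eq_sequentially[symmetric] eventually_cofinite)
  from infinite_enumerate[OF this] show ?thesis using that by auto
qed

text \<open>A failure of convergence leaves a subsequence on one side of a level different from
  \<open>L\<close>. Such one-sided conditions along subsequences are what Fatou's lemma and the
  midpoint arguments can pass to the limit.\<close>

lemma tendsto_by_subsequences:
  fixes a :: "nat \<Rightarrow> real"
  assumes "\<And>(r :: nat \<Rightarrow> nat) b. strict_mono r \<Longrightarrow> (\<And>k. a (r k) \<le> b) \<Longrightarrow> L \<le> b"
    and "\<And>(r :: nat \<Rightarrow> nat) b. strict_mono r \<Longrightarrow> (\<And>k. b \<le> a (r k)) \<Longrightarrow> b \<le> L"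
  shows "a \<longlonglongrightarrow> L"
proof (rule order_tendstoI; rule ccontr)
  fix y assume y: "y < L" and n: "\<not> (\<forall>\<^sub>F n in sequentially. y < a n)"
  obtain r :: "nat \<Rightarrow> nat" where r: "strict_mono r" "\<And>k. \<not> y < a (r k)" by (rule not_eventually_subseq[OF n]) (rule that)
  from assms(1)[OF r(1), of y] r(2) y show False by (simp add: not_less)
next
  fix y assume y: "L < y" and n: "\<not> (\<forall>\<^sub>F n in sequentially. a n < y)"
  obtain r :: "nat \<Rightarrow> nat" where r: "strict_mono r" "\<And>k. \<not> a (r k) < y" by (rule not_eventually_subseq[OF n]) (rule that)
  from assms(2)[OF r(1), of y] r(2) y show False by (simp add: not_less)
qed

text \<open>Along an almost everywhere convergent subsequence the growth condition bounds the
  integrands by functions that vary with the index but have convergent integrals.\<close>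

lemma integral_caratheodory_tendsto:
  fixes f :: "nat \<Rightarrow> 'a \<Rightarrow> 'b::euclidean_space" and G :: "'a \<Rightarrow> 'b \<Rightarrow> real"
  assumes p: "0 < p" and f: "\<And>k. f k \<in> LpV M p" "h \<in> LpV M p" "(\<lambda>k. pint M p (\<lambda>x. f k x - h x)) \<longlonglongrightarrow> 0"
    and G: "\<And>v. v \<in> LpV M p \<Longrightarrow> integrable M (\<lambda>x. G x (v x))" "AE x in M. continuous_on UNIV (G x)"
    and b: "integrable M b" "AE x in M. \<forall>s. \<bar>G x s\<bar> \<le> D * norm s powr p + b x" and D: "0 \<le> D"
  shows "(\<lambda>k. LINT x|M. G x (f k x)) \<longlonglongrightarrow> (LINT x|M. G x (h x))"
proof -
  \<comment> \<open>The sign \<open>\<sigma>\<close> treats both halves of convergence at once: each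
    is Fatou's lemma for \<open>\<sigma> * G\<close>.\<close>
  have half: "\<sigma> * (LINT x|M. G x (h x)) \<le> c" if \<sigma>: "\<bar>\<sigma>\<bar> = 1" and r: "strict_mono r" "\<And>k. \<sigma> * (LINT x|M. G x (f (r k) x)) \<le> c"
    for \<sigma> c :: real and r :: "nat \<Rightarrow> nat"
  proof -
    have lim: "(\<lambda>k. pint M p (\<lambda>x. f (r k) x - h x)) \<longlonglongrightarrow> 0"
      using LIMSEQ_subseq_LIMSEQ[OF f(3) r(1)] by (simp add: o_def)
    obtain s where s: "strict_mono s" "AE x in M. (\<lambda>k. f (r (s k)) x) \<longlonglongrightarrow> h x"
      by (rule LpV_AE_subseq[of "\<lambda>k. f (r k)", OF f(1,2) lim p]) (rule that)
    define u where "u k = f (r (s k))" for k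
    have u: "u k \<in> LpV M p" "\<sigma> * (LINT x|M. G x (u k x)) \<le> c" for k using f(1) r(2) by (simp_all add: u_def)
    have lim2: "(\<lambda>k. pint M p (\<lambda>x. u k x - h x)) \<longlonglongrightarrow> 0"
      using LIMSEQ_subseq_LIMSEQ[OF lim s(1)] by (simp add: o_def u_def)
    have ae: "AE x in M. (\<lambda>k. u k x) \<longlonglongrightarrow> h x" using s(2) by (simp add: u_def)
    \<comment> \<open>The growth bound after splitting \<open>u k\<close> into
      \<open>u k - h\<close> and \<open>h\<close>. Its integral converges because the p-integral of
      \<open>u k - h\<close> tends to zero.\<close>
    let ?l = "\<lambda>k x. - (D * (2 powr p * (norm (u k x - h x) powr p + norm (h x) powr p)) + b x)"
    let ?l' = "\<lambda>x. - (D * (2 powr p * (0 + norm (h x) powr p)) + b x)"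
    have I: "integrable M (\<lambda>x. norm (u k x - h x) powr p)" for k
      by (rule LpV_integrable[OF LpV_diff[OF u(1) f(2) less_imp_le[OF p]]])
    note I2 = LpV_integrable[OF f(2)] b(1)
    have "(LINT x|M. \<sigma> * G x (h x)) \<le> c"
    proof (rule fatou_le[where h="\<lambda>k x. \<sigma> * G x (u k x)" and l="?l" and l'="?l'"])
      show "AE x in M. (\<lambda>k. \<sigma> * G x (u k x)) \<longlonglongrightarrow> \<sigma> * G x (h x)"
        using ae G(2)
      proof eventually_elim
        case (elim x)
        from continuous_on_tendsto_compose[OF elim(2,1)] show ?case by (intro tendsto_mult tendsto_const) simp
      qed
      show "AE x in M. (\<lambda>k. ?l k x) \<longlonglongrightarrow> ?l' x"
        using ae
      proof eventually_elim
        case (elim x)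
        have "(\<lambda>k. norm (u k x - h x)) \<longlonglongrightarrow> 0"
          by (rule tendsto_norm_zero[OF LIM_zero[OF elim]])
        from tendsto_zero_powrI[OF this tendsto_const[of p]] p
        have "(\<lambda>k. norm (u k x - h x) powr p) \<longlonglongrightarrow> 0" by simp
        then show ?case by (intro tendsto_intros)
      qed
      have "(LINT x|M. ?l k x) = - (D * (2 powr p * (pint M p (\<lambda>x. u k x - h x) + pint M p h)) + (LINT x|M. b x))" for k
        using I[of k] I2 by (simp add: pint_def)
      moreover have "(LINT x|M. ?l' x) = - (D * (2 powr p * (0 + pint M p h)) + (LINT x|M. b x))"
        using I2 by (simp add: pint_def)
      ultimately show "(\<lambda>k. LINT x|M. ?l k x) \<longlonglongrightarrow> (LINT x|M. ?l' x)"
        by (simp only:) (intro tendsto_intros lim2)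
      show "AE x in M. ?l k x \<le> \<sigma> * G x (u k x)" for k
        using b(2)
      proof eventually_elim
        case (elim x)
        have "norm ((u k x - h x) + h x) powr p \<le> 2 powr p * (norm (u k x - h x) powr p + norm (h x) powr p)"
          by (rule norm_powr_add_le) (use p in simp)
        then have "D * norm (u k x) powr p \<le> D * (2 powr p * (norm (u k x - h x) powr p + norm (h x) powr p))"
          using D by (intro mult_left_mono) auto
        moreover have "\<bar>\<sigma> * G x (u k x)\<bar> \<le> D * norm (u k x) powr p + b x"
          using elim \<sigma> by (simp add: abs_mult)
        ultimately show ?case by linarith
      qed
    qed (use I I2 G(1)[OF u(1)] G(1)[OF f(2)] u(2) in simp_all)
    then show ?thesis by simp
  qed
  show ?thesis
  proof (rule tendsto_by_subsequences)
    fix r :: "nat \<Rightarrow> nat" and c assume "strict_mono r" "\<And>k. (LINT x|M. G x (f (r k) x)) \<le> c"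
    then show "(LINT x|M. G x (h x)) \<le> c" using half[of 1 r c] by simp
  next
    fix r :: "nat \<Rightarrow> nat" and c assume "strict_mono r" "\<And>k. c \<le> (LINT x|M. G x (f (r k) x))"
    then show "c \<le> (LINT x|M. G x (h x))" using half[of "-1" r "- c"] by simp
  qed
qed

lemma LpV_integral_mult_tendsto:
  fixes f :: "nat \<Rightarrow> 'a \<Rightarrow> real"
  assumes fin: "finite_measure M" and p: "1 \<le> p" and f: "\<And>k. f k \<in> LpV M p" and h: "h \<in> LpV M p"
    and lim: "(\<lambda>k. pint M p (\<lambda>x. f k x - h x)) \<longlonglongrightarrow> 0"
    and g: "g \<in> borel_measurable M" "\<And>x. \<bar>g x\<bar> \<le> B"
  shows "(\<lambda>k. LINT x|M. f k x * g x) \<longlonglongrightarrow> (LINT x|M. h x * g x)"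
proof (rule integral_caratheodory_tendsto[where G="\<lambda>x s. s * g x" and b="\<lambda>_. \<bar>B\<bar>" and D="\<bar>B\<bar>", OF _ f h lim])
  interpret finite_measure M by fact
  show "integrable M (\<lambda>x. v x * g x)" if "v \<in> LpV M p" for v
    by (rule LpV_integrable_mult_bounded[OF that fin p g])
  show "AE x in M. \<forall>s. \<bar>s * g x\<bar> \<le> \<bar>B\<bar> * norm s powr p + \<bar>B\<bar>"
  proof (intro AE_I2 allI)
    fix x and s :: real
    have "\<bar>g x\<bar> \<le> \<bar>B\<bar>" using g(2)[of x] by linarith
    then have "\<bar>s * g x\<bar> \<le> (1 + norm s powr p) * \<bar>B\<bar>"
      unfolding abs_mult using abs_le_1_powr[OF p, of s] by (intro mult_mono) auto
    then show "\<bar>s * g x\<bar> \<le> \<bar>B\<bar> * norm s powr p + \<bar>B\<bar>" by (simp add: algebra_simps)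
  qed
  show "integrable M (\<lambda>_. \<bar>B\<bar>)" by simp
qed (use p in \<open>auto intro!: continuous_intros\<close>)

text \<open>Bumps approximating box indicators show that \<open>W\<close> has vanishing box integrals; Lebesgue points do the rest.\<close>

lemma fundamental_lemma_calculus_of_variations:
  fixes W :: "real^'n::finite \<Rightarrow> real"
  assumes \<Omega>: "open \<Omega>" and W: "\<And>K. compact K \<Longrightarrow> K \<subseteq> \<Omega> \<Longrightarrow> integrable (lebesgue_on K) W"
    and zero: "\<And>\<psi>. \<psi> \<in> test_functions \<Omega> \<Longrightarrow> (LINT x|lebesgue_on \<Omega>. W x * \<psi> x) = 0"
  shows "AE x in lebesgue_on \<Omega>. W x = 0"
proof -
  let ?i = "\<lambda>a b x. indicator (cbox a b) x *\<^sub>R W x"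
  have sO: "\<Omega> \<in> sets lebesgue" using \<Omega> by simp
  have box0: "integral (cbox a b) W = 0" if ab: "cbox a b \<subseteq> \<Omega>" for a b
  proof -
    have I: "integrable lebesgue (\<lambda>x. indicator (cbox a b) x *\<^sub>R W x)"
      using W[OF compact_cbox ab] by (subst (asm) integrable_restrict_space) auto
    have w: "integrable lebesgue (\<lambda>x. norm (?i a b x))"
      using I by (rule integrable_norm)
    have mW: "(\<lambda>x. indicator (cbox a b) x *\<^sub>R W x) \<in> borel_measurable lebesgue" using I by auto
    let ?s = "\<lambda>k x. (?i a b x) * bump a b (real (Suc k)) x"
    have mb: "bump a b m \<in> borel_measurable lebesgue" for m
      by (intro measurable_lebesgue_borel borel_measurable_continuous_onI Ck_continuous[OF Ck_bump])
    have lim: "AE x in lebesgue. (\<lambda>k. ?s k x) \<longlonglongrightarrow> (?i a b x) * indicator (box a b) x"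
      by (intro AE_I2 tendsto_mult tendsto_const bump_tendsto_indicator)
    have bd: "AE x in lebesgue. norm (?s k x) \<le> norm (?i a b x)" for k
      using bump_bounds[of a b "real (Suc k)"] by (intro AE_I2) (simp add: abs_mult mult_left_le)
    have m1: "(\<lambda>x. (?i a b x) * indicator (box a b) x) \<in> borel_measurable lebesgue"
      by (intro borel_measurable_times[OF mW] borel_measurable_indicator) auto
    have m2: "?s k \<in> borel_measurable lebesgue" for k
      by (rule borel_measurable_times[OF mW mb])
    have "(\<lambda>k. integral\<^sup>L lebesgue (?s k)) \<longlonglongrightarrow> (LINT x|lebesgue. (?i a b x) * indicator (box a b) x)"
      by (rule integral_dominated_convergence[OF m1 m2 w lim bd])
    moreover have "integral\<^sup>L lebesgue (?s k) = 0" for k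
    proof -
      have "?s k = (\<lambda>x. indicator \<Omega> x *\<^sub>R (W x * bump a b (real (Suc k)) x))"
      proof
        fix x
        show "?s k x = indicator \<Omega> x *\<^sub>R (W x * bump a b (real (Suc k)) x)"
          using bump_eq_0_iff[of "real (Suc k)" a b x] box_subset_cbox[of a b] ab
          by (cases "x \<in> box a b") (auto simp: indicator_def simp del: of_nat_Suc)
      qed
      then have "integral\<^sup>L lebesgue (?s k) = (LINT x|lebesgue_on \<Omega>. W x * bump a b (real (Suc k)) x)"
        using sO by (simp add: integral_restrict_space)
      then show ?thesis using zero[OF bump_test_function[OF _ ab]] by simp
    qed
    ultimately have "(LINT x|lebesgue. (?i a b x) * indicator (box a b) x) = 0"
      by (simp add: LIMSEQ_const_iff)
    moreover have eq: "(\<lambda>x. (?i a b x) * indicator (box a b) x) = (\<lambda>x. indicator (box a b) x *\<^sub>R W x)"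
      using box_subset_cbox[of a b] by (auto simp: indicator_def fun_eq_iff)
    moreover have "set_integrable lebesgue (box a b) W"
      unfolding set_integrable_def eq[symmetric]
      by (rule integrable_dominated_convergence[OF m1 m2 w lim bd])
    from set_lebesgue_integral_eq_integral(2)[OF this]
    have "(LINT x|lebesgue. indicator (box a b) x *\<^sub>R W x) = integral (cbox a b) W"
      by (simp add: set_lebesgue_integral_def integral_open_interval)
    ultimately show ?thesis by simp
  qed
  \<comment> \<open>\<open>W\<close> is integrable on compact subsets only, so Lebesgue points are
    taken for its restriction to one closed box; countably many such boxes exhaust
    \<open>\<Omega>\<close>.\<close>
  have cb: "\<exists>N. negligible N \<and> (\<forall>x\<in>cbox c d - N. W x = 0)" if cd: "cbox c d \<subseteq> \<Omega>" for c d
  proof -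
    let ?W = "\<lambda>x. if x \<in> cbox c d then W x else 0"
    have "integrable lebesgue (\<lambda>x. indicator (cbox c d) x *\<^sub>R W x)"
      using W[OF compact_cbox cd] by (subst (asm) integrable_restrict_space) auto
    then have "W integrable_on cbox c d"
      using set_lebesgue_integral_eq_integral(1)[of "cbox c d" W] by (simp add: set_integrable_def)
    then have "?W integrable_on UNIV" by (simp only: integrable_restrict_UNIV)
    then have int: "?W integrable_on cbox a b" for a b by (rule integrable_on_subcbox) simp
    have 0: "integral (cbox a b) ?W = 0" for a b
    proof -
      obtain s t where st: "cbox c d \<inter> cbox a b = cbox s t" using Int_interval by blast
      have "integral (cbox a b) ?W = integral (cbox c d \<inter> cbox a b) W" by (rule integral_restrict_Int)
      moreover have "cbox s t \<subseteq> \<Omega>" using st cd by blast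
      ultimately show ?thesis by (simp add: st box0)
    qed
    obtain N where N: "negligible N" "\<And>x e. \<lbrakk>x \<notin> N; 0 < e\<rbrakk> \<Longrightarrow>
        \<exists>\<delta>>0. \<forall>h. 0 < h \<and> h < \<delta> \<longrightarrow> norm (integral (cbox x (x + h *\<^sub>R One)) ?W /\<^sub>R h ^ DIM(real^'n) - ?W x) < e"
      by (rule integrable_ccontinuous_explicit[OF int]) (rule that)
    have "W x = 0" if x: "x \<in> cbox c d" "x \<notin> N" for x
    proof (rule ccontr)
      assume "W x \<noteq> 0"
      then have "0 < \<bar>W x\<bar>" by simp
      from N(2)[OF x(2) this] obtain \<delta> :: real where "0 < \<delta>" "\<forall>h. 0 < h \<and> h < \<delta> \<longrightarrow> norm (?W x) < \<bar>W x\<bar>"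
        unfolding 0 by auto
      then show False using x(1) by (auto dest!: spec[of _ "\<delta> / 2"])
    qed
    then show ?thesis using N(1) by blast
  qed
  obtain D where D: "countable D" "D \<subseteq> Pow \<Omega>" "\<And>S. S \<in> D \<Longrightarrow> \<exists>a b. S = cbox a b" "\<Union>D = \<Omega>"
    by (rule open_countable_Union_open_cbox[OF \<Omega>]) (rule that)
  have "\<forall>S\<in>D. \<exists>N. negligible N \<and> (\<forall>x\<in>S - N. W x = 0)"
  proof
    fix S assume S: "S \<in> D"
    obtain a b where ab: "S = cbox a b" using D(3)[OF S] by blast
    then have "cbox a b \<subseteq> \<Omega>" using S D(2) by blast
    from cb[OF this] show "\<exists>N. negligible N \<and> (\<forall>x\<in>S - N. W x = 0)" unfolding ab .
  qed
  from bchoice[OF this] obtain N where NN: "\<forall>S\<in>D. negligible (N S) \<and> (\<forall>x\<in>S - N S. W x = 0)" ..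
  then have N: "\<And>S. S \<in> D \<Longrightarrow> negligible (N S)" "\<And>S x. S \<in> D \<Longrightarrow> x \<in> S - N S \<Longrightarrow> W x = 0" by blast+
  have neg: "negligible (\<Union>(N ` D))"
    using D(1) N(1) by (intro negligible_countable_Union) auto
  have "AE x in lebesgue. x \<in> \<Omega> \<longrightarrow> W x = 0"
  proof (rule AE_I'[of "\<Union>(N ` D)"])
    show "\<Union>(N ` D) \<in> null_sets lebesgue" using neg by (simp add: negligible_iff_null_sets)
    show "{x \<in> space lebesgue. \<not> (x \<in> \<Omega> \<longrightarrow> W x = 0)} \<subseteq> \<Union>(N ` D)" using N(2) D(4) by blast
  qed
  then show ?thesis using sO by (simp add: AE_restrict_space_iff)
qed

section \<open>Representatives, components and the gradient relation\<close>

lemma complete_measure_lebesgue_on: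
  assumes "S \<in> sets lebesgue"
  shows "complete_measure (lebesgue_on S)"
proof
  fix A B :: "'a set" assume B: "B \<subseteq> A" and A: "A \<in> null_sets (lebesgue_on S)"
  have "A \<in> null_sets lebesgue" "A \<subseteq> S" using A assms by (auto simp: null_sets_restrict_space)
  then have "B \<in> null_sets lebesgue" using B by (meson completion.complete2)
  then show "B \<in> sets (lebesgue_on S)"
    using B \<open>A \<subseteq> S\<close> assms by (subst sets_restrict_space_iff) auto
qed

lemma borel_measurable_lebesgue_on_AE:
  assumes S: "S \<in> sets lebesgue" and f: "f \<in> borel_measurable (lebesgue_on S)"
    and ae: "AE x in lebesgue_on S. f x = g x"
  shows "g \<in> borel_measurable (lebesgue_on S)"
proof (rule measurableI)
  interpret complete_measure "lebesgue_on S" by (rule complete_measure_lebesgue_on[OF S])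
  fix A :: "'b set" assume "A \<in> sets borel"
  then have "f -` A \<inter> space (lebesgue_on S) \<in> sets (lebesgue_on S)" using f by (rule measurable_sets[rotated])
  then show "g -` A \<inter> space (lebesgue_on S) \<in> sets (lebesgue_on S)"
    by (rule in_sets_AE[rotated]) (use ae in \<open>auto elim: eventually_mono\<close>)
qed simp

lemma LpV_cong_AE:
  assumes S: "S \<in> sets lebesgue" and f: "f \<in> LpV (lebesgue_on S) p"
    and ae: "AE x in lebesgue_on S. f x = g x"
  shows "g \<in> LpV (lebesgue_on S) p" "pint (lebesgue_on S) p g = pint (lebesgue_on S) p f"
proof -
  have g: "g \<in> borel_measurable (lebesgue_on S)"
    by (rule borel_measurable_lebesgue_on_AE[OF S LpV_measurable[OF f] ae])
  have ae': "AE x in lebesgue_on S. norm (f x) powr p = norm (g x) powr p"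
    using ae by eventually_elim simp
  have "integrable (lebesgue_on S) (\<lambda>x. norm (g x) powr p)"
    by (rule integrable_cong_AE_imp[OF LpV_integrable[OF f] _ ae']) (use g in measurable)
  then show "g \<in> LpV (lebesgue_on S) p" using g by (simp add: LpV_def)
  show "pint (lebesgue_on S) p g = pint (lebesgue_on S) p f"
    unfolding pint_def using ae' g LpV_measurable[OF f]
    by (intro integral_cong_AE) (measurable, auto elim: eventually_mono)
qed

lemma LpV_vec_nth:
  fixes V :: "'a \<Rightarrow> real^'m::finite"
  assumes "V \<in> LpV M p" "0 \<le> p"
  shows "(\<lambda>x. V x $ j) \<in> LpV M p"
proof -
  have [measurable]: "V \<in> borel_measurable M" using assms by (simp add: LpV_def)
  have m: "(\<lambda>x. V x $ j) \<in> borel_measurable M"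
    by (rule borel_measurable_continuous_on[OF _ \<open>V \<in> borel_measurable M\<close>, of "\<lambda>v. v $ j"]) (intro continuous_intros)
  have "integrable M (\<lambda>x. norm (V x $ j) powr p)"
    by (rule Bochner_Integration.integrable_bound[OF LpV_integrable[OF assms(1)]])
      (use m assms in \<open>auto intro!: AE_I2 powr_mono2 component_le_norm_cart\<close>)
  then show ?thesis using m by (simp add: LpV_def)
qed

lemma LpV_vecI:
  fixes V :: "'a \<Rightarrow> real^'m::finite"
  assumes "\<And>j. (\<lambda>x. V x $ j) \<in> LpV M p" "0 \<le> p"
  shows "V \<in> LpV M p"
proof -
  have eq: "V = (\<lambda>x. \<Sum>j\<in>UNIV. (V x $ j) *\<^sub>R axis j 1)"
  proof
    fix x
    show "V x = (\<Sum>j\<in>UNIV. (V x $ j) *\<^sub>R axis j 1)"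
      using basis_expansion[of "V x"] by (simp add: scalar_mult_eq_scaleR)
  qed
  have "(\<lambda>x. \<Sum>j\<in>J. (V x $ j) *\<^sub>R (axis j 1 :: real^'m)) \<in> LpV M p" if "finite J" for J
    using that
  proof (induction J rule: finite_induct)
    case empty
    show ?case by (simp add: LpV_def)
  next
    case (insert j J)
    have [measurable]: "(\<lambda>x. V x $ j) \<in> borel_measurable M" using assms(1) by (simp add: LpV_def)
    have "(\<lambda>x. (V x $ j) *\<^sub>R (axis j 1 :: real^'m)) \<in> LpV M p"
      using assms(1)[of j] by (simp add: LpV_def)
    from LpV_add[OF this insert.IH assms(2)] show ?case using insert.hyps by simp
  qed
  from this[OF finite_class.finite_UNIV] show ?thesis by (subst eq)
qed

locale X_sobolev =
  fixes X :: "('n::finite, 'm::finite) vfields" and \<Omega> :: "(real^'n) set" and p :: real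
  assumes open_\<Omega>: "open \<Omega>" and bounded_\<Omega>: "bounded \<Omega>" and p_gt_1: "1 < p"
    and loc_lip: "loc_lipschitz X"
begin

abbreviation M where "M \<equiv> lebesgue_on \<Omega>"

abbreviation en :: "(real^'n \<Rightarrow> 'b::euclidean_space) \<Rightarrow> real" where "en \<equiv> pint M p"
abbreviation grad :: "(real^'n \<Rightarrow> real) \<Rightarrow> real^'n \<Rightarrow> real^'m" where "grad \<equiv> Xgrad X \<Omega>"
abbreviation Xp :: "(real^'n \<Rightarrow> real) \<Rightarrow> real^'n \<Rightarrow> real^'m" where "Xp \<equiv> X_pointwise X"
abbreviation W0 :: "(real^'n \<Rightarrow> real) set" where "W0 \<equiv> W1p0 X \<Omega> p"
abbreviation strongly :: "(nat \<Rightarrow> real^'n \<Rightarrow> 'b::euclidean_space) \<Rightarrow> (real^'n \<Rightarrow> 'b) \<Rightarrow> bool" where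
  "strongly us u \<equiv> (\<lambda>k. en (\<lambda>x. us k x - u x)) \<longlonglongrightarrow> 0"

definition wgrad :: "(real^'n \<Rightarrow> real) \<Rightarrow> (real^'n \<Rightarrow> real^'m) \<Rightarrow> bool" where
  "wgrad u V \<longleftrightarrow> u \<in> LpV M p \<and> V \<in> LpV M p \<and> is_Xgrad X \<Omega> u V"

lemma p_bounds: "0 < p" "0 \<le> p" "1 \<le> p" using p_gt_1 by auto

lemma sets_\<Omega>: "\<Omega> \<in> sets lebesgue" using open_\<Omega> by simp

lemma finite_M: "finite_measure M"
  by (rule finite_measure_lebesgue_on_bounded[OF bounded_\<Omega> sets_\<Omega>])

lemma LpV_integrable_compact:
  assumes "V \<in> LpV M p" "compact K" "K \<subseteq> \<Omega>"
  shows "integrable (lebesgue_on K) V"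
proof -
  have K: "K \<in> sets lebesgue" using assms(2) by (simp add: compact_imp_closed)
  have "integrable lebesgue (\<lambda>x. indicator \<Omega> x *\<^sub>R V x)"
    using LpV_imp_integrable[OF assms(1) finite_M p_bounds(3)] sets_\<Omega>
    by (subst (asm) integrable_restrict_space) auto
  then have "integrable lebesgue (\<lambda>x. indicator K x *\<^sub>R (indicator \<Omega> x *\<^sub>R V x))"
    by (rule integrable_mult_indicator[OF K])
  moreover have "(\<lambda>x. indicator K x *\<^sub>R (indicator \<Omega> x *\<^sub>R V x)) = (\<lambda>x. indicator K x *\<^sub>R V x)"
    using assms(3) by (auto simp: indicator_def fun_eq_iff)
  ultimately show ?thesis using K by (subst integrable_restrict_space) auto
qed

lemma Xadj_test:
  assumes "\<psi> \<in> test_functions S"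
  shows "Xadj X j \<psi> \<in> borel_measurable borel" "Xadj X j \<psi> \<in> borel_measurable M"
    "\<exists>B\<ge>0. \<forall>x. \<bar>Xadj X j \<psi> x\<bar> \<le> B"
proof -
  obtain L where L: "L-lipschitz_on UNIV \<psi>" using test_functionD(4)[OF assms] by blast
  show 1: "Xadj X j \<psi> \<in> borel_measurable borel" "\<exists>B\<ge>0. \<forall>x. \<bar>Xadj X j \<psi> x\<bar> \<le> B"
    using Xadj_bounded_measurable[OF loc_lip L test_functionD(2)[OF assms]] by blast+
  show "Xadj X j \<psi> \<in> borel_measurable M" by (rule measurable_lebesgue_on_borel[OF 1(1)])
qed

lemma integrable_mult_Xadj:
  assumes "u \<in> LpV M p" "\<psi> \<in> test_functions S"
  shows "integrable M (\<lambda>x. u x * Xadj X j \<psi> x)"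
  using Xadj_test[OF assms(2)] LpV_integrable_mult_bounded[OF assms(1) finite_M p_bounds(3)] by blast

lemma integrable_mult_test:
  assumes "u \<in> LpV M p" "\<psi> \<in> test_functions S"
  shows "integrable M (\<lambda>x. u x * \<psi> x)"
  using test_functionD(5)[OF assms(2)] measurable_lebesgue_on_borel[OF test_functionD(3)[OF assms(2)]]
    LpV_integrable_mult_bounded[OF assms(1) finite_M p_bounds(3)] by blast

lemma wgradI:
  assumes "u \<in> LpV M p" "V \<in> LpV M p"
    and "\<And>j \<psi>. \<psi> \<in> test_functions \<Omega> \<Longrightarrow> (LINT x|M. V x $ j * \<psi> x) = - (LINT x|M. u x * Xadj X j \<psi> x)"
  shows "wgrad u V"
  unfolding wgrad_def by (intro conjI assms(1,2) is_XgradI LpV_integrable_compact[OF assms(2)] assms(3))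

lemma wgradD:
  assumes "wgrad u V"
  shows "u \<in> LpV M p" "V \<in> LpV M p" "is_Xgrad X \<Omega> u V"
    "\<psi> \<in> test_functions \<Omega> \<Longrightarrow> (LINT x|M. V x $ j * \<psi> x) = - (LINT x|M. u x * Xadj X j \<psi> x)"
proof -
  show 1: "u \<in> LpV M p" "V \<in> LpV M p" "is_Xgrad X \<Omega> u V" using assms by (auto simp: wgrad_def)
  show "(LINT x|M. V x $ j * \<psi> x) = - (LINT x|M. u x * Xadj X j \<psi> x)" if "\<psi> \<in> test_functions \<Omega>"
    by (rule is_XgradD(2)[OF 1(3) that])
qed

lemma W1p_iff: "u \<in> W1p X \<Omega> p \<longleftrightarrow> (\<exists>V. wgrad u V)"
proof -
  have "(\<forall>j. (\<lambda>x. V x $ j) \<in> LpV M p) \<longleftrightarrow> V \<in> LpV M p" for V :: "real^'n \<Rightarrow> real^'m"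
  proof
    assume "\<forall>j. (\<lambda>x. V x $ j) \<in> LpV M p"
    then show "V \<in> LpV M p" by (intro LpV_vecI[OF _ p_bounds(2)]) (rule spec)
  next
    assume "V \<in> LpV M p"
    then show "\<forall>j. (\<lambda>x. V x $ j) \<in> LpV M p" by (intro allI) (rule LpV_vec_nth[OF _ p_bounds(2)])
  qed
  then show ?thesis by (simp add: W1p_def wgrad_def Lp_eq_LpV) blast
qed

text \<open>\<open>V'\<close> is known to be integrable on compact sets only, and its product with a
  test function is integrable through the support of the latter. In this form the lemma applies to
  the value chosen by \<open>Xgrad\<close>, which thereby inherits p-integrability.\<close>

lemma wgrad_unique:
  assumes u: "wgrad u V" and V': "is_Xgrad X \<Omega> u V'"
  shows "AE x in M. V x = V' x"
proof -
  have "AE x in M. V x $ j - V' x $ j = 0" for j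
  proof (rule fundamental_lemma_calculus_of_variations[OF open_\<Omega>])
    have vn: "integrable N (\<lambda>x. V x $ j)" if "integrable N V" for N and V :: "real^'n \<Rightarrow> real^'m"
      by (rule integrable_bounded_linear[OF bounded_linear_vec_nth that])
    show "integrable (lebesgue_on K) (\<lambda>x. V x $ j - V' x $ j)" if "compact K" "K \<subseteq> \<Omega>" for K
      using is_XgradD(1)[OF wgradD(3)[OF u] that] is_XgradD(1)[OF V' that] by (intro Bochner_Integration.integrable_diff vn)
    fix \<psi> assume \<psi>: "\<psi> \<in> test_functions \<Omega>"
    have I1: "integrable M (\<lambda>x. V x $ j * \<psi> x)"
      by (rule integrable_mult_test[OF LpV_vec_nth[OF wgradD(2)[OF u] p_bounds(2)] \<psi>])
    have I2: "integrable M (\<lambda>x. V' x $ j * \<psi> x)"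
    proof -
      let ?K = "closure {x. \<psi> x \<noteq> 0}"
      have K: "compact ?K" "?K \<subseteq> \<Omega>" using test_functionD(2)[OF \<psi>] by (auto simp: compactly_supported_def)
      have Ks: "?K \<in> sets lebesgue" by simp
      obtain B where B: "0 \<le> B" "\<And>x. \<bar>\<psi> x\<bar> \<le> B" using test_functionD(5)[OF \<psi>] by blast
      have i1: "integrable (lebesgue_on ?K) (\<lambda>x. V' x $ j)" by (rule vn[OF is_XgradD(1)[OF V' K]])
      then have "integrable (lebesgue_on ?K) (\<lambda>x. V' x $ j * B)" by simp
      then have "integrable (lebesgue_on ?K) (\<lambda>x. V' x $ j * \<psi> x)"
        by (rule Bochner_Integration.integrable_bound)
          (use i1 measurable_lebesgue_on_borel[OF test_functionD(3)[OF \<psi>]] B in \<open>auto simp: abs_mult intro!: AE_I2 mult_left_mono\<close>)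
      then have "integrable lebesgue (\<lambda>x. indicator ?K x *\<^sub>R (V' x $ j * \<psi> x))"
        using Ks by (subst (asm) integrable_restrict_space) auto
      moreover have "(\<lambda>x. indicator ?K x *\<^sub>R (V' x $ j * \<psi> x)) = (\<lambda>x. indicator \<Omega> x *\<^sub>R (V' x $ j * \<psi> x))"
        using K(2) closure_subset[of "{x. \<psi> x \<noteq> 0}"] by (fastforce simp: indicator_def fun_eq_iff)
      ultimately show ?thesis using sets_\<Omega> by (subst integrable_restrict_space) auto
    qed
    show "(LINT x|M. (V x $ j - V' x $ j) * \<psi> x) = 0"
      using wgradD(4)[OF u \<psi>] is_XgradD(2)[OF V' \<psi>] I1 I2 by (simp add: left_diff_distrib)
  qed
  then have "AE x in M. \<forall>j. V x $ j - V' x $ j = 0" by (simp add: AE_all_countable)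
  then show ?thesis by eventually_elim (simp add: vec_eq_iff)
qed

lemma wgrad_cong_AE:
  assumes u: "wgrad u V" and "AE x in M. u x = u' x" "AE x in M. V x = V' x"
  shows "wgrad u' V'"
proof (rule wgradI)
  show u': "u' \<in> LpV M p" and V': "V' \<in> LpV M p"
    using LpV_cong_AE(1)[OF sets_\<Omega>] wgradD[OF u] assms by blast+
  fix j \<psi> assume \<psi>: "\<psi> \<in> test_functions \<Omega>"
  have "(LINT x|M. V' x $ j * \<psi> x) = (LINT x|M. V x $ j * \<psi> x)"
    using integrable_mult_test[OF LpV_vec_nth[OF wgradD(2)[OF u] p_bounds(2)] \<psi>, of j]
      integrable_mult_test[OF LpV_vec_nth[OF V' p_bounds(2)] \<psi>, of j] assms(3)
    by (intro integral_cong_AE) (auto elim: eventually_mono)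
  also have "\<dots> = - (LINT x|M. u x * Xadj X j \<psi> x)" by (rule wgradD(4)[OF u \<psi>])
  also have "(LINT x|M. u x * Xadj X j \<psi> x) = (LINT x|M. u' x * Xadj X j \<psi> x)"
    using integrable_mult_Xadj[OF wgradD(1)[OF u] \<psi>, of j] integrable_mult_Xadj[OF u' \<psi>, of j] assms(2)
    by (intro integral_cong_AE) (auto elim: eventually_mono)
  finally show "(LINT x|M. V' x $ j * \<psi> x) = - (LINT x|M. u' x * Xadj X j \<psi> x)" .
qed

lemma wgrad_Xgrad:
  assumes "wgrad u V"
  shows "wgrad u (grad u)" "AE x in M. V x = grad u x"
proof -
  have "is_Xgrad X \<Omega> u (grad u)"
    unfolding Xgrad_def by (rule someI[of "is_Xgrad X \<Omega> u", OF wgradD(3)[OF assms]])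
  then show ae: "AE x in M. V x = grad u x" by (rule wgrad_unique[OF assms])
  show "wgrad u (grad u)" by (rule wgrad_cong_AE[OF assms _ ae]) simp
qed

lemma W1p_Xgrad: "u \<in> W1p X \<Omega> p \<Longrightarrow> wgrad u (grad u)"
  using wgrad_Xgrad(1) W1p_iff by blast

lemma wgrad_W1p: "wgrad u V \<Longrightarrow> u \<in> W1p X \<Omega> p"
  using W1p_iff by blast

lemma pint_Xgrad:
  assumes "wgrad u V"
  shows "en (grad u) = en V"
  by (rule LpV_cong_AE(2)[OF sets_\<Omega> wgradD(2)[OF assms] wgrad_Xgrad(2)[OF assms]])

lemma wgrad_lincomb:
  assumes u: "wgrad u U" and v: "wgrad v V"
  shows "wgrad (\<lambda>x. a * u x + b * v x) (\<lambda>x. a *\<^sub>R U x + b *\<^sub>R V x)"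
proof (rule wgradI)
  show "(\<lambda>x. a * u x + b * v x) \<in> LpV M p"
    using LpV_add[OF LpV_scaleR[OF wgradD(1)[OF u], of a] LpV_scaleR[OF wgradD(1)[OF v], of b] p_bounds(2)] by simp
  show "(\<lambda>x. a *\<^sub>R U x + b *\<^sub>R V x) \<in> LpV M p"
    by (rule LpV_add[OF LpV_scaleR[OF wgradD(2)[OF u], of a] LpV_scaleR[OF wgradD(2)[OF v], of b] p_bounds(2)])
  fix j \<psi> assume \<psi>: "\<psi> \<in> test_functions \<Omega>"
  note I = integrable_mult_test[OF LpV_vec_nth[OF wgradD(2)[OF u] p_bounds(2)] \<psi>, of j]
    integrable_mult_test[OF LpV_vec_nth[OF wgradD(2)[OF v] p_bounds(2)] \<psi>, of j]
    integrable_mult_Xadj[OF wgradD(1)[OF u] \<psi>, of j] integrable_mult_Xadj[OF wgradD(1)[OF v] \<psi>, of j]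
  have "(LINT x|M. (a *\<^sub>R U x + b *\<^sub>R V x) $ j * \<psi> x) = (LINT x|M. a * (U x $ j * \<psi> x) + b * (V x $ j * \<psi> x))"
    by (simp add: algebra_simps)
  also have "\<dots> = a * (LINT x|M. U x $ j * \<psi> x) + b * (LINT x|M. V x $ j * \<psi> x)" using I by simp
  also have "\<dots> = - (a * (LINT x|M. u x * Xadj X j \<psi> x) + b * (LINT x|M. v x * Xadj X j \<psi> x))"
    using wgradD(4)[OF u \<psi>, of j] wgradD(4)[OF v \<psi>, of j] by simp
  also have "a * (LINT x|M. u x * Xadj X j \<psi> x) + b * (LINT x|M. v x * Xadj X j \<psi> x)
      = (LINT x|M. a * (u x * Xadj X j \<psi> x) + b * (v x * Xadj X j \<psi> x))" using I by simp
  also have "\<dots> = (LINT x|M. (a * u x + b * v x) * Xadj X j \<psi> x)" by (simp add: algebra_simps)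
  finally show "(LINT x|M. (a *\<^sub>R U x + b *\<^sub>R V x) $ j * \<psi> x) = - (LINT x|M. (a * u x + b * v x) * Xadj X j \<psi> x)" .
qed

lemma wgrad_diff: "wgrad u U \<Longrightarrow> wgrad v V \<Longrightarrow> wgrad (\<lambda>x. u x - v x) (\<lambda>x. U x - V x)"
  using wgrad_lincomb[of u U v V 1 "-1"] by simp

lemma wgrad_add: "wgrad u U \<Longrightarrow> wgrad v V \<Longrightarrow> wgrad (\<lambda>x. u x + v x) (\<lambda>x. U x + V x)"
  using wgrad_lincomb[of u U v V 1 1] by simp

lemma wgrad_midpoint:
  "wgrad u U \<Longrightarrow> wgrad v V \<Longrightarrow> wgrad (\<lambda>x. (1/2) * u x + (1/2) * v x) (\<lambda>x. (1/2) *\<^sub>R (U x + V x))"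
  using wgrad_lincomb[of u U v V "1/2" "1/2"] by (simp add: scaleR_add_right)

lemma pint_vec_nth_le:
  fixes V :: "real^'n \<Rightarrow> real^'k::finite"
  shows "V \<in> LpV M p \<Longrightarrow> en (\<lambda>x. V x $ j) \<le> en V"
  unfolding pint_def using LpV_vec_nth[of V M p j] p_bounds
  by (intro integral_mono) (auto simp: LpV_def intro!: powr_mono2 component_le_norm_cart)

text \<open>Test functions and their images under \<open>Xadj\<close> are bounded, so both sides of
  the weak identity are continuous under L^p convergence on the bounded set
  \<open>\<Omega>\<close>.\<close>

lemma wgrad_limit:
  assumes u: "\<And>k. wgrad (u k) (U k)" and v: "v \<in> LpV M p" and V: "V \<in> LpV M p"
    and lim: "strongly u v" "strongly U V"
  shows "wgrad v V"
proof (rule wgradI[OF v V])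
  fix j \<psi> assume \<psi>: "\<psi> \<in> test_functions \<Omega>"
  have lim2: "(\<lambda>k. en (\<lambda>x. U k x $ j - V x $ j)) \<longlonglongrightarrow> 0"
  proof (rule tendsto_sandwich[OF always_eventually always_eventually tendsto_const lim(2)])
    have "en (\<lambda>x. (U k x - V x) $ j) \<le> en (\<lambda>x. U k x - V x)" for k
      by (rule pint_vec_nth_le[OF LpV_diff[OF wgradD(2)[OF u] V p_bounds(2)]])
    then show "\<forall>k. en (\<lambda>x. U k x $ j - V x $ j) \<le> en (\<lambda>x. U k x - V x)" by simp
  qed (simp add: pint_nonneg)
  obtain B1 where B1: "\<And>x. \<bar>\<psi> x\<bar> \<le> B1" using test_functionD(5)[OF \<psi>] by blast
  obtain B2 where B2: "\<And>x. \<bar>Xadj X j \<psi> x\<bar> \<le> B2" using Xadj_test(3)[OF \<psi>] by blast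
  have "(\<lambda>k. LINT x|M. U k x $ j * \<psi> x) \<longlonglongrightarrow> (LINT x|M. V x $ j * \<psi> x)"
    by (rule LpV_integral_mult_tendsto[OF finite_M p_bounds(3) LpV_vec_nth[OF wgradD(2)[OF u] p_bounds(2)]
          LpV_vec_nth[OF V p_bounds(2)] lim2 measurable_lebesgue_on_borel[OF test_functionD(3)[OF \<psi>]] B1])
  moreover have "(\<lambda>k. LINT x|M. u k x * Xadj X j \<psi> x) \<longlonglongrightarrow> (LINT x|M. v x * Xadj X j \<psi> x)"
    by (rule LpV_integral_mult_tendsto[OF finite_M p_bounds(3) wgradD(1)[OF u] v lim(1) Xadj_test(2)[OF \<psi>] B2])
  then have "(\<lambda>k. - (LINT x|M. u k x * Xadj X j \<psi> x)) \<longlonglongrightarrow> - (LINT x|M. v x * Xadj X j \<psi> x)"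
    by (rule tendsto_minus)
  ultimately show "(LINT x|M. V x $ j * \<psi> x) = - (LINT x|M. v x * Xadj X j \<psi> x)"
    using wgradD(4)[OF u \<psi>, of _ j] LIMSEQ_unique by auto
qed

end

section \<open>Products and zero boundary values\<close>

lemma lebesgue_on_zero_outside:
  fixes f :: "'a::euclidean_space \<Rightarrow> 'b::euclidean_space"
  assumes S: "S \<in> sets lebesgue" and f: "\<And>x. x \<notin> S \<Longrightarrow> f x = 0"
  shows "integrable (lebesgue_on S) f \<longleftrightarrow> integrable lebesgue f"
    and "integral\<^sup>L (lebesgue_on S) f = integral\<^sup>L lebesgue f"
    and "f \<in> borel_measurable (lebesgue_on S) \<longleftrightarrow> f \<in> borel_measurable lebesgue"
proof -
  have eq: "(\<lambda>x. indicator S x *\<^sub>R f x) = f" using f by (auto simp: indicator_def fun_eq_iff)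
  show "integrable (lebesgue_on S) f \<longleftrightarrow> integrable lebesgue f"
    using S by (subst integrable_restrict_space) (auto simp: eq)
  show "integral\<^sup>L (lebesgue_on S) f = integral\<^sup>L lebesgue f"
    using S by (subst integral_restrict_space) (auto simp: eq)
  show "f \<in> borel_measurable (lebesgue_on S) \<longleftrightarrow> f \<in> borel_measurable lebesgue"
    using S by (subst borel_measurable_restrict_space_iff) (auto simp: eq)
qed

lemma compactly_supported_zero:
  assumes "compactly_supported S u" "x \<notin> S"
  shows "u x = 0"
  using assms closure_subset[of "{x. u x \<noteq> 0}"] by (auto simp: compactly_supported_def)

lemma compactly_supported_mult:
  fixes u v :: "real^'n::finite \<Rightarrow> real"
  assumes "compactly_supported S u"
  shows "compactly_supported S (\<lambda>x. u x * v x)" "compactly_supported S (\<lambda>x. v x * u x)"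
proof -
  let ?K = "closure {x. u x \<noteq> 0}"
  have K: "compact ?K" "?K \<subseteq> S" using assms by (auto simp: compactly_supported_def)
  have z: "u x = 0" if "x \<notin> ?K" for x using that closure_subset[of "{x. u x \<noteq> 0}"] by blast
  show "compactly_supported S (\<lambda>x. u x * v x)"
    by (rule compactly_supportedI[OF K], drule z) simp
  show "compactly_supported S (\<lambda>x. v x * u x)"
    by (rule compactly_supportedI[OF K], drule z) simp
qed

lemma compactly_supported_add:
  fixes u v :: "real^'n::finite \<Rightarrow> real"
  assumes "compactly_supported S u" "compactly_supported S v"
  shows "compactly_supported S (\<lambda>x. u x + v x)"
proof (rule compactly_supportedI[of "closure {x. u x \<noteq> 0} \<union> closure {x. v x \<noteq> 0}"])
  show "u x + v x = 0" if "x \<notin> closure {x. u x \<noteq> 0} \<union> closure {x. v x \<noteq> 0}" for x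
    using that closure_subset[of "{x. u x \<noteq> 0}"] closure_subset[of "{x. v x \<noteq> 0}"] by force
qed (use assms in \<open>auto simp: compactly_supported_def\<close>)

lemma C1c_lincomb:
  fixes S :: "(real^'n::finite) set"
  assumes "u \<in> C1c S" "v \<in> C1c S"
  shows "(\<lambda>x. a * u x + b * v x) \<in> C1c S"
proof -
  have "Ck 1 (\<lambda>x. a * u x + b * v x)" using assms by (intro Ck_add Ck_mult Ck_const) (auto simp: C1c_def)
  moreover have "compactly_supported S (\<lambda>x. a * u x + b * v x)"
    using assms by (intro compactly_supported_add compactly_supported_mult(2)) (auto simp: C1c_def)
  ultimately show ?thesis by (simp add: C1c_def)
qed

lemma integrable_bounded_compactly_supported:
  fixes f :: "real^'n::finite \<Rightarrow> real"
  assumes "f \<in> borel_measurable borel" "bounded K" "\<And>x. x \<notin> K \<Longrightarrow> f x = 0" "\<And>x. \<bar>f x\<bar> \<le> B"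
  shows "integrable lborel f"
proof -
  obtain R where "\<forall>x\<in>K. norm x \<le> R" using assms(2) by (auto simp: bounded_iff)
  then have R: "K \<subseteq> cball 0 R" by auto
  have "integrable lborel (\<lambda>x::real^'n. B * indicator (cball 0 R) x :: real)"
    by (intro integrable_mult_right integrable_real_indicator) (auto simp: emeasure_bounded_finite[unfolded infinity_ennreal_def])
  then show ?thesis
  proof (rule Bochner_Integration.integrable_bound)
    have "norm (f x) \<le> norm (B * indicator (cball 0 R) x :: real)" for x
      using assms(3)[of x] assms(4)[of x] R by (cases "x \<in> cball 0 R") (auto simp: subset_iff)
    then show "AE x in lborel. norm (f x) \<le> norm (B * indicator (cball 0 R) x :: real)" by simp
  qed (use assms(1) in simp)
qed

lemma continuous_X_pointwise:
  assumes X: "loc_lipschitz X" and u: "Ck 1 u"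
  shows "continuous_on UNIV (X_pointwise X u)"
proof -
  have "continuous_on UNIV (partial_deriv i u)" for i using u by simp
  then show ?thesis
    unfolding X_pointwise_def
    by (intro continuous_on_vec_lambda continuous_intros loc_lipschitz_continuous[OF X])
qed

lemma X_pointwise_outside:
  "x \<notin> closure {x. u x \<noteq> 0} \<Longrightarrow> X_pointwise X u x = 0"
  by (simp add: X_pointwise_def partial_deriv_outside_support vec_eq_iff)

lemma X_pointwise_bounded:
  fixes u :: "real^'n::finite \<Rightarrow> real"
  assumes X: "loc_lipschitz X" and u: "Ck 1 u" "compactly_supported S u"
  obtains B where "0 \<le> B" "\<And>x. norm (X_pointwise X u x) \<le> B"
proof -
  let ?K = "closure {x. u x \<noteq> 0}"
  have "compact (X_pointwise X u ` ?K)"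
    using u(2) by (intro compact_continuous_image continuous_on_subset[OF continuous_X_pointwise[OF X u(1)]])
      (auto simp: compactly_supported_def)
  then obtain B where B: "\<And>x. x \<in> ?K \<Longrightarrow> norm (X_pointwise X u x) \<le> B"
    by (force dest!: compact_imp_bounded simp: bounded_iff)
  have "norm (X_pointwise X u x) \<le> max B 0" for x
    using B[of x] X_pointwise_outside[of x u X] by (cases "x \<in> ?K") auto
  then show ?thesis using that[of "max B 0"] by simp
qed

text \<open>Leibniz rule for \<open>\<zeta>\<close> times the Lipschitz function
  \<open>X y $ j $ i * \<psi> y\<close>. It holds where the latter has all its partial derivatives,
  hence almost everywhere.\<close>

lemma Xadj_mult_AE:
  assumes X: "loc_lipschitz X" and z: "Ck 1 \<zeta>" and \<psi>: "\<psi> \<in> test_functions S"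
  shows "AE x in lborel. Xadj X j (\<lambda>y. \<zeta> y * \<psi> y) x = \<zeta> x * Xadj X j \<psi> x + \<psi> x * X_pointwise X \<zeta> x $ j"
proof -
  obtain L where L: "L-lipschitz_on UNIV \<psi>" using test_functionD(4)[OF \<psi>] by blast
  have "AE x in lborel. partially_differentiable i (\<lambda>y. X y $ j $ i * \<psi> y) x" for i
    by (rule coefficient_mult_lipschitz[OF X L test_functionD(2)[OF \<psi>], where j = j and i = i])
      (rule lipschitz_AE_partially_differentiable)
  then have "AE x in lborel. \<forall>i. partially_differentiable i (\<lambda>y. X y $ j $ i * \<psi> y) x"
    by (simp add: AE_all_countable)
  then show ?thesis
  proof eventually_elim
    case (elim x)
    have "partial_deriv i (\<lambda>y. X y $ j $ i * (\<zeta> y * \<psi> y)) x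
        = partial_deriv i \<zeta> x * (X x $ j $ i * \<psi> x) + \<zeta> x * partial_deriv i (\<lambda>y. X y $ j $ i * \<psi> y) x" for i
      using partial_deriv_mult(2)[OF Ck_Suc_partially_differentiable[OF z[unfolded One_nat_def], where i = i and x = x] elim[rule_format, of i]]
      by (simp add: mult.left_commute)
    then show ?case
      by (simp add: Xadj_def X_pointwise_def sum.distrib sum_distrib_left algebra_simps)
  qed
qed

context X_sobolev
begin

lemma zero_outside:
  fixes f :: "real^'n \<Rightarrow> 'b::euclidean_space"
  assumes "\<And>x. x \<notin> \<Omega> \<Longrightarrow> f x = 0"
  shows "f \<in> LpV M p \<longleftrightarrow> f \<in> LpV lebesgue p" "en f = pint lebesgue p f"
proof -
  have n: "\<And>x. x \<notin> \<Omega> \<Longrightarrow> norm (f x) powr p = 0" using assms by simp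
  show "f \<in> LpV M p \<longleftrightarrow> f \<in> LpV lebesgue p"
    unfolding LpV_def using lebesgue_on_zero_outside(3)[where f = f, OF sets_\<Omega> assms]
      lebesgue_on_zero_outside(1)[OF sets_\<Omega> n] by simp
  show "en f = pint lebesgue p f"
    unfolding pint_def by (rule lebesgue_on_zero_outside(2)[OF sets_\<Omega> n])
qed

lemma LpV_bounded:
  assumes "f \<in> borel_measurable M" "\<And>x. norm (f x) \<le> B"
  shows "f \<in> LpV M p"
proof -
  interpret finite_measure M by (rule finite_M)
  have "integrable M (\<lambda>x. norm (f x) powr p)"
    by (rule integrable_const_bound[of _ "B powr p"])
      (use assms p_bounds in \<open>auto intro!: AE_I2 powr_mono2\<close>)
  then show ?thesis using assms(1) by (simp add: LpV_def)
qed

lemma LpV_mult_bounded: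
  fixes V :: "real^'n \<Rightarrow> 'b::euclidean_space"
  assumes "V \<in> LpV M p" "g \<in> borel_measurable M" "\<And>x. \<bar>g x\<bar> \<le> B"
  shows "(\<lambda>x. g x *\<^sub>R V x) \<in> LpV M p" "en (\<lambda>x. g x *\<^sub>R V x) \<le> B powr p * en V"
proof -
  have V: "V \<in> borel_measurable M" using assms by (simp add: LpV_def)
  have I: "integrable M (\<lambda>x. B powr p * norm (V x) powr p)" using assms by (simp add: LpV_def)
  have le: "norm (g x *\<^sub>R V x) powr p \<le> B powr p * norm (V x) powr p" for x
    using assms(3)[of x] p_bounds by (auto simp: powr_mult intro!: mult_right_mono powr_mono2)
  have J: "integrable M (\<lambda>x. norm (g x *\<^sub>R V x) powr p)"
    by (rule Bochner_Integration.integrable_bound[OF I]) (use V assms(2) le in auto)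
  then show "(\<lambda>x. g x *\<^sub>R V x) \<in> LpV M p" using V assms(2) by (simp add: LpV_def)
  have "en (\<lambda>x. g x *\<^sub>R V x) \<le> (LINT x|M. B powr p * norm (V x) powr p)"
    unfolding pint_def by (rule integral_mono[OF J I le])
  then show "en (\<lambda>x. g x *\<^sub>R V x) \<le> B powr p * en V" by (simp add: pint_def)
qed

text \<open>The product of a coefficient with \<open>u\<close> and \<open>\<psi>\<close> is
  Lipschitz with compact support, so its partial derivatives integrate to zero. Expanding their sum
  by the Leibniz rule leaves the two sides.\<close>

lemma C1c_wgrad_UNIV:
  assumes u: "Ck 1 u" "compactly_supported S u" and \<psi>: "\<psi> \<in> test_functions UNIV"
  shows "(LINT x|lebesgue. Xp u x $ j * \<psi> x) = - (LINT x|lebesgue. u x * Xadj X j \<psi> x)"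
proof -
  have \<psi>1: "Ck 1 \<psi>" by (rule test_functionD(1)[OF \<psi>])
  have Cu\<psi>: "Ck 1 (\<lambda>x. u x * \<psi> x)" by (rule Ck_mult[OF u(1) \<psi>1])
  have su\<psi>: "compactly_supported S (\<lambda>x. u x * \<psi> x)" by (rule compactly_supported_mult(1)[OF u(2)])
  obtain L where L: "L-lipschitz_on UNIV (\<lambda>x. u x * \<psi> x)" using C1_lipschitz[OF Cu\<psi> su\<psi>] .
  define h where "h i y = X y $ j $ i * (u y * \<psi> y)" for i y
  have "\<exists>l. l-lipschitz_on UNIV (h i)" for i
    by (rule coefficient_mult_lipschitz[OF loc_lip L su\<psi>, where j = j and i = i]) (auto simp: h_def[abs_def])
  then obtain l where l: "\<And>i. (l i)-lipschitz_on UNIV (h i)" by metis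
  have K: "compact (closure {x. u x \<noteq> 0})" using u(2) by (simp add: compactly_supported_def)
  have "bounded {x. h i x \<noteq> 0}" for i
    by (rule bounded_subset[OF compact_imp_bounded[OF K]]) (use closure_subset in \<open>force simp: h_def\<close>)
  note h0 = integral_partial_deriv_eq_0[OF l this]
  have "AE x in lborel. Xadj X j (\<lambda>y. u y * \<psi> y) x = u x * Xadj X j \<psi> x + \<psi> x * Xp u x $ j"
    by (rule Xadj_mult_AE[OF loc_lip u(1) \<psi>])
  have um: "u \<in> borel_measurable borel" by (rule borel_measurable_continuous_onI[OF Ck_continuous[OF u(1)]])
  have Xm: "(\<lambda>x. Xp u x $ j) \<in> borel_measurable borel"
    by (intro borel_measurable_continuous_onI continuous_intros continuous_X_pointwise[OF loc_lip u(1)])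
  obtain B1 where B1: "0 \<le> B1" "\<And>x. \<bar>u x\<bar> \<le> B1" using compact_support_bounded[OF Ck_continuous[OF u(1)] u(2)] by blast
  obtain B2 where B2: "0 \<le> B2" "\<And>x. \<bar>\<psi> x\<bar> \<le> B2" using test_functionD(5)[OF \<psi>] by blast
  obtain B3 where B3: "0 \<le> B3" "\<And>x. norm (Xp u x) \<le> B3" using X_pointwise_bounded[OF loc_lip u] by blast
  obtain B4 where B4: "0 \<le> B4" "\<And>x. \<bar>Xadj X j \<psi> x\<bar> \<le> B4" using Xadj_test(3)[OF \<psi>] by blast
  have I1: "integrable lborel (\<lambda>x. u x * Xadj X j \<psi> x)"
  proof (rule integrable_bounded_compactly_supported)
    show "\<bar>u x * Xadj X j \<psi> x\<bar> \<le> B1 * B4" for x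
      using B1 B4 by (simp add: abs_mult mult_mono)
    show "u x * Xadj X j \<psi> x = 0" if "x \<notin> closure {x. u x \<noteq> 0}" for x
      using that closure_subset[of "{x. u x \<noteq> 0}"] by auto
  qed (use um Xadj_test(1)[OF \<psi>] compact_imp_bounded[OF K] in auto)
  have I2: "integrable lborel (\<lambda>x. \<psi> x * Xp u x $ j)"
  proof (rule integrable_bounded_compactly_supported)
    show "\<bar>\<psi> x * Xp u x $ j\<bar> \<le> B2 * B3" for x
      using B2 order_trans[OF component_le_norm_cart B3(2)] B3(1) by (simp add: abs_mult mult_mono)
    show "\<psi> x * Xp u x $ j = 0" if "x \<notin> closure {x. u x \<noteq> 0}" for x
      using X_pointwise_outside[OF that, of X] by simp
  qed (use Xm test_functionD(3)[OF \<psi>] compact_imp_bounded[OF K] in auto)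
  have "0 = (\<Sum>i\<in>UNIV. LINT x|lborel. partial_deriv i (h i) x)" using h0(2) by simp
  also have "\<dots> = (LINT x|lborel. (\<Sum>i\<in>UNIV. partial_deriv i (h i) x))"
    using h0(1) by (simp add: Bochner_Integration.integral_sum)
  also have "\<dots> = (LINT x|lborel. u x * Xadj X j \<psi> x + \<psi> x * Xp u x $ j)"
  proof (rule integral_cong_AE)
    show "(\<lambda>x. \<Sum>i\<in>UNIV. partial_deriv i (h i) x) \<in> borel_measurable lborel"
      using h0(1) by (intro borel_measurable_sum) auto
    show "AE x in lborel. (\<Sum>i\<in>UNIV. partial_deriv i (h i) x) = u x * Xadj X j \<psi> x + \<psi> x * Xp u x $ j"
      using Xadj_mult_AE[OF loc_lip u(1) \<psi>, of j] by (simp add: Xadj_def h_def[abs_def])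
  qed (use I1 I2 in auto)
  also have "\<dots> = (LINT x|lborel. u x * Xadj X j \<psi> x) + (LINT x|lborel. Xp u x $ j * \<psi> x)"
    using I1 I2 by (simp add: mult.commute)
  finally show ?thesis
    using I1 I2 by (simp add: integral_completion mult.commute)
qed

lemma test_functions_mono: "\<psi> \<in> test_functions S \<Longrightarrow> S \<subseteq> T \<Longrightarrow> \<psi> \<in> test_functions T"
  by (auto simp: test_functions_def compactly_supported_def)

lemma C1c_wgrad:
  assumes "u \<in> C1c \<Omega>"
  shows "wgrad u (Xp u)"
proof (rule wgradI)
  have u: "Ck 1 u" "compactly_supported \<Omega> u" using assms by (auto simp: C1c_def)
  obtain B1 where B1: "0 \<le> B1" "\<And>x. \<bar>u x\<bar> \<le> B1" using compact_support_bounded[OF Ck_continuous[OF u(1)] u(2)] by blast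
  obtain B3 where B3: "0 \<le> B3" "\<And>x. norm (Xp u x) \<le> B3" using X_pointwise_bounded[OF loc_lip u] by blast
  show "u \<in> LpV M p"
    by (rule LpV_bounded[where B = B1], rule measurable_lebesgue_on_borel,
        rule borel_measurable_continuous_onI[OF Ck_continuous[OF u(1)]]) (use B1 in simp)
  show "Xp u \<in> LpV M p"
    by (rule LpV_bounded[OF _ B3(2)], rule measurable_lebesgue_on_borel,
        rule borel_measurable_continuous_onI[OF continuous_X_pointwise[OF loc_lip u(1)]])
  fix j \<psi> assume \<psi>: "\<psi> \<in> test_functions \<Omega>"
  have z: "\<psi> x = 0" if "x \<notin> \<Omega>" for x using compactly_supported_zero[OF test_functionD(2)[OF \<psi>] that] .
  have z2: "u x = 0" if "x \<notin> \<Omega>" for x using compactly_supported_zero[OF u(2) that] .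
  show "(LINT x|M. Xp u x $ j * \<psi> x) = - (LINT x|M. u x * Xadj X j \<psi> x)"
    using C1c_wgrad_UNIV[OF u test_functions_mono[OF \<psi> subset_UNIV], of j]
    by (subst (1 2) lebesgue_on_zero_outside(2)[OF sets_\<Omega>]) (auto simp: z z2)
qed

text \<open>Moving \<open>\<zeta>\<close> onto the test function and applying the Leibniz rule for
  \<open>Xadj\<close> gives both claims. The second admits test functions of the whole space, since
  multiplication by \<open>\<zeta>\<close> brings the support into \<open>\<Omega>\<close>;
  translated mollifiers are such test functions.\<close>

lemma wgrad_mult_test:
  assumes u: "wgrad u V" and z: "\<zeta> \<in> test_functions \<Omega>"
  shows "wgrad (\<lambda>x. \<zeta> x * u x) (\<lambda>x. \<zeta> x *\<^sub>R V x + u x *\<^sub>R Xp \<zeta> x)" (is "wgrad ?w ?W")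
    and "\<psi> \<in> test_functions UNIV \<Longrightarrow>
      (LINT x|M. (\<zeta> x *\<^sub>R V x + u x *\<^sub>R Xp \<zeta> x) $ j * \<psi> x) = - (LINT x|M. \<zeta> x * u x * Xadj X j \<psi> x)"
proof -
  have z1: "Ck 1 \<zeta>" and zs: "compactly_supported \<Omega> \<zeta>" using test_functionD[OF z] by auto
  have zm: "\<zeta> \<in> borel_measurable M" by (rule measurable_lebesgue_on_borel[OF test_functionD(3)[OF z]])
  obtain B1 where B1: "0 \<le> B1" "\<And>x. \<bar>\<zeta> x\<bar> \<le> B1" using test_functionD(5)[OF z] by blast
  obtain B3 where B3: "0 \<le> B3" "\<And>x. norm (Xp \<zeta> x) \<le> B3" using X_pointwise_bounded[OF loc_lip z1 zs] by blast
  have Xm: "(\<lambda>x. Xp \<zeta> x $ j) \<in> borel_measurable M" for j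
    by (intro measurable_lebesgue_on_borel borel_measurable_continuous_onI continuous_intros continuous_X_pointwise[OF loc_lip z1])
  have Xb: "\<bar>Xp \<zeta> x $ j\<bar> \<le> B3" for x j by (rule order_trans[OF component_le_norm_cart B3(2)])
  have w: "?w \<in> LpV M p" using LpV_mult_bounded(1)[OF wgradD(1)[OF u] zm B1(2)] by simp
  have "(\<lambda>x. u x *\<^sub>R Xp \<zeta> x) \<in> LpV M p"
  proof (rule LpV_vecI)
    fix j
    show "(\<lambda>x. (u x *\<^sub>R Xp \<zeta> x) $ j) \<in> LpV M p"
      using LpV_mult_bounded(1)[OF wgradD(1)[OF u] Xm Xb, of j] by (simp add: mult.commute)
  qed (rule p_bounds)
  then have W: "?W \<in> LpV M p"
    by (rule LpV_add[OF LpV_mult_bounded(1)[OF wgradD(2)[OF u] zm B1(2)]]) (rule p_bounds)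
  have main: "(LINT x|M. ?W x $ j * \<psi> x) = - (LINT x|M. ?w x * Xadj X j \<psi> x)"
    if \<psi>: "\<psi> \<in> test_functions UNIV" for \<psi> j
  proof -
    have z\<psi>: "(\<lambda>x. \<zeta> x * \<psi> x) \<in> test_functions \<Omega>"
      using z \<psi> by (auto simp: test_functions_def intro: Ck_mult compactly_supported_mult)
    have Xe: "(\<lambda>x. u x * Xp \<zeta> x $ j) \<in> LpV M p"
      using LpV_mult_bounded(1)[OF wgradD(1)[OF u] Xm Xb, of j] by (simp add: mult.commute)
    have I1: "integrable M (\<lambda>x. V x $ j * (\<zeta> x * \<psi> x))"
      by (rule integrable_mult_test[OF LpV_vec_nth[OF wgradD(2)[OF u] p_bounds(2)] z\<psi>])
    have I2: "integrable M (\<lambda>x. u x * Xp \<zeta> x $ j * \<psi> x)"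
      by (rule integrable_mult_test[OF Xe \<psi>])
    have I3: "integrable M (\<lambda>x. u x * Xadj X j (\<lambda>x. \<zeta> x * \<psi> x) x)"
      by (rule integrable_mult_Xadj[OF wgradD(1)[OF u] z\<psi>])
    have I4: "integrable M (\<lambda>x. ?w x * Xadj X j \<psi> x)"
      by (rule integrable_mult_Xadj[OF w \<psi>])
    have "(LINT x|M. ?W x $ j * \<psi> x) = (LINT x|M. V x $ j * (\<zeta> x * \<psi> x) + u x * Xp \<zeta> x $ j * \<psi> x)"
      by (simp add: algebra_simps)
    also have "\<dots> = - (LINT x|M. u x * Xadj X j (\<lambda>x. \<zeta> x * \<psi> x) x) + (LINT x|M. u x * Xp \<zeta> x $ j * \<psi> x)"
      using I1 I2 wgradD(4)[OF u z\<psi>, of j] by simp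
    also have "(LINT x|M. u x * Xadj X j (\<lambda>x. \<zeta> x * \<psi> x) x)
        = (LINT x|M. ?w x * Xadj X j \<psi> x + u x * Xp \<zeta> x $ j * \<psi> x)"
    proof (rule integral_cong_AE)
      have "AE x in lebesgue. Xadj X j (\<lambda>y. \<zeta> y * \<psi> y) x = \<zeta> x * Xadj X j \<psi> x + \<psi> x * Xp \<zeta> x $ j"
        by (rule AE_completion[OF Xadj_mult_AE[OF loc_lip z1 \<psi>]])
      then have "AE x in M. Xadj X j (\<lambda>y. \<zeta> y * \<psi> y) x = \<zeta> x * Xadj X j \<psi> x + \<psi> x * Xp \<zeta> x $ j"
        using sets_\<Omega> by (simp add: AE_restrict_space_iff) (auto elim: eventually_mono)
      then show "AE x in M. u x * Xadj X j (\<lambda>x. \<zeta> x * \<psi> x) x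
          = ?w x * Xadj X j \<psi> x + u x * Xp \<zeta> x $ j * \<psi> x"
        by eventually_elim (simp add: algebra_simps)
    qed (use I2 I3 I4 in auto)
    also have "\<dots> = (LINT x|M. ?w x * Xadj X j \<psi> x) + (LINT x|M. u x * Xp \<zeta> x $ j * \<psi> x)"
      using I2 I4 by simp
    finally show ?thesis by simp
  qed
  show "wgrad ?w ?W" by (rule wgradI[OF w W main[OF test_functions_mono[OF _ subset_UNIV]]])
  show "(LINT x|M. ?W x $ j * \<psi> x) = - (LINT x|M. ?w x * Xadj X j \<psi> x)" if "\<psi> \<in> test_functions UNIV"
    by (rule main[OF that])
qed

text \<open>Density in terms of p-integrals and of any representatives of the gradients, freed from
  the root in the norm and from the choice in \<open>Xgrad\<close>.\<close>

lemma W1p0_iff: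
  assumes u: "wgrad u V"
  shows "u \<in> W0 \<longleftrightarrow> (\<forall>e>0. \<exists>\<psi>\<in>C1c \<Omega>. \<exists>\<Psi>. wgrad \<psi> \<Psi> \<and>
     en (\<lambda>x. u x - \<psi> x) + en (\<lambda>x. V x - \<Psi> x) < e)"
proof -
  let ?d = "\<lambda>\<psi> \<Psi>. en (\<lambda>x. u x - \<psi> x) + en (\<lambda>x. V x - \<Psi> x)"
  have iff: "W1p_norm X \<Omega> p (\<lambda>x. u x - \<psi> x) < e \<longleftrightarrow> ?d \<psi> \<Psi> < e powr p" if "wgrad \<psi> \<Psi>" "0 < e" for \<psi> \<Psi> e
  proof -
    have n: "W1p_norm X \<Omega> p (\<lambda>x. u x - \<psi> x) = ?d \<psi> \<Psi> powr (1 / p)"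
      using pint_Xgrad[OF wgrad_diff[OF u that(1)]] by (simp add: W1p_norm_def pint_def)
    have "0 \<le> ?d \<psi> \<Psi>" by (intro add_nonneg_nonneg pint_nonneg)
    then have r: "(?d \<psi> \<Psi> powr (1 / p)) powr p = ?d \<psi> \<Psi>" using p_bounds by (simp add: powr_powr)
    have "?d \<psi> \<Psi> < e powr p" if "?d \<psi> \<Psi> powr (1 / p) < e"
      using powr_less_mono2[OF p_bounds(1) _ that] r by simp
    moreover have "e powr p \<le> ?d \<psi> \<Psi>" if "e \<le> ?d \<psi> \<Psi> powr (1 / p)"
      using powr_mono2[OF p_bounds(2) _ that] r \<open>0 < e\<close> by simp
    ultimately show ?thesis unfolding n by fastforce
  qed
  show ?thesis
  proof (intro iffI allI impI)
    fix e :: real assume uW: "u \<in> W0" and e: "0 < e"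
    then obtain \<psi> where \<psi>: "\<psi> \<in> C1c \<Omega>" "W1p_norm X \<Omega> p (\<lambda>x. u x - \<psi> x) < e powr (1 / p)"
      unfolding W1p0_def by (auto dest!: spec[of _ "e powr (1 / p)"])
    then show "\<exists>\<psi>\<in>C1c \<Omega>. \<exists>\<Psi>. wgrad \<psi> \<Psi> \<and> ?d \<psi> \<Psi> < e"
      using iff[OF C1c_wgrad[OF \<psi>(1)], of "e powr (1 / p)"] C1c_wgrad[OF \<psi>(1)] e p_bounds by (auto simp: powr_powr)
  next
    assume *: "\<forall>e>0. \<exists>\<psi>\<in>C1c \<Omega>. \<exists>\<Psi>. wgrad \<psi> \<Psi> \<and> ?d \<psi> \<Psi> < e"
    have "\<exists>\<psi>\<in>C1c \<Omega> \<inter> W1p X \<Omega> p. W1p_norm X \<Omega> p (\<lambda>x. u x - \<psi> x) < e" if e: "0 < e" for e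
    proof -
      have "0 < e powr p" using e by simp
      then obtain \<psi> \<Psi> where \<psi>: "\<psi> \<in> C1c \<Omega>" "wgrad \<psi> \<Psi>" "?d \<psi> \<Psi> < e powr p" using * by blast
      then show ?thesis using iff[OF \<psi>(2) e] wgrad_W1p[OF \<psi>(2)] by blast
    qed
    then show "u \<in> W0" using wgrad_W1p[OF u] by (simp add: W1p0_def)
  qed
qed

lemma W1p0_wgrad: "u \<in> W0 \<Longrightarrow> wgrad u (grad u)"
  by (rule W1p_Xgrad) (simp add: W1p0_def)

lemma W1p0_C1c: "\<psi> \<in> C1c \<Omega> \<Longrightarrow> \<psi> \<in> W0"
  unfolding W1p0_iff[OF C1c_wgrad] using C1c_wgrad by (intro allI impI bexI[of _ \<psi>] exI[of _ "Xp \<psi>"]) (auto simp: pint_def)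

lemma pint_diff_triangle:
  assumes "f \<in> LpV M p" "g \<in> LpV M p" "h \<in> LpV M p"
  shows "en (\<lambda>x. f x - h x) \<le> 2 powr p * (en (\<lambda>x. f x - g x) + en (\<lambda>x. g x - h x))"
  using pint_add_le[OF LpV_diff[OF assms(1,2) p_bounds(2)] LpV_diff[OF assms(2,3) p_bounds(2)] p_bounds(2)]
  by simp

lemma W1p0_limit:
  assumes w: "\<And>k. w k \<in> W0" "\<And>k. wgrad (w k) (W k)" and u: "wgrad u V"
    and lim: "strongly w u" "strongly W V"
  shows "u \<in> W0"
  unfolding W1p0_iff[OF u]
proof (intro allI impI)
  fix e :: real assume e: "0 < e"
  define e' where "e' = e / (2 * 2 powr p)"
  have e': "0 < e'" using e by (simp add: e'_def)
  have "(\<lambda>k. en (\<lambda>x. w k x - u x) + en (\<lambda>x. W k x - V x)) \<longlonglongrightarrow> 0 + 0" by (intro tendsto_add lim)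
  then have "\<forall>\<^sub>F k in sequentially. en (\<lambda>x. w k x - u x) + en (\<lambda>x. W k x - V x) < e'"
    using e' by (intro order_tendstoD) auto
  then obtain k where k: "en (\<lambda>x. w k x - u x) + en (\<lambda>x. W k x - V x) < e'"
    by (auto simp: eventually_sequentially)
  obtain \<psi> \<Psi> where \<psi>: "\<psi> \<in> C1c \<Omega>" "wgrad \<psi> \<Psi>"
    "en (\<lambda>x. w k x - \<psi> x) + en (\<lambda>x. W k x - \<Psi> x) < e'"
    using w(1)[of k] e' unfolding W1p0_iff[OF w(2)] by blast
  have "en (\<lambda>x. u x - \<psi> x) + en (\<lambda>x. V x - \<Psi> x)
     \<le> 2 powr p * (en (\<lambda>x. w k x - u x) + en (\<lambda>x. w k x - \<psi> x))
     + 2 powr p * (en (\<lambda>x. W k x - V x) + en (\<lambda>x. W k x - \<Psi> x))"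
    using pint_diff_triangle[OF wgradD(1)[OF u] wgradD(1)[OF w(2)] wgradD(1)[OF \<psi>(2)], of k]
      pint_diff_triangle[OF wgradD(2)[OF u] wgradD(2)[OF w(2)] wgradD(2)[OF \<psi>(2)], of k]
    by (simp only: pint_minus[of M p u] pint_minus[of M p V])
  also have "\<dots> = 2 powr p * ((en (\<lambda>x. w k x - u x) + en (\<lambda>x. W k x - V x))
      + (en (\<lambda>x. w k x - \<psi> x) + en (\<lambda>x. W k x - \<Psi> x)))" by (simp add: algebra_simps)
  also have "\<dots> < 2 powr p * (e' + e')"
    using k \<psi>(3) by (intro mult_strict_left_mono add_strict_mono) auto
  also have "\<dots> = e" by (simp add: e'_def)
  finally show "\<exists>\<psi>\<in>C1c \<Omega>. \<exists>\<Psi>. wgrad \<psi> \<Psi> \<and> en (\<lambda>x. u x - \<psi> x) + en (\<lambda>x. V x - \<Psi> x) < e"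
    using \<psi> by blast
qed

lemma W1p0_approx:
  assumes u: "u \<in> W0" and gu: "wgrad u V"
  obtains f F where "\<And>k::nat. f k \<in> C1c \<Omega>" "\<And>k. wgrad (f k) (F k)"
    "(\<lambda>k. en (\<lambda>x. u x - f k x)) \<longlonglongrightarrow> 0" "(\<lambda>k. en (\<lambda>x. V x - F k x)) \<longlonglongrightarrow> 0"
proof -
  define Q where "Q k z \<longleftrightarrow> fst z \<in> C1c \<Omega> \<and> wgrad (fst z) (snd z) \<and>
      en (\<lambda>x. u x - fst z x) + en (\<lambda>x. V x - snd z x) < 1 / real (Suc k)" for k z
  have "\<forall>k. \<exists>z. Q k z"
  proof
    fix k :: nat
    have "0 < 1 / real (Suc k)" by simp
    then obtain \<psi> \<Psi> where "\<psi> \<in> C1c \<Omega>" "wgrad \<psi> \<Psi>"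
      "en (\<lambda>x. u x - \<psi> x) + en (\<lambda>x. V x - \<Psi> x) < 1 / real (Suc k)"
      using u unfolding W1p0_iff[OF gu] by blast
    then show "\<exists>z. Q k z" by (intro exI[of _ "(\<psi>, \<Psi>)"]) (simp add: Q_def)
  qed
  from choice[OF this] obtain z where z: "\<And>k. Q k (z k)" by blast
  have lim: "g \<longlonglongrightarrow> 0" if "\<And>k. 0 \<le> g k" "\<And>k. g k \<le> 1 / real (Suc k)" for g :: "nat \<Rightarrow> real"
    by (rule tendsto_sandwich[OF always_eventually always_eventually tendsto_const LIMSEQ_Suc[OF lim_1_over_n]]) (use that in auto)
  show ?thesis
  proof (rule that[of "\<lambda>k. fst (z k)" "\<lambda>k. snd (z k)"])
    have le: "en (\<lambda>x. u x - fst (z k) x) \<le> 1 / real (Suc k)" "en (\<lambda>x. V x - snd (z k) x) \<le> 1 / real (Suc k)" for k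
      using z[of k] pint_nonneg[of M p "\<lambda>x. u x - fst (z k) x"] pint_nonneg[of M p "\<lambda>x. V x - snd (z k) x"]
      unfolding Q_def by linarith+
    show "(\<lambda>k. en (\<lambda>x. u x - fst (z k) x)) \<longlonglongrightarrow> 0" "(\<lambda>k. en (\<lambda>x. V x - snd (z k) x)) \<longlonglongrightarrow> 0"
      by (rule lim[OF pint_nonneg le(1)], rule lim[OF pint_nonneg le(2)])
  qed (use z in \<open>simp_all add: Q_def\<close>)
qed

lemma W1p0_lincomb:
  assumes u: "u \<in> W0" and v: "v \<in> W0"
  shows "(\<lambda>x. a * u x + b * v x) \<in> W0"
proof -
  note gu = W1p0_wgrad[OF u] and gv = W1p0_wgrad[OF v]
  obtain f F where f: "\<And>k. f k \<in> C1c \<Omega>" "\<And>k. wgrad (f k) (F k)"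
    "(\<lambda>k. en (\<lambda>x. u x - f k x)) \<longlonglongrightarrow> 0" "(\<lambda>k. en (\<lambda>x. grad u x - F k x)) \<longlonglongrightarrow> 0"
    by (rule W1p0_approx[OF u gu]) (rule that)
  obtain g G where g: "\<And>k. g k \<in> C1c \<Omega>" "\<And>k. wgrad (g k) (G k)"
    "(\<lambda>k. en (\<lambda>x. v x - g k x)) \<longlonglongrightarrow> 0" "(\<lambda>k. en (\<lambda>x. grad v x - G k x)) \<longlonglongrightarrow> 0"
    by (rule W1p0_approx[OF v gv]) (rule that)
  have key: "(\<lambda>k. en (\<lambda>x. (a *\<^sub>R s k x + b *\<^sub>R t k x) - (a *\<^sub>R s' x + b *\<^sub>R t' x))) \<longlonglongrightarrow> 0"
    if "\<And>k. s k \<in> LpV M p" "s' \<in> LpV M p" "\<And>k. t k \<in> LpV M p" "t' \<in> LpV M p"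
      and lim: "(\<lambda>k. en (\<lambda>x. s' x - s k x)) \<longlonglongrightarrow> 0" "(\<lambda>k. en (\<lambda>x. t' x - t k x)) \<longlonglongrightarrow> 0"
    for s t :: "nat \<Rightarrow> real^'n \<Rightarrow> 'c::euclidean_space" and s' t'
  proof (rule tendsto_sandwich[OF always_eventually always_eventually tendsto_const], intro allI pint_nonneg, intro allI)
    fix k
    have "en (\<lambda>x. (a *\<^sub>R s k x + b *\<^sub>R t k x) - (a *\<^sub>R s' x + b *\<^sub>R t' x))
       = en (\<lambda>x. a *\<^sub>R (s k x - s' x) + b *\<^sub>R (t k x - t' x))" by (simp add: algebra_simps)
    also have "\<dots> \<le> 2 powr p * (en (\<lambda>x. a *\<^sub>R (s k x - s' x)) + en (\<lambda>x. b *\<^sub>R (t k x - t' x)))"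
      by (intro pint_add_le LpV_scaleR LpV_diff that p_bounds)
    finally show "en (\<lambda>x. (a *\<^sub>R s k x + b *\<^sub>R t k x) - (a *\<^sub>R s' x + b *\<^sub>R t' x))
      \<le> 2 powr p * (\<bar>a\<bar> powr p * en (\<lambda>x. s' x - s k x) + \<bar>b\<bar> powr p * en (\<lambda>x. t' x - t k x))"
      by (simp only: pint_scaleR pint_minus[of M p "s k"] pint_minus[of M p "t k"])
  next
    have "(\<lambda>k. 2 powr p * (\<bar>a\<bar> powr p * en (\<lambda>x. s' x - s k x) + \<bar>b\<bar> powr p * en (\<lambda>x. t' x - t k x)))
       \<longlonglongrightarrow> 2 powr p * (\<bar>a\<bar> powr p * 0 + \<bar>b\<bar> powr p * 0)" by (intro tendsto_intros lim)
    then show "(\<lambda>k. 2 powr p * (\<bar>a\<bar> powr p * en (\<lambda>x. s' x - s k x) + \<bar>b\<bar> powr p * en (\<lambda>x. t' x - t k x))) \<longlonglongrightarrow> 0" by simp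
  qed
  show ?thesis
    using key[OF wgradD(1)[OF f(2)] wgradD(1)[OF gu] wgradD(1)[OF g(2)] wgradD(1)[OF gv] f(3) g(3)]
      key[OF wgradD(2)[OF f(2)] wgradD(2)[OF gu] wgradD(2)[OF g(2)] wgradD(2)[OF gv] f(4) g(4)]
    by (intro W1p0_limit[OF W1p0_C1c[OF C1c_lincomb[OF f(1) g(1)]] wgrad_lincomb[OF f(2) g(2)] wgrad_lincomb[OF gu gv]]) simp_all
qed

end

section \<open>Subunit curves\<close>

text \<open>Lebesgue measure is complete, so the set of failures can itself serve as the null set.
  In this explicit form exceptional sets can be united, reflected and translated together with the
  curves.\<close>

lemma AE_lebesgue_on_negligible_iff:
  assumes S: "S \<in> sets lebesgue"
  shows "(AE x in lebesgue_on S. P x) \<longleftrightarrow> (\<exists>N. negligible N \<and> (\<forall>x\<in>S - N. P x))"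
proof -
  have "(AE x in lebesgue_on S. P x) \<longleftrightarrow> (AE x in lebesgue. x \<in> S \<longrightarrow> P x)"
    using S by (simp add: AE_restrict_space_iff)
  also have "\<dots> \<longleftrightarrow> {x. \<not> (x \<in> S \<longrightarrow> P x)} \<in> null_sets lebesgue"
    using complete_measure.AE_iff_null_sets[OF completion.complete_measure_axioms, where P = "\<lambda>x. x \<in> S \<longrightarrow> P x"] by simp
  also have "\<dots> \<longleftrightarrow> (\<exists>N. negligible N \<and> (\<forall>x\<in>S - N. P x))"
    unfolding negligible_iff_null_sets[symmetric]
    by (auto intro: negligible_subset exI[of _ "{x. \<not> (x \<in> S \<longrightarrow> P x)}"])
  finally show ?thesis .
qed

lemma negligible_subset_open_measure_less:
  fixes N :: "'a::euclidean_space set"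
  assumes N: "negligible N" and d: "0 < d"
  obtains U where "open U" "N \<subseteq> U" "U \<in> lmeasurable" "measure lebesgue U < d"
proof -
  have "N \<in> sets lebesgue" using N by (simp add: negligible_imp_sets)
  then obtain U where U: "open U" "N \<subseteq> U" "U - N \<in> lmeasurable" "emeasure lebesgue (U - N) < ennreal d"
    using d by (rule sets_lebesgue_outer_open)
  have eq: "U = (U - N) \<union> N" using U by auto
  have Nm: "N \<in> lmeasurable" "measure lebesgue N = 0"
    using N by (auto simp: negligible_iff_measure)
  have Um: "U \<in> lmeasurable" using U(3) Nm(1) eq by (metis fmeasurable.Un)
  have "measure lebesgue U \<le> measure lebesgue (U - N) + measure lebesgue N"
    using U(3) Nm(1) eq measure_Un_le[of "U - N" lebesgue N] by (simp add: fmeasurableD)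
  also have "\<dots> < d"
    using U(3,4) d Nm(2) by (simp add: emeasure_eq_measure2 ennreal_less_iff)
  finally show ?thesis using that U(1,2) Um by blast
qed

lemma absolutely_continuous_onE:
  assumes "absolutely_continuous_on S f" "0 < e"
  obtains d where "0 < d" "\<And>D T. D division_of T \<Longrightarrow> T \<subseteq> S \<Longrightarrow> (\<Sum>k\<in>D. Sup k - Inf k) < d \<Longrightarrow>
      (\<Sum>k\<in>D. norm (f (Sup k) - f (Inf k))) < e"
proof -
  from assms(1)[unfolded absolutely_continuous_on_def, rule_format, OF assms(2)]
  obtain d where d: "d > 0 \<and> (\<forall>D T. D division_of T \<and> T \<subseteq> S \<and> (\<Sum>k\<in>D. Sup k - Inf k) < d \<longrightarrow>
        (\<Sum>k\<in>D. norm (f (Sup k) - f (Inf k))) < e)" ..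
  show ?thesis by (rule that[OF conjunct1[OF d]]) (rule conjunct2[OF d, rule_format], intro conjI)
qed

text \<open>
  Cousin's lemma for a gauge that is a neighbourhood of small measure on the exceptional null set
  and given by differentiability elsewhere.
\<close>

lemma absolutely_continuous_speed_bound:
  fixes g :: "real \<Rightarrow> 'a::euclidean_space"
  assumes ac: "absolutely_continuous_on S g" and ab: "a \<le> b" "{a..b} \<subseteq> S" and N: "negligible N" and B: "0 \<le> B"
    and der: "\<And>t. t \<in> {a..b} - N \<Longrightarrow> \<exists>v. (g has_vector_derivative v) (at t within {a..b}) \<and> norm v \<le> B"
  shows "norm (g b - g a) \<le> B * (b - a)"
proof (rule field_le_epsilon)
  fix e0 :: real assume e0: "0 < e0"
  \<comment> \<open>Error \<open>e\<close> per unit of length off the null set and error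
    \<open>e\<close> on it add up to \<open>e * (b - a + 1) = e0\<close>.\<close>
  define e where "e = e0 / (b - a + 1)"
  have e: "0 < e" using e0 ab by (simp add: e_def)
  obtain d where d: "0 < d" and dac: "\<And>D T. D division_of T \<Longrightarrow> T \<subseteq> S \<Longrightarrow> (\<Sum>k\<in>D. Sup k - Inf k) < d \<Longrightarrow>
      (\<Sum>k\<in>D. norm (g (Sup k) - g (Inf k))) < e"
    by (rule absolutely_continuous_onE[OF ac e]) (rule that)
  obtain U where U: "open U" "N \<subseteq> U" "U \<in> lmeasurable" "measure lebesgue U < d"
    by (rule negligible_subset_open_measure_less[OF N d])
  have "\<forall>t. \<exists>v r. t \<in> {a..b} - N \<longrightarrow> norm v \<le> B \<and> 0 < r \<and>
      (\<forall>s\<in>{a..b}. \<bar>s - t\<bar> < r \<longrightarrow> norm (g s - g t - (s - t) *\<^sub>R v) \<le> e * \<bar>s - t\<bar>)"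
  proof (intro allI)
    fix t
    show "\<exists>v r. t \<in> {a..b} - N \<longrightarrow> norm v \<le> B \<and> 0 < r \<and>
      (\<forall>s\<in>{a..b}. \<bar>s - t\<bar> < r \<longrightarrow> norm (g s - g t - (s - t) *\<^sub>R v) \<le> e * \<bar>s - t\<bar>)"
    proof (cases "t \<in> {a..b} - N")
      case True
      then obtain v where v: "(g has_vector_derivative v) (at t within {a..b})" "norm v \<le> B" using der by blast
      have "\<exists>r>0. \<forall>s\<in>{a..b}. norm (s - t) < r \<longrightarrow> norm (g s - g t - (s - t) *\<^sub>R v) \<le> e * norm (s - t)"
        using v(1)[unfolded has_vector_derivative_def has_derivative_within_alt, THEN conjunct2, rule_format, OF e] .
      then show ?thesis using v(2) by auto
    qed auto
  qed
  then obtain v r where vr: "\<And>t. t \<in> {a..b} - N \<Longrightarrow> norm (v t) \<le> B" "\<And>t. t \<in> {a..b} - N \<Longrightarrow> 0 < r t"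
    "\<And>t s. t \<in> {a..b} - N \<Longrightarrow> s \<in> {a..b} \<Longrightarrow> \<bar>s - t\<bar> < r t \<Longrightarrow> norm (g s - g t - (s - t) *\<^sub>R v t) \<le> e * \<bar>s - t\<bar>"
    by metis
  define G where "G t = (if t \<in> N then U else if t \<in> {a..b} then ball t (r t) else ball t 1)" for t
  have "gauge G" using U(1,2) vr(2) by (auto simp: gauge_def G_def)
  then obtain p where p: "p tagged_division_of {a..b}" "G fine p"
    using fine_division_exists[of G a b] by (metis interval_cbox)
  have fin: "finite p" using p(1) by blast
  have K: "\<exists>c d. K = {c..d} \<and> c \<le> d \<and> x \<in> K \<and> K \<subseteq> {a..b} \<and> Sup K = d \<and> Inf K = c" if xK: "(x, K) \<in> p" for x K
  proof -
    obtain c d where cd: "K = cbox c d" using tagged_division_ofD(4)[OF p(1) xK] by blast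
    have "x \<in> K" "K \<subseteq> {a..b}" using tagged_division_ofD(2,3)[OF p(1) xK] by auto
    then show ?thesis using cd by (intro exI[of _ c] exI[of _ d]) auto
  qed
  have ne: "K \<noteq> {}" if "(x, K) \<in> p" for x K using K[OF that] by blast
  \<comment> \<open>Intervals tagged off \<open>N\<close> satisfy the speed bound up to
    \<open>e\<close>. Those tagged in \<open>N\<close> lie in \<open>U\<close>, whose measure is
    below the threshold \<open>d\<close> of absolute continuity, so their increments together stay
    below \<open>e\<close>.\<close>
  define good where "good = {z\<in>p. fst z \<notin> N}"
  define bad where "bad = {z\<in>p. fst z \<in> N}"
  have split: "p = good \<union> bad" "good \<inter> bad = {}" "finite good" "finite bad" using fin by (auto simp: good_def bad_def)
  have tot: "(\<Sum>(x, K)\<in>p. g (Sup K) - g (Inf K)) = g b - g a"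
    by (rule additive_tagged_division_1[OF ab(1) p(1)])
  have len: "(\<Sum>(x, K)\<in>p. Sup K - Inf K) = b - a"
    using additive_tagged_division_1[OF ab(1) p(1), of "\<lambda>x. x"] by simp
  have goodb: "norm (g (Sup K) - g (Inf K)) \<le> (B + e) * (Sup K - Inf K)" if z: "(x, K) \<in> good" for x K
  proof -
    have xp: "(x, K) \<in> p" "x \<notin> N" using z by (auto simp: good_def)
    obtain c d where cd: "K = {c..d}" "c \<le> d" "x \<in> K" "K \<subseteq> {a..b}" "Sup K = d" "Inf K = c" using K[OF xp(1)] by blast
    have x: "x \<in> {a..b} - N" using cd xp by auto
    have "K \<subseteq> ball x (r x)" using fineD[OF p(2) xp(1)] x by (simp add: G_def)
    moreover have "c \<in> K" "d \<in> K" using cd by auto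
    ultimately have "c \<in> ball x (r x)" "d \<in> ball x (r x)" by blast+
    then have c: "norm (g c - g x - (c - x) *\<^sub>R v x) \<le> e * \<bar>c - x\<bar>" and d: "norm (g d - g x - (d - x) *\<^sub>R v x) \<le> e * \<bar>d - x\<bar>"
      using vr(3)[OF x, of c] vr(3)[OF x, of d] cd by (auto simp: dist_real_def abs_minus_commute)
    have "g d - g c = (g d - g x - (d - x) *\<^sub>R v x) - (g c - g x - (c - x) *\<^sub>R v x) + (d - c) *\<^sub>R v x"
      by (simp add: algebra_simps)
    from arg_cong[OF this, of norm] have "norm (g d - g c) \<le> norm (g d - g x - (d - x) *\<^sub>R v x) + norm (g c - g x - (c - x) *\<^sub>R v x) + norm ((d - c) *\<^sub>R v x)"
      using norm_triangle_ineq4[of "g d - g x - (d - x) *\<^sub>R v x" "g c - g x - (c - x) *\<^sub>R v x"]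
        norm_triangle_ineq[of "(g d - g x - (d - x) *\<^sub>R v x) - (g c - g x - (c - x) *\<^sub>R v x)" "(d - c) *\<^sub>R v x"] by linarith
    also have "\<dots> \<le> e * \<bar>d - x\<bar> + e * \<bar>c - x\<bar> + (d - c) * B"
      using c d vr(1)[OF x] cd(2) by (intro add_mono) (auto intro: mult_left_mono)
    also have "\<dots> = (B + e) * (d - c)" using cd by (simp add: algebra_simps abs_if)
    finally show ?thesis by (simp add: cd)
  qed
  have "norm (\<Sum>(x, K)\<in>good. g (Sup K) - g (Inf K)) \<le> (\<Sum>(x, K)\<in>good. norm (g (Sup K) - g (Inf K)))"
    using norm_sum[of "\<lambda>(x, K). g (Sup K) - g (Inf K)" good] by (simp add: case_prod_unfold)
  also have "\<dots> \<le> (\<Sum>(x, K)\<in>good. (B + e) * (Sup K - Inf K))"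
    by (rule sum_mono) (use goodb in auto)
  also have "\<dots> \<le> (\<Sum>(x, K)\<in>p. (B + e) * (Sup K - Inf K))"
  proof (rule sum_mono2[OF fin])
    show "0 \<le> (case z of (x, K) \<Rightarrow> (B + e) * (Sup K - Inf K))" if "z \<in> p - good" for z
    proof (cases z)
      case (Pair x K)
      then have "(x, K) \<in> p" using that by simp
      from K[OF this] obtain c d where "c \<le> d" "Sup K = d" "Inf K = c" by blast
      then show ?thesis using Pair B e by simp
    qed
  qed (auto simp: good_def)
  also have "\<dots> = (B + e) * (b - a)" unfolding len[symmetric] by (simp add: sum_distrib_left case_prod_unfold)
  finally have 1: "norm (\<Sum>(x, K)\<in>good. g (Sup K) - g (Inf K)) \<le> (B + e) * (b - a)" .
  have "bad tagged_partial_division_of {a..b}"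
    using p(1) by (auto simp: bad_def intro: tagged_partial_division_subset tagged_division_of_def[THEN iffD1, THEN conjunct1])
  then have tb: "bad tagged_division_of \<Union>(snd ` bad)" by (rule tagged_partial_division_of_Union_self)
  have db: "snd ` bad division_of \<Union>(snd ` bad)" by (rule division_of_tagged_division[OF tb])
  have subU: "\<Union>(snd ` bad) \<subseteq> U"
    using fineD[OF p(2)] by (fastforce simp: bad_def G_def)
  have cont: "Sup k - Inf k = measure lebesgue k" if "k \<in> snd ` bad" for k
  proof -
    obtain x where "(x, k) \<in> p" using \<open>k \<in> snd ` bad\<close> by (auto simp: bad_def)
    from K[OF this] obtain c d where "k = {c..d}" "c \<le> d" "Sup k = d" "Inf k = c" by blast
    then show ?thesis by simp
  qed
  have "(\<Sum>k\<in>snd ` bad. Sup k - Inf k) = (\<Sum>k\<in>snd ` bad. measure lebesgue k)" by (rule sum.cong[OF refl cont])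
  also have "\<dots> = measure lebesgue (\<Union>(snd ` bad))" by (rule content_division[OF db])
  also have "\<dots> \<le> measure lebesgue U"
    by (rule measure_mono_fmeasurable[OF subU _ U(3)]) (use lmeasurable_division[OF db] in \<open>auto simp: fmeasurableD\<close>)
  also have "\<dots> < d" by (rule U)
  finally have small: "(\<Sum>k\<in>snd ` bad. Sup k - Inf k) < d" .
  have subS: "\<Union>(snd ` bad) \<subseteq> S" using K ab(2) by (fastforce simp: bad_def)
  have "norm (\<Sum>(x, K)\<in>bad. g (Sup K) - g (Inf K)) \<le> (\<Sum>(x, K)\<in>bad. norm (g (Sup K) - g (Inf K)))"
    using norm_sum[of "\<lambda>(x, K). g (Sup K) - g (Inf K)" bad] by (simp add: case_prod_unfold)
  \<comment> \<open>The case distinction fixes the value 0 on empty intervals, where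
    \<open>Sup\<close> and \<open>Inf\<close> are unspecified. Degenerate intervals contribute 0 as
    well, so passing from tagged intervals to the set of intervals loses nothing.\<close>
  also have "\<dots> = (\<Sum>(x, k)\<in>bad. if k = {} then 0 else norm (g (Sup k) - g (Inf k)))"
    by (rule sum.cong) (use ne in \<open>auto simp: bad_def\<close>)
  also have "\<dots> = (\<Sum>k\<in>snd ` bad. if k = {} then 0 else norm (g (Sup k) - g (Inf k)))"
  proof (rule sum.over_tagged_division_lemma[OF tb])
    show "(if cbox u w = {} then 0 else norm (g (Sup (cbox u w)) - g (Inf (cbox u w)))) = 0" if "box u w = {}" for u w
      using that by (cases "u = w") (auto simp: cbox_interval box_real not_less)
  qed
  also have "\<dots> = (\<Sum>k\<in>snd ` bad. norm (g (Sup k) - g (Inf k)))"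
    by (rule sum.cong) (use ne in \<open>auto simp: bad_def\<close>)
  also have "\<dots> < e" by (rule dac[OF db subS small])
  finally have 2: "norm (\<Sum>(x, K)\<in>bad. g (Sup K) - g (Inf K)) < e" .
  have "g b - g a = (\<Sum>(x, K)\<in>good. g (Sup K) - g (Inf K)) + (\<Sum>(x, K)\<in>bad. g (Sup K) - g (Inf K))"
    using tot split sum.union_disjoint[OF split(3,4,2)] by metis
  from arg_cong[OF this, of norm] have "norm (g b - g a) \<le> (B + e) * (b - a) + e"
    using 1 2 norm_triangle_ineq[of "\<Sum>(x, K)\<in>good. g (Sup K) - g (Inf K)" "\<Sum>(x, K)\<in>bad. g (Sup K) - g (Inf K)"] by linarith
  also have "\<dots> = B * (b - a) + e * (b - a + 1)" by (simp add: algebra_simps)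
  also have "e * (b - a + 1) = e0" using ab by (simp add: e_def)
  finally show "norm (g b - g a) \<le> B * (b - a) + e0" .
qed

lemma absolutely_continuous_imp_continuous:
  fixes g :: "real \<Rightarrow> 'a::real_normed_vector"
  assumes "absolutely_continuous_on {a..b} g"
  shows "continuous_on {a..b} g"
  unfolding continuous_on_iff
proof (intro ballI allI impI)
  fix t e :: real assume t: "t \<in> {a..b}" and e: "0 < e"
  obtain d where d: "0 < d" and dac: "\<And>D T. D division_of T \<Longrightarrow> T \<subseteq> {a..b} \<Longrightarrow> (\<Sum>k\<in>D. Sup k - Inf k) < d \<Longrightarrow>
      (\<Sum>k\<in>D. norm (g (Sup k) - g (Inf k))) < e"
    by (rule absolutely_continuous_onE[OF assms e]) (rule that)
  have *: "dist (g u) (g w) < e" if "u \<in> {a..b}" "w \<in> {a..b}" "w \<le> u" "u - w < d" for u w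
  proof -
    have "{cbox w u} division_of cbox w u" using that by (intro division_of_self) auto
    from dac[OF this] that show ?thesis by (auto simp: dist_norm)
  qed
  show "\<exists>d>0. \<forall>s\<in>{a..b}. dist s t < d \<longrightarrow> dist (g s) (g t) < e"
  proof (intro exI[of _ d] conjI ballI impI d)
    fix s assume "s \<in> {a..b}" "dist s t < d"
    then show "dist (g s) (g t) < e" using *[of s t] *[of t s] t by (cases "t \<le> s") (auto simp: dist_real_def dist_commute)
  qed
qed

lemma lipschitz_imp_absolutely_continuous:
  fixes g :: "real \<Rightarrow> 'a::real_normed_vector"
  assumes g: "L-lipschitz_on {a..b} g"
  shows "absolutely_continuous_on {a..b} g"
  unfolding absolutely_continuous_on_def
proof (intro allI impI)
  have L: "0 \<le> L" by (rule lipschitz_on_nonneg[OF g])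
  fix e :: real assume e: "0 < e"
  show "\<exists>d>0. \<forall>D T. D division_of T \<and> T \<subseteq> {a..b} \<and> (\<Sum>k\<in>D. Sup k - Inf k) < d \<longrightarrow> (\<Sum>k\<in>D. norm (g (Sup k) - g (Inf k))) < e"
  proof (intro exI[of _ "e / (L + 1)"] conjI allI impI)
    show "0 < e / (L + 1)" using e L by simp
    fix D T assume D: "D division_of T \<and> T \<subseteq> {a..b} \<and> (\<Sum>k\<in>D. Sup k - Inf k) < e / (L + 1)"
    have le: "norm (g (Sup k) - g (Inf k)) \<le> L * (Sup k - Inf k) \<and> 0 \<le> Sup k - Inf k" if k: "k \<in> D" for k
    proof -
      obtain c d where cd: "k = cbox c d" "k \<noteq> {}" "k \<subseteq> {a..b}"
        using division_ofD(2,3,4)[OF conjunct1[OF D] k] D by blast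
      then have "c \<le> d" "c \<in> {a..b}" "d \<in> {a..b}" "Sup k = d" "Inf k = c" by auto
      then show ?thesis using lipschitz_onD[OF g, of d c] by (simp add: dist_norm)
    qed
    have "(\<Sum>k\<in>D. norm (g (Sup k) - g (Inf k))) \<le> L * (\<Sum>k\<in>D. Sup k - Inf k)"
      unfolding sum_distrib_left by (rule sum_mono) (use le in auto)
    also have "\<dots> \<le> (L + 1) * (\<Sum>k\<in>D. Sup k - Inf k)"
      using sum_nonneg[of D "\<lambda>k. Sup k - Inf k"] le by (intro mult_right_mono) auto
    also have "\<dots> < (L + 1) * (e / (L + 1))" using D L by (intro mult_strict_left_mono) auto
    also have "\<dots> = e" using L by simp
    finally show "(\<Sum>k\<in>D. norm (g (Sup k) - g (Inf k))) < e" .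
  qed
qed

definition subunit_velocity :: "('n::finite, 'm::finite) vfields \<Rightarrow> real^'n \<Rightarrow> real^'n \<Rightarrow> bool" where
  "subunit_velocity X x v \<longleftrightarrow> (\<forall>\<xi>. (v \<bullet> \<xi>)\<^sup>2 \<le> (\<Sum>j\<in>UNIV. (X x $ j \<bullet> \<xi>)\<^sup>2))"

abbreviation subunit_at :: "('n::finite, 'm::finite) vfields \<Rightarrow> (real \<Rightarrow> real^'n) \<Rightarrow> real \<Rightarrow> real filter \<Rightarrow> bool" where
  "subunit_at X \<gamma> t F \<equiv> \<exists>v. (\<gamma> has_vector_derivative v) F \<and> subunit_velocity X (\<gamma> t) v"

text \<open>Choosing \<open>v\<close> itself as the covector and applying Cauchy-Schwarz to each
  summand leaves one factor \<open>norm v\<close> squared to cancel.\<close>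

lemma subunit_velocity_norm:
  assumes "subunit_velocity X x v"
  shows "norm v \<le> norm (X x)"
proof (cases "v = 0")
  case False
  have "(v \<bullet> v)\<^sup>2 \<le> (\<Sum>j\<in>UNIV. (X x $ j \<bullet> v)\<^sup>2)" using assms by (auto simp: subunit_velocity_def)
  also have "\<dots> \<le> (\<Sum>j\<in>UNIV. (norm (X x $ j))\<^sup>2 * (norm v)\<^sup>2)"
  proof (rule sum_mono)
    fix j
    have "\<bar>X x $ j \<bullet> v\<bar> \<le> norm (X x $ j) * norm v" by (rule Cauchy_Schwarz_ineq2)
    then have "\<bar>X x $ j \<bullet> v\<bar>\<^sup>2 \<le> (norm (X x $ j) * norm v)\<^sup>2" by (rule power_mono) simp
    then show "(X x $ j \<bullet> v)\<^sup>2 \<le> (norm (X x $ j))\<^sup>2 * (norm v)\<^sup>2" by (simp add: power_mult_distrib)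
  qed
  also have "\<dots> = (norm (X x))\<^sup>2 * (norm v)\<^sup>2"
    by (simp add: norm_vec_def L2_set_def sum_nonneg sum_distrib_right)
  finally have "(norm v)\<^sup>2 * (norm v)\<^sup>2 \<le> (norm (X x))\<^sup>2 * (norm v)\<^sup>2"
    by (simp add: power2_norm_eq_inner[symmetric] power2_eq_square)
  then have "(norm v)\<^sup>2 \<le> (norm (X x))\<^sup>2" by (rule mult_right_le_imp_le) (use False in simp)
  then show ?thesis by (rule power2_le_imp_le) simp
qed simp

text \<open>Along the compact trace of the curve the coefficients are bounded, so the speed is
  bounded and absolute continuity improves to a Lipschitz condition. Lipschitz curves with an
  explicit null set are easy to reverse and concatenate, and two-sided derivatives at interior times
  allow the chain rule; the endpoints join the null set.\<close>

lemma subunit_iff_lipschitz: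
  assumes X: "loc_lipschitz X" and T: "0 \<le> T"
  shows "subunit X T \<gamma> \<longleftrightarrow> (\<exists>L. L-lipschitz_on {0..T} \<gamma>) \<and>
    (\<exists>N. negligible N \<and> (\<forall>t\<in>{0<..<T} - N. subunit_at X \<gamma> t (at t)))"
    (is "_ \<longleftrightarrow> ?lip \<and> ?vel")
proof -
  have Ts: "{0..T} \<in> sets lebesgue" by simp
  have at: "at t within {0..T} = at t" if "t \<in> {0<..<T}" for t
    using that by (intro at_within_interior) auto
  have "(AE t in lebesgue_on {0..T}. \<exists>v. (\<gamma> has_vector_derivative v) (at t within {0..T}) \<and>
        (\<forall>\<xi>. (v \<bullet> \<xi>)\<^sup>2 \<le> (\<Sum>j\<in>UNIV. (X (\<gamma> t) $ j \<bullet> \<xi>)\<^sup>2))) \<longleftrightarrow>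
     (\<exists>N. negligible N \<and> (\<forall>t\<in>{0..T} - N. subunit_at X \<gamma> t (at t within {0..T})))"
    unfolding AE_lebesgue_on_negligible_iff[OF Ts] subunit_velocity_def ..
  also have "\<dots> \<longleftrightarrow> ?vel"
  proof
    assume "\<exists>N. negligible N \<and> (\<forall>t\<in>{0..T} - N. subunit_at X \<gamma> t (at t within {0..T}))"
    then obtain N where N: "negligible N" "\<And>t. t \<in> {0..T} - N \<Longrightarrow> subunit_at X \<gamma> t (at t within {0..T})"
      by blast
    have "subunit_at X \<gamma> t (at t)" if "t \<in> {0<..<T} - N" for t
      using N(2)[of t] at[of t] that by auto
    then show ?vel using N(1) by blast
  next
    assume ?vel
    then obtain N where N: "negligible N" "\<And>t. t \<in> {0<..<T} - N \<Longrightarrow> subunit_at X \<gamma> t (at t)"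
      by blast
    have "negligible (N \<union> {0, T})" using N(1) by (intro negligible_Un) auto
    moreover have "subunit_at X \<gamma> t (at t within {0..T})"
      if "t \<in> {0..T} - (N \<union> {0, T})" for t
      using N(2)[of t] that by (auto intro: has_vector_derivative_at_within)
    ultimately show "\<exists>N. negligible N \<and> (\<forall>t\<in>{0..T} - N. subunit_at X \<gamma> t (at t within {0..T}))"
      by blast
  qed
  finally have eq: "subunit X T \<gamma> \<longleftrightarrow> absolutely_continuous_on {0..T} \<gamma> \<and> ?vel" by (simp add: subunit_def)
  have "?lip" if ac: "absolutely_continuous_on {0..T} \<gamma>" and ?vel
  proof -
    obtain N where N: "negligible N" "\<And>t. t \<in> {0<..<T} - N \<Longrightarrow> subunit_at X \<gamma> t (at t)"
      using \<open>?vel\<close> by blast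
    have c: "continuous_on {0..T} \<gamma>" by (rule absolutely_continuous_imp_continuous[OF ac])
    have "compact ((\<lambda>t. X (\<gamma> t)) ` {0..T})"
      by (intro compact_continuous_image continuous_on_compose2[OF loc_lipschitz_continuous[OF X] c]) auto
    then obtain B where B: "\<And>t. t \<in> {0..T} \<Longrightarrow> norm (X (\<gamma> t)) \<le> B"
      by (force dest!: compact_imp_bounded simp: bounded_iff)
    have B0: "0 \<le> B" using order_trans[OF norm_ge_zero B[of 0]] T by simp
    have nN: "negligible (N \<union> {0, T})" using N(1) by (intro negligible_Un) auto
    have le: "norm (\<gamma> b - \<gamma> a) \<le> B * (b - a)" if "0 \<le> a" "a \<le> b" "b \<le> T" for a b
    proof (rule absolutely_continuous_speed_bound[OF ac that(2) _ nN B0])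
      fix t assume "t \<in> {a..b} - (N \<union> {0, T})"
      then show "\<exists>v. (\<gamma> has_vector_derivative v) (at t within {a..b}) \<and> norm v \<le> B"
        using N(2)[of t] B[of t] that subunit_velocity_norm
        by (fastforce intro: has_vector_derivative_at_within order_trans)
    qed (use that in auto)
    have "B-lipschitz_on {0..T} \<gamma>"
    proof (rule lipschitz_onI)
      fix s t assume "s \<in> {0..T}" "t \<in> {0..T}"
      then show "dist (\<gamma> s) (\<gamma> t) \<le> B * dist s t"
        using le[of s t] le[of t s] by (cases "s \<le> t") (auto simp: dist_norm norm_minus_commute)
    qed (rule B0)
    then show ?thesis ..
  qed
  then show ?thesis using eq lipschitz_imp_absolutely_continuous by blast
qed

lemma subunit_reverse:
  assumes X: "loc_lipschitz X" and T: "0 \<le> T" and \<gamma>: "subunit X T \<gamma>"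
  shows "subunit X T (\<lambda>t. \<gamma> (T - t))"
proof -
  obtain L N where L: "L-lipschitz_on {0..T} \<gamma>" and N: "negligible N"
    "\<And>t. t \<in> {0<..<T} - N \<Longrightarrow> subunit_at X \<gamma> t (at t)"
    using \<gamma> unfolding subunit_iff_lipschitz[OF X T] by blast
  have "L-lipschitz_on {0..T} (\<lambda>t. \<gamma> (T - t))"
  proof (rule lipschitz_onI)
    fix s t assume "s \<in> {0..T}" "t \<in> {0..T}"
    then show "dist (\<gamma> (T - s)) (\<gamma> (T - t)) \<le> L * dist s t"
      using lipschitz_onD[OF L, of "T - s" "T - t"] by (auto simp: dist_real_def abs_minus_commute)
  qed (rule lipschitz_on_nonneg[OF L])
  moreover have "negligible ((\<lambda>t. T - t) ` N)"
  proof (rule negligible_locally_Lipschitz_image[OF _ N(1)])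
    show "\<exists>U B. open U \<and> x \<in> U \<and> (\<forall>y\<in>N \<inter> U. norm ((T - y) - (T - x)) \<le> B * norm (y - x))" for x
      by (intro exI[of _ UNIV] exI[of _ 1]) (auto simp: abs_minus_commute)
  qed simp
  moreover have "\<exists>v. ((\<lambda>t. \<gamma> (T - t)) has_vector_derivative v) (at t) \<and> subunit_velocity X (\<gamma> (T - t)) v"
    if t: "t \<in> {0<..<T} - (\<lambda>t. T - t) ` N" for t
  proof -
    have "T - t \<in> {0<..<T} - N" using t by force
    then obtain v where v: "(\<gamma> has_vector_derivative v) (at (T - t))" "subunit_velocity X (\<gamma> (T - t)) v" using N(2) by blast
    have "((\<gamma> \<circ> (\<lambda>t. T - t)) has_vector_derivative (-1) *\<^sub>R v) (at t)"
      by (rule vector_diff_chain_at) (use v(1) in \<open>auto intro!: derivative_eq_intros simp: has_vector_derivative_def\<close>)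
    then show ?thesis using v(2) by (intro exI[of _ "- v"]) (simp add: o_def subunit_velocity_def)
  qed
  ultimately show ?thesis unfolding subunit_iff_lipschitz[OF X T] by blast
qed

text \<open>The junction time joins the exceptional set, and a common Lipschitz constant carries
  over it.\<close>

lemma subunit_concat:
  assumes X: "loc_lipschitz X" and T: "0 \<le> T1" "0 \<le> T2"
    and g1: "subunit X T1 \<gamma>1" and g2: "subunit X T2 \<gamma>2" and j: "\<gamma>1 T1 = \<gamma>2 0"
  shows "subunit X (T1 + T2) (\<lambda>t. if t \<le> T1 then \<gamma>1 t else \<gamma>2 (t - T1))" (is "subunit X _ ?g")
proof -
  obtain L1 N1 where L1: "L1-lipschitz_on {0..T1} \<gamma>1" and N1: "negligible N1"
    "\<And>t. t \<in> {0<..<T1} - N1 \<Longrightarrow> subunit_at X \<gamma>1 t (at t)"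
    using g1 unfolding subunit_iff_lipschitz[OF X T(1)] by blast
  obtain L2 N2 where L2: "L2-lipschitz_on {0..T2} \<gamma>2" and N2: "negligible N2"
    "\<And>t. t \<in> {0<..<T2} - N2 \<Longrightarrow> subunit_at X \<gamma>2 t (at t)"
    using g2 unfolding subunit_iff_lipschitz[OF X T(2)] by blast
  let ?L = "max L1 L2"
  have "?L-lipschitz_on {0..T1 + T2} ?g"
  proof (rule lipschitz_on_concat)
    show "?L-lipschitz_on {0..T1} \<gamma>1" by (rule lipschitz_on_mono[OF L1]) auto
    show "?L-lipschitz_on {T1..T1 + T2} (\<lambda>t. \<gamma>2 (t - T1))"
    proof (rule lipschitz_onI)
      fix s t assume "s \<in> {T1..T1 + T2}" "t \<in> {T1..T1 + T2}"
      then have "dist (\<gamma>2 (s - T1)) (\<gamma>2 (t - T1)) \<le> L2 * dist s t"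
        using lipschitz_onD[OF L2, of "s - T1" "t - T1"] by (auto simp: dist_real_def)
      also have "\<dots> \<le> ?L * dist s t" by (intro mult_right_mono) auto
      finally show "dist (\<gamma>2 (s - T1)) (\<gamma>2 (t - T1)) \<le> ?L * dist s t" .
    qed (use lipschitz_on_nonneg[OF L1] in simp)
  qed (use j in simp)
  moreover have "negligible (N1 \<union> (+) T1 ` N2 \<union> {T1})"
    using N1(1) N2(1) by (intro negligible_Un negligible_translation) auto
  moreover have "subunit_at X ?g t (at t)"
    if t: "t \<in> {0<..<T1 + T2} - (N1 \<union> (+) T1 ` N2 \<union> {T1})" for t
  proof (cases "t < T1")
    case True
    then obtain v where v: "(\<gamma>1 has_vector_derivative v) (at t)" "subunit_velocity X (\<gamma>1 t) v" using N1(2)[of t] t by auto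
    have "(?g has_vector_derivative v) (at t)"
      by (rule has_vector_derivative_transform_within_open[OF v(1), of "{..<T1}"]) (use True in auto)
    then show ?thesis using v(2) True by auto
  next
    case False
    then have tT: "T1 < t" using t by auto
    have "t - T1 \<notin> N2" using t by (auto simp: image_iff)
    then obtain v where v: "(\<gamma>2 has_vector_derivative v) (at (t - T1))" "subunit_velocity X (\<gamma>2 (t - T1)) v"
      using N2(2)[of "t - T1"] t tT by auto
    have "((\<gamma>2 \<circ> (\<lambda>t. t - T1)) has_vector_derivative 1 *\<^sub>R v) (at t)"
      by (rule vector_diff_chain_at) (use v(1) in \<open>auto intro!: derivative_eq_intros simp: has_vector_derivative_def\<close>)
    then have "((\<lambda>t. \<gamma>2 (t - T1)) has_vector_derivative v) (at t)" by (simp add: o_def)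
    then have "(?g has_vector_derivative v) (at t)"
      by (rule has_vector_derivative_transform_within_open[of _ _ _ "{T1<..}"]) (use tT in auto)
    then show ?thesis using v(2) tT by auto
  qed
  ultimately show ?thesis using T unfolding subunit_iff_lipschitz[OF X add_nonneg_nonneg[OF T]] by blast
qed

lemma cc_dist_le: "0 \<le> T \<Longrightarrow> subunit X T \<gamma> \<Longrightarrow> cc_dist X (\<gamma> 0) (\<gamma> T) \<le> ennreal T"
  unfolding cc_dist_def by (rule INF_lower) auto

lemma cc_dist_lessE:
  assumes "cc_dist X x y < r"
  obtains T \<gamma> where "0 \<le> T" "ennreal T < r" "subunit X T \<gamma>" "\<gamma> 0 = x" "\<gamma> T = y"
  using assms unfolding cc_dist_def INF_less_iff by blast

lemma cc_dist_refl: "cc_dist X x x = 0"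
proof -
  have "subunit X 0 (\<lambda>_. x)"
    unfolding subunit_def
  proof
    show "absolutely_continuous_on {0..0} (\<lambda>_. x)" by (auto simp: absolutely_continuous_on_def intro: exI[of _ 1])
    have "{0} \<in> null_sets (lebesgue :: real measure)" by (simp add: negligible_iff_null_sets[symmetric])
    then show "AE t in lebesgue_on {0..0}. \<exists>v. ((\<lambda>_. x) has_vector_derivative v) (at t within {0..0}) \<and>
        (\<forall>\<xi>. (v \<bullet> \<xi>)\<^sup>2 \<le> (\<Sum>j\<in>UNIV. (X x $ j \<bullet> \<xi>)\<^sup>2))"
      by (intro AE_I2 exI[of _ 0]) (auto simp: sum_nonneg)
  qed
  from cc_dist_le[OF _ this] show ?thesis by simp
qed

lemma cc_dist_commute:
  assumes X: "loc_lipschitz X"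
  shows "cc_dist X x y = cc_dist X y x"
proof -
  have "cc_dist X x y \<le> cc_dist X y x" for x y
  proof (rule dense_ge)
    fix r assume "cc_dist X y x < r"
    then obtain T \<gamma> where T: "0 \<le> T" "ennreal T < r" "subunit X T \<gamma>" "\<gamma> 0 = y" "\<gamma> T = x" by (rule cc_dist_lessE)
    from cc_dist_le[OF T(1) subunit_reverse[OF X T(1,3)]] T show "cc_dist X x y \<le> r" by (simp add: order_trans less_imp_le)
  qed
  then show ?thesis by (simp add: order_antisym)
qed

lemma cc_dist_triangle_less:
  assumes X: "loc_lipschitz X" and "cc_dist X x y < a" "cc_dist X y z < b"
  shows "cc_dist X x z < a + b"
proof -
  obtain T1 \<gamma>1 where T1: "0 \<le> T1" "ennreal T1 < a" "subunit X T1 \<gamma>1" "\<gamma>1 0 = x" "\<gamma>1 T1 = y"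
    using assms(2) by (rule cc_dist_lessE)
  obtain T2 \<gamma>2 where T2: "0 \<le> T2" "ennreal T2 < b" "subunit X T2 \<gamma>2" "\<gamma>2 0 = y" "\<gamma>2 T2 = z"
    using assms(3) by (rule cc_dist_lessE)
  \<comment> \<open>For \<open>T2 = 0\<close> the concatenated curve ends on its first branch, at
    \<open>\<gamma>1 T1\<close>, which then equals \<open>z\<close>; hence the case
    distinction.\<close>
  have "cc_dist X x z \<le> ennreal (T1 + T2)"
    using cc_dist_le[OF _ subunit_concat[OF X T1(1) T2(1) T1(3) T2(3)]] T1 T2 by (cases "T2 = 0") auto
  also have "\<dots> = ennreal T1 + ennreal T2" using T1 T2 by simp
  also have "\<dots> < a + b" using T1(2) T2(2) by (rule add_strict_mono)
  finally show ?thesis .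
qed

text \<open>The bound on \<open>X\<close> is known near \<open>z\<close> only. A curve leaving the
  ball of radius \<open>d\<close> would have a first exit time \<open>s\<close>, up to which its
  speed is at most \<open>B\<close>; this forces \<open>d \<le> B * s < B * r\<close>, against
  \<open>B * r \<le> d\<close>. Having stayed inside, it travels at most
  \<open>B * r\<close>.\<close>

lemma cc_dist_less_imp_close:
  assumes X: "loc_lipschitz X" and B: "0 \<le> B" "\<And>y. y \<in> cball z d \<Longrightarrow> norm (X y) \<le> B"
    and d: "0 < d" and r: "B * r \<le> d" and less: "cc_dist X z y < ennreal r"
  shows "dist z y \<le> B * r"
proof -
  obtain T \<gamma> where T: "0 \<le> T" "ennreal T < ennreal r" "subunit X T \<gamma>" "\<gamma> 0 = z" "\<gamma> T = y"
    using less by (rule cc_dist_lessE)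
  have Tr: "T < r" using T by (simp add: ennreal_less_iff)
  obtain L N where L: "L-lipschitz_on {0..T} \<gamma>" and N: "negligible N"
    "\<And>t. t \<in> {0<..<T} - N \<Longrightarrow> subunit_at X \<gamma> t (at t)"
    using T(3) unfolding subunit_iff_lipschitz[OF X T(1)] by blast
  have ac: "absolutely_continuous_on {0..T} \<gamma>" by (rule lipschitz_imp_absolutely_continuous[OF L])
  have cont: "continuous_on {0..T} \<gamma>" by (rule absolutely_continuous_imp_continuous[OF ac])
  have speed: "norm (\<gamma> s - \<gamma> 0) \<le> B * s" if s: "0 \<le> s" "s \<le> T" and near: "\<And>t. 0 \<le> t \<Longrightarrow> t < s \<Longrightarrow> dist z (\<gamma> t) < d" for s
  proof -
    have "norm (\<gamma> s - \<gamma> 0) \<le> B * (s - 0)"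
    proof (rule absolutely_continuous_speed_bound[OF ac s(1) _ _ B(1)])
      show "negligible (N \<union> {0, s})" using N(1) by (intro negligible_Un) auto
      fix t assume t: "t \<in> {0..s} - (N \<union> {0, s})"
      then obtain v where v: "(\<gamma> has_vector_derivative v) (at t)" "subunit_velocity X (\<gamma> t) v" using N(2)[of t] s by auto
      have "norm v \<le> B" using subunit_velocity_norm[OF v(2)] B(2)[of "\<gamma> t"] near[of t] t by auto
      then show "\<exists>v. (\<gamma> has_vector_derivative v) (at t within {0..s}) \<and> norm v \<le> B"
        using v(1) has_vector_derivative_at_within by blast
    qed (use s in auto)
    then show ?thesis by simp
  qed
  have near: "dist z (\<gamma> t) < d" if t: "t \<in> {0..T}" for t
  proof (rule ccontr)
    assume far: "\<not> dist z (\<gamma> t) < d"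
    define A where "A = {s\<in>{0..T}. d \<le> dist z (\<gamma> s)}"
    have "closed A"
      unfolding A_def by (intro continuous_on_closed_Collect_le continuous_intros cont closed_atLeastAtMost)
    moreover have "bounded A" by (rule bounded_subset[of "{0..T}"]) (auto simp: A_def)
    moreover have "A \<noteq> {}" using far t by (auto simp: A_def)
    ultimately obtain s where s: "s \<in> A" "\<And>s'. s' \<in> A \<Longrightarrow> s \<le> s'"
      using compact_attains_inf[of A] by (auto simp: compact_eq_bounded_closed)
    have s0: "0 \<le> s" "s \<le> T" "d \<le> dist z (\<gamma> s)" using s(1) by (auto simp: A_def)
    have "dist z (\<gamma> t') < d" if "0 \<le> t'" "t' < s" for t'
    proof (rule ccontr)
      assume "\<not> dist z (\<gamma> t') < d"
      then have "t' \<in> A" using that s0 by (auto simp: A_def)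
      then show False using s(2) that by fastforce
    qed
    from speed[OF s0(1,2) this] have "dist z (\<gamma> s) \<le> B * s" using T(4) by (simp add: dist_norm norm_minus_commute)
    then have "d \<le> B * s" using s0 by simp
    also have "\<dots> \<le> B * T" using s0 B by (intro mult_left_mono) auto
    finally have "d \<le> B * T" .
    moreover have "0 < B" using \<open>d \<le> B * T\<close> d B(1) by (cases "B = 0") auto
    then have "B * T < B * r" using Tr by simp
    ultimately show False using r by simp
  qed
  have "norm (\<gamma> T - \<gamma> 0) \<le> B * T" by (rule speed) (use T(1) near in auto)
  also have "\<dots> \<le> B * r" using Tr B by (intro mult_left_mono) auto
  finally show ?thesis using T by (simp add: dist_norm norm_minus_commute)
qed

section \<open>Compact embedding\<close>

lemma cc_dist_triangle:
  assumes X: "loc_lipschitz X"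
  shows "cc_dist X x z \<le> cc_dist X x y + cc_dist X y z"
proof (cases "cc_dist X x y = \<infinity> \<or> cc_dist X y z = \<infinity>")
  case False
  show ?thesis
  proof (rule ennreal_le_epsilon)
    fix e :: real assume e: "0 < e"
    have lt: "a < a + ennreal (e/2)" if "a \<noteq> \<infinity>" for a :: ennreal
      using that e ennreal_add_left_cancel_less[of a 0 "ennreal (e/2)"] by (simp add: less_top)
    have "cc_dist X x z < (cc_dist X x y + ennreal (e/2)) + (cc_dist X y z + ennreal (e/2))"
      using False by (intro cc_dist_triangle_less[OF X, where y = y] lt) auto
    also have "\<dots> = cc_dist X x y + cc_dist X y z + (ennreal (e/2) + ennreal (e/2))" by (simp add: ac_simps)
    also have "ennreal (e/2) + ennreal (e/2) = ennreal e" using e by (subst ennreal_plus[symmetric]) auto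
    finally show "cc_dist X x z \<le> cc_dist X x y + cc_dist X y z + ennreal e" by simp
  qed
qed auto

locale X_compact = X_sobolev X \<Omega> p for X :: "('n::finite, 'm::finite) vfields" and \<Omega> p +
  fixes \<Omega>0 :: "(real^'n) set"
  assumes open_\<Omega>0: "open \<Omega>0" and closure_\<Omega>: "closure \<Omega> \<subseteq> \<Omega>0"
    and H1: "H1 X \<Omega>0" and H2: "H2 X \<Omega>0" and H3: "H3 X \<Omega>0"
begin

section \<open>Small Carnot-Caratheodory balls\<close>

definition D :: "real^'n \<Rightarrow> real^'n \<Rightarrow> real" where "D x y = enn2real (cc_dist X x y)"

definition bl :: "real^'n \<Rightarrow> real \<Rightarrow> (real^'n) set" where "bl x r = cc_ball X \<Omega>0 x (ennreal r)"

definition m :: "real^'n \<Rightarrow> real \<Rightarrow> real" where "m x r = measure lebesgue (bl x r)"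

lemma \<Omega>_sub: "\<Omega> \<subseteq> closure \<Omega>" "closure \<Omega> \<subseteq> \<Omega>0" "\<Omega> \<subseteq> \<Omega>0"
  using closure_subset closure_\<Omega> by blast+

lemma compact_closure_\<Omega>: "compact (closure \<Omega>)"
  using bounded_\<Omega> by (simp add: compact_closure)

lemma cc_dist_D: "x \<in> \<Omega>0 \<Longrightarrow> y \<in> \<Omega>0 \<Longrightarrow> cc_dist X x y = ennreal (D x y)"
  using H1 by (simp add: H1_def D_def)

lemma D_nonneg: "0 \<le> D x y" by (simp add: D_def)

lemma D_self: "D x x = 0" by (simp add: D_def cc_dist_refl)

lemma D_commute: "D x y = D y x" by (simp add: D_def cc_dist_commute[OF loc_lip, of x y])

lemma D_triangle:
  assumes "x \<in> \<Omega>0" "y \<in> \<Omega>0" "z \<in> \<Omega>0"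
  shows "D x z \<le> D x y + D y z"
proof -
  have "ennreal (D x z) \<le> ennreal (D x y) + ennreal (D y z)"
    using cc_dist_triangle[OF loc_lip, of x z y] assms by (simp add: cc_dist_D)
  then show ?thesis using D_nonneg by (simp add: ennreal_plus[symmetric] del: ennreal_plus)
qed

lemma bl_iff: "x \<in> \<Omega>0 \<Longrightarrow> y \<in> bl x r \<longleftrightarrow> y \<in> \<Omega>0 \<and> D x y < r"
  unfolding bl_def cc_ball_def using D_nonneg by (auto simp: cc_dist_D ennreal_less_iff)

lemma D_continuous: "continuous_on (\<Omega>0 \<times> \<Omega>0) (\<lambda>z. D (fst z) (snd z))"
proof -
  have c: "continuous_on (\<Omega>0 \<times> \<Omega>0) (\<lambda>(x, y). cc_dist X x y)" using H1 by (simp add: H1_def)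
  show ?thesis
    unfolding continuous_on_def
  proof
    fix z assume z: "z \<in> \<Omega>0 \<times> \<Omega>0"
    obtain a b where ab: "z = (a, b)" by (cases z)
    have "((\<lambda>(x, y). cc_dist X x y) \<longlongrightarrow> ennreal (D a b)) (at z within \<Omega>0 \<times> \<Omega>0)"
      using c z unfolding continuous_on_def ab by (auto simp: cc_dist_D)
    from tendsto_enn2real[OF this D_nonneg]
    show "((\<lambda>z. D (fst z) (snd z)) \<longlongrightarrow> D (fst z) (snd z)) (at z within \<Omega>0 \<times> \<Omega>0)"
      by (simp add: D_def case_prod_unfold ab)
  qed
qed

lemma open_bl:
  assumes x: "x \<in> \<Omega>0"
  shows "open (bl x r)"
proof -
  have "continuous_on \<Omega>0 (\<lambda>y. D (fst (x, y)) (snd (x, y)))"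
    by (rule continuous_on_compose2[OF D_continuous]) (use x in \<open>auto intro!: continuous_intros\<close>)
  then have "continuous_on \<Omega>0 (D x)" by simp
  then have "open (D x -` {..<r} \<inter> \<Omega>0)"
    using continuous_on_open_vimage[OF open_\<Omega>0, of "D x"] open_lessThan[of r] by blast
  moreover have "bl x r = D x -` {..<r} \<inter> \<Omega>0" using bl_iff[OF x] by auto
  ultimately show ?thesis by simp
qed

lemma bl_self: "x \<in> \<Omega>0 \<Longrightarrow> 0 < r \<Longrightarrow> x \<in> bl x r"
  by (simp add: bl_iff D_self)

text \<open>The vector fields are bounded near the compact closure of \<open>\<Omega>\<close>, so a
  metric ball of radius \<open>r\<close> lies in a Euclidean ball of radius proportional to
  \<open>r\<close>. Balls of the whole space then satisfy the inclusion demanded in (H3), with a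
  threshold independent of the centre.\<close>

lemma small_balls:
  obtains r0 where "0 < r0" "\<And>z r. z \<in> closure \<Omega> \<Longrightarrow> r \<le> r0 \<Longrightarrow> {y. cc_dist X z y < ennreal r} \<subseteq> \<Omega>0 \<inter> cball z 1"
proof -
  obtain e where e: "0 < e" "(\<Union>x\<in>closure \<Omega>. cball x e) \<subseteq> \<Omega>0"
    using compact_subset_open_imp_cball_epsilon_subset[OF compact_closure_\<Omega> open_\<Omega>0 \<Omega>_sub(2)] by blast
  define d where "d = min e 1"
  have d: "0 < d" "d \<le> e" "d \<le> 1" using e by (auto simp: d_def)
  obtain R where "\<forall>x\<in>closure \<Omega>. norm x \<le> R"
    using compact_imp_bounded[OF compact_closure_\<Omega>] by (auto simp: bounded_iff)
  then have R: "closure \<Omega> \<subseteq> cball 0 R" by auto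
  have "compact (X ` cball 0 (R + d))"
    by (intro compact_continuous_image continuous_on_subset[OF loc_lipschitz_continuous[OF loc_lip]]) auto
  then obtain B where B: "\<And>y. y \<in> cball 0 (R + d) \<Longrightarrow> norm (X y) \<le> B"
    by (force dest!: compact_imp_bounded simp: bounded_iff)
  define B' where "B' = max B 0 + 1"
  have B': "0 < B'" by (simp add: B'_def)
  show ?thesis
  proof (rule that[of "d / B'"])
    show "0 < d / B'" using d B' by simp
    fix z r assume z: "z \<in> closure \<Omega>" and r: "r \<le> d / B'"
    show "{y. cc_dist X z y < ennreal r} \<subseteq> \<Omega>0 \<inter> cball z 1"
    proof
      fix y assume y: "y \<in> {y. cc_dist X z y < ennreal r}"
      have le: "B' * r \<le> d" using r B' by (simp add: field_simps)
      have "dist z y \<le> B' * r"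
      proof (rule cc_dist_less_imp_close[OF loc_lip less_imp_le[OF B'] _ d(1) le])
        show "norm (X y) \<le> B'" if "y \<in> cball z d" for y
        proof -
          have "norm y \<le> norm z + dist z y" using norm_triangle_ineq2[of y z] by (simp add: dist_norm norm_minus_commute)
          then have "y \<in> cball 0 (R + d)" using that z R by (force simp: subset_iff)
          from B[OF this] show ?thesis by (simp add: B'_def)
        qed
      qed (use y in simp)
      then have "y \<in> cball z e" "y \<in> cball z 1" using le d by auto
      then show "y \<in> \<Omega>0 \<inter> cball z 1" using e(2) z by blast
    qed
  qed
qed

text \<open>Small balls are open, nonempty and bounded, so their measures are positive and finite
  and (H2) on the closure of \<open>\<Omega>\<close> becomes an inequality between real
  numbers.\<close>

lemma doubling:
  obtains r1 A where "0 < r1" "1 \<le> A" "\<And>x r. x \<in> closure \<Omega> \<Longrightarrow> 0 < r \<Longrightarrow> r \<le> r1 \<Longrightarrow> 0 < m x r"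
    "\<And>x r. x \<in> closure \<Omega> \<Longrightarrow> 0 < r \<Longrightarrow> r \<le> r1 \<Longrightarrow> emeasure lebesgue (bl x r) = ennreal (m x r)"
    "\<And>x r. x \<in> closure \<Omega> \<Longrightarrow> 0 < r \<Longrightarrow> 2 * r \<le> r1 \<Longrightarrow> m x (2 * r) \<le> A * m x r"
    "\<And>z r. z \<in> closure \<Omega> \<Longrightarrow> r \<le> r1 \<Longrightarrow> {y. cc_dist X z y < ennreal r} \<subseteq> \<Omega>0"
proof -
  obtain r0 where r0: "0 < r0" "\<And>z r. z \<in> closure \<Omega> \<Longrightarrow> r \<le> r0 \<Longrightarrow> {y. cc_dist X z y < ennreal r} \<subseteq> \<Omega>0 \<inter> cball z 1"
    using small_balls by blast
  obtain rK CK where rK: "0 < rK" "0 < CK" "\<And>x r. x \<in> closure \<Omega> \<Longrightarrow> 0 < r \<Longrightarrow> r < rK \<Longrightarrow>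
      emeasure lebesgue (bl x (2 * r)) \<le> ennreal CK * emeasure lebesgue (bl x r)"
  proof -
    from H2[unfolded H2_def, rule_format, OF conjI[OF compact_closure_\<Omega> \<Omega>_sub(2)]]
    obtain r C where "r > 0" "C > 0" "\<forall>x\<in>closure \<Omega>. \<forall>s. 0 < s \<and> s < r \<longrightarrow>
        emeasure lebesgue (cc_ball X \<Omega>0 x (ennreal (2 * s))) \<le> ennreal C * emeasure lebesgue (cc_ball X \<Omega>0 x (ennreal s))"
      by auto
    then show ?thesis by (intro that[of r C]) (auto simp: bl_def)
  qed
  define r1 where "r1 = min r0 rK"
  have bd: "bounded (bl x r)" if "x \<in> closure \<Omega>" "r \<le> r1" for x r
    by (rule bounded_subset[of "cball x 1"]) (use r0(2)[OF that(1), of r] that in \<open>auto simp: r1_def bl_def cc_ball_def\<close>)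
  have op: "open (bl x r)" if "x \<in> closure \<Omega>" for x r using open_bl that \<Omega>_sub(2) by blast
  have lm: "bl x r \<in> lmeasurable" if "x \<in> closure \<Omega>" "r \<le> r1" for x r
    using bd[OF that] op[OF that(1)] by (intro bounded_set_imp_lmeasurable) auto
  have em: "emeasure lebesgue (bl x r) = ennreal (m x r)" if "x \<in> closure \<Omega>" "r \<le> r1" for x r
    using lm[OF that] unfolding m_def by (rule emeasure_eq_measure2)
  have pos: "0 < m x r" if x: "x \<in> closure \<Omega>" and r: "0 < r" "r \<le> r1" for x r
  proof -
    have "\<not> negligible (bl x r)"
      using open_not_negligible[OF op[OF x]] bl_self[of x r] x r \<Omega>_sub(2) by blast
    then have "m x r \<noteq> 0" using lm[OF x r(2)] by (simp add: m_def negligible_iff_measure)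
    then show ?thesis by (simp add: m_def less_le)
  qed
  show ?thesis
  proof (rule that[of r1 "max CK 1"])
    show "0 < r1" "1 \<le> max CK 1" using r0(1) rK(1) by (auto simp: r1_def)
    fix x r assume x: "x \<in> closure \<Omega>"
    show "0 < m x r" if "0 < r" "r \<le> r1" using pos[OF x that] .
    show "emeasure lebesgue (bl x r) = ennreal (m x r)" if "0 < r" "r \<le> r1" using em[OF x that(2)] .
    show "{y. cc_dist X x y < ennreal r} \<subseteq> \<Omega>0" if "r \<le> r1"
      using r0(2)[OF x, of r] that by (auto simp: r1_def)
    show "m x (2 * r) \<le> max CK 1 * m x r" if r: "0 < r" "2 * r \<le> r1"
    proof -
      have mn: "0 \<le> m x r" by (simp add: m_def)
      have "ennreal (m x (2 * r)) \<le> ennreal CK * ennreal (m x r)"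
        using rK(3)[OF x r(1)] em[OF x r(2)] em[OF x, of r] r rK(1) by (auto simp: r1_def)
      then have "m x (2 * r) \<le> CK * m x r" using rK(2) mn by (simp add: ennreal_mult[symmetric])
      also have "\<dots> \<le> max CK 1 * m x r" using mn by (intro mult_right_mono) auto
      finally show ?thesis .
    qed
  qed
qed

text \<open>The kernel of (H3), cut off at distance \<open>R\<close> and restricted to
  \<open>\<Omega>\<close>. The truncation makes its Schur bounds of order \<open>R\<close>, the
  origin of all smallness in the compactness proof.\<close>

definition kern :: "real \<Rightarrow> real^'n \<Rightarrow> real^'n \<Rightarrow> real" where
  "kern R x y = (if x \<in> \<Omega> \<and> y \<in> \<Omega> \<and> 0 < D x y \<and> D x y < R then D x y / m x (D x y) else 0)"

lemma kern_nonneg: "0 \<le> kern R x y"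
  by (simp add: kern_def m_def)

lemma borel_measurable_D:
  "(\<lambda>(x, y). if x \<in> \<Omega>0 \<and> y \<in> \<Omega>0 then D x y else 0) \<in> borel_measurable (borel \<Otimes>\<^sub>M borel)"
proof -
  have "(\<lambda>z. indicator (\<Omega>0 \<times> \<Omega>0) z *\<^sub>R D (fst z) (snd z)) \<in> borel_measurable borel"
    by (rule borel_measurable_continuous_on_indicator[OF borel_open[OF open_Times[OF open_\<Omega>0 open_\<Omega>0]] D_continuous])
  moreover have "(\<lambda>z. indicator (\<Omega>0 \<times> \<Omega>0) z *\<^sub>R D (fst z) (snd z)) = (\<lambda>(x, y). if x \<in> \<Omega>0 \<and> y \<in> \<Omega>0 then D x y else 0)"
    by (auto simp: fun_eq_iff indicator_def)
  ultimately show ?thesis by (simp add: borel_prod)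
qed

text \<open>The ball in the denominator has a radius depending on both variables. Its measure is
  that of the section at \<open>(x, y)\<close> of the set \<open>Q\<close> of triples with
  \<open>D x z < D x y\<close>, and measures of sections depend measurably on the point.\<close>

lemma kern_measurable: "case_prod (\<lambda>x y. ennreal (kern R x y)) \<in> borel_measurable (lborel \<Otimes>\<^sub>M lborel)"
proof -
  \<comment> \<open>\<open>D\<close> is continuous on \<open>\<Omega>0 \<times> \<Omega>0\<close>;
    extension by zero makes it Borel on the whole product.\<close>
  let ?D = "\<lambda>x y. if x \<in> \<Omega>0 \<and> y \<in> \<Omega>0 then D x y else 0"
  have Dm[measurable]: "(\<lambda>(x, y). ?D x y) \<in> borel_measurable (borel \<Otimes>\<^sub>M borel)" by (rule borel_measurable_D)
  have [measurable]: "\<Omega> \<in> sets borel" "\<Omega>0 \<in> sets borel" using open_\<Omega> open_\<Omega>0 by auto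
  define Q where "Q = {w \<in> space ((borel \<Otimes>\<^sub>M borel) \<Otimes>\<^sub>M lborel). fst (fst w) \<in> \<Omega>0 \<and> snd (fst w) \<in> \<Omega>0 \<and> snd w \<in> \<Omega>0 \<and>
      ?D (fst (fst w)) (snd w) < ?D (fst (fst w)) (snd (fst w))}"
  have D1: "(\<lambda>w. ?D (fst (fst w)) (snd w)) \<in> borel_measurable ((borel \<Otimes>\<^sub>M borel) \<Otimes>\<^sub>M (lborel :: (real^'n) measure))"
    using measurable_compose[OF _ Dm, of "\<lambda>w. (fst (fst w), snd w)" "(borel \<Otimes>\<^sub>M borel) \<Otimes>\<^sub>M lborel"] by simp
  have D2: "(\<lambda>w. ?D (fst (fst w)) (snd (fst w))) \<in> borel_measurable ((borel \<Otimes>\<^sub>M borel) \<Otimes>\<^sub>M (lborel :: (real^'n) measure))"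
    using measurable_compose[OF _ Dm, of fst "(borel \<Otimes>\<^sub>M borel) \<Otimes>\<^sub>M lborel"] by (simp add: case_prod_unfold)
  note [measurable] = D1 D2
  have "Q \<in> sets ((borel \<Otimes>\<^sub>M borel) \<Otimes>\<^sub>M lborel)" unfolding Q_def by measurable
  then have em: "(\<lambda>z. emeasure lborel (Pair z -` Q)) \<in> borel_measurable (borel \<Otimes>\<^sub>M borel)"
    by (rule sigma_finite_measure.measurable_emeasure_Pair[OF sigma_finite_lborel])
  have Qm: "enn2real (emeasure lborel (Pair (x, y) -` Q)) = m x (D x y)" if "x \<in> \<Omega>0" "y \<in> \<Omega>0" for x y
  proof -
    have "Pair (x, y) -` Q = bl x (D x y)"
      unfolding Q_def using that bl_iff[OF that(1)] by (auto simp: space_pair_measure)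
    then show ?thesis using open_bl[OF that(1)] by (simp add: m_def measure_def)
  qed
  have eq: "ennreal (kern R x y) = (if x \<in> \<Omega> \<and> y \<in> \<Omega> \<and> 0 < ?D x y \<and> ?D x y < R
     then ennreal (?D x y / enn2real (emeasure lborel (Pair (x, y) -` Q))) else 0)" for x y
    using Qm[of x y] \<Omega>_sub(3) by (auto simp: kern_def subset_iff)
  have "(\<lambda>z. if fst z \<in> \<Omega> \<and> snd z \<in> \<Omega> \<and> 0 < ?D (fst z) (snd z) \<and> ?D (fst z) (snd z) < R
     then ennreal (?D (fst z) (snd z) / enn2real (emeasure lborel (Pair z -` Q))) else 0) \<in> borel_measurable (borel \<Otimes>\<^sub>M borel)"
  proof -
    have [measurable]: "(\<lambda>z. ?D (fst z) (snd z)) \<in> borel_measurable (borel \<Otimes>\<^sub>M borel)" using Dm by (simp add: case_prod_unfold)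
    note [measurable] = em
    show ?thesis by measurable
  qed
  moreover have "borel_measurable (lborel \<Otimes>\<^sub>M lborel) = (borel_measurable (borel \<Otimes>\<^sub>M borel) :: ((real^'n) \<times> (real^'n) \<Rightarrow> ennreal) set)"
    by (intro measurable_cong_sets sets_pair_measure_cong) auto
  ultimately show ?thesis unfolding eq case_prod_unfold prod.collapse by simp
qed

text \<open>Dyadic decomposition: where the distance lies between \<open>\<rho> (Suc k)\<close> and
  \<open>\<rho> k\<close>, the kernel is at most \<open>\<rho> k / m x (\<rho> (Suc k))\<close>, and
  doubling bounds the integral of this value over the larger ball by \<open>A * \<rho> k\<close>.
  The geometric series gives \<open>2 * A * R\<close>. For the other variable,
  \<open>m y d \<le> m x (2 * d) \<le> A * m x d\<close> at \<open>d = D x y\<close> makes the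
  kernel symmetric up to the factor \<open>A\<close>.\<close>

lemma kern_integrals:
  obtains r1 A where "0 < r1" "1 \<le> A"
    "\<And>R x. 0 < R \<Longrightarrow> R \<le> r1 \<Longrightarrow> (\<integral>\<^sup>+y. ennreal (kern R x y) \<partial>lborel) \<le> ennreal (A * R)"
    "\<And>R y. 0 < R \<Longrightarrow> R \<le> r1 \<Longrightarrow> (\<integral>\<^sup>+x. ennreal (kern R x y) \<partial>lborel) \<le> ennreal (A * R)"
    "\<And>x r. x \<in> closure \<Omega> \<Longrightarrow> 0 < r \<Longrightarrow> r \<le> r1 \<Longrightarrow> 0 < m x r"
    "\<And>x r. x \<in> closure \<Omega> \<Longrightarrow> 0 < r \<Longrightarrow> r \<le> r1 \<Longrightarrow> emeasure lebesgue (bl x r) = ennreal (m x r)"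
    "\<And>z r. z \<in> closure \<Omega> \<Longrightarrow> r \<le> r1 \<Longrightarrow> {y. cc_dist X z y < ennreal r} \<subseteq> \<Omega>0"
proof -
  let ?\<kappa> = "\<lambda>\<rho> k x y. ennreal (\<rho> k / m x (\<rho> (Suc k))) * indicator (bl x (\<rho> k)) y"
  obtain r1 A where A: "0 < r1" "1 \<le> A" and pos: "\<And>x r. x \<in> closure \<Omega> \<Longrightarrow> 0 < r \<Longrightarrow> r \<le> r1 \<Longrightarrow> 0 < m x r"
    and em: "\<And>x r. x \<in> closure \<Omega> \<Longrightarrow> 0 < r \<Longrightarrow> r \<le> r1 \<Longrightarrow> emeasure lebesgue (bl x r) = ennreal (m x r)"
    and dbl: "\<And>x r. x \<in> closure \<Omega> \<Longrightarrow> 0 < r \<Longrightarrow> 2 * r \<le> r1 \<Longrightarrow> m x (2 * r) \<le> A * m x r"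
    and inc: "\<And>z r. z \<in> closure \<Omega> \<Longrightarrow> r \<le> r1 \<Longrightarrow> {y. cc_dist X z y < ennreal r} \<subseteq> \<Omega>0"
    by (rule doubling) (rule that)
  have first: "(\<integral>\<^sup>+y. ennreal (kern R x y) \<partial>lborel) \<le> ennreal (2 * A * R)" if R: "0 < R" "R \<le> r1" for R x
  proof (cases "x \<in> \<Omega>")
    case False
    then show ?thesis by (simp add: kern_def)
  next
    case x\<Omega>: True
    then have x: "x \<in> closure \<Omega>" "x \<in> \<Omega>0" using \<Omega>_sub by auto
    define \<rho> where "\<rho> k = R * (1/2)^k" for k
    have \<rho>: "0 < \<rho> k" "\<rho> k \<le> R" "\<rho> (Suc k) = \<rho> k / 2" for k
      using R by (auto simp: \<rho>_def power_le_one mult_left_le)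
    have mono: "m x s \<le> m x t" if "0 < s" "s \<le> t" "t \<le> r1" for s t
    proof -
      have "bl x s \<subseteq> bl x t" using that bl_iff[OF x(2)] by auto
      then have "emeasure lebesgue (bl x s) \<le> emeasure lebesgue (bl x t)"
        using open_bl[OF x(2)] by (intro emeasure_mono) auto
      then show ?thesis using em[OF x(1)] that by (simp add: m_def)
    qed
    have pt: "ennreal (kern R x y) \<le> (\<Sum>k. ?\<kappa> \<rho> k x y)" for y
    proof (cases "y \<in> \<Omega> \<and> 0 < D x y \<and> D x y < R")
      case True
      have "(\<lambda>k. \<rho> k) \<longlonglongrightarrow> R * 0" unfolding \<rho>_def by (intro tendsto_intros LIMSEQ_power_zero) auto
      then have "\<forall>\<^sub>F k in sequentially. \<rho> k < D x y" using True by (intro order_tendstoD) auto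
      then have ex: "\<exists>k. \<rho> k \<le> D x y" by (auto simp: eventually_sequentially intro: less_imp_le)
      \<comment> \<open>The first dyadic radius not above the distance; its predecessor exists
        because \<open>\<rho> 0 = R\<close> exceeds the distance.\<close>
      define k where "k = (LEAST k. \<rho> k \<le> D x y)"
      have k: "\<rho> k \<le> D x y" unfolding k_def by (rule LeastI_ex[OF ex])
      have "\<rho> 0 = R" by (simp add: \<rho>_def)
      then have "k \<noteq> 0" using k True by (intro notI) simp
      then obtain j where j: "k = Suc j" using not0_implies_Suc by blast
      have jl: "D x y < \<rho> j" using not_less_Least[of j "\<lambda>k. \<rho> k \<le> D x y"] j unfolding k_def by auto
      have "y \<in> bl x (\<rho> j)" using jl True bl_iff[OF x(2)] \<Omega>_sub(3) by auto
      have "kern R x y = D x y / m x (D x y)" using True x\<Omega> by (simp add: kern_def)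
      also have "\<dots> \<le> \<rho> j / m x (\<rho> (Suc j))"
      proof (rule frac_le)
        show "0 < m x (\<rho> (Suc j))" using pos[OF x(1) \<rho>(1), of "Suc j"] \<rho>(2)[of "Suc j"] R by simp
        show "m x (\<rho> (Suc j)) \<le> m x (D x y)" using k j True R by (intro mono \<rho>) auto
      qed (use jl \<rho>(1)[of j] in auto)
      finally have "ennreal (kern R x y) \<le> ennreal (\<rho> j / m x (\<rho> (Suc j))) * indicator (bl x (\<rho> j)) y"
        using \<open>y \<in> bl x (\<rho> j)\<close> by (simp add: ennreal_leI)
      also have "\<dots> \<le> (\<Sum>k. ?\<kappa> \<rho> k x y)"
        using sum_le_suminf[of "\<lambda>k. ?\<kappa> \<rho> k x y" "{j}"]
        by (simp only: sum.insert[OF finite.emptyI empty_iff[THEN iffD1, THEN notI]] sum.empty add_0_right) simp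
      finally show ?thesis .
    qed (auto simp: kern_def)
    have blb: "bl x r \<in> sets borel" for r using open_bl[OF x(2)] by simp
    have "(\<integral>\<^sup>+y. ennreal (kern R x y) \<partial>lborel) \<le> (\<integral>\<^sup>+y. (\<Sum>k. ?\<kappa> \<rho> k x y) \<partial>lborel)"
      by (rule nn_integral_mono) (rule pt)
    also have "\<dots> = (\<Sum>k. \<integral>\<^sup>+y. ?\<kappa> \<rho> k x y \<partial>lborel)"
      by (rule nn_integral_suminf) (use blb in measurable)
    also have "\<dots> \<le> (\<Sum>k. ennreal (A * R * (1/2)^k))"
    proof (rule suminf_le)
      fix k
      have p1: "0 < m x (\<rho> (Suc k))" using pos[OF x(1) \<rho>(1), of "Suc k"] \<rho>(2)[of "Suc k"] R by simp
      have "(\<integral>\<^sup>+y. ?\<kappa> \<rho> k x y \<partial>lborel)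
          = ennreal (\<rho> k / m x (\<rho> (Suc k))) * emeasure lborel (bl x (\<rho> k))"
        using blb by (simp add: nn_integral_cmult)
      also have "emeasure lborel (bl x (\<rho> k)) = ennreal (m x (\<rho> k))"
        using em[OF x(1) \<rho>(1), of k] \<rho>(2)[of k] R blb by simp
      also have "ennreal (\<rho> k / m x (\<rho> (Suc k))) * ennreal (m x (\<rho> k)) = ennreal (\<rho> k / m x (\<rho> (Suc k)) * m x (\<rho> k))"
        using p1 \<rho>(1)[of k] by (intro ennreal_mult[symmetric]) (auto simp: m_def)
      also have "\<dots> \<le> ennreal (A * R * (1/2)^k)"
      proof (rule ennreal_leI)
        have "m x (\<rho> k) \<le> A * m x (\<rho> (Suc k))"
          using dbl[OF x(1) \<rho>(1), of "Suc k"] \<rho>(2)[of k] R by (simp add: \<rho>(3))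
        then have "\<rho> k / m x (\<rho> (Suc k)) * m x (\<rho> k) \<le> \<rho> k / m x (\<rho> (Suc k)) * (A * m x (\<rho> (Suc k)))"
          using p1 \<rho>(1)[of k] by (intro mult_left_mono) auto
        also have "\<dots> = A * R * (1/2)^k" using p1 by (simp add: \<rho>_def)
        finally show "\<rho> k / m x (\<rho> (Suc k)) * m x (\<rho> k) \<le> A * R * (1/2)^k" .
      qed
      finally show "(\<integral>\<^sup>+y. ?\<kappa> \<rho> k x y \<partial>lborel) \<le> ennreal (A * R * (1/2)^k)" .
    qed auto
    also have "\<dots> = ennreal (\<Sum>k. A * R * (1/2)^k)"
      by (rule suminf_ennreal2) (use A R in \<open>auto intro!: summable_mult summable_geometric\<close>)
    also have "(\<Sum>k. A * R * (1/2)^k) = 2 * A * R"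
      by (subst suminf_mult) (auto simp: suminf_geometric intro!: summable_geometric)
    finally show ?thesis .
  qed
  have second: "(\<integral>\<^sup>+x. ennreal (kern R x y) \<partial>lborel) \<le> ennreal (A * (2 * A * R))" if R: "0 < R" "2 * R \<le> r1" for R y
  proof -
    have "ennreal (kern R x y) \<le> ennreal A * ennreal (kern R y x)" for x
    proof (cases "x \<in> \<Omega> \<and> y \<in> \<Omega> \<and> 0 < D x y \<and> D x y < R")
      case True
      then have xy: "x \<in> closure \<Omega>" "y \<in> closure \<Omega>" "x \<in> \<Omega>0" "y \<in> \<Omega>0" using \<Omega>_sub by auto
      let ?d = "D x y"
      have "bl y ?d \<subseteq> bl x (2 * ?d)"
        using xy D_triangle[OF xy(3,4)] D_commute[of x y] by (force simp: bl_iff)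
      then have "emeasure lebesgue (bl y ?d) \<le> emeasure lebesgue (bl x (2 * ?d))"
        using open_bl[OF xy(3)] by (intro emeasure_mono) auto
      then have "m y ?d \<le> m x (2 * ?d)" using em[OF xy(1), of "2 * ?d"] em[OF xy(2), of ?d] True R by (simp add: m_def)
      also have "\<dots> \<le> A * m x ?d" using dbl[OF xy(1), of ?d] True R by simp
      finally have le: "m y ?d \<le> A * m x ?d" .
      have mp: "0 < m x ?d" "0 < m y ?d" using pos[OF xy(1), of ?d] pos[OF xy(2), of ?d] True R by auto
      have "kern R x y = ?d / m x ?d" using True by (simp add: kern_def)
      also have "\<dots> \<le> A * (?d / m y ?d)"
      proof -
        have "?d * m y ?d \<le> ?d * (A * m x ?d)" using le True by (intro mult_left_mono) auto
        then show ?thesis using mp by (simp add: field_simps)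
      qed
      also have "?d / m y ?d = kern R y x" using True by (simp add: kern_def D_commute[of x y])
      finally have "ennreal (kern R x y) \<le> ennreal (A * kern R y x)" by (rule ennreal_leI)
      then show ?thesis using A kern_nonneg by (simp add: ennreal_mult)
    next
      case False
      then have "kern R x y = 0" by (auto simp: kern_def)
      then show ?thesis by simp
    qed
    then have "(\<integral>\<^sup>+x. ennreal (kern R x y) \<partial>lborel) \<le> (\<integral>\<^sup>+x. ennreal A * ennreal (kern R y x) \<partial>lborel)"
      by (rule nn_integral_mono)
    also have "\<dots> = ennreal A * (\<integral>\<^sup>+x. ennreal (kern R y x) \<partial>lborel)"
    proof (rule nn_integral_cmult)
      have "(\<lambda>x. case_prod (\<lambda>x y. ennreal (kern R x y)) (y, x)) \<in> borel_measurable lborel"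
        by (rule measurable_compose[OF _ kern_measurable]) measurable
      then show "(\<lambda>x. ennreal (kern R y x)) \<in> borel_measurable lborel" by simp
    qed
    also have "\<dots> \<le> ennreal A * ennreal (2 * A * R)" using R by (intro mult_left_mono first) auto
    also have "\<dots> = ennreal (A * (2 * A * R))" using A R by (simp add: ennreal_mult)
    finally show ?thesis .
  qed
  show ?thesis
  \<comment> \<open>The symmetry argument doubles a radius, so \<open>R\<close> is limited to
    \<open>r1 / 2\<close>; the constant \<open>2 * A * A\<close> covers both integrals.\<close>
  proof (rule that[of "r1 / 2" "2 * A * A"])
    show "0 < r1 / 2" using A by simp
    have AA: "1 \<le> A * A" using mult_mono[OF A(2) A(2)] A by simp
    then show "1 \<le> 2 * A * A" by simp
    fix R x assume R: "0 < R" "R \<le> r1 / 2"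
    have "2 * A * R \<le> 2 * A * A * R" using A R by simp
    then show "(\<integral>\<^sup>+y. ennreal (kern R x y) \<partial>lborel) \<le> ennreal (2 * A * A * R)"
      using first[of R x] R A by (auto intro: order_trans ennreal_leI)
    show "(\<integral>\<^sup>+y. ennreal (kern R y x) \<partial>lborel) \<le> ennreal (2 * A * A * R)"
      using second[of R x] R by (simp add: ac_simps)
  qed (use pos em inc A in auto)
qed

end

context X_compact
begin

section \<open>From the oscillation estimate to compactness\<close>

lemma C1cD:
  assumes "v \<in> C1c \<Omega>"
  shows "Ck 1 v" "compactly_supported \<Omega> v" "v \<in> borel_measurable borel" "continuous_on UNIV v"
    "\<And>x. x \<notin> \<Omega> \<Longrightarrow> v x = 0" "\<And>x. x \<notin> \<Omega> \<Longrightarrow> Xp v x = 0"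
    "Xp v \<in> borel_measurable borel"
proof -
  show 1: "Ck 1 v" "compactly_supported \<Omega> v" using assms by (auto simp: C1c_def)
  show c: "continuous_on UNIV v" by (rule Ck_continuous[OF 1(1)])
  then show "v \<in> borel_measurable borel" by (rule borel_measurable_continuous_onI)
  show "v x = 0" if "x \<notin> \<Omega>" for x by (rule compactly_supported_zero[OF 1(2) that])
  show "Xp v x = 0" if "x \<notin> \<Omega>" for x
    by (rule X_pointwise_outside) (use 1(2) that in \<open>auto simp: compactly_supported_def\<close>)
  show "Xp v \<in> borel_measurable borel"
    by (rule borel_measurable_continuous_onI[OF continuous_X_pointwise[OF loc_lip 1(1)]])
qed

text \<open>An inequality of Ehrling type. The closure of \<open>\<Omega>\<close> is covered by
  finitely many small balls; on each of them (H3) bounds the deviation from the mean by a potential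
  with truncated kernel, whose Schur norm is small. What remains are finitely many means, and these
  converge along a subsequence of any bounded sequence.\<close>

lemma key_estimate:
  assumes e: "0 < e"
  obtains Z \<rho> C where "finite Z" "Z \<subseteq> \<Omega>0" "0 \<le> C"
    "\<And>v. v \<in> C1c \<Omega> \<Longrightarrow> en v \<le> e * en (Xp v)
       + C * (\<Sum>z\<in>Z. \<bar>LINT y|lebesgue_on (bl z \<rho>). v y\<bar>) powr p"
proof -
  let ?k = "\<lambda>x y. cc_dist X x y / emeasure lebesgue (cc_ball X \<Omega>0 x (cc_dist X x y))"
  let ?K = "\<lambda>u x y. ennreal (norm (Xp u y)) * ?k x y"
  obtain r1 A where A: "0 < r1" "1 \<le> A"
    and k1: "\<And>R x. 0 < R \<Longrightarrow> R \<le> r1 \<Longrightarrow> (\<integral>\<^sup>+y. ennreal (kern R x y) \<partial>lborel) \<le> ennreal (A * R)"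
    and k2: "\<And>R y. 0 < R \<Longrightarrow> R \<le> r1 \<Longrightarrow> (\<integral>\<^sup>+x. ennreal (kern R x y) \<partial>lborel) \<le> ennreal (A * R)"
    and pos: "\<And>x r. x \<in> closure \<Omega> \<Longrightarrow> 0 < r \<Longrightarrow> r \<le> r1 \<Longrightarrow> 0 < m x r"
    and em: "\<And>x r. x \<in> closure \<Omega> \<Longrightarrow> 0 < r \<Longrightarrow> r \<le> r1 \<Longrightarrow> emeasure lebesgue (bl x r) = ennreal (m x r)"
    and inc: "\<And>z r. z \<in> closure \<Omega> \<Longrightarrow> r \<le> r1 \<Longrightarrow> {y. cc_dist X z y < ennreal r} \<subseteq> \<Omega>0"
    by (rule kern_integrals) (rule that)
  have "\<exists>c>0. \<exists>C3>0. \<forall>z\<in>\<Omega>0. \<forall>r>0. {y. cc_dist X z y < ennreal (c * r)} \<subseteq> \<Omega>0 \<longrightarrow>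
     (\<forall>u. (\<exists>L. L-lipschitz_on (closure (bl z (c * r))) u) \<longrightarrow> (\<forall>x\<in>closure (bl z r) \<inter> \<Omega>0.
     ennreal \<bar>u x - (1 / m z r) * (LINT y|lebesgue_on (bl z r). u y)\<bar>
       \<le> ennreal C3 * (\<integral>\<^sup>+ y. ?K u x y \<partial>(lebesgue_on (bl z (c * r))))))"
    using H3 unfolding H3_def Let_def bl_def m_def .
  then obtain c C3 where c: "0 < c" and C3: "0 < C3" and H3'': "\<forall>z\<in>\<Omega>0. \<forall>r>0. {y. cc_dist X z y < ennreal (c * r)} \<subseteq> \<Omega>0 \<longrightarrow>
     (\<forall>u. (\<exists>L. L-lipschitz_on (closure (bl z (c * r))) u) \<longrightarrow> (\<forall>x\<in>closure (bl z r) \<inter> \<Omega>0.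
     ennreal \<bar>u x - (1 / m z r) * (LINT y|lebesgue_on (bl z r). u y)\<bar>
       \<le> ennreal C3 * (\<integral>\<^sup>+ y. ?K u x y \<partial>(lebesgue_on (bl z (c * r))))))"
    by - (elim exE conjE, rule that)
  note H3' = H3''[rule_format]
  \<comment> \<open>Chosen so that \<open>2 * A' \<le> e powr (1/p)\<close> for the Schur constant
    \<open>A' = C3 * A * R\<close>; the factor 2 anticipates the splitting of the p-th power of a
    sum.\<close>
  define R where "R = min r1 ((e powr (1/p)) / (2 * C3 * A))"
  have R: "0 < R" "R \<le> r1" using A C3 e by (auto simp: R_def)
  define A' where "A' = C3 * A * R"
  have A': "0 < A'" using A C3 R by (simp add: A'_def)
  have eA: "2 powr p * A' powr p \<le> e"
  proof -
    have "R \<le> (e powr (1/p)) / (2 * C3 * A)" by (simp add: R_def)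
    then have "2 * A' \<le> e powr (1/p)" using A C3 by (simp add: A'_def field_simps)
    then have "(2 * A') powr p \<le> (e powr (1/p)) powr p" using A' p_bounds by (intro powr_mono2) auto
    then show ?thesis using A' e p_bounds by (simp add: powr_mult powr_powr)
  qed
  \<comment> \<open>If \<open>x\<close> has distance less than \<open>\<rho>\<close> from a centre
    and \<open>y\<close> less than \<open>c * \<rho>\<close>, then their distance is below
    \<open>\<rho> + c * \<rho> = R\<close>, so the truncation loses nothing on
    \<open>cB\<close>.\<close>
  define \<rho> where "\<rho> = R / (1 + c)"
  have \<rho>: "0 < \<rho>" "\<rho> \<le> R" "\<rho> + c * \<rho> = R"
  proof -
    have c1: "0 < 1 + c" using c by simp
    then have "\<rho> * (1 + c) = R" by (simp add: \<rho>_def)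
    then show "\<rho> + c * \<rho> = R" by (simp add: algebra_simps)
    show "0 < \<rho>" using R c1 by (simp add: \<rho>_def)
    then show "\<rho> \<le> R" using \<open>\<rho> + c * \<rho> = R\<close> mult_pos_pos[OF c] by (metis add_increasing2 less_imp_le order_refl)
  qed
  have c\<rho>: "0 < c * \<rho>" "c * \<rho> \<le> r1" using \<rho> R c by (auto intro: order_trans[of _ R])
  have "\<exists>Z\<subseteq>closure \<Omega>. finite Z \<and> closure \<Omega> \<subseteq> (\<Union>z\<in>Z. bl z \<rho>)"
  proof (rule compactE_image[OF compact_closure_\<Omega>])
    show "open (bl z \<rho>)" if "z \<in> closure \<Omega>" for z using open_bl \<Omega>_sub that by blast
    show "closure \<Omega> \<subseteq> (\<Union>z\<in>closure \<Omega>. bl z \<rho>)" using bl_self \<rho>(1) \<Omega>_sub by blast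
  qed blast
  then obtain Z where Z: "Z \<subseteq> closure \<Omega>" "finite Z" "closure \<Omega> \<subseteq> (\<Union>z\<in>Z. bl z \<rho>)" by blast
  define Q where "Q = (\<Sum>z\<in>Z. 1 / m z \<rho>)"
  have mp: "0 < m z \<rho>" if "z \<in> Z" for z using pos[of z \<rho>] that Z \<rho> R by auto
  have Q0: "0 \<le> Q" unfolding Q_def using mp by (intro sum_nonneg) (simp add: less_imp_le)
  define \<mu> where "\<mu> = measure M (space M)"
  have "en v \<le> e * en (Xp v) + (2 powr p * Q powr p * \<mu>) * (\<Sum>z\<in>Z. \<bar>LINT y|lebesgue_on (bl z \<rho>). v y\<bar>) powr p"
    if v: "v \<in> C1c \<Omega>" for v
  proof -
    note vD = C1cD[OF v]
    define I where "I z = (LINT y|lebesgue_on (bl z \<rho>). v y)" for z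
    \<comment> \<open>One number dominating the absolute means over all balls of the cover,
      whichever ball contains \<open>x\<close>.\<close>
    define S where "S = Q * (\<Sum>z\<in>Z. \<bar>I z\<bar>)"
    have S0: "0 \<le> S" using Q0 by (simp add: S_def sum_nonneg)
    \<comment> \<open>The part of \<open>\<bar>v\<bar>\<close> above \<open>S\<close>. It is at most
      the deviation of \<open>v\<close> from the mean over a ball containing \<open>x\<close>, hence
      controlled by the potential.\<close>
    define F where "F x = (if x \<in> \<Omega> then max 0 (\<bar>v x\<bar> - S) else 0)" for x
    have [measurable]: "\<Omega> \<in> sets borel" using open_\<Omega> by simp
    have [measurable]: "v \<in> borel_measurable borel" by (rule vD)
    have Fm[measurable]: "F \<in> borel_measurable borel" unfolding F_def by measurable
    obtain Lv where Lv: "Lv-lipschitz_on UNIV v" using C1_lipschitz[OF vD(1,2)] by blast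
    have Fle: "ennreal (F x) \<le> (\<integral>\<^sup>+y. (ennreal C3 * ennreal (kern R x y)) * ennreal (norm (Xp v y)) \<partial>lborel)" for x
    proof (cases "x \<in> \<Omega>")
      case x: True
      have x': "x \<in> closure \<Omega>" "x \<in> \<Omega>0" using x \<Omega>_sub by auto
      obtain z where z: "z \<in> Z" "x \<in> bl z \<rho>" using Z(3) x' by blast
      have z': "z \<in> closure \<Omega>" "z \<in> \<Omega>0" using z Z \<Omega>_sub by auto
      have xz: "D z x < \<rho>" using z(2) bl_iff[OF z'(2)] by simp
      have aS: "\<bar>1 / m z \<rho> * I z\<bar> \<le> S"
      proof -
        have "\<bar>1 / m z \<rho> * I z\<bar> = (1 / m z \<rho>) * \<bar>I z\<bar>" using mp[OF z(1)] by (simp add: abs_mult)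
        also have "\<dots> \<le> Q * (\<Sum>z\<in>Z. \<bar>I z\<bar>)"
        proof (rule mult_mono)
          show "1 / m z \<rho> \<le> Q" unfolding Q_def
            by (rule member_le_sum[OF z(1)]) (use mp Z in \<open>auto intro: less_imp_le\<close>)
          show "\<bar>I z\<bar> \<le> (\<Sum>z\<in>Z. \<bar>I z\<bar>)" by (rule member_le_sum[OF z(1)]) (use Z in auto)
        qed (use Q0 in auto)
        finally show ?thesis by (simp add: S_def)
      qed
      have "max 0 (\<bar>v x\<bar> - S) \<le> \<bar>v x - 1 / m z \<rho> * I z\<bar>"
        by (intro max.boundedI) (use aS in linarith)+
      then have "F x \<le> \<bar>v x - 1 / m z \<rho> * I z\<bar>" using x by (simp only: F_def if_True)
      then have "ennreal (F x) \<le> ennreal \<bar>v x - 1 / m z \<rho> * I z\<bar>" by (rule ennreal_leI)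
      also have "\<dots> \<le> ennreal C3 * (\<integral>\<^sup>+ y. ?K v x y \<partial>(lebesgue_on (bl z (c * \<rho>))))"
        unfolding I_def
      proof (rule H3'[OF z'(2) \<rho>(1) inc[OF z'(1) c\<rho>(2)]])
        show "\<exists>L. L-lipschitz_on (closure (bl z (c * \<rho>))) v" using lipschitz_on_subset[OF Lv] by blast
        show "x \<in> closure (bl z \<rho>) \<inter> \<Omega>0" using z(2) x' closure_subset by blast
      qed
      also have "(\<integral>\<^sup>+ y. ?K v x y \<partial>(lebesgue_on (bl z (c * \<rho>))))
          = (\<integral>\<^sup>+ y. ?K v x y * indicator (bl z (c * \<rho>)) y \<partial>lebesgue)"
        using open_bl[OF z'(2)] by (intro nn_integral_restrict_space) auto
      also have "\<dots> \<le> (\<integral>\<^sup>+ y. ennreal (kern R x y) * ennreal (norm (Xp v y)) \<partial>lebesgue)"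
      proof (rule nn_integral_mono)
        fix y
        show "?K v x y * indicator (bl z (c * \<rho>)) y
            \<le> ennreal (kern R x y) * ennreal (norm (Xp v y))"
        proof (cases "y \<in> bl z (c * \<rho>) \<and> y \<in> \<Omega> \<and> 0 < D x y")
          case True
          then have y: "y \<in> \<Omega>" "y \<in> \<Omega>0" "D z y < c * \<rho>" using bl_iff[OF z'(2)] by auto
          have "D x y \<le> D x z + D z y" by (rule D_triangle[OF x'(2) z'(2) y(2)])
          then have less: "D x y < R" using xz y(3) \<rho>(3) D_commute[of x z] by linarith
          have "?k x y = ennreal (D x y) / ennreal (m x (D x y))"
            using em[OF x'(1), of "D x y"] True less R cc_dist_D[OF x'(2) y(2)] by (simp add: bl_def)
          also have "\<dots> = ennreal (D x y / m x (D x y))"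
            using pos[OF x'(1), of "D x y"] True less R by (intro divide_ennreal) auto
          also have "\<dots> = ennreal (kern R x y)" using x y True less by (simp add: kern_def)
          finally show ?thesis using True by (simp add: mult.commute)
        next
          case False
          \<comment> \<open>In the three remaining cases the integrand of (H3) vanishes: outside the
            ball, outside \<open>\<Omega>\<close> where the gradient is zero, or at distance zero,
            where the numerator of the kernel is zero.\<close>
          then consider "y \<notin> bl z (c * \<rho>)" | "y \<notin> \<Omega>" | "y \<in> bl z (c * \<rho>)" "D x y = 0"
            using D_nonneg[of x y] by linarith
          then show ?thesis
          proof cases
            case 3
            then have "cc_dist X x y = 0" using bl_iff[OF z'(2)] cc_dist_D[OF x'(2), of y] by simp
            then show ?thesis by simp
          qed (use vD(6) in auto)
        qed
      qed
      also have "ennreal C3 * \<dots> = (\<integral>\<^sup>+ y. (ennreal C3 * ennreal (kern R x y)) * ennreal (norm (Xp v y)) \<partial>lborel)"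
      proof -
        have [measurable]: "(\<lambda>y. ennreal (kern R x y)) \<in> borel_measurable lborel"
          using measurable_compose[OF _ kern_measurable, of "\<lambda>y. (x, y)" lborel R] by simp
        have [measurable]: "Xp v \<in> borel_measurable borel" by (rule vD)
        have "(\<integral>\<^sup>+ y. (ennreal C3 * ennreal (kern R x y)) * ennreal (norm (Xp v y)) \<partial>lborel)
           = ennreal C3 * (\<integral>\<^sup>+ y. ennreal (kern R x y) * ennreal (norm (Xp v y)) \<partial>lborel)"
          unfolding mult.assoc by (rule nn_integral_cmult) measurable
        then show ?thesis by (simp add: nn_integral_completion)
      qed
      finally show ?thesis by (simp add: mult_left_mono)
    qed (simp add: F_def)
    have XLp: "Xp v \<in> LpV M p" by (rule wgradD(2)[OF C1c_wgrad[OF v]])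
    have "(\<integral>\<^sup>+x. ennreal (F x powr p) \<partial>lborel) \<le> ennreal (A' powr (p - 1) * A') * (\<integral>\<^sup>+y. ennreal (norm (Xp v y) powr p) \<partial>lborel)"
    proof (rule schur_test[where k = "\<lambda>x y. ennreal C3 * ennreal (kern R x y)", OF sigma_finite_lborel sigma_finite_lborel])
      show "(\<lambda>(x, y). ennreal C3 * ennreal (kern R x y)) \<in> borel_measurable (lborel \<Otimes>\<^sub>M lborel)"
        using kern_measurable[of R] by (simp add: case_prod_unfold)
      show "(\<lambda>y. norm (Xp v y)) \<in> borel_measurable lborel" using vD(7) by simp
      show "(\<integral>\<^sup>+y. ennreal C3 * ennreal (kern R x y) \<partial>lborel) \<le> ennreal A'" for x
      proof -
        have "(\<integral>\<^sup>+y. ennreal C3 * ennreal (kern R x y) \<partial>lborel) = ennreal C3 * (\<integral>\<^sup>+y. ennreal (kern R x y) \<partial>lborel)"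
          by (rule nn_integral_cmult) (use measurable_compose[OF _ kern_measurable, of "\<lambda>y. (x, y)" lborel R] in simp)
        also have "\<dots> \<le> ennreal C3 * ennreal (A * R)" by (intro mult_left_mono k1 R) simp
        finally show ?thesis using C3 A R by (simp add: A'_def ennreal_mult mult.assoc)
      qed
      show "(\<integral>\<^sup>+x. ennreal C3 * ennreal (kern R x y) \<partial>lborel) \<le> ennreal A'" for y
      proof -
        have "(\<integral>\<^sup>+x. ennreal C3 * ennreal (kern R x y) \<partial>lborel) = ennreal C3 * (\<integral>\<^sup>+x. ennreal (kern R x y) \<partial>lborel)"
          by (rule nn_integral_cmult) (use measurable_compose[OF _ kern_measurable, of "\<lambda>x. (x, y)" lborel R] in simp)
        also have "\<dots> \<le> ennreal C3 * ennreal (A * R)" by (intro mult_left_mono k2 R) simp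
        finally show ?thesis using C3 A R by (simp add: A'_def ennreal_mult mult.assoc)
      qed
    qed (use Fle p_gt_1 A' in \<open>auto simp: F_def\<close>)
    also have "A' powr (p - 1) * A' = A' powr p" using A' by (simp add: powr_diff)
    also have "(\<integral>\<^sup>+y. ennreal (norm (Xp v y) powr p) \<partial>lborel) = ennreal (en (Xp v))"
    proof -
      have "Xp v \<in> LpV lebesgue p" using zero_outside(1)[of "Xp v", OF vD(6)] XLp by simp
      from nn_integral_pint[OF this] show ?thesis
        using zero_outside(2)[of "Xp v", OF vD(6)] by (simp add: nn_integral_completion)
    qed
    finally have Fint: "(\<integral>\<^sup>+x. ennreal (F x powr p) \<partial>lborel) \<le> ennreal (A' powr p * en (Xp v))"
      by (simp add: ennreal_mult pint_nonneg)
    have vLp: "v \<in> LpV M p" by (rule wgradD(1)[OF C1c_wgrad[OF v]])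
    have Fm': "F \<in> borel_measurable M" by (rule measurable_lebesgue_on_borel[OF Fm])
    have mu: "emeasure M (space M) = ennreal \<mu>" unfolding \<mu>_def
      using finite_M by (simp add: finite_measure.emeasure_eq_measure)
    have "ennreal (en v) = (\<integral>\<^sup>+x. ennreal (norm (v x) powr p) \<partial>M)" by (rule nn_integral_pint[OF vLp, symmetric])
    also have "\<dots> \<le> (\<integral>\<^sup>+x. ennreal (2 powr p) * (ennreal (F x powr p) + ennreal (S powr p)) \<partial>M)"
    proof (rule nn_integral_mono)
      fix x assume "x \<in> space M"
      then have "\<bar>v x\<bar> \<le> norm (F x + S)" using S0 by (simp add: F_def)
      then have "norm (v x) powr p \<le> norm (F x + S) powr p" using p_bounds by (intro powr_mono2) auto
      also have "\<dots> \<le> 2 powr p * (norm (F x) powr p + norm S powr p)" by (rule norm_powr_add_le[OF p_bounds(2)])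
      also have "norm (F x) = F x" by (simp add: F_def)
      finally show "ennreal (norm (v x) powr p) \<le> ennreal (2 powr p) * (ennreal (F x powr p) + ennreal (S powr p))"
        using S0 by (simp add: ennreal_mult[symmetric] ennreal_plus[symmetric] ennreal_leI del: ennreal_plus)
    qed
    also have "\<dots> = ennreal (2 powr p) * ((\<integral>\<^sup>+x. ennreal (F x powr p) \<partial>M) + ennreal (S powr p) * ennreal \<mu>)"
      using Fm' by (simp add: nn_integral_cmult nn_integral_add mu[simplified])
    also have "(\<integral>\<^sup>+x. ennreal (F x powr p) \<partial>M) \<le> ennreal (A' powr p * en (Xp v))"
    proof -
      have "(\<integral>\<^sup>+x. ennreal (F x powr p) \<partial>M) = (\<integral>\<^sup>+x. ennreal (F x powr p) * indicator \<Omega> x \<partial>lebesgue)"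
        using sets_\<Omega> by (intro nn_integral_restrict_space) auto
      also have "\<dots> \<le> (\<integral>\<^sup>+x. ennreal (F x powr p) \<partial>lebesgue)"
        by (intro nn_integral_mono) (auto simp: indicator_def)
      also have "\<dots> \<le> ennreal (A' powr p * en (Xp v))" using Fint by (simp add: nn_integral_completion)
      finally show ?thesis .
    qed
    finally have "ennreal (en v) \<le> ennreal (2 powr p) * (ennreal (A' powr p * en (Xp v)) + ennreal (S powr p) * ennreal \<mu>)"
      by (simp add: mult_left_mono)
    also have "\<dots> = ennreal (2 powr p * (A' powr p * en (Xp v) + S powr p * \<mu>))"
      by (simp add: ennreal_mult ennreal_plus pint_nonneg \<mu>_def)
    finally have "en v \<le> 2 powr p * (A' powr p * en (Xp v) + S powr p * \<mu>)"
      by (simp add: ennreal_le_iff pint_nonneg \<mu>_def)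
    also have "\<dots> = (2 powr p * A' powr p) * en (Xp v) + 2 powr p * S powr p * \<mu>" by (simp add: algebra_simps)
    also have "\<dots> \<le> e * en (Xp v) + 2 powr p * S powr p * \<mu>"
      by (intro add_right_mono mult_right_mono eA pint_nonneg)
    also have "S powr p = Q powr p * (\<Sum>z\<in>Z. \<bar>I z\<bar>) powr p"
      unfolding S_def by (rule powr_mult)
    finally show ?thesis by (simp add: I_def ac_simps)
  qed
  then show ?thesis
    using that[of Z "2 powr p * Q powr p * \<mu>" \<rho>] Z \<Omega>_sub(2) by (auto simp: \<mu>_def)
qed

lemma C1c_pint_diff:
  assumes "v \<in> C1c \<Omega>" "w \<in> C1c \<Omega>"
  shows "(\<lambda>x. v x - w x) \<in> C1c \<Omega>"
    "en (Xp (\<lambda>x. v x - w x)) \<le> 2 powr p * (en (Xp v) + en (Xp w))"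
proof -
  show d: "(\<lambda>x. v x - w x) \<in> C1c \<Omega>" using C1c_lincomb[OF assms, of 1 "-1"] by simp
  note g = wgrad_diff[OF C1c_wgrad[OF assms(1)] C1c_wgrad[OF assms(2)]]
  have "en (Xp (\<lambda>x. v x - w x)) = en (\<lambda>x. Xp v x - Xp w x)"
    using pint_Xgrad[OF C1c_wgrad[OF d]] pint_Xgrad[OF g] by simp
  also have "\<dots> \<le> 2 powr p * (en (Xp v) + en (Xp w))"
    by (rule pint_diff_le[OF wgradD(2)[OF C1c_wgrad[OF assms(1)]] wgradD(2)[OF C1c_wgrad[OF assms(2)]] p_bounds(2)])
  finally show "en (Xp (\<lambda>x. v x - w x)) \<le> 2 powr p * (en (Xp v) + en (Xp w))" .
qed

lemma C1c_integral_subset: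
  assumes v: "v \<in> C1c \<Omega>" and B: "B \<in> sets lebesgue"
  shows "integrable (lebesgue_on B) v" "\<bar>LINT y|lebesgue_on B. v y\<bar> \<le> measure M (space M) + en v"
proof -
  note vD = C1cD[OF v]
  have vLp: "v \<in> LpV M p" by (rule wgradD(1)[OF C1c_wgrad[OF v]])
  have "integrable M v" by (rule LpV_imp_integrable[OF vLp finite_M p_bounds(3)])
  then have il: "integrable lebesgue v" using lebesgue_on_zero_outside(1)[of \<Omega> v, OF sets_\<Omega> vD(5)] by simp
  have iB: "integrable lebesgue (\<lambda>x. indicator B x *\<^sub>R v x)" by (rule integrable_mult_indicator[OF B il])
  then show "integrable (lebesgue_on B) v" using B by (subst integrable_restrict_space) auto
  have "(LINT y|lebesgue_on B. v y) = (LINT y|lebesgue. indicator B y *\<^sub>R v y)"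
    using B by (intro integral_restrict_space) auto
  then have "\<bar>LINT y|lebesgue_on B. v y\<bar> \<le> (LINT y|lebesgue. norm (indicator B y *\<^sub>R v y))"
    using integral_norm_bound[of lebesgue "\<lambda>y. indicator B y *\<^sub>R v y"] by simp
  also have "\<dots> \<le> (LINT y|lebesgue. norm (v y))"
    using iB il by (intro integral_mono) (auto simp: indicator_def)
  also have "\<dots> = (LINT y|M. norm (v y))"
    by (rule lebesgue_on_zero_outside(2)[OF sets_\<Omega>, symmetric]) (simp add: vD(5))
  also have "\<dots> \<le> (LINT y|M. 1 + norm (v y) powr p)"
  proof -
    interpret finite_measure M by (rule finite_M)
    show ?thesis using \<open>integrable M v\<close> vLp
      by (intro integral_mono abs_le_1_powr[OF p_bounds(3)]) (auto simp: LpV_def)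
  qed
  also have "\<dots> = measure M (space M) + en v"
  proof -
    interpret finite_measure M by (rule finite_M)
    show ?thesis using vLp by (simp add: LpV_def pint_def)
  qed
  finally show "\<bar>LINT y|lebesgue_on B. v y\<bar> \<le> measure M (space M) + en v" .
qed

text \<open>All means over the balls belonging to the tolerances \<open>1 / Suc n\<close> form a
  countable family of bounded sequences, so a diagonal subsequence makes all of them converge. The
  Ehrling inequality applied to differences then shows that this subsequence is Cauchy.\<close>

lemma C1c_compact:
  assumes f: "\<And>k::nat. f k \<in> C1c \<Omega>" and K: "\<And>k. en (f k) \<le> K" "\<And>k. en (Xp (f k)) \<le> K"
  obtains r u where "strict_mono r" "u \<in> LpV M p" "strongly (\<lambda>k. f (r k)) u"
proof -
  have K0: "0 \<le> K" using order_trans[OF pint_nonneg K(1)] .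
  have fLp: "f k \<in> LpV M p" for k by (rule wgradD(1)[OF C1c_wgrad[OF f]])
  define q where "q n Z \<rho> C \<longleftrightarrow> finite Z \<and> Z \<subseteq> \<Omega>0 \<and> 0 \<le> C \<and> (\<forall>v\<in>C1c \<Omega>. en v \<le> 1 / real (Suc n) * en (Xp v)
       + C * (\<Sum>z\<in>Z. \<bar>LINT y|lebesgue_on (bl z \<rho>). v y\<bar>) powr p)" for n Z \<rho> C
  have "\<exists>Z \<rho> C. q n Z \<rho> C" for n
  proof -
    have "0 < 1 / real (Suc n)" by simp
    then obtain Z \<rho> C where "q n Z \<rho> C" unfolding q_def by (rule key_estimate) blast
    then show ?thesis by blast
  qed
  then obtain Z \<rho> C where q: "\<And>n. q n (Z n) (\<rho> n) (C n)" by metis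
  then have Z: "finite (Z n)" "Z n \<subseteq> \<Omega>0" "0 \<le> C n"
    and est: "v \<in> C1c \<Omega> \<Longrightarrow> en v \<le> 1 / Suc n * en (Xp v) + C n * (\<Sum>z\<in>Z n. \<bar>LINT y|lebesgue_on (bl z (\<rho> n)). v y\<bar>) powr p"
    for v n by (simp_all add: q_def)
  have bls: "bl z (\<rho> n) \<in> sets lebesgue" if "z \<in> Z n" for z n using open_bl[of z] Z(2)[of n] that by auto
  define b where "b k q = (LINT y|lebesgue_on (bl (snd q) (\<rho> (fst q))). f k y)" for k and q :: "nat \<times> (real^'n)"
  \<comment> \<open>Pairs of a tolerance and a ball centre, so that one extraction serves all
    tolerances.\<close>
  define S where "S = (SIGMA n:UNIV. Z n)"
  obtain r where r: "strict_mono r" "\<And>q. q \<in> S \<Longrightarrow> \<exists>l. (\<lambda>k. b (r k) q) \<longlonglongrightarrow> l"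
  proof (rule function_convergent_subsequence[of S b "measure M (space M) + K"])
    show "countable S" unfolding S_def using Z(1) by (intro countable_SIGMA) (auto intro: countable_finite)
    show "norm (b k q) \<le> measure M (space M) + K" if "q \<in> S" for k q
      using C1c_integral_subset(2)[OF f[of k] bls] K(1)[of k] that by (force simp: S_def b_def)
  qed (rule that)
  define L where "L q = lim (\<lambda>k. b (r k) q)" for q
  have L: "(\<lambda>k. b (r k) q) \<longlonglongrightarrow> L q" if "q \<in> S" for q
    using r(2)[OF that] by (simp add: L_def convergent_LIMSEQ_iff[symmetric] convergent_def)
  have "\<exists>N. \<forall>i\<ge>N. \<forall>j\<ge>N. en (\<lambda>x. f (r i) x - f (r j) x) < e" if e: "0 < e" for e
  proof -
    define K' where "K' = 2 powr p * (K + K)"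
    have K': "0 \<le> K'" using K0 by (simp add: K'_def)
    obtain n where n: "1 / real (Suc n) < e / (2 * (K' + 1))" using e K' nat_approx_posE[of "e / (2 * (K' + 1))"] by auto
    have n': "1 / Suc n * K' \<le> e / 2"
    proof -
      have "1 / Suc n * K' \<le> e / (2 * (K' + 1)) * (K' + 1)" using n K' e by (intro mult_mono) auto
      also have "\<dots> = e / 2"
      proof -
        have "2 * K' + 2 \<noteq> 0" using K' by linarith
        then show ?thesis by (simp add: field_simps)
      qed
      finally show ?thesis .
    qed
    define s where "s k = (\<Sum>z\<in>Z n. \<bar>b (r k) (n, z) - L (n, z)\<bar>)" for k
    have "(\<lambda>k. s k) \<longlonglongrightarrow> (\<Sum>z\<in>Z n. \<bar>L (n, z) - L (n, z)\<bar>)"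
      unfolding s_def by (intro tendsto_intros L) (simp add: S_def)
    then have s0: "s \<longlonglongrightarrow> 0" by simp
    \<comment> \<open>The p-th power of the admissible sum of means. Enlarging \<open>C n\<close> by
      1 avoids division by zero and makes \<open>C n * q < e / 2\<close> strict.\<close>
    define q where "q = e / (2 * (C n + 1))"
    have q: "0 < q" "q * (C n + 1) = e / 2"
    proof -
      have "0 < 2 * C n + 2" using Z(3)[of n] by linarith
      then show "0 < q" "q * (C n + 1) = e / 2" using e by (simp_all add: q_def field_simps)
    qed
    define \<eta> where "\<eta> = q powr (1/p) / 2"
    have \<eta>: "0 < \<eta>" "C n * (2 * \<eta>) powr p < e / 2"
    proof -
      show "0 < \<eta>" using q(1) by (simp add: \<eta>_def)
      have "(2 * \<eta>) powr p = q" using q(1) p_bounds by (simp add: \<eta>_def powr_powr)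
      then show "C n * (2 * \<eta>) powr p < e / 2" using q by (simp add: algebra_simps)
    qed
    obtain N where N: "\<And>k. N \<le> k \<Longrightarrow> s k < \<eta>"
      using order_tendstoD(2)[OF s0 \<eta>(1)] by (auto simp: eventually_sequentially)
    show ?thesis
    proof (intro exI[of _ N] allI impI)
      fix i j assume ij: "N \<le> i" "N \<le> j"
      let ?v = "\<lambda>x. f (r i) x - f (r j) x"
      have v: "?v \<in> C1c \<Omega>" by (rule C1c_pint_diff(1)[OF f f])
      have "en (Xp ?v) \<le> 2 powr p * (en (Xp (f (r i))) + en (Xp (f (r j))))"
        by (rule C1c_pint_diff(2)[OF f f])
      also have "\<dots> \<le> K'" unfolding K'_def by (intro mult_left_mono add_mono K) simp
      finally have "1 / Suc n * en (Xp ?v) \<le> 1 / Suc n * K'" by (intro mult_left_mono) auto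
      then have 1: "1 / Suc n * en (Xp ?v) \<le> e / 2" using n' by linarith
      have "(\<Sum>z\<in>Z n. \<bar>LINT y|lebesgue_on (bl z (\<rho> n)). ?v y\<bar>) \<le> (\<Sum>z\<in>Z n. \<bar>b (r i) (n, z) - L (n, z)\<bar> + \<bar>b (r j) (n, z) - L (n, z)\<bar>)"
      proof (rule sum_mono)
        fix z assume z: "z \<in> Z n"
        have "(LINT y|lebesgue_on (bl z (\<rho> n)). ?v y) = b (r i) (n, z) - b (r j) (n, z)"
          unfolding b_def using C1c_integral_subset(1)[OF f bls[OF z]] by simp
        then show "\<bar>LINT y|lebesgue_on (bl z (\<rho> n)). ?v y\<bar> \<le> \<bar>b (r i) (n, z) - L (n, z)\<bar> + \<bar>b (r j) (n, z) - L (n, z)\<bar>" by linarith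
      qed
      also have "\<dots> = s i + s j" by (simp add: s_def sum.distrib)
      also have "\<dots> \<le> 2 * \<eta>" using N[OF ij(1)] N[OF ij(2)] by simp
      finally have "(\<Sum>z\<in>Z n. \<bar>LINT y|lebesgue_on (bl z (\<rho> n)). ?v y\<bar>) powr p \<le> (2 * \<eta>) powr p"
        using p_bounds by (intro powr_mono2) (auto intro: sum_nonneg)
      then have "C n * (\<Sum>z\<in>Z n. \<bar>LINT y|lebesgue_on (bl z (\<rho> n)). ?v y\<bar>) powr p \<le> C n * (2 * \<eta>) powr p"
        by (rule mult_left_mono[OF _ Z(3)])
      then show "en ?v < e" using est[OF v, of n] 1 \<eta>(2) by linarith
    qed
  qed
  then have cau: "\<And>e. 0 < e \<Longrightarrow> \<exists>N. \<forall>i\<ge>N. \<forall>j\<ge>N. en (\<lambda>x. f (r i) x - f (r j) x) < e" .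
  show ?thesis
    by (rule LpV_complete[of "\<lambda>k. f (r k)", OF fLp p_bounds(3) cau]) (use that r(1) in blast)+
qed

text \<open>Replacing \<open>w k\<close> by a \<open>C1c\<close> function within
  \<open>1 / Suc k\<close> keeps the bounds up to a constant and does not change L^p limits.\<close>

lemma W1p0_compact:
  assumes w: "\<And>k::nat. w k \<in> W0" "\<And>k. wgrad (w k) (W k)"
    and K: "\<And>k. en (w k) \<le> K" "\<And>k. en (W k) \<le> K"
  obtains r u where "strict_mono r" "u \<in> LpV M p" "strongly (\<lambda>k. w (r k)) u"
proof -
  let ?K = "2 powr p * (K + 1)" and ?b = "\<lambda>f u k. 2 powr p * (1 / real (Suc k) + en (\<lambda>x. f k x - u x))"
  have "\<forall>k::nat. \<exists>\<psi>. \<psi> \<in> C1c \<Omega> \<and> en (\<lambda>x. \<psi> x - w k x) < 1 / Suc k \<and> en (Xp \<psi>) \<le> ?K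
     \<and> en \<psi> \<le> ?K"
  proof
    fix k :: nat
    have "0 < 1 / real (Suc k)" by simp
    then obtain \<psi> \<Psi> where \<psi>: "\<psi> \<in> C1c \<Omega>" "wgrad \<psi> \<Psi>"
      "en (\<lambda>x. w k x - \<psi> x) + en (\<lambda>x. W k x - \<Psi> x) < 1 / Suc k"
      using w(1)[of k] unfolding W1p0_iff[OF w(2)] by blast
    have le1: "1 / real (Suc k) \<le> 1" by simp
    have s: "en (\<lambda>x. w k x - \<psi> x) < 1 / Suc k" "en (\<lambda>x. W k x - \<Psi> x) < 1 / Suc k"
      using \<psi>(3) pint_nonneg[of M p "\<lambda>x. w k x - \<psi> x"] pint_nonneg[of M p "\<lambda>x. W k x - \<Psi> x"] by linarith+
    have s1: "en (\<lambda>x. w k x - \<psi> x) \<le> 1" "en (\<lambda>x. W k x - \<Psi> x) \<le> 1"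
      using s le1 by linarith+
    have "en \<psi> = en (\<lambda>x. w k x - (w k x - \<psi> x))" by simp
    also have "\<dots> \<le> 2 powr p * (en (w k) + en (\<lambda>x. w k x - \<psi> x))"
      by (intro pint_diff_le LpV_diff wgradD(1)[OF w(2)] wgradD(1)[OF \<psi>(2)] p_bounds)
    also have "\<dots> \<le> ?K" using K(1)[of k] s1 by (intro mult_left_mono add_mono) auto
    finally have 1: "en \<psi> \<le> ?K" .
    have "en (Xp \<psi>) = en \<Psi>" using pint_Xgrad[OF \<psi>(2)] pint_Xgrad[OF C1c_wgrad[OF \<psi>(1)]] by simp
    also have "\<dots> = en (\<lambda>x. W k x - (W k x - \<Psi> x))" by simp
    also have "\<dots> \<le> 2 powr p * (en (W k) + en (\<lambda>x. W k x - \<Psi> x))"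
      by (intro pint_diff_le LpV_diff wgradD(2)[OF w(2)] wgradD(2)[OF \<psi>(2)] p_bounds)
    also have "\<dots> \<le> ?K" using K(2)[of k] s1 by (intro mult_left_mono add_mono) auto
    finally show "\<exists>\<psi>. \<psi> \<in> C1c \<Omega> \<and> en (\<lambda>x. \<psi> x - w k x) < 1 / Suc k \<and> en (Xp \<psi>) \<le> ?K
     \<and> en \<psi> \<le> ?K" using 1 s(1) \<psi>(1) by (auto simp: pint_minus[of M p "w k"])
  qed
  from choice[OF this] obtain f where f: "\<forall>k. f k \<in> C1c \<Omega> \<and> en (\<lambda>x. f k x - w k x) < 1 / Suc k \<and>
     en (Xp (f k)) \<le> ?K \<and> en (f k) \<le> ?K" ..
  then have f1: "\<And>k. f k \<in> C1c \<Omega>" "\<And>k. en (f k) \<le> ?K" "\<And>k. en (Xp (f k)) \<le> ?K"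
    and f2: "\<And>k. en (\<lambda>x. f k x - w k x) < 1 / Suc k" by blast+
  obtain r u where ru: "strict_mono r" "u \<in> LpV M p" "strongly (\<lambda>k. f (r k)) u"
    by (rule C1c_compact[OF f1]) (rule that)
  have fLp: "f k \<in> LpV M p" for k by (rule wgradD(1)[OF C1c_wgrad[OF f1(1)]])
  have "strongly (\<lambda>k. w (r k)) u"
  proof (rule tendsto_sandwich[OF always_eventually always_eventually tendsto_const])
    have "(\<lambda>k. 1 / real (Suc (r k))) \<longlonglongrightarrow> 0"
      using LIMSEQ_subseq_LIMSEQ[OF LIMSEQ_Suc[OF lim_1_over_n] ru(1)] by (simp add: o_def)
    then have "(\<lambda>k. ?b f u (r k)) \<longlonglongrightarrow> 2 powr p * (0 + 0)"
      by (intro tendsto_intros ru(3))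
    then show "(\<lambda>k. ?b f u (r k)) \<longlonglongrightarrow> 0" by simp
    show "\<forall>k. en (\<lambda>x. w (r k) x - u x) \<le> ?b f u (r k)"
    proof
      fix k
      have "en (\<lambda>x. w (r k) x - u x) \<le> 2 powr p * (en (\<lambda>x. w (r k) x - f (r k) x) + en (\<lambda>x. f (r k) x - u x))"
        by (rule pint_diff_triangle[OF wgradD(1)[OF w(2)] fLp ru(2)])
      also have "\<dots> \<le> ?b f u (r k)"
        using f2[of "r k"] by (intro mult_left_mono add_mono) (auto simp: pint_minus[of M p "w (r k)"])
      finally show "en (\<lambda>x. w (r k) x - u x) \<le> ?b f u (r k)" .
    qed
  qed (simp add: pint_nonneg)
  then show ?thesis using that ru by blast
qed

end

section \<open>Mollification\<close>

lemma partial_deriv_test_function: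
  assumes "\<phi> \<in> test_functions S"
  shows "partial_deriv i \<phi> \<in> test_functions S"
proof -
  have "Ck (Suc k) \<phi>" for k using assms by (simp add: test_functions_def del: Ck.simps)
  then have "Ck k (partial_deriv i \<phi>)" for k by simp
  moreover have "compactly_supported S (partial_deriv i \<phi>)"
    by (rule compactly_supportedI[of "closure {x. \<phi> x \<noteq> 0}"])
      (use assms partial_deriv_outside_support(1) in \<open>auto simp: test_functions_def compactly_supported_def\<close>)
  ultimately show ?thesis by (simp add: test_functions_def)
qed

lemma integrable_translated_mult:
  fixes w :: "real^'n::finite \<Rightarrow> real"
  assumes "continuous_on UNIV \<theta>" "\<And>x. \<bar>\<theta> x\<bar> \<le> B" "integrable lborel w"
  shows "integrable lborel (\<lambda>y. \<theta> (y - x) * w y)"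
proof -
  have "(\<lambda>y. \<theta> (y - x)) \<in> borel_measurable borel"
    by (intro borel_measurable_continuous_onI continuous_on_compose2[OF assms(1)]) (auto intro!: continuous_intros)
  moreover have "\<bar>B\<bar> = B" using order_trans[OF abs_ge_zero assms(2)] by simp
  ultimately show ?thesis
    by (intro Bochner_Integration.integrable_bound[OF integrable_mult_right[OF assms(3), of B]])
      (use assms in \<open>auto simp: abs_mult intro!: AE_I2 mult_right_mono\<close>)
qed

lemma convolution_continuous:
  fixes w :: "real^'n::finite \<Rightarrow> real"
  assumes \<theta>: "K-lipschitz_on UNIV \<theta>" "\<And>x. \<bar>\<theta> x\<bar> \<le> B" and w: "integrable lborel w"
  shows "continuous_on UNIV (\<lambda>x. LINT y|lborel. \<theta> (y - x) * w y)"
proof (rule lipschitz_on_continuous_on[of "K * (LINT y|lborel. \<bar>w y\<bar>)"], rule lipschitz_onI)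
  note I = integrable_translated_mult[OF lipschitz_on_continuous_on[OF \<theta>(1)] \<theta>(2) w]
  have K: "0 \<le> K" by (rule lipschitz_on_nonneg[OF \<theta>(1)])
  show "0 \<le> K * (LINT y|lborel. \<bar>w y\<bar>)" using K by simp
  fix x x' :: "real^'n"
  have "(LINT y|lborel. \<theta> (y - x) * w y) - (LINT y|lborel. \<theta> (y - x') * w y) = (LINT y|lborel. (\<theta> (y - x) - \<theta> (y - x')) * w y)"
    using I[of x] I[of x'] by (simp add: left_diff_distrib)
  also have "norm \<dots> \<le> (LINT y|lborel. K * dist x x' * \<bar>w y\<bar>)"
  proof (rule order_trans[OF integral_norm_bound integral_mono])
    show "integrable lborel (\<lambda>y. norm ((\<theta> (y - x) - \<theta> (y - x')) * w y))"
      using Bochner_Integration.integrable_diff[OF I[of x] I[of x']] by (simp add: left_diff_distrib)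
    show "integrable lborel (\<lambda>y. K * dist x x' * \<bar>w y\<bar>)" using w by simp
    show "norm ((\<theta> (y - x) - \<theta> (y - x')) * w y) \<le> K * dist x x' * \<bar>w y\<bar>" for y
      using lipschitz_onD[OF \<theta>(1), of "y - x" "y - x'"]
      by (auto simp: abs_mult dist_norm norm_minus_commute intro!: mult_right_mono)
  qed
  finally show "dist (LINT y|lborel. \<theta> (y - x) * w y) (LINT y|lborel. \<theta> (y - x') * w y) \<le> K * (LINT y|lborel. \<bar>w y\<bar>) * dist x x'"
    by (simp add: dist_norm algebra_simps)
qed

text \<open>Mean value theorem for \<open>\<phi>\<close> along the segment from \<open>z\<close> to
  \<open>z - h\<close>, corrected by the linear term; Lipschitz partial derivatives make the error
  quadratic. The sign of \<open>h\<close> fits the shift of \<open>x\<close> in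
  \<open>\<phi> (y - x)\<close>.\<close>

lemma smooth_taylor:
  fixes \<phi> :: "real^'n::finite \<Rightarrow> real"
  assumes "Ck 1 \<phi>" and l: "\<And>i. (l i)-lipschitz_on UNIV (partial_deriv i \<phi>)"
  shows "\<bar>\<phi> (z - h) - \<phi> z + (\<Sum>i\<in>UNIV. h $ i * partial_deriv i \<phi> z)\<bar> \<le> (\<Sum>i\<in>UNIV. l i) * (norm h)\<^sup>2"
proof -
  let ?p = "\<lambda>i t. partial_deriv i \<phi> (z - t *\<^sub>R h)"
  have dif: "\<phi> differentiable (at x)" for x using assms(1) by simp
  define F where "F t = \<phi> (z - t *\<^sub>R h) + t * (\<Sum>i\<in>UNIV. h $ i * partial_deriv i \<phi> z)" for t :: real
  define F' where "F' t = (\<Sum>i\<in>UNIV. h $ i * (partial_deriv i \<phi> z - ?p i t))" for t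
  have D: "(F has_real_derivative F' t) (at t)" for t
  proof -
    have "((\<lambda>t. z - t *\<^sub>R h) has_derivative (\<lambda>s. - (s *\<^sub>R h))) (at t)"
      by (auto intro!: derivative_eq_intros)
    from has_derivative_compose[OF this has_derivative_partial_deriv(1)[OF dif]]
    have "((\<lambda>t. \<phi> (z - t *\<^sub>R h)) has_derivative (\<lambda>s. \<Sum>i\<in>UNIV. (- (s *\<^sub>R h)) $ i * ?p i t)) (at t)" .
    moreover have "(\<lambda>s. \<Sum>i\<in>UNIV. (- (s *\<^sub>R h)) $ i * ?p i t)
        = (*) (- (\<Sum>i\<in>UNIV. h $ i * ?p i t))"
      by (auto simp: fun_eq_iff sum_negf sum_distrib_left sum_distrib_right ac_simps)
    ultimately have "((\<lambda>t. \<phi> (z - t *\<^sub>R h)) has_real_derivative - (\<Sum>i\<in>UNIV. h $ i * ?p i t)) (at t)"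
      by (simp add: has_field_derivative_def)
    then have "(F has_real_derivative - (\<Sum>i\<in>UNIV. h $ i * ?p i t) + (\<Sum>i\<in>UNIV. h $ i * partial_deriv i \<phi> z)) (at t)"
      unfolding F_def by (auto intro!: derivative_eq_intros)
    then show ?thesis by (simp add: F'_def right_diff_distrib sum_subtractf)
  qed
  have "\<exists>t>0. t < 1 \<and> F 1 - F 0 = (1 - 0) * F' t" by (rule MVT2) (use D in auto)
  then obtain t where t: "0 < t" "t < 1" "F 1 - F 0 = F' t" by auto
  have "\<bar>F' t\<bar> \<le> (\<Sum>i\<in>UNIV. \<bar>h $ i * (partial_deriv i \<phi> z - ?p i t)\<bar>)"
    unfolding F'_def by (rule sum_abs)
  also have "\<dots> \<le> (\<Sum>i\<in>UNIV. norm h * (l i * norm h))"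
  proof (rule sum_mono)
    fix i
    have "\<bar>partial_deriv i \<phi> z - ?p i t\<bar> \<le> l i * (t * norm h)"
      using lipschitz_onD[OF l[of i], of z "z - t *\<^sub>R h"] t by (simp add: dist_norm)
    also have "\<dots> \<le> l i * norm h"
      using t lipschitz_on_nonneg[OF l[of i]] by (intro mult_left_mono) (auto simp: mult_left_le_one_le)
    finally show "\<bar>h $ i * (partial_deriv i \<phi> z - ?p i t)\<bar> \<le> norm h * (l i * norm h)"
      by (auto simp: abs_mult intro!: mult_mono component_le_norm_cart)
  qed
  also have "\<dots> = (\<Sum>i\<in>UNIV. l i) * (norm h)\<^sup>2" by (simp add: sum_distrib_left power2_eq_square ac_simps)
  finally show ?thesis using t(3) by (simp add: F_def)
qed

text \<open>The Taylor error is quadratic uniformly in \<open>y\<close>, so it can be integrated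
  against \<open>\<bar>w\<bar>\<close>. The kernel is \<open>\<phi> (y - x)\<close>, so a derivative
  in \<open>x\<close> falls on \<open>\<phi>\<close> with a minus sign.\<close>

lemma convolution_C1:
  fixes w :: "real^'n::finite \<Rightarrow> real"
  assumes \<phi>: "\<phi> \<in> test_functions UNIV" and w: "integrable lborel w"
  defines "g \<equiv> \<lambda>x. LINT y|lborel. \<phi> (y - x) * w y"
  shows "Ck 1 g" "partial_deriv i g x = - (LINT y|lborel. partial_deriv i \<phi> (y - x) * w y)"
proof -
  let ?d = "\<lambda>h y x. \<Sum>i\<in>UNIV. h $ i * partial_deriv i \<phi> (y - x)"
  have p\<phi>: "partial_deriv i \<phi> \<in> test_functions UNIV" for i by (rule partial_deriv_test_function[OF \<phi>])
  have "\<exists>L. L-lipschitz_on UNIV (partial_deriv i \<phi>)" for i by (rule test_functionD(4)[OF p\<phi>])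
  then obtain l where l: "\<And>i. (l i)-lipschitz_on UNIV (partial_deriv i \<phi>)" by metis
  have I: "integrable lborel (\<lambda>y. \<theta> (y - x) * w y)" if \<theta>: "\<theta> \<in> test_functions UNIV" for \<theta> x
  proof -
    obtain B where "\<And>x. \<bar>\<theta> x\<bar> \<le> B" using test_functionD(5)[OF \<theta>] by blast
    from integrable_translated_mult[OF Ck_continuous[OF test_functionD(1)[OF \<theta>]] this w] show ?thesis .
  qed
  define G where "G i x = - (LINT y|lborel. partial_deriv i \<phi> (y - x) * w y)" for i x
  define C where "C = (\<Sum>i\<in>UNIV. l i) * (LINT y|lborel. \<bar>w y\<bar>)"
  have C0: "0 \<le> C" unfolding C_def using lipschitz_on_nonneg[OF l] by (intro mult_nonneg_nonneg sum_nonneg) auto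
  have est: "\<bar>g (x + h) - g x - (\<Sum>i\<in>UNIV. h $ i * G i x)\<bar> \<le> C * (norm h)\<^sup>2" for x h
  proof -
    have "(\<Sum>i\<in>UNIV. h $ i * G i x) = - (LINT y|lborel. ?d h y x * w y)"
    proof -
      have "(LINT y|lborel. ?d h y x * w y)
          = (LINT y|lborel. (\<Sum>i\<in>UNIV. h $ i * (partial_deriv i \<phi> (y - x) * w y)))"
        by (simp add: sum_distrib_right mult.assoc)
      also have "\<dots> = (\<Sum>i\<in>UNIV. h $ i * (LINT y|lborel. partial_deriv i \<phi> (y - x) * w y))"
        using I[OF p\<phi>] by (simp add: Bochner_Integration.integral_sum)
      finally show ?thesis by (simp add: G_def sum_negf)
    qed
    moreover have Is: "integrable lborel (\<lambda>y. ?d h y x * w y)"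
    proof -
      have "integrable lborel (\<lambda>y. \<Sum>i\<in>UNIV. h $ i * (partial_deriv i \<phi> (y - x) * w y))" using I[OF p\<phi>] by simp
      then show ?thesis by (simp add: sum_distrib_right mult.assoc)
    qed
    ultimately have "g (x + h) - g x - (\<Sum>i\<in>UNIV. h $ i * G i x)
       = (LINT y|lborel. \<phi> (y - (x + h)) * w y - \<phi> (y - x) * w y + ?d h y x * w y)"
      using I[OF \<phi>, of "x + h"] I[OF \<phi>, of x] unfolding g_def by simp
    also have "\<bar>\<dots>\<bar> \<le> (LINT y|lborel. (\<Sum>i\<in>UNIV. l i) * (norm h)\<^sup>2 * \<bar>w y\<bar>)"
    proof (rule order_trans[OF integral_abs_bound integral_mono])
      show "integrable lborel (\<lambda>y. \<bar>\<phi> (y - (x + h)) * w y - \<phi> (y - x) * w y + ?d h y x * w y\<bar>)"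
        by (intro integrable_abs Bochner_Integration.integrable_add Bochner_Integration.integrable_diff Is I[OF \<phi>])
      show "integrable lborel (\<lambda>y. (\<Sum>i\<in>UNIV. l i) * (norm h)\<^sup>2 * \<bar>w y\<bar>)" using w by simp
      fix y
      have "\<phi> (y - (x + h)) * w y - \<phi> (y - x) * w y + ?d h y x * w y
         = (\<phi> ((y - x) - h) - \<phi> (y - x) + ?d h y x) * w y"
        by (simp add: algebra_simps)
      then show "\<bar>\<phi> (y - (x + h)) * w y - \<phi> (y - x) * w y + ?d h y x * w y\<bar>
         \<le> (\<Sum>i\<in>UNIV. l i) * (norm h)\<^sup>2 * \<bar>w y\<bar>"
        using smooth_taylor[OF test_functionD(1)[OF \<phi>] l, of "y - x" h] by (simp add: abs_mult mult_right_mono)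
    qed
    also have "\<dots> = C * (norm h)\<^sup>2" by (simp add: C_def)
    finally show ?thesis .
  qed
  have der: "(g has_derivative (\<lambda>h. \<Sum>i\<in>UNIV. h $ i * G i x)) (at x)" for x
    unfolding has_derivative_at_alt
  proof (intro conjI allI impI)
    show "bounded_linear (\<lambda>h. \<Sum>i\<in>UNIV. h $ i * G i x)"
      by (intro bounded_linear_sum bounded_linear_mult_const bounded_linear_vec_nth)
    fix e :: real assume e: "0 < e"
    show "\<exists>d>0. \<forall>y. norm (y - x) < d \<longrightarrow> norm (g y - g x - (\<Sum>i\<in>UNIV. (y - x) $ i * G i x)) \<le> e * norm (y - x)"
    proof (intro exI[of _ "e / (C + 1)"] conjI allI impI)
      show "0 < e / (C + 1)" using e C0 by simp
      fix y assume y: "norm (y - x) < e / (C + 1)"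
      have "(C + 1) * norm (y - x) \<le> e" using y C0 by (simp add: field_simps)
      then have "C * norm (y - x) \<le> e" using C0 by (simp add: algebra_simps) (smt (verit) norm_ge_zero)
      then have "C * norm (y - x) * norm (y - x) \<le> e * norm (y - x)" by (rule mult_right_mono) simp
      then show "norm (g y - g x - (\<Sum>i\<in>UNIV. (y - x) $ i * G i x)) \<le> e * norm (y - x)"
        using est[of x "y - x"] by (simp add: power2_eq_square mult.assoc)
    qed
  qed
  have dif: "g differentiable (at x)" for x using der by (auto simp: differentiable_def)
  have pd: "partial_deriv i g x = G i x" for i x
  proof -
    have "(\<lambda>h. \<Sum>i\<in>UNIV. h $ i * G i x) = (\<lambda>h. \<Sum>i\<in>UNIV. h $ i * partial_deriv i g x)"
      by (rule has_derivative_unique[OF der has_derivative_partial_deriv(1)[OF dif]])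
    from fun_cong[OF this, of "axis i 1"] show ?thesis
      by (simp add: axis_def if_distrib[where f = "\<lambda>c. c * _"] cong: if_cong)
  qed
  then show "partial_deriv i g x = - (LINT y|lborel. partial_deriv i \<phi> (y - x) * w y)" by (simp add: G_def)
  have "continuous_on UNIV (partial_deriv i g)" for i
  proof -
    obtain B where "\<And>x. \<bar>partial_deriv i \<phi> x\<bar> \<le> B" using test_functionD(5)[OF p\<phi>] by blast
    from continuous_on_minus[OF convolution_continuous[OF l[of i] this w]]
    have "continuous_on UNIV (G i)" by (simp add: G_def[abs_def])
    moreover have "partial_deriv i g = G i" using pd by auto
    ultimately show ?thesis by simp
  qed
  then show "Ck 1 g" using dif by simp
qed

section \<open>Cube mollifiers and averages over cubes\<close>

definition cube :: "real \<Rightarrow> (real^'n::finite) \<Rightarrow> (real^'n) set" where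
  "cube e x = cbox (x - (\<chi> i. e)) (x + (\<chi> i. e))"

text \<open>A mollifier of scale \<open>e\<close> without normalization. The steepness
  \<open>1 / e\<close> makes it a rescaling of \<open>cbump 1\<close>, whence a Lipschitz constant
  of order \<open>1 / e\<close> and a mass of order \<open>e\<close> to the power of the
  dimension.\<close>

definition cbump :: "real \<Rightarrow> (real^'n::finite) \<Rightarrow> real" where
  "cbump e = bump (- (\<chi> i. e)) (\<chi> i. e) (1 / e)"

lemma cube_iff: "y \<in> cube e x \<longleftrightarrow> (\<forall>i. \<bar>y $ i - x $ i\<bar> \<le> e)"
  by (auto simp: cube_def mem_box_cart abs_le_iff algebra_simps)

lemma cube_commute: "y \<in> cube e x \<longleftrightarrow> x \<in> cube e y"
  by (simp add: cube_iff abs_minus_commute)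

lemma cube_norm: "(y :: real^'n::finite) \<in> cube e x \<Longrightarrow> norm (y - x) \<le> real CARD('n) * e"
proof -
  assume y: "y \<in> cube e x"
  have "norm (y - x) \<le> (\<Sum>i\<in>UNIV. \<bar>(y - x) $ i\<bar>)" by (rule norm_le_l1_cart)
  also have "\<dots> \<le> (\<Sum>i\<in>(UNIV::'n set). e)" using y by (intro sum_mono) (simp add: cube_iff)
  finally show ?thesis by simp
qed

lemma cube_translate: "y \<in> cube e x \<longleftrightarrow> y - x \<in> cube e 0"
  by (simp add: cube_iff)

lemma measure_cube: "0 \<le> e \<Longrightarrow> emeasure lborel (cube e x :: (real^'n::finite) set) = ennreal ((2 * e) ^ CARD('n))"
proof -
  assume e: "0 \<le> e"
  have "measure lborel (cube e x) = (\<Prod>i\<in>(UNIV::'n set). (x + (\<chi> i. e)) $ i - (x - (\<chi> i. e)) $ i)"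
    unfolding cube_def by (rule content_cbox_cart) (use e in \<open>auto simp: interval_ne_empty_cart\<close>)
  also have "\<dots> = (2 * e) ^ CARD('n)" by simp
  finally show ?thesis
    by (subst emeasure_eq_measure2) (auto simp: cube_def)
qed

lemma cbump_bounds: "0 \<le> cbump e z" "cbump e z \<le> 1"
  by (auto simp: cbump_def bump_bounds)

lemma cbump_nonzero: "0 < e \<Longrightarrow> cbump e z \<noteq> 0 \<Longrightarrow> z \<in> cube e 0"
  using bump_eq_0_iff[of "1 / e" "- (\<chi> i. e)" "\<chi> i. e" z] box_subset_cbox[of "- (\<chi> i. e)" "\<chi> i. e"]
  by (auto simp: cbump_def cube_def)

lemma cbump_uminus: "cbump e (- z) = cbump e z"
  unfolding cbump_def bump_def by (rule prod.cong) (auto simp: algebra_simps)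

lemma cbump_scale: "0 < e \<Longrightarrow> cbump e z = cbump 1 ((1 / e) *\<^sub>R z)"
  unfolding cbump_def bump_def by (rule prod.cong) (auto simp: field_simps)

lemma cbump_test: "0 < e \<Longrightarrow> cbump e \<in> test_functions UNIV"
  unfolding cbump_def by (rule bump_test_function) auto

lemma cbump_translate: "0 < e \<Longrightarrow> (\<lambda>y. cbump e (y - x)) = bump (x - (\<chi> i. e)) (x + (\<chi> i. e)) (1 / e)"
  unfolding cbump_def bump_def by (rule ext, rule prod.cong) (auto simp: algebra_simps)

lemma cbump_translate_test: "0 < e \<Longrightarrow> (\<lambda>y. cbump e (y - x)) \<in> test_functions UNIV"
  unfolding cbump_translate by (rule bump_test_function) auto

lemma cbump_lipschitz:
  obtains L where "0 \<le> L" "\<And>e (y::real^'n::finite) z. 0 < e \<Longrightarrow> \<bar>cbump e y - cbump e z\<bar> \<le> L / e * norm (y - z)"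
proof -
  obtain L where L: "L-lipschitz_on UNIV (cbump 1 :: real^'n \<Rightarrow> real)"
    using test_functionD(4)[OF cbump_test[OF zero_less_one]] by blast
  have "\<bar>cbump e y - cbump e z\<bar> \<le> L / e * norm (y - z)" if e: "0 < e" for e and y z :: "real^'n"
  proof -
    have "dist (cbump 1 ((1 / e) *\<^sub>R y)) (cbump 1 ((1 / e) *\<^sub>R z)) \<le> L * dist ((1 / e) *\<^sub>R y) ((1 / e) *\<^sub>R z)"
      by (rule lipschitz_onD[OF L]) auto
    then show ?thesis
      unfolding cbump_scale[OF e] using e by (simp add: dist_norm scaleR_diff_right[symmetric] del: scaleR_diff_right)
  qed
  then show ?thesis using that[of L] lipschitz_on_nonneg[OF L] by blast
qed

lemma cbump_integrable: "0 < e \<Longrightarrow> integrable lborel (cbump e :: real^'n::finite \<Rightarrow> real)"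
proof (rule integrable_bounded_compactly_supported[where K = "cube e 0" and B = 1])
  assume e: "0 < e"
  show "cbump e \<in> borel_measurable (borel :: (real^'n) measure)" by (rule test_functionD(3)[OF cbump_test[OF e]])
  show "\<bar>cbump e x\<bar> \<le> 1" for x :: "real^'n" using cbump_bounds[of e x] by simp
  show "cbump e x = 0" if "x \<notin> cube e 0" for x :: "real^'n" using cbump_nonzero[OF e] that by blast
qed (simp add: cube_def)

text \<open>On the half-size cube every factor of the bump is at least \<open>exp (-2)\<close>.\<close>

lemma cbump_integral_lower:
  obtains \<kappa> where "0 < \<kappa>" "\<And>e. 0 < e \<Longrightarrow> \<kappa> * e ^ CARD('n) \<le> (LINT y|lborel. cbump e (y :: real^'n::finite))"
proof -
  define \<kappa> :: real where "\<kappa> = (exp (-2) * exp (-2)) ^ CARD('n)"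
  have flat: "exp (-2) \<le> flat 1 t" if "1/2 \<le> t" for t :: real
    using that by (auto simp: flat_def field_simps)
  have low: "\<kappa> \<le> cbump e y" if e: "0 < e" and y: "y \<in> cube (e/2) 0" for e and y :: "real^'n"
  proof -
    have "(\<Prod>i\<in>(UNIV::'n set). exp (-2) * exp (-2)) \<le> (\<Prod>i\<in>(UNIV::'n set). flat 1 ((1/e) * (y $ i - (- (\<chi> i. e)) $ i)) * flat 1 ((1/e) * ((\<chi> i. e) $ i - y $ i)))"
    proof (rule prod_mono, intro conjI mult_mono flat)
      fix i :: 'n
      have i: "\<bar>y $ i\<bar> \<le> e / 2" using y by (simp add: cube_iff)
      show "1/2 \<le> (1/e) * (y $ i - (- (\<chi> i. e)) $ i)" "1/2 \<le> (1/e) * ((\<chi> i. e) $ i - y $ i)"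
        using e i by (auto simp: field_simps abs_le_iff)
    qed (auto simp: flat_1_bounds)
    then show ?thesis by (simp add: \<kappa>_def cbump_def bump_def)
  qed
  show ?thesis
  proof (rule that)
    show k0: "0 < \<kappa>" by (simp add: \<kappa>_def)
    fix e :: real assume e: "0 < e"
    have em: "emeasure lborel (cube (e/2) (0::real^'n)) = ennreal (e ^ CARD('n))" using measure_cube[of "e/2" "0::real^'n"] e by simp
    have cb: "cube (e/2) (0::real^'n) \<in> sets lborel" by (simp add: cube_def)
    have "\<kappa> * e ^ CARD('n) = (LINT y|lborel. \<kappa> * indicator (cube (e/2) (0::real^'n)) y)"
      using em cb e by (simp add: measure_def)
    also have "\<dots> \<le> (LINT y|lborel. cbump e (y :: real^'n))"
    proof (rule integral_mono)
      show "integrable lborel (\<lambda>y. \<kappa> * indicator (cube (e/2) (0::real^'n)) y)"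
        using em cb by (intro integrable_mult_right integrable_real_indicator) auto
      show "\<kappa> * indicator (cube (e/2) 0) y \<le> cbump e y" for y :: "real^'n"
        using low[OF e, of y] cbump_bounds(1)[of e y] by (auto simp: indicator_def)
    qed (rule cbump_integrable[OF e])
    finally show "\<kappa> * e ^ CARD('n) \<le> (LINT y|lborel. cbump e (y :: real^'n))" .
  qed
qed

lemma integral_cbump_translate:
  "(LINT y|lborel. cbump e (y - x :: real^'n::finite)) = (LINT y|lborel. cbump e (y :: real^'n))"
  "(LINT x|lborel. cbump e (y - x :: real^'n)) = (LINT y|lborel. cbump e (y :: real^'n))"
proof -
  have 1: "(LINT y|lborel. cbump e (y - x :: real^'n)) = (LINT y|lborel. cbump e (y :: real^'n))" for x :: "real^'n"
  proof -
    have m: "cbump e \<in> borel_measurable (borel :: (real^'n) measure)"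
      unfolding cbump_def by (intro borel_measurable_continuous_onI Ck_continuous[OF Ck_bump])
    have "(LINT y|lborel. cbump e (y :: real^'n)) = (LINT y|distr lborel borel ((+) (- x)). cbump e y)"
      by (simp add: lborel_distr_plus)
    also have "\<dots> = (LINT y|lborel. cbump e (- x + y))" using m by (subst integral_distr) auto
    finally show ?thesis by simp
  qed
  then show "(LINT y|lborel. cbump e (y - x :: real^'n)) = (LINT y|lborel. cbump e (y :: real^'n))" .
  have "cbump e (y - x) = cbump e (x - y)" for x :: "real^'n" using cbump_uminus[of e "x - y"] by simp
  then have "(LINT x|lborel. cbump e (y - x :: real^'n)) = (LINT x|lborel. cbump e (x - y :: real^'n))"
    by (simp only:)
  then show "(LINT x|lborel. cbump e (y - x :: real^'n)) = (LINT y|lborel. cbump e (y :: real^'n))" using 1 by simp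
qed

lemma partial_deriv_lincomb:
  assumes "partially_differentiable i u x" "partially_differentiable i v x"
  shows "partially_differentiable i (\<lambda>y. u y - a * v y) x"
    "partial_deriv i (\<lambda>y. u y - a * v y) x = partial_deriv i u x - a * partial_deriv i v x"
proof -
  have D: "((\<lambda>t. u (x + t *\<^sub>R axis i 1) - a * v (x + t *\<^sub>R axis i 1)) has_real_derivative
      partial_deriv i u x - a * partial_deriv i v x) (at 0)"
    by (intro DERIV_diff DERIV_cmult partial_deriv_DERIV assms)
  show "partially_differentiable i (\<lambda>y. u y - a * v y) x" by (rule partially_differentiableI[OF D])
  show "partial_deriv i (\<lambda>y. u y - a * v y) x = partial_deriv i u x - a * partial_deriv i v x"
    by (rule partial_deriv_eqI[OF D])
qed

lemma partial_deriv_translate: "partial_deriv i (\<lambda>y. u (y - a)) x = partial_deriv i u (x - a)"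
  by (simp add: partial_deriv_def algebra_simps)

lemma cube_kernel_measurable:
  "(\<lambda>(x, y). ennreal c * indicator (cube e x) y) \<in> borel_measurable (lborel \<Otimes>\<^sub>M (lborel :: (real^'n::finite) measure))"
proof -
  have "closed {z :: (real^'n) \<times> (real^'n). \<forall>i. \<bar>snd z $ i - fst z $ i\<bar> \<le> e}"
    by (intro closed_Collect_all closed_Collect_le continuous_intros)
  then have "{z :: (real^'n) \<times> (real^'n). snd z \<in> cube e (fst z)} \<in> sets borel" by (simp add: cube_iff)
  then have s: "{z :: (real^'n) \<times> (real^'n). snd z \<in> cube e (fst z)} \<in> sets (lborel \<Otimes>\<^sub>M lborel)"
    by (simp add: borel_prod[symmetric] cong: sets_pair_measure_cong)
  have "(\<lambda>z. ennreal c * indicator {z :: (real^'n) \<times> (real^'n). snd z \<in> cube e (fst z)} z) \<in> borel_measurable (lborel \<Otimes>\<^sub>M lborel)"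
    using s by measurable
  moreover have "(\<lambda>z. ennreal c * indicator {z :: (real^'n) \<times> (real^'n). snd z \<in> cube e (fst z)} z) = (\<lambda>(x, y). ennreal c * indicator (cube e x) y)"
    by (auto simp: indicator_def fun_eq_iff)
  ultimately show ?thesis by simp
qed

text \<open>Schur test for \<open>c\<close> times the indicator of a cube: membership in cubes is
  symmetric, so both kernel integrals equal \<open>c\<close> times the volume of the cube.\<close>

lemma cube_average_pint:
  fixes F v :: "real^'n::finite \<Rightarrow> real"
  assumes p: "1 < p" and e: "0 < e" and c: "0 < c" and v: "v \<in> borel_measurable borel" "\<And>y. 0 \<le> v y" "integrable lborel v"
    and F: "\<And>x. 0 \<le> F x" "\<And>x. F x \<le> c * (LINT y|lborel. indicator (cube e x) y * v y)"
  shows "(\<integral>\<^sup>+x. ennreal (F x powr p) \<partial>lborel) \<le> ennreal ((c * (2 * e) ^ CARD('n)) powr p) * (\<integral>\<^sup>+y. ennreal (v y powr p) \<partial>lborel)"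
proof -
  let ?k = "\<lambda>(x :: real^'n) y. ennreal c * indicator (cube e x) y"
  let ?A = "c * (2 * e) ^ CARD('n)"
  have A: "0 < ?A" using c e by simp
  have cb: "cube e x \<in> sets borel" for x :: "real^'n" by (simp add: cube_def)
  have "(\<integral>\<^sup>+x. ennreal (F x powr p) \<partial>lborel) \<le> ennreal (?A powr (p - 1) * ?A) * (\<integral>\<^sup>+y. ennreal (v y powr p) \<partial>lborel)"
  proof (rule schur_test[where k = "\<lambda>x y. ?k x y", OF sigma_finite_lborel sigma_finite_lborel])
    show "(\<lambda>(x, y). ?k x y) \<in> borel_measurable (lborel \<Otimes>\<^sub>M (lborel :: (real^'n) measure))"
      by (rule cube_kernel_measurable)
    have 1: "(\<integral>\<^sup>+y. ?k x y \<partial>lborel) = ennreal ?A" for x :: "real^'n"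
      using cb measure_cube[of e x] e c by (simp add: nn_integral_cmult ennreal_mult)
    then show "(\<integral>\<^sup>+y. ?k x y \<partial>lborel) \<le> ennreal ?A" for x :: "real^'n" by simp
    have "(\<integral>\<^sup>+x. ?k x y \<partial>lborel) = (\<integral>\<^sup>+x. ennreal c * indicator (cube e y) x \<partial>lborel)" for y :: "real^'n"
      using cube_commute by (intro nn_integral_cong) (auto simp: indicator_def)
    then show "(\<integral>\<^sup>+x. ?k x y \<partial>lborel) \<le> ennreal ?A" for y :: "real^'n" using 1 by simp
    fix x :: "real^'n"
    have I: "integrable lborel (\<lambda>y. indicator (cube e x) y * v y)"
      using integrable_mult_indicator[of "cube e x" lborel v] cb v(3) by simp
    have "ennreal (F x) \<le> ennreal (c * (LINT y|lborel. indicator (cube e x) y * v y))" by (rule ennreal_leI[OF F(2)])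
    also have "\<dots> = ennreal c * ennreal (LINT y|lborel. indicator (cube e x) y * v y)"
      using c v(2) by (intro ennreal_mult) (auto intro!: integral_nonneg_AE)
    also have "ennreal (LINT y|lborel. indicator (cube e x) y * v y) = (\<integral>\<^sup>+y. ennreal (indicator (cube e x) y * v y) \<partial>lborel)"
      using I v(2) by (intro nn_integral_eq_integral[symmetric]) auto
    also have "ennreal c * \<dots> = (\<integral>\<^sup>+y. ennreal c * ennreal (indicator (cube e x) y * v y) \<partial>lborel)"
      by (rule nn_integral_cmult[symmetric]) (use I in auto)
    also have "\<dots> = (\<integral>\<^sup>+y. ?k x y * ennreal (v y) \<partial>lborel)"
      by (intro nn_integral_cong) (auto simp: indicator_def)
    finally show "ennreal (F x) \<le> (\<integral>\<^sup>+y. ?k x y * ennreal (v y) \<partial>lborel)" .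
  qed (use p A v F in auto)
  moreover have "a powr (p - 1) * a = a powr p" if "0 < a" for a :: real using that by (simp add: powr_diff)
  ultimately show ?thesis using A by (simp only:)
qed

context X_compact
begin

lemma pint_le_of_cube_average:
  fixes F :: "real^'n \<Rightarrow> 'b::euclidean_space"
  assumes e: "0 < e" and c: "0 < c" and v: "v \<in> borel_measurable borel" "\<And>y. 0 \<le> v y" "integrable lborel v" "v \<in> LpV lborel p"
    and F: "F \<in> LpV M p" "\<And>x. norm (F x) \<le> c * (LINT y|lborel. indicator (cube e x) y * v y)"
  shows "en F \<le> (c * (2 * e) ^ CARD('n)) powr p * pint lborel p v"
proof -
  have "ennreal (en F) = (\<integral>\<^sup>+x. ennreal (norm (F x) powr p) \<partial>M)" by (rule nn_integral_pint[OF F(1), symmetric])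
  also have "\<dots> = (\<integral>\<^sup>+x. ennreal (norm (F x) powr p) * indicator \<Omega> x \<partial>lebesgue)"
    using sets_\<Omega> by (intro nn_integral_restrict_space) auto
  also have "\<dots> \<le> (\<integral>\<^sup>+x. ennreal (norm (F x) powr p) \<partial>lebesgue)"
    by (intro nn_integral_mono) (auto simp: indicator_def)
  also have "\<dots> \<le> ennreal ((c * (2 * e) ^ CARD('n)) powr p) * (\<integral>\<^sup>+y. ennreal (v y powr p) \<partial>lborel)"
    unfolding nn_integral_completion by (rule cube_average_pint[OF p_gt_1 e c v(1-3)]) (use F in auto)
  also have "(\<integral>\<^sup>+y. ennreal (v y powr p) \<partial>lborel) = ennreal (pint lborel p v)"
    using nn_integral_pint[OF v(4)] v(2) by simp
  also have "ennreal ((c * (2 * e) ^ CARD('n)) powr p) * ennreal (pint lborel p v) = ennreal ((c * (2 * e) ^ CARD('n)) powr p * pint lborel p v)"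
    by (rule ennreal_mult[symmetric]) (auto simp: pint_nonneg)
  finally show ?thesis by (simp add: ennreal_le_iff pint_nonneg)
qed

section \<open>Strong convergence from midpoint-stable properties\<close>

lemma pint_midpoint_le:
  assumes "a \<in> LpV M p" "b \<in> LpV M p" "u \<in> LpV M p"
  shows "en (\<lambda>x. (1/2) *\<^sub>R (a x + b x) - u x) \<le> (en (\<lambda>x. a x - u x) + en (\<lambda>x. b x - u x)) / 2"
proof -
  have L: "(\<lambda>x. a x - u x) \<in> LpV M p" "(\<lambda>x. b x - u x) \<in> LpV M p" using assms by (auto intro!: LpV_diff p_bounds)
  have "(\<lambda>x. (1/2) *\<^sub>R ((a x - u x) + (b x - u x))) \<in> LpV M p" by (intro LpV_scaleR LpV_add L p_bounds)
  then have I: "integrable M (\<lambda>x. norm ((1/2) *\<^sub>R ((a x - u x) + (b x - u x))) powr p)" by (rule LpV_integrable)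
  have eq: "(1/2) *\<^sub>R (a x + b x) - u x = (1/2) *\<^sub>R ((a x - u x) + (b x - u x))" for x
    by (simp add: algebra_simps flip: scaleR_add_left)
  have "en (\<lambda>x. (1/2) *\<^sub>R (a x + b x) - u x) \<le> (LINT x|M. (norm (a x - u x) powr p + norm (b x - u x) powr p) / 2)"
    unfolding pint_def eq
    by (rule integral_mono[OF I _ convex_norm_powr_midpoint[OF p_bounds(3)]]) (use L in \<open>simp add: LpV_def\<close>)
  also have "\<dots> = (en (\<lambda>x. a x - u x) + en (\<lambda>x. b x - u x)) / 2"
    using L by (simp add: pint_def LpV_def)
  finally show ?thesis .
qed

lemma pint_zero: "en (\<lambda>x. 0) = 0"
  by (simp add: pint_def)

lemma pint_midpoint:
  assumes "a \<in> LpV M p" "b \<in> LpV M p"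
  shows "en (\<lambda>x. (1/2) *\<^sub>R (a x + b x)) \<le> (en a + en b) / 2"
  using pint_midpoint_le[OF assms, of "\<lambda>_. 0"] by (simp add: LpV_def)

text \<open>
  This replaces weak compactness and Mazur's lemma: a midpoint-stable property of a bounded sequence
  passes to a sequence with the same limit whose gradients converge strongly.
\<close>

lemma weak_to_strong:
  assumes wg: "\<And>k. wgrad (us k) (V k)" "\<And>k. P (us k) (V k)" and K: "\<And>k. en (V k) \<le> K"
    and u: "u \<in> LpV M p" "strongly us u"
    and mid: "\<And>w W v V. wgrad w W \<Longrightarrow> wgrad v V \<Longrightarrow> P w W \<Longrightarrow> P v V \<Longrightarrow>
       P (\<lambda>x. (1/2) * w x + (1/2) * v x) (\<lambda>x. (1/2) *\<^sub>R (W x + V x))"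
  obtains w W U where "\<And>k. wgrad (w k) (W k)" "\<And>k. P (w k) (W k)" "wgrad u U"
    "strongly W U" "strongly w u"
proof -
  \<comment> \<open>Gradients of admissible functions ever closer to \<open>u\<close>. Convexity of
    the energy and of the distance to \<open>u\<close> keeps these nested sets stable under
    midpoints, and the tolerance makes the underlying functions converge to
    \<open>u\<close>.\<close>
  define A where "A k = {W. \<exists>w. wgrad w W \<and> P w W \<and> en W \<le> K \<and> en (\<lambda>x. w x - u x) \<le> 1 / real (Suc k)}" for k
  obtain W U where W: "\<And>k. W k \<in> A k" "U \<in> LpV M p" "strongly W U"
  proof (rule midpoint_convex_sets_converge[OF p_gt_1, of A M K])
    fix k
    have "eventually (\<lambda>j. en (\<lambda>x. us j x - u x) < 1 / real (Suc k)) sequentially"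
      using u(2) by (rule order_tendstoD) simp
    then obtain j where "en (\<lambda>x. us j x - u x) < 1 / real (Suc k)" by (auto simp: eventually_sequentially)
    then have "V j \<in> A k" using wg[of j] K[of j] unfolding A_def by (blast intro: less_imp_le)
    then show "A k \<noteq> {}" by blast
    have "1 / real (Suc (Suc k)) \<le> 1 / real (Suc k)" by (intro divide_left_mono) auto
    then show "A (Suc k) \<subseteq> A k" unfolding A_def by (blast intro: order_trans)
    show "A k \<subseteq> LpV M p" using wgradD(2) by (auto simp: A_def)
    show "en W \<le> K" if "W \<in> A k" for W using that by (auto simp: A_def)
    show "(\<lambda>x. (1/2) *\<^sub>R (W x + Z x)) \<in> A k" if WZ: "W \<in> A k" "Z \<in> A k" for W Z
    proof -
      obtain w v where a: "wgrad w W" "P w W" "en W \<le> K" "en (\<lambda>x. w x - u x) \<le> 1 / real (Suc k)"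
        "wgrad v Z" "P v Z" "en Z \<le> K" "en (\<lambda>x. v x - u x) \<le> 1 / real (Suc k)"
        using WZ unfolding A_def by blast
      have 1: "en (\<lambda>x. (1/2) *\<^sub>R (W x + Z x)) \<le> K"
        by (rule order_trans[OF pint_midpoint[OF wgradD(2)[OF a(1)] wgradD(2)[OF a(5)]]]) (use a(3,7) in simp)
      have "en (\<lambda>x. (1/2) *\<^sub>R (w x + v x) - u x) \<le> 1 / real (Suc k)"
        by (rule order_trans[OF pint_midpoint_le[OF wgradD(1)[OF a(1)] wgradD(1)[OF a(5)] u(1)]]) (use a(4,8) in simp)
      then have "en (\<lambda>x. ((1/2) * w x + (1/2) * v x) - u x) \<le> 1 / real (Suc k)" by (simp add: distrib_left del: of_nat_Suc)
      then show ?thesis using wgrad_midpoint[OF a(1,5)] mid[OF a(1,5,2,6)] 1 unfolding A_def by blast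
    qed
  qed (rule that)
  have "\<exists>w. wgrad w (W k) \<and> P w (W k) \<and> en (\<lambda>x. w x - u x) \<le> 1 / real (Suc k)" for k
    using W(1)[of k] unfolding A_def by blast
  then obtain w where w: "\<And>k. wgrad (w k) (W k)" "\<And>k. P (w k) (W k)" "\<And>k. en (\<lambda>x. w k x - u x) \<le> 1 / real (Suc k)" by metis
  have lim: "strongly w u"
    by (rule tendsto_sandwich[OF always_eventually always_eventually tendsto_const LIMSEQ_Suc[OF lim_1_over_n]])
      (use w(3) pint_nonneg in auto)
  show ?thesis by (rule that[OF w(1,2) wgrad_limit[OF w(1) u(1) W(2) lim W(3)] W(3) lim])
qed

text \<open>Friedrichs' commutator. For fixed \<open>x\<close> the derivative of the mollified
  function, with coefficients frozen at \<open>x\<close>, is compared with the mollification of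
  \<open>W\<close>, using the weak identity with the translated mollifier as test function. The
  difference has the integrand \<open>w\<close> times the divergence of (coefficients minus their
  values at \<open>x\<close>) times the mollifier: on the cube these coefficients are of order
  \<open>e\<close>, the derivative of the mollifier of order \<open>1 / e\<close>, and the
  derivative of the coefficients is bounded.\<close>

lemma mollified_bounds:
  assumes wb: "w \<in> borel_measurable borel" "W \<in> borel_measurable borel"
    and S: "compact S" "S \<subseteq> \<Omega>" "\<And>x. x \<notin> S \<Longrightarrow> w x = 0" "\<And>x. x \<notin> S \<Longrightarrow> W x = 0"
    and int: "integrable lborel w" "integrable lborel W"
    and id: "\<And>j \<psi>. \<psi> \<in> test_functions UNIV \<Longrightarrow> (LINT x|lborel. W x $ j * \<psi> x) = - (LINT x|lborel. w x * Xadj X j \<psi> x)"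
  obtains e0 B where "0 < e0" "0 \<le> B"
    "\<And>e N. 0 < e \<Longrightarrow> e \<le> e0 \<Longrightarrow> N = (LINT y|lborel. cbump e (y :: real^'n)) \<Longrightarrow>
      (\<lambda>x. 1 / N * (LINT y|lborel. cbump e (y - x) * w y)) \<in> C1c \<Omega> \<and>
      (\<forall>x. norm (Xp (\<lambda>x. 1 / N * (LINT y|lborel. cbump e (y - x) * w y)) x)
        \<le> 1 / N * (LINT y|lborel. indicator (cube e x) y * (real CARD('m) * (norm (W y) + B * \<bar>w y\<bar>))))"
proof -
  define n where "n = real CARD('n)"
  have n: "1 \<le> n" by (simp add: n_def Suc_le_eq)
  obtain e1 where e1: "0 < e1" "(\<Union>x\<in>S. cball x e1) \<subseteq> \<Omega>"
    using compact_subset_open_imp_cball_epsilon_subset[OF S(1) open_\<Omega> S(2)] by blast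
  \<comment> \<open>A point of \<open>cube e x\<close> has Euclidean distance at most
    \<open>n * e\<close> from \<open>x\<close>; with this bound on \<open>e\<close>, every cube
    meeting \<open>S\<close> has its centre in \<open>\<Omega>\<close>.\<close>
  define e0 where "e0 = e1 / n"
  have e0: "0 < e0" using e1 n by (simp add: e0_def)
  have cubeS: "x \<in> \<Omega>" if "s \<in> S" "s \<in> cube e x" "e \<le> e0" for s x e
  proof -
    have "dist s x \<le> n * e" using cube_norm[OF that(2)] by (simp add: dist_norm n_def)
    also have "\<dots> \<le> n * e0" using that(3) n by (intro mult_left_mono) auto
    also have "\<dots> = e1" using n by (simp add: e0_def)
    finally have "x \<in> cball s e1" by simp
    then show ?thesis using that(1) e1(2) by blast
  qed
  obtain L where L: "L-lipschitz_on (closure \<Omega>) X" using loc_lipschitz_compact[OF loc_lip compact_closure_\<Omega>] .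
  have L0: "0 \<le> L" by (rule lipschitz_on_nonneg[OF L])
  have c_lip: "\<bar>X y $ j $ i - X z $ j $ i\<bar> \<le> L * norm (y - z)" if "y \<in> \<Omega>" "z \<in> \<Omega>" for y z j i
    using lipschitz_onD[OF lipschitz_component[OF L, of j i], of y z] that \<Omega>_sub(1) by (auto simp: dist_norm)
  obtain L1 where L1: "0 \<le> L1" "\<And>e (y::real^'n) z. 0 < e \<Longrightarrow> \<bar>cbump e y - cbump e z\<bar> \<le> L1 / e * norm (y - z)"
    using cbump_lipschitz by blast
  \<comment> \<open>\<open>L\<close> from the derivative of the coefficients,
    \<open>L * n * e\<close> times \<open>L1 / e\<close> from the derivative of the
    mollifier.\<close>
  define B1 where "B1 = L * (1 + n * L1)"
  have B1: "0 \<le> B1" using L0 L1(1) n by (simp add: B1_def)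
  let ?b = "\<lambda>e (x :: real^'n) y. indicator (cube e x) y * (norm (W y) + n * B1 * \<bar>w y\<bar>)"
  let ?s = "\<lambda>x j \<psi> y. \<Sum>i\<in>UNIV. X x $ j $ i * partial_deriv i \<psi> y"
  have wj: "integrable lborel (\<lambda>y. W y $ j)" for j
    by (rule integrable_bounded_linear[OF bounded_linear_vec_nth int(2)])
  show ?thesis
  proof (rule that[OF e0, of "n * B1"])
    show "0 \<le> n * B1" using n B1 by simp
    fix e N assume e: "0 < e" "e \<le> e0" and N: "N = (LINT y|lborel. cbump e (y :: real^'n))"
    have N0: "0 < N"
      using cbump_integral_lower e(1) N by (metis mult_pos_pos zero_less_power less_le_trans)
    define g where "g x = (LINT y|lborel. cbump e (y - x) * w y)" for x
    have ct: "cbump e \<in> test_functions (UNIV :: (real^'n) set)" by (rule cbump_test[OF e(1)])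
    note conv = convolution_C1[OF ct int(1), folded g_def]
    have gC: "Ck 1 g" using conv(1) by (simp add: g_def[abs_def])
    have gp: "partial_deriv i g x = - (LINT y|lborel. partial_deriv i (cbump e) (y - x) * w y)" for i x
      using conv(2) by (simp add: g_def[abs_def])
    have supp0: "cbump e (y - x) = 0" "partial_deriv i (cbump e) (y - x) = 0" if "y \<notin> cube e x" for x y :: "real^'n" and i
    proof -
      have nc: "y - x \<notin> cube e 0" using that cube_translate by blast
      then show "cbump e (y - x) = 0" using cbump_nonzero[OF e(1)] by blast
      have "closure {z. cbump e z \<noteq> 0} \<subseteq> cube e (0 :: real^'n)"
        using cbump_nonzero[OF e(1)] by (intro closure_minimal) (auto simp: cube_def)
      then show "partial_deriv i (cbump e) (y - x) = 0" using nc by (intro partial_deriv_outside_support) blast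
    qed
    let ?u = "\<lambda>x. 1 / N * (LINT y|lborel. cbump e (y - x) * w y)"
    have ug: "?u = (\<lambda>x. 1 / N * g x)" by (simp add: g_def)
    have uC: "Ck 1 ?u" unfolding ug by (intro Ck_mult Ck_const gC)
    have supp: "compactly_supported \<Omega> ?u"
    proof (rule compactly_supportedI)
      show "compact {a + b |a b. a \<in> S \<and> b \<in> cube e 0}" by (intro compact_sums S(1)) (simp add: cube_def)
      show "{a + b |a b. a \<in> S \<and> b \<in> cube e 0} \<subseteq> \<Omega>"
        using cubeS[OF _ _ e(2)] by (auto simp: cube_iff)
      fix x assume x: "x \<notin> {a + b |a b. a \<in> S \<and> b \<in> cube e 0}"
      have "cbump e (y - x) * w y = 0" for y
      proof (rule ccontr)
        assume "cbump e (y - x) * w y \<noteq> 0"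
        then have "y \<in> S" "y \<in> cube e x" using S(3)[of y] supp0(1)[of y x] by auto
        then have "x = y + (x - y)" "x - y \<in> cube e 0" by (auto simp: cube_iff abs_minus_commute)
        then show False using x \<open>y \<in> S\<close> by blast
      qed
      then have "(\<lambda>y. cbump e (y - x) * w y) = (\<lambda>_. 0)" by blast
      then show "?u x = 0" by simp
    qed
    have XPu: "Xp ?u x $ j = 1 / N * (\<Sum>i\<in>UNIV. X x $ j $ i * partial_deriv i g x)" for x j
    proof -
      have "partial_deriv i ?u x = 1 / N * partial_deriv i g x" for i
        unfolding ug using partial_deriv_mult(2)[where i = i and u = "\<lambda>_. 1 / N" and x = x and v = g] Ck_Suc_partially_differentiable[OF gC[unfolded One_nat_def], where i = i and x = x]
        by simp
      then show ?thesis by (simp add: X_pointwise_def sum_distrib_left ac_simps)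
    qed
    have main: "\<bar>\<Sum>i\<in>UNIV. X x $ j $ i * partial_deriv i g x\<bar> \<le> (LINT y|lborel. ?b e x y)" for x j
    \<comment> \<open>If the cube misses \<open>S\<close>, everything vanishes. Otherwise
      \<open>x\<close> lies in \<open>\<Omega>\<close>, where the Lipschitz constant
      \<open>L\<close> of the coefficients is valid.\<close>
    proof (cases "cube e x \<inter> S = {}")
      case True
      have "partial_deriv i (cbump e) (y - x) * w y = 0" for y i
        using True supp0(2)[of y x i] S(3)[of y] by (cases "y \<in> cube e x") auto
      then have "(\<lambda>y. partial_deriv i (cbump e) (y - x) * w y) = (\<lambda>_. 0)" for i by blast
      then have "partial_deriv i g x = 0" for i by (simp add: gp)
      then show ?thesis using B1 n by (auto intro!: integral_nonneg_AE)
    next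
      case False
      then obtain s where s: "s \<in> S" "s \<in> cube e x" by blast
      have x: "x \<in> \<Omega>" by (rule cubeS[OF s e(2)])
      define \<psi> where "\<psi> y = cbump e (y - x)" for y
      have \<psi>t: "\<psi> \<in> test_functions UNIV" unfolding \<psi>_def using cbump_translate_test[OF e(1)] .
      have \<psi>p: "partial_deriv i \<psi> y = partial_deriv i (cbump e) (y - x)" for i y
        unfolding \<psi>_def[abs_def] by (rule partial_deriv_translate)
      have \<psi>C: "Ck k \<psi>" for k by (rule test_functionD(1)[OF \<psi>t])
      obtain Bp where Bp: "\<And>i y. \<bar>partial_deriv i \<psi> y\<bar> \<le> Bp"
      proof -
        have "\<forall>i. \<exists>B\<ge>0. \<forall>y. \<bar>partial_deriv i \<psi> y\<bar> \<le> B" using test_functionD(5)[OF partial_deriv_test_function[OF \<psi>t]] by blast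
        then obtain b where b: "\<And>i y. \<bar>partial_deriv i \<psi> y\<bar> \<le> b i" "\<And>i. 0 \<le> b i" by metis
        have "\<bar>partial_deriv i \<psi> y\<bar> \<le> (\<Sum>i\<in>UNIV. b i)" for i y
          using b(1)[of i y] member_le_sum[of i UNIV b] b(2) by fastforce
        then show ?thesis by (rule that)
      qed
      have Ipart: "integrable lborel (\<lambda>y. partial_deriv i \<psi> y * w y)" for i
        by (rule Bochner_Integration.integrable_bound[OF integrable_mult_right[OF int(1), of Bp]])
          (use wb(1) test_functionD(3)[OF partial_deriv_test_function[OF \<psi>t]] order_trans[OF Bp abs_ge_self] in \<open>auto simp: abs_mult intro!: AE_I2 mult_right_mono\<close>)
      obtain Ba where Ba: "0 \<le> Ba" "\<And>y. \<bar>Xadj X j \<psi> y\<bar> \<le> Ba" using Xadj_test(3)[OF \<psi>t] by blast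
      have Iadj: "integrable lborel (\<lambda>y. w y * Xadj X j \<psi> y)"
        by (rule Bochner_Integration.integrable_bound[OF integrable_mult_right[OF int(1), of Ba]])
          (use wb(1) Xadj_test(1)[OF \<psi>t] Ba in \<open>auto simp: abs_mult mult.commute[of "\<bar>w _\<bar>"] intro!: AE_I2 mult_right_mono\<close>)
      have \<psi>b: "\<bar>\<psi> y\<bar> \<le> 1" for y using cbump_bounds[of e "y - x"] by (simp add: \<psi>_def)
      have IW: "integrable lborel (\<lambda>y. W y $ j * \<psi> y)"
        by (rule Bochner_Integration.integrable_bound[OF wj[of j]])
          (use wj[of j] test_functionD(3)[OF \<psi>t] \<psi>b in \<open>auto simp: abs_mult mult_left_le intro!: AE_I2\<close>)
      \<comment> \<open>The commutator: adjoint of the true vector field minus the one with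
        coefficients frozen at \<open>x\<close>.\<close>
      define E where "E y = w y * (Xadj X j \<psi> y - ?s x j \<psi> y)" for y
      have IE1: "integrable lborel (\<lambda>y. w y * ?s x j \<psi> y)"
      proof -
        have "integrable lborel (\<lambda>y. \<Sum>i\<in>UNIV. X x $ j $ i * (partial_deriv i \<psi> y * w y))" using Ipart by simp
        then show ?thesis by (simp add: sum_distrib_left ac_simps)
      qed
      have IE: "integrable lborel E"
        unfolding E_def right_diff_distrib by (rule Bochner_Integration.integrable_diff[OF Iadj IE1])
      have "(\<Sum>i\<in>UNIV. X x $ j $ i * partial_deriv i g x) = - (LINT y|lborel. w y * ?s x j \<psi> y)"
      proof -
        have "(LINT y|lborel. w y * ?s x j \<psi> y) = (LINT y|lborel. (\<Sum>i\<in>UNIV. X x $ j $ i * (partial_deriv i \<psi> y * w y)))"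
          by (simp add: sum_distrib_left ac_simps)
        also have "\<dots> = (\<Sum>i\<in>UNIV. X x $ j $ i * (LINT y|lborel. partial_deriv i \<psi> y * w y))"
          using Ipart by (simp add: Bochner_Integration.integral_sum)
        finally show ?thesis by (simp add: gp \<psi>p sum_negf)
      qed
      also have "\<dots> = (LINT y|lborel. W y $ j * \<psi> y) + (LINT y|lborel. E y)"
        unfolding E_def right_diff_distrib using Iadj IE1 id[OF \<psi>t, of j] by simp
      also have "\<dots> = (LINT y|lborel. W y $ j * \<psi> y + E y)" using IW IE by simp
      finally have eq: "(\<Sum>i\<in>UNIV. X x $ j $ i * partial_deriv i g x) = (LINT y|lborel. W y $ j * \<psi> y + E y)" .
      have cube_m: "cube e x \<in> sets lborel" by (simp add: cube_def)
      obtain L\<psi> where L\<psi>: "L\<psi>-lipschitz_on UNIV \<psi>" using test_functionD(4)[OF \<psi>t] by blast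
      have "AE y in lborel. partially_differentiable i (\<lambda>y. X y $ j $ i * \<psi> y) y" for i
        by (rule coefficient_mult_lipschitz[OF loc_lip L\<psi> test_functionD(2)[OF \<psi>t], where j = j and i = i])
          (rule lipschitz_AE_partially_differentiable)
      then have "AE y in lborel. \<forall>i. partially_differentiable i (\<lambda>y. X y $ j $ i * \<psi> y) y" by (simp add: AE_all_countable)
      then have Ebd: "AE y in lborel. \<bar>E y\<bar> \<le> indicator (cube e x) y * (n * B1 * \<bar>w y\<bar>)"
      proof eventually_elim
        case (elim y)
        show ?case
        proof (cases "y \<in> S \<and> y \<in> cube e x")
          case False
          then consider "y \<notin> S" | "y \<notin> cube e x" by blast
          then have "E y = 0"
          proof cases
            case 2
            have cl: "closure {z. \<psi> z \<noteq> 0} \<subseteq> cube e x"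
              using supp0(1)[of _ x] by (intro closure_minimal) (auto simp: cube_def \<psi>_def)
            then have "Xadj X j \<psi> y = 0" using 2 by (intro Xadj_outside) blast
            then show ?thesis using supp0(2)[OF 2] by (simp add: E_def \<psi>p)
          qed (simp add: E_def S(3))
          then show ?thesis using B1 n by simp
        next
          case True
          then have y: "y \<in> \<Omega>" "y \<in> cube e x" using S(2) by auto
          obtain d where d: "0 < d" "ball y d \<subseteq> \<Omega>" using open_\<Omega> y(1) openE by blast
          have t: "\<bar>partial_deriv i (\<lambda>y. X y $ j $ i * \<psi> y) y - X x $ j $ i * partial_deriv i \<psi> y\<bar> \<le> B1" for i
          proof -
            note lc = partial_deriv_lincomb[OF elim[rule_format, of i] Ck_Suc_partially_differentiable[OF \<psi>C, where i = i and x = y], of "X x $ j $ i"]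
            have "\<bar>partial_deriv i (\<lambda>y. X y $ j $ i * \<psi> y - X x $ j $ i * \<psi> y) y\<bar> \<le> B1"
            proof (rule partial_deriv_abs_le[OF lc(1) _ d(1)])
              fix y' assume "y' \<in> ball y d"
              then have y': "y' \<in> \<Omega>" using d(2) by blast
              have "\<bar>(X y' $ j $ i * \<psi> y' - X x $ j $ i * \<psi> y') - (X y $ j $ i * \<psi> y - X x $ j $ i * \<psi> y)\<bar>
                 = \<bar>(X y' $ j $ i - X y $ j $ i) * \<psi> y' + (X y $ j $ i - X x $ j $ i) * (\<psi> y' - \<psi> y)\<bar>"
                by (simp add: algebra_simps)
              also have "\<dots> \<le> \<bar>X y' $ j $ i - X y $ j $ i\<bar> * \<bar>\<psi> y'\<bar> + \<bar>X y $ j $ i - X x $ j $ i\<bar> * \<bar>\<psi> y' - \<psi> y\<bar>"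
                by (rule order_trans[OF abs_triangle_ineq]) (simp add: abs_mult)
              also have "\<dots> \<le> (L * norm (y' - y)) * 1 + (L * (n * e)) * (L1 / e * norm (y' - y))"
              proof (intro add_mono mult_mono)
                show "\<bar>X y' $ j $ i - X y $ j $ i\<bar> \<le> L * norm (y' - y)" by (rule c_lip[OF y' y(1)])
                show "\<bar>\<psi> y'\<bar> \<le> 1" by (rule \<psi>b)
                have "\<bar>X y $ j $ i - X x $ j $ i\<bar> \<le> L * norm (y - x)" by (rule c_lip[OF y(1) x])
                also have "\<dots> \<le> L * (n * e)" using cube_norm[OF y(2)] L0 by (intro mult_left_mono) (auto simp: n_def)
                finally show "\<bar>X y $ j $ i - X x $ j $ i\<bar> \<le> L * (n * e)" .
                show "\<bar>\<psi> y' - \<psi> y\<bar> \<le> L1 / e * norm (y' - y)" using L1(2)[OF e(1), of "y' - x" "y - x"] by (simp add: \<psi>_def)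
              qed (use L0 n e in auto)
              also have "\<dots> = B1 * norm (y' - y)" using e by (simp add: B1_def field_simps)
              finally show "\<bar>(X y' $ j $ i * \<psi> y' - X x $ j $ i * \<psi> y') - (X y $ j $ i * \<psi> y - X x $ j $ i * \<psi> y)\<bar> \<le> B1 * norm (y' - y)" .
            qed
            then show ?thesis by (simp only: lc(2))
          qed
          have "\<bar>Xadj X j \<psi> y - ?s x j \<psi> y\<bar>
             = \<bar>\<Sum>i\<in>UNIV. partial_deriv i (\<lambda>y. X y $ j $ i * \<psi> y) y - X x $ j $ i * partial_deriv i \<psi> y\<bar>"
            by (simp add: Xadj_def sum_subtractf)
          also have "\<dots> \<le> (\<Sum>i\<in>(UNIV::'n set). B1)" by (rule order_trans[OF sum_abs sum_mono[OF t]])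
          also have "\<dots> = n * B1" by (simp add: n_def)
          finally have "\<bar>E y\<bar> \<le> \<bar>w y\<bar> * (n * B1)" by (auto simp: E_def abs_mult intro: mult_left_mono)
          then show ?thesis using True by (simp add: ac_simps)
        qed
      qed
      have Ir: "integrable lborel (\<lambda>y. ?b e x y)"
        using integrable_mult_indicator[OF cube_m, of "\<lambda>y. norm (W y) + n * B1 * \<bar>w y\<bar>"] int by simp
      have "\<bar>LINT y|lborel. W y $ j * \<psi> y + E y\<bar> \<le> (LINT y|lborel. ?b e x y)"
      proof (rule order_trans[OF integral_abs_bound integral_mono_AE])
        show "integrable lborel (\<lambda>y. \<bar>W y $ j * \<psi> y + E y\<bar>)" using IW IE by simp
        show "AE y in lborel. \<bar>W y $ j * \<psi> y + E y\<bar> \<le> ?b e x y"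
          using Ebd
        proof eventually_elim
          case (elim y)
          have "\<bar>W y $ j * \<psi> y\<bar> \<le> indicator (cube e x) y * norm (W y)"
          proof (cases "y \<in> cube e x")
            case True
            have "\<bar>W y $ j\<bar> * \<bar>\<psi> y\<bar> \<le> norm (W y) * 1"
              using cbump_bounds[of e "y - x"] by (intro mult_mono component_le_norm_cart) (auto simp: \<psi>_def)
            then show ?thesis using True by (simp add: abs_mult)
          qed (simp add: \<psi>_def supp0)
          then show ?case using elim by (simp add: distrib_left)
        qed
      qed (rule Ir)
      then show ?thesis by (simp only: eq)
    qed
    have "norm (Xp ?u x) \<le> 1 / N * (LINT y|lborel. indicator (cube e x) y * (real CARD('m) * (norm (W y) + n * B1 * \<bar>w y\<bar>)))" for x
    proof -
      have "norm (Xp ?u x) \<le> (\<Sum>j\<in>UNIV. \<bar>Xp ?u x $ j\<bar>)" by (rule norm_le_l1_cart)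
      also have "\<dots> \<le> (\<Sum>j\<in>(UNIV::'m set). 1 / N * (LINT y|lborel. ?b e x y))"
        unfolding XPu using N0 main[of x] by (intro sum_mono) (simp add: abs_mult divide_right_mono)
      also have "\<dots> = 1 / N * (real CARD('m) * (LINT y|lborel. ?b e x y))" by simp
      also have "real CARD('m) * (LINT y|lborel. ?b e x y)
          = (LINT y|lborel. real CARD('m) * (?b e x y))"
        by (rule integral_mult_right_zero[symmetric])
      finally show ?thesis by (simp add: ac_simps)
    qed
    then show "?u \<in> C1c \<Omega> \<and> (\<forall>x. norm (Xp ?u x)
        \<le> 1 / N * (LINT y|lborel. indicator (cube e x) y * (real CARD('m) * (norm (W y) + n * B1 * \<bar>w y\<bar>))))"
      using uC supp by (simp add: C1c_def)
  qed
qed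

end

context X_compact
begin

text \<open>The mollified functions lie in \<open>C1c\<close> and are bounded together with their
  gradients, so a subsequence converges in L^p; pairing with test functions identifies the limit as
  \<open>w\<close>. Since \<open>C1c\<close> is stable under midpoints, there are also
  \<open>C1c\<close> functions tending to \<open>w\<close> with strongly convergent
  gradients.\<close>

lemma W1p0_of_global_gradient:
  assumes wb: "w \<in> borel_measurable borel" "W \<in> borel_measurable borel"
    and S: "compact S" "S \<subseteq> \<Omega>" "\<And>x. x \<notin> S \<Longrightarrow> w x = 0" "\<And>x. x \<notin> S \<Longrightarrow> W x = 0"
    and g: "wgrad w W"
    and id: "\<And>j \<psi>. \<psi> \<in> test_functions UNIV \<Longrightarrow> (LINT x|lborel. W x $ j * \<psi> x) = - (LINT x|lborel. w x * Xadj X j \<psi> x)"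
  shows "w \<in> W0"
proof -
  let ?c = "\<lambda>e \<psi> (y :: real^'n). LINT x|lborel. cbump e (y - x) * \<psi> x"
  let ?r = "\<lambda>N e \<psi> y. w y * ?c e \<psi> y - N e * (w y * \<psi> y)"
  have out: "\<And>x. x \<notin> \<Omega> \<Longrightarrow> w x = 0" "\<And>x. x \<notin> \<Omega> \<Longrightarrow> W x = 0" using S by blast+
  have int: "integrable lborel w" "integrable lborel W"
    using LpV_imp_integrable[OF wgradD(1)[OF g] finite_M p_bounds(3)] LpV_imp_integrable[OF wgradD(2)[OF g] finite_M p_bounds(3)]
      lebesgue_on_zero_outside(1)[OF sets_\<Omega> out(1)] lebesgue_on_zero_outside(1)[OF sets_\<Omega> out(2)] wb
    by (simp_all add: integrable_completion)
  have Lp: "w \<in> LpV lborel p" "W \<in> LpV lborel p"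
    using wgradD(1,2)[OF g] zero_outside(1)[OF out(1)] zero_outside(1)[OF out(2)] wb
    by (simp_all add: LpV_def integrable_completion)
  obtain e0 B where e0: "0 < e0" and B: "0 \<le> B"
    and moll: "\<And>e N. 0 < e \<Longrightarrow> e \<le> e0 \<Longrightarrow> N = (LINT y|lborel. cbump e (y :: real^'n)) \<Longrightarrow>
      (\<lambda>x. 1 / N * (LINT y|lborel. cbump e (y - x) * w y)) \<in> C1c \<Omega> \<and>
      (\<forall>x. norm (Xp (\<lambda>x. 1 / N * (LINT y|lborel. cbump e (y - x) * w y)) x)
        \<le> 1 / N * (LINT y|lborel. indicator (cube e x) y * (real CARD('m) * (norm (W y) + B * \<bar>w y\<bar>))))"
    by (rule mollified_bounds[OF wb S int id]) (assumption | rule that)+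
  obtain \<kappa> where \<kappa>: "0 < \<kappa>" "\<And>e. 0 < e \<Longrightarrow> \<kappa> * e ^ CARD('n) \<le> (LINT y|lborel. cbump e (y :: real^'n))"
    using cbump_integral_lower by blast
  define N where "N e = (LINT y|lborel. cbump e (y :: real^'n))" for e
  define mw where "mw e x = 1 / N e * (LINT y|lborel. cbump e (y - x) * w y)" for e x
  have N0: "0 < N e" if "0 < e" for e
  proof -
    have "0 < \<kappa> * e ^ CARD('n)" using \<kappa>(1) that by simp
    then show ?thesis using \<kappa>(2)[OF that] unfolding N_def by linarith
  qed
  have mwC: "mw e \<in> C1c \<Omega>" if "0 < e" "e \<le> e0" for e
    using moll[OF that N_def] by (simp add: mw_def[abs_def])
  \<comment> \<open>The mass \<open>N e\<close> is at least \<open>\<kappa> * e ^ CARD('n)\<close>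
    and the cube has volume \<open>(2 * e) ^ CARD('n)\<close>, so the powers of \<open>e\<close>
    cancel and the Schur constant is independent of the scale.\<close>
  define A where "A = (2 ^ CARD('n) / \<kappa>) powr p"
  have A_le: "(1 / N e * (2 * e) ^ CARD('n)) powr p \<le> A" if e: "0 < e" for e
  proof -
    have "1 / N e * (2 * e) ^ CARD('n) \<le> 1 / (\<kappa> * e ^ CARD('n)) * (2 * e) ^ CARD('n)"
    proof (rule mult_right_mono)
      have "0 < \<kappa> * e ^ CARD('n)" using \<kappa>(1) e by simp
      moreover have "\<kappa> * e ^ CARD('n) \<le> N e" using \<kappa>(2)[OF e] by (simp only: N_def)
      ultimately show "1 / N e \<le> 1 / (\<kappa> * e ^ CARD('n))" by (intro frac_le) simp_all
      show "0 \<le> (2 * e) ^ CARD('n)" using e by simp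
    qed
    also have "\<dots> = 2 ^ CARD('n) / \<kappa>" using \<kappa>(1) e by (simp add: power_mult_distrib)
    finally show ?thesis unfolding A_def using N0[OF e] e p_bounds by (intro powr_mono2) auto
  qed
  let ?v1 = "\<lambda>y. \<bar>w y\<bar>"
  let ?v2 = "\<lambda>y. real CARD('m) * (norm (W y) + B * \<bar>w y\<bar>)"
  have v1: "?v1 \<in> LpV lborel p" using Lp(1) by (auto simp: LpV_def)
  have nW: "(\<lambda>y. norm (W y)) \<in> LpV lborel p" using Lp(2) by (auto simp: LpV_def)
  have v2: "?v2 \<in> LpV lborel p"
    using LpV_scaleR[OF LpV_add[OF nW LpV_scaleR[OF v1, of B] p_bounds(2)], of "real CARD('m)"] by simp
  define K where "K = max (A * pint lborel p ?v1) (A * pint lborel p ?v2)"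
  have mwb: "en (mw e) \<le> K" "en (Xp (mw e)) \<le> K" if e: "0 < e" "e \<le> e0" for e
  proof -
    note mwg = C1c_wgrad[OF mwC[OF e]]
    have "en (mw e) \<le> (1 / N e * (2 * e) ^ CARD('n)) powr p * pint lborel p ?v1"
    proof (rule pint_le_of_cube_average[OF e(1) _ _ _ _ v1 wgradD(1)[OF mwg]])
      show "0 < 1 / N e" using N0[OF e(1)] by simp
      show "integrable lborel ?v1" using int by simp
      fix x :: "real^'n"
      have I: "integrable lborel (\<lambda>y. indicator (cube e x) y * \<bar>w y\<bar>)"
        using integrable_mult_indicator[of "cube e x" lborel ?v1] int by (simp add: cube_def)
      obtain B' where "\<And>x. \<bar>cbump e (x :: real^'n)\<bar> \<le> B'" using test_functionD(5)[OF cbump_test[OF e(1)]] by blast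
      from integrable_translated_mult[OF Ck_continuous[OF test_functionD(1)[OF cbump_test[OF e(1)]]] this int(1)]
      have J: "integrable lborel (\<lambda>y. cbump e (y - x) * w y)" .
      have "\<bar>LINT y|lborel. cbump e (y - x) * w y\<bar> \<le> (LINT y|lborel. indicator (cube e x) y * \<bar>w y\<bar>)"
      proof (rule order_trans[OF integral_abs_bound integral_mono])
        show "\<bar>cbump e (y - x) * w y\<bar> \<le> indicator (cube e x) y * \<bar>w y\<bar>" for y
        proof (cases "y \<in> cube e x")
          case True
          then show ?thesis using cbump_bounds[of e "y - x"] by (simp add: abs_mult mult_left_le_one_le)
        next
          case False
          then have "cbump e (y - x) = 0" using cbump_nonzero[OF e(1), of "y - x"] cube_translate[of y e x] by blast
          then show ?thesis by simp
        qed
      qed (use I J in auto)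
      then show "norm (mw e x) \<le> 1 / N e * (LINT y|lborel. indicator (cube e x) y * \<bar>w y\<bar>)"
        using N0[OF e(1)] by (simp add: mw_def abs_mult divide_right_mono)
    qed (use wb in auto)
    also have "\<dots> \<le> A * pint lborel p ?v1" by (intro mult_right_mono A_le e pint_nonneg)
    finally show "en (mw e) \<le> K" by (simp add: K_def)
    have "en (Xp (mw e)) \<le> (1 / N e * (2 * e) ^ CARD('n)) powr p * pint lborel p ?v2"
    proof (rule pint_le_of_cube_average[OF e(1) _ _ _ _ v2 wgradD(2)[OF mwg]])
      show "0 < 1 / N e" using N0[OF e(1)] by simp
      show "integrable lborel ?v2" using int by simp
      show "norm (Xp (mw e) x) \<le> 1 / N e * (LINT y|lborel. indicator (cube e x) y * ?v2 y)" for x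
        using moll[OF e N_def] by (simp add: mw_def[abs_def])
    qed (use wb B in auto)
    also have "\<dots> \<le> A * pint lborel p ?v2" by (intro mult_right_mono A_le e pint_nonneg)
    finally show "en (Xp (mw e)) \<le> K" by (simp add: K_def)
  qed
  define \<epsilon> where "\<epsilon> k = e0 / real (Suc k)" for k
  have \<epsilon>: "0 < \<epsilon> k" "\<epsilon> k \<le> e0" for k using e0 by (auto simp: \<epsilon>_def divide_le_eq mult_le_cancel_left1)
  have \<epsilon>0: "\<epsilon> \<longlonglongrightarrow> 0"
  proof -
    have "(\<lambda>k. e0 * (1 / real (Suc k))) \<longlonglongrightarrow> e0 * 0" by (intro tendsto_intros LIMSEQ_Suc[OF lim_1_over_n])
    then show ?thesis by (simp add: \<epsilon>_def[abs_def])
  qed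
  obtain r u where r: "strict_mono r" and u: "u \<in> LpV M p" and conv: "strongly (\<lambda>k. mw (\<epsilon> (r k))) u"
    by (rule C1c_compact[OF mwC[OF \<epsilon>] mwb(1)[OF \<epsilon>] mwb(2)[OF \<epsilon>]]) (rule that)
  \<comment> \<open>Fubini moves the mollifier from \<open>w\<close> to \<open>\<psi>\<close>. As
    \<open>\<psi>\<close> is Lipschitz, its mollification differs from it by a multiple of
    \<open>e\<close>, so the pairings with \<open>mw e\<close> converge to the pairing with
    \<open>w\<close>.\<close>
  have weak: "(LINT x|M. u x * \<psi> x) = (LINT x|M. w x * \<psi> x)" if \<psi>: "\<psi> \<in> test_functions \<Omega>" for \<psi>
  proof -
    obtain Bp where Bp: "0 \<le> Bp" "\<And>x. \<bar>\<psi> x\<bar> \<le> Bp" using test_functionD(5)[OF \<psi>] by blast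
    obtain L where L: "L-lipschitz_on UNIV \<psi>" using test_functionD(4)[OF \<psi>] by blast
    have \<psi>m[measurable]: "\<psi> \<in> borel_measurable borel" by (rule test_functionD(3)[OF \<psi>])
    have \<psi>0: "\<psi> x = 0" if "x \<notin> \<Omega>" for x by (rule compactly_supported_zero[OF test_functionD(2)[OF \<psi>] that])
    have \<psi>i: "integrable lborel \<psi>"
      by (rule integrable_bounded_compactly_supported[OF \<psi>m bounded_\<Omega> \<psi>0 Bp(2)])
    have toM: "(LINT x|M. f x * \<psi> x) = (LINT x|lborel. f x * \<psi> x)" if "f \<in> borel_measurable borel" for f :: "real^'n \<Rightarrow> real"
    proof -
      have "(LINT x|M. f x * \<psi> x) = (LINT x|lebesgue. f x * \<psi> x)"
        by (rule lebesgue_on_zero_outside(2)[OF sets_\<Omega>]) (simp add: \<psi>0)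
      also have "\<dots> = (LINT x|lborel. f x * \<psi> x)" using that by (intro integral_completion) simp
      finally show ?thesis .
    qed
    define C where "C = L * real CARD('n) * (LINT y|lborel. \<bar>w y\<bar>)"
    have est: "\<bar>(LINT x|M. mw e x * \<psi> x) - (LINT x|M. w x * \<psi> x)\<bar> \<le> C * e" if e: "0 < e" "e \<le> e0" for e
    proof -
      have cbm: "cbump e \<in> borel_measurable (borel :: (real^'n) measure)" by (rule test_functionD(3)[OF cbump_test[OF e(1)]])
      have cbc: "continuous_on UNIV (cbump e :: real^'n \<Rightarrow> real)" by (rule Ck_continuous[OF test_functionD(1)[OF cbump_test[OF e(1)]]])
      have cb1: "\<bar>cbump e z\<bar> \<le> 1" for z :: "real^'n" using cbump_bounds[of e z] by simp
      have mwm: "mw e \<in> borel_measurable borel" using C1cD(3)[OF mwC[OF e]] .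
      let ?f = "\<lambda>(x :: real^'n, y :: real^'n). cbump e (y - x) * w y * \<psi> x"
      have fm: "?f \<in> borel_measurable (lborel \<Otimes>\<^sub>M lborel)"
      proof -
        have "(\<lambda>z :: (real^'n) \<times> (real^'n). cbump e (snd z - fst z)) \<in> borel_measurable borel"
          by (intro borel_measurable_continuous_onI continuous_on_compose2[OF cbc]) (auto intro!: continuous_intros)
        then have "(\<lambda>z :: (real^'n) \<times> (real^'n). cbump e (snd z - fst z)) \<in> borel_measurable (lborel \<Otimes>\<^sub>M lborel)"
          by (simp add: borel_prod[symmetric] cong: measurable_cong_sets sets_pair_measure_cong)
        then show ?thesis using wb(1) \<psi>m unfolding case_prod_unfold by measurable
      qed
      have Iy: "integrable lborel (\<lambda>y. cbump e (y - x) * w y)" for x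
        by (rule integrable_translated_mult[OF cbc cb1 int(1)])
      have fI: "integrable (lborel \<Otimes>\<^sub>M lborel) ?f"
      proof (rule lborel_pair.Fubini_integrable[OF fm])
        show "AE x in lborel. integrable lborel (\<lambda>y. ?f (x, y))" using Iy by (intro AE_I2) simp
        have le: "(LINT y|lborel. norm (?f (x, y))) \<le> (LINT y|lborel. \<bar>w y\<bar>) * \<bar>\<psi> x\<bar>" for x
        proof -
          have "(LINT y|lborel. norm (?f (x, y))) \<le> (LINT y|lborel. \<bar>w y\<bar> * \<bar>\<psi> x\<bar>)"
          proof (rule integral_mono)
            show "integrable lborel (\<lambda>y. norm (?f (x, y)))" using Iy[of x] by simp
            show "integrable lborel (\<lambda>y. \<bar>w y\<bar> * \<bar>\<psi> x\<bar>)" using int by simp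
            show "norm (?f (x, y)) \<le> \<bar>w y\<bar> * \<bar>\<psi> x\<bar>" for y
              using mult_left_le_one_le[of "\<bar>w y\<bar> * \<bar>\<psi> x\<bar>" "\<bar>cbump e (y - x)\<bar>"] cb1 by (simp add: abs_mult mult.assoc)
          qed
          then show ?thesis by simp
        qed
        show "integrable lborel (\<lambda>x. LINT y|lborel. norm (?f (x, y)))"
        proof (rule Bochner_Integration.integrable_bound)
          show "integrable lborel (\<lambda>x. (LINT y|lborel. \<bar>w y\<bar>) * \<bar>\<psi> x\<bar>)" using \<psi>i by simp
          show "(\<lambda>x. LINT y|lborel. norm (?f (x, y))) \<in> borel_measurable lborel"
            by (rule lborel.borel_measurable_lebesgue_integral) (use fm in measurable)
          show "AE x in lborel. norm (LINT y|lborel. norm (?f (x, y))) \<le> norm ((LINT y|lborel. \<bar>w y\<bar>) * \<bar>\<psi> x\<bar>)"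
          proof (intro AE_I2)
            fix x
            have "0 \<le> (LINT y|lborel. norm (?f (x, y)))" "0 \<le> (LINT y|lborel. \<bar>w y\<bar>)" by (auto intro!: integral_nonneg_AE)
            then show "norm (LINT y|lborel. norm (?f (x, y))) \<le> norm ((LINT y|lborel. \<bar>w y\<bar>) * \<bar>\<psi> x\<bar>)"
              using le[of x] by (simp only: real_norm_def abs_mult abs_of_nonneg abs_abs)
          qed
        qed
      qed
      have inner: "\<bar>?c e \<psi> y - N e * \<psi> y\<bar> \<le> N e * (L * (real CARD('n) * e))" for y
      proof -
        have c1: "integrable lborel (\<lambda>x. cbump e (y - x))"
        proof -
          have "integrable lborel (\<lambda>x. cbump e (x - y) * 1)"
          proof (rule integrable_bounded_compactly_supported[where K = "cube e y" and B = 1])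
            show "(\<lambda>x. cbump e (x - y) * 1) \<in> borel_measurable borel" using cbm by measurable
            show "\<bar>cbump e (x - y) * 1\<bar> \<le> 1" for x using cb1 by simp
            show "cbump e (x - y) * 1 = 0" if "x \<notin> cube e y" for x
              using cbump_nonzero[OF e(1), of "x - y"] cube_translate[of x e y] that by auto
          qed (simp add: cube_def)
          moreover have "cbump e (y - x) = cbump e (x - y)" for x using cbump_uminus[of e "x - y"] by simp
          ultimately show ?thesis by simp
        qed
        have c2: "integrable lborel (\<lambda>x. cbump e (y - x) * \<psi> x)"
          by (rule Bochner_Integration.integrable_bound[OF integrable_mult_right[OF c1, of Bp]])
            (use c1 \<psi>m Bp cbump_bounds[of e] in \<open>auto simp: abs_mult mult.commute[of Bp] intro!: AE_I2 mult_left_mono\<close>)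
        have Ne: "N e = (LINT x|lborel. cbump e (y - x))" by (simp add: N_def integral_cbump_translate(2))
        have "?c e \<psi> y - N e * \<psi> y = (LINT x|lborel. cbump e (y - x) * \<psi> x - cbump e (y - x) * \<psi> y)"
          unfolding Ne using c1 c2 by simp
        also have "\<bar>\<dots>\<bar> \<le> (LINT x|lborel. cbump e (y - x) * (L * (real CARD('n) * e)))"
        proof (rule order_trans[OF integral_abs_bound integral_mono])
          show "integrable lborel (\<lambda>x. \<bar>cbump e (y - x) * \<psi> x - cbump e (y - x) * \<psi> y\<bar>)" using c1 c2 by simp
          show "integrable lborel (\<lambda>x. cbump e (y - x) * (L * (real CARD('n) * e)))" using c1 by simp
          fix x
          show "\<bar>cbump e (y - x) * \<psi> x - cbump e (y - x) * \<psi> y\<bar> \<le> cbump e (y - x) * (L * (real CARD('n) * e))"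
          proof (cases "cbump e (y - x) = 0")
            case False
            then have "y \<in> cube e x" using cbump_nonzero[OF e(1)] cube_translate by blast
            then have n: "norm (y - x) \<le> real CARD('n) * e" by (rule cube_norm)
            have "\<bar>\<psi> x - \<psi> y\<bar> \<le> L * norm (y - x)" using lipschitz_onD[OF L, of y x] by (simp add: dist_norm abs_minus_commute)
            also have "\<dots> \<le> L * (real CARD('n) * e)" by (rule mult_left_mono[OF n lipschitz_on_nonneg[OF L]])
            finally have "\<bar>cbump e (y - x)\<bar> * \<bar>\<psi> x - \<psi> y\<bar> \<le> cbump e (y - x) * (L * (real CARD('n) * e))"
              using cbump_bounds[of e "y - x"] by (simp add: mult_left_mono)
            then show ?thesis by (simp add: abs_mult[symmetric] right_diff_distrib)
          qed simp
        qed
        finally show ?thesis unfolding Ne by simp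
      qed
      have ww: "integrable lborel (\<lambda>y. w y * \<psi> y)"
        by (rule Bochner_Integration.integrable_bound[OF integrable_mult_right[OF int(1), of Bp]])
          (use int \<psi>m Bp in \<open>auto simp: abs_mult mult.commute[of Bp] intro!: AE_I2 mult_left_mono\<close>)
      have I2: "integrable lborel (\<lambda>y. w y * ?c e \<psi> y)"
      proof -
        have "integrable lborel (\<lambda>y. LINT x|lborel. ?f (x, y))" using lborel_pair.integrable_snd[of "\<lambda>x y. ?f (x, y)"] fI by (simp add: case_prod_unfold)
        moreover have "(LINT x|lborel. ?f (x, y)) = w y * ?c e \<psi> y" for y
        proof -
          have "(LINT x|lborel. ?f (x, y)) = (LINT x|lborel. w y * (cbump e (y - x) * \<psi> x))" by (simp add: ac_simps)
          then show ?thesis by (simp only: integral_mult_right_zero)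
        qed
        ultimately show ?thesis by simp
      qed
      have "(LINT x|M. mw e x * \<psi> x) = (LINT x|lborel. mw e x * \<psi> x)" by (rule toM[OF mwm])
      also have "\<dots> = 1 / N e * (LINT x|lborel. (LINT y|lborel. ?f (x, y)))"
      proof -
        have "(LINT y|lborel. ?f (x, y)) = (LINT y|lborel. cbump e (y - x) * w y) * \<psi> x" for x by simp
        then have "mw e x * \<psi> x = 1 / N e * (LINT y|lborel. ?f (x, y))" for x by (simp add: mw_def)
        then show ?thesis by (simp only: integral_mult_right_zero)
      qed
      also have "(LINT x|lborel. (LINT y|lborel. ?f (x, y))) = (LINT y|lborel. (LINT x|lborel. ?f (x, y)))"
        by (rule lborel_pair.Fubini_integral[symmetric, of "\<lambda>x y. ?f (x, y)"]) (use fI in \<open>simp add: case_prod_unfold\<close>)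
      also have "\<dots> = (LINT y|lborel. w y * ?c e \<psi> y)"
      proof (rule Bochner_Integration.integral_cong[OF refl])
        fix y
        have "(LINT x|lborel. ?f (x, y)) = (LINT x|lborel. w y * (cbump e (y - x) * \<psi> x))" by (simp add: ac_simps)
        then show "(LINT x|lborel. ?f (x, y)) = w y * ?c e \<psi> y" by (simp only: integral_mult_right_zero)
      qed
      finally have "(LINT x|M. mw e x * \<psi> x) - (LINT x|M. w x * \<psi> x)
          = 1 / N e * (LINT y|lborel. w y * ?c e \<psi> y) - (LINT y|lborel. w y * \<psi> y)"
        by (simp only: toM[OF wb(1)])
      also have "\<dots> = 1 / N e * (LINT y|lborel. ?r N e \<psi> y)"
        using I2 ww N0[OF e(1)] by (simp add: field_simps)
      finally have eq: "(LINT x|M. mw e x * \<psi> x) - (LINT x|M. w x * \<psi> x)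
          = 1 / N e * (LINT y|lborel. ?r N e \<psi> y)" .
      have "\<bar>LINT y|lborel. ?r N e \<psi> y\<bar>
         \<le> (LINT y|lborel. \<bar>w y\<bar> * (N e * (L * (real CARD('n) * e))))"
      proof (rule order_trans[OF integral_abs_bound integral_mono])
        show "integrable lborel (\<lambda>y. \<bar>?r N e \<psi> y\<bar>)" using I2 ww by simp
        show "integrable lborel (\<lambda>y. \<bar>w y\<bar> * (N e * (L * (real CARD('n) * e))))" using int by simp
        show "\<bar>?r N e \<psi> y\<bar> \<le> \<bar>w y\<bar> * (N e * (L * (real CARD('n) * e)))" for y
        proof -
          have "?r N e \<psi> y = w y * (?c e \<psi> y - N e * \<psi> y)"
            by (simp add: algebra_simps)
          then show ?thesis using inner[of y] by (simp only: abs_mult mult_left_mono abs_ge_zero)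
        qed
      qed
      also have "\<dots> = N e * (C * e)" by (simp add: C_def)
      finally have "\<bar>LINT y|lborel. ?r N e \<psi> y\<bar> \<le> N e * (C * e)" .
      then show ?thesis unfolding eq using N0[OF e(1)] by (simp add: abs_mult field_simps)
    qed
    have mwL: "mw (\<epsilon> (r k)) \<in> LpV M p" for k by (rule wgradD(1)[OF C1c_wgrad[OF mwC[OF \<epsilon>]]])
    have "(\<lambda>k. LINT x|M. mw (\<epsilon> (r k)) x * \<psi> x) \<longlonglongrightarrow> (LINT x|M. u x * \<psi> x)"
      by (rule LpV_integral_mult_tendsto[OF finite_M p_bounds(3) mwL u conv measurable_lebesgue_on_borel[OF \<psi>m] Bp(2)])
    moreover have "(\<lambda>k. LINT x|M. mw (\<epsilon> (r k)) x * \<psi> x) \<longlonglongrightarrow> (LINT x|M. w x * \<psi> x)"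
    proof (rule LIM_zero_cancel, rule Lim_null_comparison[OF always_eventually])
      show "\<forall>k. norm ((LINT x|M. mw (\<epsilon> (r k)) x * \<psi> x) - (LINT x|M. w x * \<psi> x)) \<le> C * \<epsilon> (r k)"
        using est[OF \<epsilon>] by simp
      have "(\<lambda>k. C * \<epsilon> (r k)) \<longlonglongrightarrow> C * 0"
        using LIMSEQ_subseq_LIMSEQ[OF \<epsilon>0 r] by (intro tendsto_intros) (simp add: o_def)
      then show "(\<lambda>k. C * \<epsilon> (r k)) \<longlonglongrightarrow> 0" by simp
    qed
    ultimately show ?thesis by (rule LIMSEQ_unique)
  qed
  have wL: "w \<in> LpV M p" by (rule wgradD(1)[OF g])
  have "AE x in M. u x - w x = 0"
  proof (rule fundamental_lemma_calculus_of_variations[OF open_\<Omega>])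
    show "integrable (lebesgue_on K) (\<lambda>x. u x - w x)" if "compact K" "K \<subseteq> \<Omega>" for K
      by (rule LpV_integrable_compact[OF LpV_diff[OF u wL p_bounds(2)] that])
    show "(LINT x|M. (u x - w x) * \<psi> x) = 0" if "\<psi> \<in> test_functions \<Omega>" for \<psi>
      using weak[OF that] integrable_mult_test[OF u that] integrable_mult_test[OF wL that] by (simp add: left_diff_distrib)
  qed
  then have uw: "AE x in M. u x = w x" by eventually_elim simp
  have conv': "strongly (\<lambda>k. mw (\<epsilon> (r k))) w"
  proof -
    have "en (\<lambda>x. mw (\<epsilon> (r k)) x - w x) = en (\<lambda>x. mw (\<epsilon> (r k)) x - u x)" for k
      by (rule LpV_cong_AE(2)[OF sets_\<Omega> LpV_diff[OF wgradD(1)[OF C1c_wgrad[OF mwC[OF \<epsilon>]]] u p_bounds(2)]])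
        (use uw in \<open>auto elim: eventually_mono\<close>)
    then show ?thesis using conv by simp
  qed
  have mid: "(\<lambda>x. (1/2) * v x + (1/2) * v' x) \<in> C1c \<Omega>" if "v \<in> C1c \<Omega>" "v' \<in> C1c \<Omega>" for v v'
    by (rule C1c_lincomb[OF that])
  obtain v V V' where vV: "\<And>k. wgrad (v k) (V k)" "\<And>k. v k \<in> C1c \<Omega>" "wgrad w V'"
    "strongly V V'" "strongly v w"
    by (rule weak_to_strong[of "\<lambda>k. mw (\<epsilon> (r k))" "\<lambda>k. Xp (mw (\<epsilon> (r k)))" "\<lambda>v V. v \<in> C1c \<Omega>",
          OF C1c_wgrad[OF mwC[OF \<epsilon>]] mwC[OF \<epsilon>] mwb(2)[OF \<epsilon>] wL conv' mid]) (assumption | rule that)+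
  show ?thesis by (rule W1p0_limit[OF W1p0_C1c[OF vV(2)] vV(1,3,5,4)])
qed

lemma W1p0_cong_AE:
  assumes "u \<in> W0" "AE x in M. u x = v x"
  shows "v \<in> W0"
proof -
  note g = W1p0_wgrad[OF assms(1)]
  have g': "wgrad v (grad u)" by (rule wgrad_cong_AE[OF g assms(2)]) simp
  have "en (\<lambda>x. u x - v x) = 0"
    using LpV_cong_AE(2)[OF sets_\<Omega>, of "\<lambda>_. 0" p "\<lambda>x. u x - v x"] assms(2)
    by (auto simp: LpV_def pint_zero elim: eventually_mono)
  then show ?thesis by (intro W1p0_limit[of "\<lambda>_. u" "\<lambda>_. grad u", OF assms(1) g g']) (simp_all add: pint_zero)
qed

text \<open>Mollification exchanges integrals over a product of Borel-Lebesgue measures, so the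
  completed representative is replaced by a Borel one. Multiplying by the indicator of
  \<open>S\<close> keeps the support exact, not just up to null sets.\<close>

lemma borel_representative:
  fixes f :: "real^'n \<Rightarrow> real"
  assumes f: "f \<in> borel_measurable M" and S: "compact S" "S \<subseteq> \<Omega>" "\<And>x. x \<notin> S \<Longrightarrow> f x = 0"
  obtains g where "g \<in> borel_measurable borel" "AE x in lebesgue. f x = g x" "\<And>x. x \<notin> S \<Longrightarrow> g x = 0"
proof -
  have "f \<in> borel_measurable lebesgue" using f lebesgue_on_zero_outside(3)[of \<Omega> f, OF sets_\<Omega>] S by blast
  then obtain g where g: "g \<in> borel_measurable lborel" "AE x in lborel. f x = g x"
    using completion_ex_borel_measurable_real by blast
  have Sb: "S \<in> sets borel" using S(1) by (simp add: compact_imp_closed borel_closed)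
  show ?thesis
  proof (rule that[of "\<lambda>x. indicator S x * g x"])
    show "(\<lambda>x. indicator S x * g x) \<in> borel_measurable borel" using g(1) Sb by simp
    show "AE x in lebesgue. f x = indicator S x * g x"
      using AE_completion[OF g(2)] by eventually_elim (use S(3) in \<open>auto simp: indicator_def\<close>)
  qed auto
qed

text \<open>The product and its gradient are passed to Borel representatives vanishing off the
  support of \<open>\<zeta>\<close>. Their weak identity holds against test functions of the whole
  space, which is the condition under which mollification gives zero boundary values.\<close>

lemma W1p0_mult_test:
  assumes u: "wgrad u V" and z: "\<zeta> \<in> test_functions \<Omega>"
  shows "(\<lambda>x. \<zeta> x * u x) \<in> W0"
proof -
  let ?w = "\<lambda>x. \<zeta> x * u x" and ?W = "\<lambda>x. \<zeta> x *\<^sub>R V x + u x *\<^sub>R Xp \<zeta> x"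
  define S where "S = closure {x. \<zeta> x \<noteq> 0}"
  have S: "compact S" "S \<subseteq> \<Omega>" using test_functionD(2)[OF z] by (auto simp: compactly_supported_def S_def)
  have z0: "\<zeta> x = 0" "Xp \<zeta> x = 0" if "x \<notin> S" for x
    using that closure_subset[of "{x. \<zeta> x \<noteq> 0}"] X_pointwise_outside[of x \<zeta> X] by (auto simp: S_def)
  note g = wgrad_mult_test(1)[OF u z]
  obtain w where w: "w \<in> borel_measurable borel" "AE x in lebesgue. ?w x = w x" "\<And>x. x \<notin> S \<Longrightarrow> w x = 0"
    by (rule borel_representative[OF LpV_measurable[OF wgradD(1)[OF g]] S]) (use z0 in \<open>auto intro: that\<close>)
  have "\<forall>j. \<exists>f. f \<in> borel_measurable borel \<and> (AE x in lebesgue. ?W x $ j = f x) \<and> (\<forall>x. x \<notin> S \<longrightarrow> f x = 0)"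
  proof
    fix j
    show "\<exists>f. f \<in> borel_measurable borel \<and> (AE x in lebesgue. ?W x $ j = f x) \<and> (\<forall>x. x \<notin> S \<longrightarrow> f x = 0)"
    by (rule borel_representative[OF LpV_measurable[OF LpV_vec_nth[OF wgradD(2)[OF g] p_bounds(2)]] S, of j])
      (use z0 in auto)
  qed
  from choice[OF this] obtain W where "\<forall>j. W j \<in> borel_measurable borel \<and> (AE x in lebesgue. ?W x $ j = W j x) \<and> (\<forall>x. x \<notin> S \<longrightarrow> W j x = 0)" ..
  then have W: "\<And>j. W j \<in> borel_measurable borel" "\<And>j. AE x in lebesgue. ?W x $ j = W j x" "\<And>j x. x \<notin> S \<Longrightarrow> W j x = 0"
    by blast+
  define W' where "W' x = (\<chi> j. W j x)" for x
  have W'b: "W' \<in> borel_measurable borel"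
  proof -
    have "(\<lambda>x. \<Sum>j\<in>UNIV. W j x *\<^sub>R (axis j 1 :: real^'m)) \<in> borel_measurable borel" using W(1) by measurable
    moreover have "W' x = (\<Sum>j\<in>UNIV. W j x *\<^sub>R (axis j 1 :: real^'m))" for x
      using basis_expansion[of "W' x"] by (simp add: scalar_mult_eq_scaleR W'_def)
    ultimately show ?thesis by (simp cong: measurable_cong)
  qed
  have aeW: "AE x in lebesgue. ?W x = W' x"
  proof -
    have "AE x in lebesgue. \<forall>j. ?W x $ j = W j x" unfolding AE_all_countable using W(2) by blast
    then show ?thesis by eventually_elim (simp add: vec_eq_iff W'_def)
  qed
  have toM: "AE x in M. P x" if "AE x in lebesgue. P x" for P
    using that sets_\<Omega> by (simp add: AE_restrict_space_iff) (auto elim: eventually_mono)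
  have gw: "wgrad w W'" by (rule wgrad_cong_AE[OF g toM[OF w(2)] toM[OF aeW]])
  have "w \<in> W0"
  proof (rule W1p0_of_global_gradient[OF w(1) W'b S w(3) _ gw])
    show "W' x = 0" if "x \<notin> S" for x using W(3)[OF that] by (simp add: W'_def vec_eq_iff)
    fix j \<psi> assume \<psi>: "\<psi> \<in> test_functions (UNIV :: (real^'n) set)"
    have o: "w x = 0" "W' x = 0" if "x \<notin> \<Omega>" for x using that S w(3)[of x] W(3)[of x] by (auto simp: W'_def vec_eq_iff)
    have "(LINT x|lborel. W' x $ j * \<psi> x) = (LINT x|lebesgue. W' x $ j * \<psi> x)"
      by (rule integral_completion[symmetric]) (use W(1) test_functionD(3)[OF \<psi>] in \<open>simp add: W'_def\<close>)
    also have "\<dots> = (LINT x|M. W' x $ j * \<psi> x)"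
      by (rule lebesgue_on_zero_outside(2)[OF sets_\<Omega>, symmetric]) (simp add: o)
    also have "\<dots> = (LINT x|M. ?W x $ j * \<psi> x)"
    proof (rule integral_cong_AE)
      show "AE x in M. W' x $ j * \<psi> x = ?W x $ j * \<psi> x" using toM[OF aeW] by eventually_elim simp
    qed (use integrable_mult_test[OF LpV_vec_nth[OF wgradD(2)[OF gw] p_bounds(2)] \<psi>, of j]
        integrable_mult_test[OF LpV_vec_nth[OF wgradD(2)[OF g] p_bounds(2)] \<psi>, of j] in auto)
    also have "\<dots> = - (LINT x|M. ?w x * Xadj X j \<psi> x)" by (rule wgrad_mult_test(2)[OF u z \<psi>])
    also have "(LINT x|M. ?w x * Xadj X j \<psi> x) = (LINT x|M. w x * Xadj X j \<psi> x)"
      using integrable_mult_Xadj[OF wgradD(1)[OF g] \<psi>, of j] integrable_mult_Xadj[OF wgradD(1)[OF gw] \<psi>, of j] toM[OF w(2)]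
      by (intro integral_cong_AE) (auto elim: eventually_mono)
    also have "\<dots> = (LINT x|lebesgue. w x * Xadj X j \<psi> x)"
      by (rule lebesgue_on_zero_outside(2)[OF sets_\<Omega>]) (simp add: o)
    also have "\<dots> = (LINT x|lborel. w x * Xadj X j \<psi> x)"
      by (rule integral_completion) (use w(1) Xadj_test(1)[OF \<psi>] in simp)
    finally show "(LINT x|lborel. W' x $ j * \<psi> x) = - (LINT x|lborel. w x * Xadj X j \<psi> x)" .
  qed
  moreover have "AE x in M. w x = ?w x" using toM[OF w(2)] by eventually_elim simp
  ultimately show ?thesis by (rule W1p0_cong_AE)
qed

end

section \<open>Integrands and lower semicontinuity\<close>

text \<open>Write \<open>a + b\<close> as the convex combination of \<open>(1/s) a\<close> and
  \<open>(1/(1-s)) b\<close> with weights \<open>s\<close> and \<open>1 - s\<close>. The weight is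
  determined by \<open>s powr (1 - p) = \<rho>\<close>, so the factor of \<open>a\<close> can be as
  close to 1 as desired.\<close>

lemma norm_powr_add_le_weighted:
  assumes p: "1 < p" and \<rho>: "1 < \<rho>"
  obtains C where "0 \<le> C"
    "\<And>a b :: 'b::real_normed_vector. norm (a + b) powr p \<le> \<rho> * norm a powr p + C * norm b powr p"
proof -
  define s where "s = \<rho> powr (- 1 / (p - 1))"
  have s: "0 < s" "s < 1" using p \<rho> by (simp_all add: s_def powr_less_one divide_neg_pos)
  have s\<rho>: "s * (1 / s) powr p = \<rho>"
  proof -
    have "s * (1 / s) powr p = s powr (1 - p)" using s by (simp add: powr_diff powr_divide)
    also have "\<dots> = \<rho>"
    proof -
      have "- 1 / (p - 1) * (1 - p) = 1" using p by (simp add: field_simps)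
      then show ?thesis using \<rho> unfolding s_def powr_powr by simp
    qed
    finally show ?thesis .
  qed
  show ?thesis
  proof (rule that[of "(1 - s) * (1 / (1 - s)) powr p"])
    show "0 \<le> (1 - s) * (1 / (1 - s)) powr p" using s by simp
    fix a b :: 'b
    have "norm ((1 - (1 - s)) *\<^sub>R ((1 / s) *\<^sub>R a) + (1 - s) *\<^sub>R ((1 / (1 - s)) *\<^sub>R b)) powr p
       \<le> (1 - (1 - s)) * norm ((1 / s) *\<^sub>R a) powr p + (1 - s) * norm ((1 / (1 - s)) *\<^sub>R b) powr p"
      by (rule convex_onD[OF convex_on_norm_powr]) (use p s in auto)
    moreover have "(1 - (1 - s)) *\<^sub>R ((1 / s) *\<^sub>R a) + (1 - s) *\<^sub>R ((1 / (1 - s)) *\<^sub>R b) = a + b" using s by simp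
    moreover have "norm ((1 / s) *\<^sub>R a) powr p = (1 / s) powr p * norm a powr p"
      "norm ((1 / (1 - s)) *\<^sub>R b) powr p = (1 / (1 - s)) powr p * norm b powr p"
      using s by (simp_all only: norm_scaleR powr_mult) simp_all
    ultimately have "norm (a + b) powr p \<le> s * ((1 / s) powr p * norm a powr p) + (1 - s) * ((1 / (1 - s)) powr p * norm b powr p)"
      by (simp only:) simp
    also have "\<dots> = (s * (1 / s) powr p) * norm a powr p + (1 - s) * (1 / (1 - s)) powr p * norm b powr p"
      by (simp only: mult.assoc)
    finally show "norm (a + b) powr p \<le> \<rho> * norm a powr p + (1 - s) * (1 / (1 - s)) powr p * norm b powr p"
      by (simp only: s\<rho>)
  qed
qed

text \<open>Countably many boxes with closure in \<open>\<Omega>\<close> cover it. One minus the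
  product of \<open>1 - \<beta>\<close> over finitely many of them has compact support, and it tends
  to 1 on \<open>\<Omega>\<close> as boxes are added and bumps grow steeper; dominated convergence
  does the rest.\<close>

lemma test_function_cutoff:
  fixes \<Omega> :: "(real^'n::finite) set"
  assumes \<Omega>: "open \<Omega>" and q: "integrable (lebesgue_on \<Omega>) q" and e: "0 < e"
  obtains \<zeta> where "\<zeta> \<in> test_functions \<Omega>" "\<And>x. 0 \<le> \<zeta> x" "\<And>x. \<zeta> x \<le> 1"
    "(LINT x|lebesgue_on \<Omega>. (1 - \<zeta> x) * q x) < e"
proof -
  define F where "F = {box a b | a b. cbox a b \<subseteq> \<Omega>}"
  have 1: "\<And>S. S \<in> F \<Longrightarrow> open S" by (auto simp: F_def)
  obtain F' where F': "F' \<subseteq> F" "countable F'" "\<Union>F' = \<Union>F" by - (rule Lindelof[of F], erule 1, rule that)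
  have UF: "\<Omega> \<subseteq> \<Union>F"
  proof
    fix x assume "x \<in> \<Omega>"
    obtain a b where "cbox a b \<subseteq> \<Omega>" "x \<in> box a b"
      by (rule open_contains_cbox[OF \<Omega> \<open>x \<in> \<Omega>\<close>]) (rule that)
    moreover from this(1) have "box a b \<in> F" unfolding F_def by blast
    ultimately show "x \<in> \<Union>F" by (intro UnionI)
  qed
  have "cbox (1 :: real^'n) 0 = {}" by (force simp: mem_box_cart)
  then have "box (1 :: real^'n) 0 \<in> F" unfolding F_def by blast
  \<comment> \<open>An empty box is added so that the family can be enumerated even if it was
    empty.\<close>
  define F2 where "F2 = insert (box (1 :: real^'n) 0) F'"
  have F2: "F2 \<noteq> {}" "countable F2" "F2 \<subseteq> F" "\<Omega> \<subseteq> \<Union>F2"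
    using F' UF \<open>box 1 0 \<in> F\<close> by (auto simp: F2_def)
  have "\<forall>i. \<exists>ab. from_nat_into F2 i = box (fst ab) (snd ab) \<and> cbox (fst ab) (snd ab) \<subseteq> \<Omega>"
    using from_nat_into[OF F2(1)] F2(3) unfolding F_def by fastforce
  then obtain ab where ab: "\<And>i. from_nat_into F2 i = box (fst (ab i)) (snd (ab i))" "\<And>i. cbox (fst (ab i)) (snd (ab i)) \<subseteq> \<Omega>"
    using choice[of "\<lambda>i ab. from_nat_into F2 i = box (fst ab) (snd ab) \<and> cbox (fst ab) (snd ab) \<subseteq> \<Omega>"] by blast
  define \<beta> where "\<beta> k i = bump (fst (ab i)) (snd (ab i)) (real (Suc k))" for k i
  have \<beta>: "0 \<le> \<beta> k i x" "\<beta> k i x \<le> 1" for k i x by (simp_all add: \<beta>_def bump_bounds)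
  \<comment> \<open>The index \<open>k\<close> governs both the number of boxes and the steepness.
    Writing the factors as \<open>1 + (-1) * \<beta>\<close> lets the sum and product rules for
    \<open>Ck\<close> apply directly.\<close>
  define \<eta> where "\<eta> k x = (\<Prod>i<k. 1 + (-1) * \<beta> k i x)" for k x
  have \<eta>: "0 \<le> \<eta> k x" "\<eta> k x \<le> 1" for k x
    using \<beta>[of k _ x] unfolding \<eta>_def by (auto intro!: prod_nonneg prod_le_1)
  have Ck: "Ck m (\<lambda>x. 1 + (-1) * \<eta> k x)" for m k
  proof -
    have "Ck m (\<eta> k)" unfolding \<eta>_def[abs_def] \<beta>_def
      by (intro Ck_prod Ck_add Ck_const Ck_mult Ck_bump) auto
    then show ?thesis by (intro Ck_add Ck_const Ck_mult)
  qed
  have test: "(\<lambda>x. 1 + (-1) * \<eta> k x) \<in> test_functions \<Omega>" for k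
  proof -
    have "compactly_supported \<Omega> (\<lambda>x. 1 + (-1) * \<eta> k x)"
    proof (rule compactly_supportedI)
      show "compact (\<Union>i<k. cbox (fst (ab i)) (snd (ab i)))" by (intro compact_UN) auto
      show "(\<Union>i<k. cbox (fst (ab i)) (snd (ab i))) \<subseteq> \<Omega>" using ab(2) by blast
      fix x assume x: "x \<notin> (\<Union>i<k. cbox (fst (ab i)) (snd (ab i)))"
      have "\<beta> k i x = 0" if "i < k" for i
        using x that bump_eq_0_iff[of "real (Suc k)" "fst (ab i)" "snd (ab i)" x] box_subset_cbox[of "fst (ab i)" "snd (ab i)"]
        unfolding \<beta>_def by (auto simp del: of_nat_Suc)
      then show "1 + (-1) * \<eta> k x = 0" by (simp add: \<eta>_def)
    qed
    with Ck show ?thesis by (simp add: test_functions_def)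
  qed
  have lim: "(\<lambda>k. \<eta> k x) \<longlonglongrightarrow> 0" if x: "x \<in> \<Omega>" for x
  proof -
    obtain S where "S \<in> F2" "x \<in> S" using F2(4) x by blast
    moreover obtain i where "from_nat_into F2 i = S" using from_nat_into_surj[OF F2(2) \<open>S \<in> F2\<close>] by blast
    ultimately have "x \<in> box (fst (ab i)) (snd (ab i))" using ab(1)[of i] by simp
    then have "(\<lambda>k. \<beta> k i x) \<longlonglongrightarrow> 1"
      using bump_tendsto_indicator[of "fst (ab i)" "snd (ab i)" x] by (simp add: \<beta>_def)
    from tendsto_diff[OF tendsto_const[of 1] this] have 0: "(\<lambda>k. 1 - \<beta> k i x) \<longlonglongrightarrow> 0" by simp
    have "\<eta> k x \<le> 1 - \<beta> k i x" if "i < k" for k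
    proof -
      have "\<eta> k x = (1 + (-1) * \<beta> k i x) * (\<Prod>j\<in>{..<k} - {i}. 1 + (-1) * \<beta> k j x)"
        unfolding \<eta>_def using that by (intro prod.remove) auto
      also have "\<dots> \<le> (1 + (-1) * \<beta> k i x) * 1"
        using \<beta>[of k _ x] by (intro mult_left_mono prod_le_1) auto
      finally show ?thesis by simp
    qed
    then have "eventually (\<lambda>k. \<eta> k x \<le> 1 - \<beta> k i x) sequentially"
      using eventually_gt_at_top[of i] by (rule eventually_mono[rotated])
    with 0 \<eta> show ?thesis by (intro tendsto_sandwich[OF _ _ tendsto_const 0]) (auto intro: always_eventually)
  qed
  have "(\<lambda>k. LINT x|lebesgue_on \<Omega>. \<eta> k x * q x) \<longlonglongrightarrow> (LINT x|lebesgue_on \<Omega>. 0)"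
  proof (rule integral_dominated_convergence[where w="\<lambda>x. \<bar>q x\<bar>"])
    show "(\<lambda>x. \<eta> k x * q x) \<in> borel_measurable (lebesgue_on \<Omega>)" for k
    proof -
      have "(\<lambda>x. 1 + (-1) * \<eta> k x) \<in> borel_measurable borel" by (rule test_functionD(3)[OF test])
      then have "(\<lambda>x. 1 - (1 + (-1) * \<eta> k x)) \<in> borel_measurable borel" by measurable
      then have "\<eta> k \<in> borel_measurable borel" by simp
      then have "\<eta> k \<in> borel_measurable (lebesgue_on \<Omega>)" by (rule measurable_lebesgue_on_borel)
      then show ?thesis using q by simp
    qed
    show "AE x in lebesgue_on \<Omega>. (\<lambda>k. \<eta> k x * q x) \<longlonglongrightarrow> 0"
      using lim by (intro AE_I2) (auto intro!: tendsto_mult_left_zero)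
    show "AE x in lebesgue_on \<Omega>. norm (\<eta> k x * q x) \<le> \<bar>q x\<bar>" for k
      using \<eta> by (intro AE_I2) (auto simp: abs_mult mult_left_le_one_le)
  qed (use q in auto)
  then have "eventually (\<lambda>k. (LINT x|lebesgue_on \<Omega>. \<eta> k x * q x) < e) sequentially"
    using e by (intro order_tendstoD(2)[where y="LINT x|lebesgue_on \<Omega>. 0"]) auto
  then obtain k where "(LINT x|lebesgue_on \<Omega>. \<eta> k x * q x) < e" by (auto simp: eventually_sequentially)
  then show ?thesis using \<eta>[of k] by (intro that[OF test[of k]]) auto
qed

context X_compact
begin

text \<open>A sublevel set of a linear functional \<open>L\<close> is stable under midpoints, so a
  bound for \<open>L (us (r k))\<close> passes to a sequence converging strongly to \<open>u\<close>
  in the Sobolev norm, and hence to \<open>L u\<close>. Applying this to \<open>L\<close> and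
  \<open>- L\<close> along subsequences gives convergence.\<close>

lemma W1p_weak_convergence:
  assumes wg: "\<And>k. wgrad (us k) (V k)" and K: "\<And>k. en (V k) \<le> K"
    and u: "u \<in> LpV M p" "strongly us u"
  shows "W1p_converges_weakly X \<Omega> p us u"
proof -
  obtain U where U: "wgrad u U"
    by (rule weak_to_strong[of us V "\<lambda>_ _. True", OF wg _ K u]) simp_all
  have le: "L u \<le> b" if L: "L \<in> W1p_dual X \<Omega> p" and r: "strict_mono r" "\<And>k. L (us (r k)) \<le> b" for L b and r :: "nat \<Rightarrow> nat"
  proof -
    have lin: "L (\<lambda>x. a * v x + c * w x) = a * L v + c * L w" if "v \<in> W1p X \<Omega> p" "w \<in> W1p X \<Omega> p" for a c v w
      using L that by (simp add: W1p_dual_def)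
    obtain B where B: "\<And>v. v \<in> W1p X \<Omega> p \<Longrightarrow> \<bar>L v\<bar> \<le> B * W1p_norm X \<Omega> p v" using L unfolding W1p_dual_def by blast
    have ur: "strongly (\<lambda>k. us (r k)) u"
      using LIMSEQ_subseq_LIMSEQ[OF u(2) r(1)] by (simp add: o_def)
    have mid: "L (\<lambda>x. (1/2) * w x + (1/2) * v x) \<le> b" if "wgrad w W" "wgrad v Z" "L w \<le> b" "L v \<le> b" for w W v Z
      using lin[OF wgrad_W1p[OF that(1)] wgrad_W1p[OF that(2)], of "1/2" "1/2"] that(3,4) by simp
    obtain w W U' where w: "\<And>k. wgrad (w k) (W k)" "\<And>k. L (w k) \<le> b" "wgrad u U'"
      "strongly W U'" "strongly w u"
      by (rule weak_to_strong[of "\<lambda>k. us (r k)" "\<lambda>k. V (r k)" "\<lambda>w W. L w \<le> b", OF wg r(2) K u(1) ur mid])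
        (assumption | rule that)+
    have n: "W1p_norm X \<Omega> p (\<lambda>x. w k x - u x) = (en (\<lambda>x. w k x - u x) + en (\<lambda>x. W k x - U' x)) powr (1 / p)" for k
      using pint_Xgrad[OF wgrad_diff[OF w(1)[of k] w(3)]] by (simp add: W1p_norm_def pint_def)
    have "(\<lambda>k. W1p_norm X \<Omega> p (\<lambda>x. w k x - u x)) \<longlonglongrightarrow> 0"
      unfolding n using tendsto_add[OF w(5,4)] p_bounds
      by (intro tendsto_zero_powrI[OF _ tendsto_const]) (auto intro!: always_eventually add_nonneg_nonneg pint_nonneg)
    from tendsto_mult[OF tendsto_const[of B] this] have z: "(\<lambda>k. B * W1p_norm X \<Omega> p (\<lambda>x. w k x - u x)) \<longlonglongrightarrow> 0" by simp
    have "L u - b \<le> B * W1p_norm X \<Omega> p (\<lambda>x. w k x - u x)" for k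
    proof -
      have "L (\<lambda>x. w k x - u x) = L (w k) - L u"
        using lin[OF wgrad_W1p[OF w(1)[of k]] wgrad_W1p[OF U], of 1 "-1"] by simp
      moreover have "\<bar>L (\<lambda>x. w k x - u x)\<bar> \<le> B * W1p_norm X \<Omega> p (\<lambda>x. w k x - u x)"
        by (rule B[OF wgrad_W1p[OF wgrad_diff[OF w(1) w(3)]]])
      ultimately show ?thesis using w(2)[of k] by linarith
    qed
    then have "L u - b \<le> 0" using LIMSEQ_le_const[OF z] by blast
    then show ?thesis by simp
  qed
  have "(\<lambda>k. L (us k)) \<longlonglongrightarrow> L u" if L: "L \<in> W1p_dual X \<Omega> p" for L
  proof (rule tendsto_by_subsequences)
    fix r :: "nat \<Rightarrow> nat" and b assume r: "strict_mono r" "\<And>k. L (us (r k)) \<le> b"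
    show "L u \<le> b" by (rule le[OF L r])
  next
    fix r :: "nat \<Rightarrow> nat" and b assume r: "strict_mono r" "\<And>k. b \<le> L (us (r k))"
    have "(\<lambda>v. - L v) \<in> W1p_dual X \<Omega> p" using L by (auto simp: W1p_dual_def)
    from le[OF this r(1), of "- b"] r(2) show "b \<le> L u" by simp
  qed
  then show ?thesis
    unfolding W1p_converges_weakly_def using wgrad_W1p[OF wg] wgrad_W1p[OF U] by blast
qed

lemma Lp_converges_iff:
  "Lp_converges \<Omega> p us u \<longleftrightarrow> (\<forall>h. us h \<in> LpV M p) \<and> u \<in> LpV M p \<and> strongly us u"
proof -
  have n: "Lp_norm \<Omega> p v = en v powr (1 / p)" for v by (simp add: Lp_norm_def pint_def)
  have "(\<lambda>h. en (\<lambda>x. us h x - u x) powr (1 / p)) \<longlonglongrightarrow> 0 \<longleftrightarrow> strongly us u"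
  proof
    assume "(\<lambda>h. en (\<lambda>x. us h x - u x) powr (1 / p)) \<longlonglongrightarrow> 0"
    from tendsto_zero_powrI[OF this tendsto_const[of p]] p_bounds
    show "strongly us u" by (simp add: powr_powr pint_nonneg)
  next
    assume "strongly us u"
    from tendsto_zero_powrI[OF this tendsto_const[of "1 / p"]] p_bounds
    show "(\<lambda>h. en (\<lambda>x. us h x - u x) powr (1 / p)) \<longlonglongrightarrow> 0" by (simp add: pint_nonneg)
  qed
  then show ?thesis by (simp add: Lp_converges_def Lp_eq_LpV n)
qed

end

section \<open>The direct method and convergence of minima\<close>

text \<open>With \<open>y = (1 - z) v + z w\<close>, the argument of \<open>F\<close> is the convex
  combination of \<open>y\<close> with weight \<open>1 - t\<close> and of \<open>y + e / t\<close>
  with weight \<open>t\<close>. The growth bound is then spent only on a fraction \<open>t\<close>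
  of the energies and on a multiple, depending on \<open>t\<close>, of the p-th power of the error
  \<open>e\<close>. Where \<open>z = 1\<close>, the remaining cost is \<open>F w\<close>.\<close>

lemma convex_cutoff_bound:
  fixes F :: "'b::real_normed_vector \<Rightarrow> real"
  assumes F: "convex_on UNIV F" "\<And>y. - a \<le> F y" "\<And>y. F y \<le> c * norm y powr p + b"
    and c: "0 \<le> c" "0 \<le> a" "0 \<le> b" and z: "0 \<le> z" "z \<le> 1" and t: "0 < t" "t < 1" and p: "1 \<le> p"
  shows "F (v + (z *\<^sub>R (w - v) + e)) \<le> F w + (1 - z) * (c * norm v powr p + a + b)
    + t * (a + b + c * (2 powr p * (norm v powr p + norm w powr p))) + t * (c * (2 powr p * ((1 / t) powr p * norm e powr p)))"
proof -
  define y where "y = (1 - z) *\<^sub>R v + z *\<^sub>R w"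
  have "F ((1 - t) *\<^sub>R y + t *\<^sub>R (y + (1 / t) *\<^sub>R e)) \<le> (1 - t) * F y + t * F (y + (1 / t) *\<^sub>R e)"
    by (rule convex_onD[OF F(1)]) (use t in auto)
  moreover have "(1 - t) *\<^sub>R y + t *\<^sub>R (y + (1 / t) *\<^sub>R e) = v + (z *\<^sub>R (w - v) + e)"
    using t by (simp add: y_def algebra_simps)
  ultimately have "F (v + (z *\<^sub>R (w - v) + e)) \<le> (1 - t) * F y + t * F (y + (1 / t) *\<^sub>R e)" by (simp only:)
  then have 1: "F (v + (z *\<^sub>R (w - v) + e)) \<le> F y - t * F y + t * F (y + (1 / t) *\<^sub>R e)" by (simp only: left_diff_distrib mult_1)
  have 2: "F y \<le> (1 - z) * F v + z * F w" unfolding y_def by (rule convex_onD[OF F(1)]) (use z in auto)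
  have 3: "(1 - z) * F v \<le> (1 - z) * (c * norm v powr p + b)" "(1 - z) * (- a) \<le> (1 - z) * F w" "t * (- a) \<le> t * F y"
    by (intro mult_left_mono F(2,3); use z t in simp)+
  have "norm y powr p \<le> (1 - z) * norm v powr p + z * norm w powr p"
    unfolding y_def by (rule convex_onD[OF convex_on_norm_powr[OF p]]) (use z in auto)
  also have "\<dots> \<le> norm v powr p + norm w powr p"
    using z by (intro add_mono mult_left_le_one_le) auto
  finally have ny: "norm y powr p \<le> norm v powr p + norm w powr p" .
  have "norm (y + (1 / t) *\<^sub>R e) powr p \<le> 2 powr p * (norm y powr p + norm ((1 / t) *\<^sub>R e) powr p)"
    by (rule norm_powr_add_le) (use p in simp)
  also have "norm ((1 / t) *\<^sub>R e) powr p = (1 / t) powr p * norm e powr p"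
    using t by (simp only: norm_scaleR powr_mult) simp
  also have "2 powr p * (norm y powr p + (1 / t) powr p * norm e powr p)
     \<le> 2 powr p * ((norm v powr p + norm w powr p) + (1 / t) powr p * norm e powr p)"
    using ny by (intro mult_left_mono) auto
  finally have "c * norm (y + (1 / t) *\<^sub>R e) powr p \<le> c * (2 powr p * ((norm v powr p + norm w powr p) + (1 / t) powr p * norm e powr p))"
    using c by (intro mult_left_mono) auto
  with F(3)[of "y + (1 / t) *\<^sub>R e"] have "F (y + (1 / t) *\<^sub>R e) \<le> c * (2 powr p * ((norm v powr p + norm w powr p) + (1 / t) powr p * norm e powr p)) + b"
    by linarith
  then have "t * F (y + (1 / t) *\<^sub>R e) \<le> t * (c * (2 powr p * ((norm v powr p + norm w powr p) + (1 / t) powr p * norm e powr p)) + b)"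
    using t by (intro mult_left_mono) auto
  with 1 2 3 show ?thesis by (simp add: algebra_simps)
qed

locale variational = X_compact X \<Omega> p \<Omega>0
  for X :: "('n::finite, 'm::finite) vfields" and \<Omega> p \<Omega>0 +
  fixes c0 c1 d0 d1 :: real and a0 a1 b0 b1 \<phi> :: "real^'n \<Rightarrow> real" and g :: "real^'n \<Rightarrow> real \<Rightarrow> real"
  assumes c: "0 < c0" "c0 \<le> c1" and a: "nonneg_L1 \<Omega> a0" "nonneg_L1 \<Omega> a1"
    and car: "caratheodory \<Omega> g" and b: "nonneg_L1 \<Omega> b0" "nonneg_L1 \<Omega> b1"
    and g_bounds: "AE x in lebesgue_on \<Omega>. \<forall>s. d0 * \<bar>s\<bar> powr p - b0 x \<le> g x s \<and> g x s \<le> d1 * \<bar>s\<bar> powr p + b1 x"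
    and d: "0 < d1" "- (ereal c0 * poincare_const X \<Omega> p) < ereal d0"
    and \<phi>: "\<phi> \<in> W1p X \<Omega> p"
begin

abbreviation cls :: "(real^'n \<Rightarrow> real^'m \<Rightarrow> real) set" where "cls \<equiv> integrands \<Omega> p c0 c1 a0 a1"
abbreviation bdry :: "(real^'n \<Rightarrow> real) set" where "bdry \<equiv> W1p_bdry X \<Omega> p \<phi>"
abbreviation Fi :: "(real^'n \<Rightarrow> real^'m \<Rightarrow> real) \<Rightarrow> (real^'n \<Rightarrow> real^'m) \<Rightarrow> real" where "Fi f V \<equiv> (LINT x|M. f x (V x))"
abbreviation Gi :: "(real^'n \<Rightarrow> real) \<Rightarrow> real" where "Gi u \<equiv> (LINT x|M. g x (u x))"
abbreviation J :: "(real^'n \<Rightarrow> real^'m \<Rightarrow> real) \<Rightarrow> (real^'n \<Rightarrow> real) \<Rightarrow> real" where "J f u \<equiv> Fi f (grad u) + Gi u"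
abbreviation A0 :: real where "A0 \<equiv> (LINT x|M. a0 x)"
abbreviation A1 :: real where "A1 \<equiv> (LINT x|M. a1 x)"

lemma integrable_ab: "integrable M a0" "integrable M a1" "integrable M b0" "integrable M b1"
  and AE_ab: "AE x in M. 0 \<le> a0 x \<and> 0 \<le> a1 x \<and> 0 \<le> b0 x \<and> 0 \<le> b1 x"
  using a b by (auto simp: nonneg_L1_def)

section \<open>The integral functionals and the boundary class\<close>

lemma integrand_AE:
  assumes "f \<in> cls"
  shows "AE x in M. convex_on UNIV (f x) \<and> 0 \<le> a0 x \<and> 0 \<le> a1 x \<and>
    (\<forall>\<eta>. - a0 x \<le> f x \<eta> \<and> c0 * norm \<eta> powr p - a0 x \<le> f x \<eta> \<and> f x \<eta> \<le> c1 * norm \<eta> powr p + a1 x)"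
proof -
  have "AE x in M. convex_on UNIV (f x)" "AE x in M. \<forall>\<eta>. c0 * norm \<eta> powr p - a0 x \<le> f x \<eta> \<and> f x \<eta> \<le> c1 * norm \<eta> powr p + a1 x"
    using assms by (auto simp: integrands_def)
  then show ?thesis using AE_ab
  proof eventually_elim
    case (elim x)
    moreover have "0 \<le> c0 * norm \<eta> powr p" for \<eta> :: "real^'m" using c by simp
    then have "- a0 x \<le> c0 * norm \<eta> powr p - a0 x" for \<eta> :: "real^'m" by simp
    ultimately show ?case by (meson order_trans)
  qed
qed

lemma integrand_measurable:
  assumes f: "f \<in> cls" and V: "V \<in> borel_measurable M"
  shows "(\<lambda>x. f x (V x)) \<in> borel_measurable M"
proof -
  have 1: "(\<lambda>x. (x, V x)) \<in> measurable M (restrict_space borel (\<Omega> \<times> UNIV))"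
    by (intro measurable_restrict_space2 borel_measurable_Pair V measurable_lebesgue_on_borel)
      (auto simp: space_restrict_space intro: borel_measurable_continuous_onI continuous_on_id)
  have 2: "(\<lambda>(x, \<eta>). f x \<eta>) \<in> borel_measurable (restrict_space borel (\<Omega> \<times> UNIV))"
    using f by (simp add: integrands_def)
  from measurable_compose[OF 1 2] show ?thesis by simp
qed

lemma integrand_integral:
  assumes f: "f \<in> cls" and V: "V \<in> LpV M p"
  shows "integrable M (\<lambda>x. f x (V x))" "c0 * en V - A0 \<le> Fi f V" "Fi f V \<le> c1 * en V + A1"
proof -
  note I = LpV_integrable[OF V] integrable_ab
  show int: "integrable M (\<lambda>x. f x (V x))"
  proof (rule Bochner_Integration.integrable_bound)
    show "integrable M (\<lambda>x. c1 * norm (V x) powr p + a1 x + a0 x)" using I by simp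
    show "(\<lambda>x. f x (V x)) \<in> borel_measurable M" by (rule integrand_measurable[OF f LpV_measurable[OF V]])
    show "AE x in M. norm (f x (V x)) \<le> norm (c1 * norm (V x) powr p + a1 x + a0 x)"
      using integrand_AE[OF f]
    proof eventually_elim
      case (elim x)
      have "0 \<le> c1 * norm (V x) powr p" using c by simp
      moreover have "- a0 x \<le> f x (V x)" "f x (V x) \<le> c1 * norm (V x) powr p + a1 x" "0 \<le> a0 x" "0 \<le> a1 x" using elim by auto
      ultimately show ?case by simp
    qed
  qed
  have "(LINT x|M. c0 * norm (V x) powr p - a0 x) \<le> Fi f V"
    by (rule integral_mono_AE) (use int I integrand_AE[OF f] in \<open>auto elim: eventually_mono\<close>)
  then show "c0 * en V - A0 \<le> Fi f V" using I by (simp add: pint_def)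
  have "Fi f V \<le> (LINT x|M. c1 * norm (V x) powr p + a1 x)"
    by (rule integral_mono_AE) (use int I integrand_AE[OF f] in \<open>auto elim: eventually_mono\<close>)
  then show "Fi f V \<le> c1 * en V + A1" using I by (simp add: pint_def)
qed

lemma Fi_grad:
  assumes f: "f \<in> cls" and u: "wgrad u V"
  shows "Fi f (grad u) = Fi f V"
  using wgrad_Xgrad[OF u] integrand_measurable[OF f LpV_measurable[OF wgradD(2)[OF u]]]
    integrand_measurable[OF f LpV_measurable[OF wgradD(2)[OF wgrad_Xgrad(1)[OF u]]]]
  by (intro integral_cong_AE) auto

text \<open>A finite convex function on a Euclidean space is continuous, so the integrands converge
  almost everywhere along a subsequence, and Fatou's lemma applies with the integrable minorant
  \<open>- a0\<close>.\<close>

lemma Fi_lsc_strong: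
  assumes f: "f \<in> cls" and V: "\<And>k. V k \<in> LpV M p" "U \<in> LpV M p" "strongly V U"
    and le: "\<And>k::nat. Fi f (V k) \<le> b"
  shows "Fi f U \<le> b"
proof -
  obtain r where r: "strict_mono r" "AE x in M. (\<lambda>k. V (r k) x) \<longlonglongrightarrow> U x"
    by (rule LpV_AE_subseq[OF V p_bounds(1)]) (rule that)
  show ?thesis
  proof (rule fatou_le[where h="\<lambda>k x. f x (V (r k) x)" and l="\<lambda>k x. - a0 x" and l'="\<lambda>x. - a0 x"])
    show "AE x in M. (\<lambda>k. f x (V (r k) x)) \<longlonglongrightarrow> f x (U x)"
      using r(2) integrand_AE[OF f]
    proof eventually_elim
      case (elim x)
      have "continuous_on UNIV (f x)" using elim by (intro convex_on_continuous) auto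
      from continuous_on_tendsto_compose[OF this elim(1)] show ?case by simp
    qed
    show "AE x in M. - a0 x \<le> f x (V (r k) x)" for k using integrand_AE[OF f] by (auto elim: eventually_mono)
  qed (use integrand_integral(1)[OF f] V integrable_ab le in auto)
qed

text \<open>The bound on the energies bounds the gradients, and convexity makes the sublevel set
  stable under midpoints; the passage to strongly convergent gradients reduces the claim to the
  strong case.\<close>

lemma Fi_lsc:
  assumes f: "f \<in> cls" and us: "\<And>k. wgrad (us k) (V k)" "\<And>k::nat. Fi f (V k) \<le> b"
    and u: "wgrad u U" "strongly us u"
  shows "Fi f U \<le> b"
proof -
  have K: "en (V k) \<le> (b + A0) / c0" for k
    using integrand_integral(2)[OF f wgradD(2)[OF us(1)], of k] us(2)[of k] c by (simp add: field_simps)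
  have mid: "Fi f (\<lambda>x. (1/2) *\<^sub>R (W x + Z x)) \<le> b" if "wgrad w W" "wgrad v Z" "Fi f W \<le> b" "Fi f Z \<le> b" for w W v Z
  proof -
    note W = wgradD(2)[OF that(1)] and Z = wgradD(2)[OF that(2)]
    note I = integrand_integral(1)[OF f W] integrand_integral(1)[OF f Z]
      integrand_integral(1)[OF f LpV_scaleR[OF LpV_add[OF W Z p_bounds(2)], of "1/2"]]
    have "Fi f (\<lambda>x. (1/2) *\<^sub>R (W x + Z x)) \<le> (LINT x|M. (1/2) * f x (W x) + (1/2) * f x (Z x))"
    proof (rule integral_mono_AE)
      show "AE x in M. f x ((1/2) *\<^sub>R (W x + Z x)) \<le> (1/2) * f x (W x) + (1/2) * f x (Z x)"
        using integrand_AE[OF f]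
      proof eventually_elim
        case (elim x)
        then have "convex_on UNIV (f x)" by blast
        from convex_onD[OF this, of "1/2" "W x" "Z x"] show ?case by (simp add: scaleR_add_right)
      qed
    qed (use I in auto)
    also have "\<dots> = (1/2) * Fi f W + (1/2) * Fi f Z" using I by simp
    finally show ?thesis using that by simp
  qed
  obtain w W U' where w: "\<And>k. wgrad (w k) (W k)" "\<And>k. Fi f (W k) \<le> b" "wgrad u U'"
    "strongly W U'"
    by (rule weak_to_strong[of us V "\<lambda>w W. Fi f W \<le> b", OF us K wgradD(1)[OF u(1)] u(2) mid]) (assumption | rule that)+
  have "Fi f U' \<le> b"
    by (rule Fi_lsc_strong[OF f wgradD(2)[OF w(1)] wgradD(2)[OF w(3)] w(4,2)])
  moreover have "Fi f U' = Fi f U" using Fi_grad[OF f u(1)] Fi_grad[OF f w(3)] by simp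
  ultimately show ?thesis by simp
qed

lemma bdry_iff: "u \<in> bdry \<longleftrightarrow> (\<lambda>x. u x - \<phi> x) \<in> W0"
proof
  assume "(\<lambda>x. u x - \<phi> x) \<in> W0"
  then show "u \<in> bdry" unfolding W1p_bdry_def by (intro image_eqI[where x="\<lambda>x. u x - \<phi> x"]) simp_all
qed (auto simp: W1p_bdry_def)

lemma bdry_wgrad:
  assumes "u \<in> bdry"
  shows "wgrad u (grad u)"
proof -
  have "wgrad (\<lambda>x. (u x - \<phi> x) + \<phi> x) (\<lambda>x. grad (\<lambda>x. u x - \<phi> x) x + grad \<phi> x)"
    using assms by (intro wgrad_add W1p0_wgrad W1p_Xgrad[OF \<phi>]) (simp add: bdry_iff)
  then show ?thesis by (intro wgrad_Xgrad(1)) simp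
qed

lemma \<phi>_bdry: "\<phi> \<in> bdry"
proof -
  have "(\<lambda>_. 0) \<in> C1c \<Omega>" using Ck_const[of 1 0] compactly_supportedI[of "{}" \<Omega> "\<lambda>_. 0"] by (simp add: C1c_def)
  from W1p0_C1c[OF this] show ?thesis by (simp add: bdry_iff)
qed

text \<open>Having \<open>w - \<phi>\<close> in \<open>W0\<close> is stable under midpoints, so L^p
  convergence with bounded gradients can be upgraded to strong convergence, under which
  \<open>W0\<close> is closed.\<close>

lemma bdry_closed:
  assumes us: "\<And>k. us k \<in> bdry" "\<And>k::nat. en (grad (us k)) \<le> K"
    and u: "u \<in> LpV M p" "strongly us u"
  shows "u \<in> bdry"
proof -
  let ?P = "\<lambda>w W. (\<lambda>x. w x - \<phi> x) \<in> W0"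
  have mid: "(\<lambda>x. ((1/2) * w x + (1/2) * v x) - \<phi> x) \<in> W0"
    if "(\<lambda>x. w x - \<phi> x) \<in> W0" "(\<lambda>x. v x - \<phi> x) \<in> W0" for w v
  proof -
    have "(\<lambda>x. ((1/2) * w x + (1/2) * v x) - \<phi> x) = (\<lambda>x. (1/2) * (w x - \<phi> x) + (1/2) * (v x - \<phi> x))"
      by (intro ext) (simp add: field_simps)
    then show ?thesis using W1p0_lincomb[OF that, of "1/2" "1/2"] by (simp only:)
  qed
  obtain w W U where w: "\<And>k. wgrad (w k) (W k)" "\<And>k. (\<lambda>x. w k x - \<phi> x) \<in> W0" "wgrad u U"
    "strongly W U" "strongly w u"
    by (rule weak_to_strong[of us "\<lambda>k. grad (us k)" ?P, OF bdry_wgrad[OF us(1)] us(1)[unfolded bdry_iff] us(2) u mid])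
      (assumption | rule that)+
  note g\<phi> = W1p_Xgrad[OF \<phi>]
  have "(\<lambda>x. u x - \<phi> x) \<in> W0"
    by (rule W1p0_limit[OF w(2) wgrad_diff[OF w(1) g\<phi>] wgrad_diff[OF w(3) g\<phi>]]) (use w(4,5) in simp_all)
  then show ?thesis by (simp add: bdry_iff)
qed

text \<open>Composition with a simple function is measurable because only finitely many slices of
  \<open>g\<close> occur. Continuity in the second argument passes this to limits almost everywhere,
  and completeness of the measure corrects the null set.\<close>

lemma g_measurable:
  assumes u: "u \<in> borel_measurable M"
  shows "(\<lambda>x. g x (u x)) \<in> borel_measurable M"
proof -
  obtain F where F: "\<And>i. simple_function M (F i)" "\<And>x. x \<in> space M \<Longrightarrow> (\<lambda>i. F i x) \<longlonglongrightarrow> u x"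
    using borel_measurable_implies_sequence_metric[OF u, of 0] by blast
  have gm: "(\<lambda>x. g x s) \<in> borel_measurable M" for s using car by (simp add: caratheodory_def)
  have 1: "(\<lambda>x. g x (F i x)) \<in> borel_measurable M" for i
  proof (rule measurable_compose_countable'[where f="\<lambda>s x. g x s" and I="F i ` space M"])
    show "F i \<in> measurable M (count_space (F i ` space M))"
      using F(1)[of i] by (subst measurable_count_space_eq2) (auto simp: simple_function_def)
    show "countable (F i ` space M)" using F(1)[of i] by (auto simp: simple_function_def intro: countable_finite)
  qed (rule gm)
  have "AE x in M. continuous_on UNIV (g x)" using car by (simp add: caratheodory_def)
  then have "AE x in M. lim (\<lambda>i. g x (F i x)) = g x (u x)"
    using AE_space
  proof eventually_elim
    case (elim x)
    from continuous_on_tendsto_compose[OF elim(1) F(2)[OF elim(2)]] show ?case by (intro limI) simp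
  qed
  from borel_measurable_lebesgue_on_AE[OF sets_\<Omega> borel_measurable_lim_metric[OF 1] this] show ?thesis .
qed

lemma g_abs_le: "AE x in M. \<forall>s. \<bar>g x s\<bar> \<le> (\<bar>d0\<bar> + d1) * \<bar>s\<bar> powr p + (b0 x + b1 x)"
  using g_bounds AE_ab
proof eventually_elim
  case (elim x)
  show ?case
  proof
    fix s
    have "(- \<bar>d0\<bar>) * \<bar>s\<bar> powr p \<le> d0 * \<bar>s\<bar> powr p" by (rule mult_right_mono) auto
    moreover have "0 \<le> \<bar>d0\<bar> * \<bar>s\<bar> powr p" "0 \<le> d1 * \<bar>s\<bar> powr p"
      using d by auto
    moreover have "d0 * \<bar>s\<bar> powr p - b0 x \<le> g x s" "g x s \<le> d1 * \<bar>s\<bar> powr p + b1 x" "0 \<le> b0 x" "0 \<le> b1 x"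
      using elim by auto
    ultimately show "\<bar>g x s\<bar> \<le> (\<bar>d0\<bar> + d1) * \<bar>s\<bar> powr p + (b0 x + b1 x)"
      unfolding distrib_right by linarith
  qed
qed

lemma g_integral:
  assumes u: "u \<in> LpV M p"
  shows "integrable M (\<lambda>x. g x (u x))" "d0 * en u - (LINT x|M. b0 x) \<le> Gi u"
proof -
  note I = LpV_integrable[OF u] integrable_ab
  show int: "integrable M (\<lambda>x. g x (u x))"
  proof (rule Bochner_Integration.integrable_bound)
    show "integrable M (\<lambda>x. (\<bar>d0\<bar> + d1) * norm (u x) powr p + (b0 x + b1 x))" using I by simp
    show "(\<lambda>x. g x (u x)) \<in> borel_measurable M" by (rule g_measurable[OF LpV_measurable[OF u]])
    show "AE x in M. norm (g x (u x)) \<le> norm ((\<bar>d0\<bar> + d1) * norm (u x) powr p + (b0 x + b1 x))"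
      using g_abs_le by (rule eventually_mono) (auto intro: order_trans[OF _ abs_ge_self])
  qed
  have "(LINT x|M. d0 * norm (u x) powr p - b0 x) \<le> Gi u"
    by (rule integral_mono_AE) (use int I g_bounds in \<open>auto elim: eventually_mono\<close>)
  then show "d0 * en u - (LINT x|M. b0 x) \<le> Gi u" using I by (simp add: pint_def)
qed

lemma Gi_tendsto:
  assumes us: "\<And>k::nat. us k \<in> LpV M p" "u \<in> LpV M p" "strongly us u"
  shows "(\<lambda>k. Gi (us k)) \<longlonglongrightarrow> Gi u"
proof (rule integral_caratheodory_tendsto[OF p_bounds(1) us g_integral(1)])
  show "AE x in M. continuous_on UNIV (g x)" using car by (simp add: caratheodory_def)
  show "AE x in M. \<forall>s. \<bar>g x s\<bar> \<le> (\<bar>d0\<bar> + d1) * norm s powr p + (b0 x + b1 x)" using g_abs_le by simp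
qed (use d integrable_ab in auto)

section \<open>Coercivity on the boundary class\<close>

lemma pint_add_le_weighted:
  assumes r: "1 < \<rho>"
  obtains C where "0 \<le> C"
    "\<And>v w :: real^'n \<Rightarrow> 'b::euclidean_space. v \<in> LpV M p \<Longrightarrow> w \<in> LpV M p \<Longrightarrow> en (\<lambda>x. v x + w x) \<le> \<rho> * en v + C * en w"
proof -
  obtain C where C: "0 \<le> C" "\<And>a b :: 'b. norm (a + b) powr p \<le> \<rho> * norm a powr p + C * norm b powr p"
    by (rule norm_powr_add_le_weighted[OF p_gt_1 r]) (rule that)
  show ?thesis
  proof (rule that[OF C(1)])
    fix v w :: "real^'n \<Rightarrow> 'b" assume v: "v \<in> LpV M p" "w \<in> LpV M p"
    note I = LpV_integrable[OF v(1)] LpV_integrable[OF v(2)] LpV_integrable[OF LpV_add[OF v p_bounds(2)]]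
    have "en (\<lambda>x. v x + w x) \<le> (LINT x|M. \<rho> * norm (v x) powr p + C * norm (w x) powr p)"
      unfolding pint_def using C I by (intro integral_mono) auto
    then show "en (\<lambda>x. v x + w x) \<le> \<rho> * en v + C * en w" using I by (simp add: pint_def)
  qed
qed

text \<open>For nonpositive \<open>d0\<close> the negative term is absorbed by the gradient through
  the Poincare inequality for \<open>u - \<phi>\<close>. Returning from \<open>u - \<phi>\<close> to
  \<open>u\<close> costs a factor \<open>\<rho>\<close> for the functions and one for the gradients,
  plus constants depending on \<open>\<phi>\<close>; strictness of the condition on
  \<open>d0\<close> allows \<open>\<rho>\<close> larger than 1.\<close>

lemma coercive:
  obtains \<kappa> C where "0 < \<kappa>" "\<And>u. u \<in> bdry \<Longrightarrow> \<kappa> * (en (grad u) + en u) \<le> c0 * en (grad u) + d0 * en u + C"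
proof (cases "0 < d0")
  case True
  show ?thesis
  proof (rule that[of "min c0 d0" 0])
    show "0 < min c0 d0" using True c by simp
    fix u assume "u \<in> bdry"
    have "min c0 d0 * en (grad u) \<le> c0 * en (grad u)" "min c0 d0 * en u \<le> d0 * en u"
      by (auto intro!: mult_right_mono pint_nonneg)
    then show "min c0 d0 * (en (grad u) + en u) \<le> c0 * en (grad u) + d0 * en u + 0"
      by (simp add: distrib_left)
  qed
next
  case False
  \<comment> \<open>An admissible constant below the supremum is extracted, since the supremum is an
    extended real.\<close>
  have "\<exists>cP. 0 \<le> cP \<and> - d0 < c0 * cP \<and> (\<forall>u\<in>W0. cP * en u \<le> en (grad u))"
  proof (rule ccontr)
    assume n: "\<not> ?thesis"
    have "poincare_const X \<Omega> p \<le> ereal (- d0 / c0)"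
      unfolding poincare_const_def
    proof (rule SUP_least)
      fix cP assume "cP \<in> {c. 0 \<le> c \<and> (\<forall>u\<in>W0.
         c * (LINT x|lebesgue_on \<Omega>. \<bar>u x\<bar> powr p) \<le> (LINT x|lebesgue_on \<Omega>. norm (grad u x) powr p))}"
      then have "\<not> - d0 < c0 * cP" using n by (auto simp: pint_def)
      then show "ereal cP \<le> ereal (- d0 / c0)" using c by (simp add: field_simps)
    qed
    then have "ereal c0 * poincare_const X \<Omega> p \<le> ereal c0 * ereal (- d0 / c0)"
      using c by (intro ereal_mult_left_mono) auto
    also have "\<dots> = ereal (- d0)" using c by simp
    finally have "ereal d0 \<le> - (ereal c0 * poincare_const X \<Omega> p)"
      by (metis ereal_minus_le_minus ereal_uminus_uminus uminus_ereal.simps(1))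
    with d show False by simp
  qed
  then obtain cP where cP: "0 \<le> cP" "- d0 < c0 * cP"
    "\<And>u. u \<in> W0 \<Longrightarrow> cP * en u \<le> en (grad u)" by blast
  have cP0: "0 < cP" using cP(1,2) False c by (cases "cP = 0") auto
  define \<delta> where "\<delta> = - d0"
  have \<delta>: "0 \<le> \<delta>" "\<delta> < c0 * cP" using False cP(2) by (auto simp: \<delta>_def)
  \<comment> \<open>With \<open>s = c0 * cP\<close> its square is
    \<open>(3 * s + \<delta>) / (2 * (s + \<delta>))\<close>. This exceeds 1 because
    \<open>\<delta> < s\<close>, and \<open>\<delta>\<close> times it is still below
    \<open>s\<close>.\<close>
  define \<rho> where "\<rho> = sqrt ((c0 * cP + (\<delta> + c0 * cP) / 2) / (2 * ((\<delta> + c0 * cP) / 2)))"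
  have s: "0 < c0 * cP" using c cP0 by simp
  have \<rho>: "1 < \<rho>" "\<delta> * (\<rho> * \<rho>) < c0 * cP"
  proof -
    have e: "(c0 * cP + (\<delta> + c0 * cP) / 2) / (2 * ((\<delta> + c0 * cP) / 2)) = (3 * (c0 * cP) + \<delta>) / (2 * (\<delta> + c0 * cP))"
      using s \<delta> by (simp add: field_simps)
    show "1 < \<rho>" unfolding \<rho>_def e using s \<delta> by (simp add: field_simps)
    have "\<rho> * \<rho> = (3 * (c0 * cP) + \<delta>) / (2 * (\<delta> + c0 * cP))"
      unfolding \<rho>_def e using s \<delta> by simp
    moreover have "\<delta> * (3 * (c0 * cP) + \<delta>) < c0 * cP * (2 * (\<delta> + c0 * cP))"
    proof -
      have "0 < (c0 * cP - \<delta>) * (2 * (c0 * cP) + \<delta>)" using s \<delta> by (intro mult_pos_pos) auto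
      then show ?thesis by (simp add: algebra_simps)
    qed
    ultimately show "\<delta> * (\<rho> * \<rho>) < c0 * cP" using s \<delta> by (simp add: divide_less_eq)
  qed
  obtain C1 where C1: "0 \<le> C1" "\<And>v w :: real^'n \<Rightarrow> real. v \<in> LpV M p \<Longrightarrow> w \<in> LpV M p \<Longrightarrow>
      en (\<lambda>x. v x + w x) \<le> \<rho> * en v + C1 * en w"
    by (rule pint_add_le_weighted[OF \<rho>(1)]) (rule that)
  obtain C2 where C2: "0 \<le> C2" "\<And>v w :: real^'n \<Rightarrow> real^'m. v \<in> LpV M p \<Longrightarrow> w \<in> LpV M p \<Longrightarrow>
      en (\<lambda>x. v x + w x) \<le> \<rho> * en v + C2 * en w"
    by (rule pint_add_le_weighted[OF \<rho>(1)]) (rule that)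
  note g\<phi> = W1p_Xgrad[OF \<phi>]
  define q where "q = \<rho> * \<rho> / cP"
  define C where "C = \<rho> / cP * (C2 * en (\<lambda>x. - grad \<phi> x)) + C1 * en \<phi>"
  have q: "0 \<le> q" "\<delta> * q < c0" using cP0 \<rho> by (auto simp: q_def field_simps)
  have bd: "en u \<le> q * en (grad u) + C" if u: "u \<in> bdry" for u
  proof -
    let ?w = "\<lambda>x. u x - \<phi> x"
    have gu: "wgrad u (grad u)" by (rule bdry_wgrad[OF u])
    have gw: "wgrad ?w (\<lambda>x. grad u x - grad \<phi> x)" by (rule wgrad_diff[OF gu g\<phi>])
    have m: "(\<lambda>x. - grad \<phi> x) \<in> LpV M p" using LpV_scaleR[OF wgradD(2)[OF g\<phi>], of "-1"] by simp
    have "cP * en ?w \<le> en (\<lambda>x. grad u x - grad \<phi> x)"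
      using cP(3)[OF u[unfolded bdry_iff]] pint_Xgrad[OF gw] by simp
    also have "\<dots> \<le> \<rho> * en (grad u) + C2 * en (\<lambda>x. - grad \<phi> x)"
      using C2(2)[OF wgradD(2)[OF gu] m] by simp
    finally have "en ?w \<le> (\<rho> * en (grad u) + C2 * en (\<lambda>x. - grad \<phi> x)) / cP"
      using cP0 by (simp add: pos_le_divide_eq mult.commute)
    then have "\<rho> * en ?w \<le> \<rho> * ((\<rho> * en (grad u) + C2 * en (\<lambda>x. - grad \<phi> x)) / cP)"
      using \<rho> by (intro mult_left_mono) auto
    also have "\<dots> = q * en (grad u) + \<rho> / cP * (C2 * en (\<lambda>x. - grad \<phi> x))"
      by (simp add: q_def add_divide_distrib distrib_left)
    finally show ?thesis using C1(2)[OF wgradD(1)[OF gw] wgradD(1)[OF g\<phi>]] by (simp add: C_def)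
  qed
  \<comment> \<open>Solves \<open>\<kappa> * (1 + q) = c0 - \<delta> * q\<close>: after inserting
    \<open>en u \<le> q * en (grad u) + C\<close>, the coefficients of the gradient term balance
    exactly.\<close>
  define \<kappa> where "\<kappa> = (c0 - \<delta> * q) / (1 + q)"
  have "\<kappa> * (1 + q) = c0 - \<delta> * q" using q by (simp add: \<kappa>_def)
  then have \<kappa>: "0 < \<kappa>" "\<kappa> + \<kappa> * q = c0 - \<delta> * q" using q by (auto simp: \<kappa>_def distrib_left)
  show ?thesis
  proof (rule that[OF \<kappa>(1), of "(\<kappa> + \<delta>) * C"])
    fix u assume u: "u \<in> bdry"
    have "(\<kappa> + \<delta>) * en u \<le> (\<kappa> + \<delta>) * (q * en (grad u) + C)"
      using bd[OF u] \<kappa> \<delta> by (intro mult_left_mono) auto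
    also have "\<dots> = (\<kappa> * q + \<delta> * q) * en (grad u) + (\<kappa> + \<delta>) * C" by (simp add: algebra_simps)
    also have "\<kappa> * q + \<delta> * q = c0 - \<kappa>" using \<kappa>(2) by simp
    finally show "\<kappa> * (en (grad u) + en u) \<le> c0 * en (grad u) + d0 * en u + (\<kappa> + \<delta>) * C"
      by (simp add: algebra_simps \<delta>_def)
  qed
qed

lemma J_coercive:
  obtains \<kappa> C where "0 < \<kappa>" "\<And>f u. f \<in> cls \<Longrightarrow> u \<in> bdry \<Longrightarrow> \<kappa> * (en (grad u) + en u) \<le> J f u + C"
proof -
  obtain \<kappa> C where \<kappa>: "0 < \<kappa>" "\<And>u. u \<in> bdry \<Longrightarrow> \<kappa> * (en (grad u) + en u) \<le> c0 * en (grad u) + d0 * en u + C"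
    by (rule coercive) (rule that)
  show ?thesis
  proof (rule that[OF \<kappa>(1), of "C + A0 + (LINT x|M. b0 x)"])
    fix f u assume f: "f \<in> cls" and u: "u \<in> bdry"
    show "\<kappa> * (en (grad u) + en u) \<le> J f u + (C + A0 + (LINT x|M. b0 x))"
      using \<kappa>(2)[OF u] integrand_integral(2)[OF f wgradD(2)[OF bdry_wgrad[OF u]]] g_integral(2)[OF wgradD(1)[OF bdry_wgrad[OF u]]]
      by linarith
  qed
qed

end

context variational
begin

text \<open>The direct method with the lower bound left as a parameter \<open>LI\<close>. Weak lower
  semicontinuity supplies it for a fixed integrand and yields existence; the liminf inequality of
  Gamma-convergence supplies it for varying integrands and yields convergence of minimizers. It
  concerns the gradient part alone, because \<open>Gi\<close> is continuous in L^p.\<close>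

lemma almost_minimizers_converge:
  assumes fs: "\<And>k. fs k \<in> cls" and us: "\<And>k::nat. us k \<in> bdry" "\<And>k. J (fs k) (us k) \<le> b k" and b: "b \<longlonglongrightarrow> b'"
    and LI: "\<And>(r :: nat \<Rightarrow> nat) u s. strict_mono r \<Longrightarrow> u \<in> bdry \<Longrightarrow> strongly (\<lambda>k. us (r k)) u \<Longrightarrow>
      (\<And>k. Fi (fs (r k)) (grad (us (r k))) \<le> s) \<Longrightarrow> Fi f (grad u) \<le> s"
  obtains r u where "strict_mono r" "u \<in> bdry" "W1p_converges_weakly X \<Omega> p (us \<circ> r) u" "Lp_converges \<Omega> p (us \<circ> r) u"
    "J f u \<le> b'"
proof -
  obtain \<kappa> C where \<kappa>: "0 < \<kappa>" "\<And>f u. f \<in> cls \<Longrightarrow> u \<in> bdry \<Longrightarrow> \<kappa> * (en (grad u) + en u) \<le> J f u + C"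
    by (rule J_coercive) (rule that)
  obtain B where B: "\<And>k. norm (b k) \<le> B"
    using BseqD[OF convergent_imp_Bseq[OF convergentI[OF b]]] by blast
  define K where "K = (B + C) / \<kappa>"
  note gus = bdry_wgrad[OF us(1)] and g\<phi> = W1p_Xgrad[OF \<phi>]
  have K0: "en (grad (us k)) + en (us k) \<le> K" for k
  proof -
    have "b k \<le> B" using B[of k] by simp
    then have "\<kappa> * (en (grad (us k)) + en (us k)) \<le> B + C"
      using \<kappa>(2)[OF fs us(1), of k k] us(2)[of k] by linarith
    then show ?thesis unfolding K_def using \<kappa>(1) by (simp add: pos_le_divide_eq mult.commute)
  qed
  have K: "en (grad (us k)) \<le> K" "en (us k) \<le> K" for k
    using K0[of k] pint_nonneg[of M p "grad (us k)"] pint_nonneg[of M p "us k"] by linarith+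
  define K' where "K' = 2 powr p * (K + max (en \<phi>) (en (grad \<phi>)))"
  have w0: "(\<lambda>x. us k x - \<phi> x) \<in> W0" for k using us(1) by (simp add: bdry_iff)
  have K': "en (\<lambda>x. us k x - \<phi> x) \<le> K'" "en (\<lambda>x. grad (us k) x - grad \<phi> x) \<le> K'" for k
  proof -
    have "2 powr p * (en (us k) + en \<phi>) \<le> K'" "2 powr p * (en (grad (us k)) + en (grad \<phi>)) \<le> K'"
      unfolding K'_def using K[of k] by (auto intro!: mult_left_mono add_mono)
    then show "en (\<lambda>x. us k x - \<phi> x) \<le> K'" "en (\<lambda>x. grad (us k) x - grad \<phi> x) \<le> K'"
      using pint_diff_le[OF wgradD(1)[OF gus[of k]] wgradD(1)[OF g\<phi>] p_bounds(2)]
        pint_diff_le[OF wgradD(2)[OF gus[of k]] wgradD(2)[OF g\<phi>] p_bounds(2)] by linarith+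
  qed
  obtain r v where r: "strict_mono r" and v: "v \<in> LpV M p"
    "(\<lambda>k. en (\<lambda>x. (us (r k) x - \<phi> x) - v x)) \<longlonglongrightarrow> 0"
    by (rule W1p0_compact[OF w0 wgrad_diff[OF gus g\<phi>] K']) (rule that)
  define u where "u x = v x + \<phi> x" for x
  have u: "u \<in> LpV M p" unfolding u_def[abs_def] by (rule LpV_add[OF v(1) wgradD(1)[OF g\<phi>] p_bounds(2)])
  have lim: "strongly (\<lambda>k. us (r k)) u" using v(2) by (simp add: u_def algebra_simps)
  have ub: "u \<in> bdry" by (rule bdry_closed[OF us(1) K(1) u lim])
  have "W1p_converges_weakly X \<Omega> p (us \<circ> r) u"
    using W1p_weak_convergence[OF gus K(1) u lim] by (simp add: o_def)
  moreover have "Lp_converges \<Omega> p (us \<circ> r) u"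
    using wgradD(1)[OF gus] u lim by (simp add: Lp_converges_iff)
  moreover have "J f u \<le> b'"
  proof (rule field_le_epsilon)
    fix e :: real assume e: "0 < e"
    have br: "(\<lambda>k. b (r k) - Gi (us (r k))) \<longlonglongrightarrow> b' - Gi u"
      using LIMSEQ_subseq_LIMSEQ[OF b r] Gi_tendsto[OF wgradD(1)[OF gus] u lim]
      by (intro tendsto_diff) (simp_all add: o_def)
    from order_tendstoD(2)[OF this, of "b' - Gi u + e"] e obtain N where
      N: "\<And>k. N \<le> k \<Longrightarrow> b (r k) - Gi (us (r k)) < b' - Gi u + e" by (auto simp: eventually_sequentially)
    have "Fi f (grad u) \<le> b' - Gi u + e"
    proof (rule LI[of "\<lambda>k. r (k + N)"])
      show "strict_mono (\<lambda>k. r (k + N))" using r by (simp add: strict_mono_def)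
      show "(\<lambda>k. en (\<lambda>x. us (r (k + N)) x - u x)) \<longlonglongrightarrow> 0" using LIMSEQ_ignore_initial_segment[OF lim, of N] .
      show "Fi (fs (r (k + N))) (grad (us (r (k + N)))) \<le> b' - Gi u + e" for k
        using us(2)[of "r (k + N)"] N[of "k + N"] by simp
    qed (rule ub)
    then show "J f u \<le> b' + e" by simp
  qed
  ultimately show ?thesis using r ub by (intro that)
qed

definition minimizes :: "(real^'n \<Rightarrow> real^'m \<Rightarrow> real) \<Rightarrow> (real^'n \<Rightarrow> real) \<Rightarrow> bool" where
  "minimizes f u \<longleftrightarrow> u \<in> bdry \<and> (\<forall>v\<in>bdry. J f u \<le> J f v)"

lemma minimizer_exists:
  assumes f: "f \<in> cls"
  obtains u where "minimizes f u"
proof -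
  obtain \<kappa> C where \<kappa>: "0 < \<kappa>" "\<And>f u. f \<in> cls \<Longrightarrow> u \<in> bdry \<Longrightarrow> \<kappa> * (en (grad u) + en u) \<le> J f u + C"
    by (rule J_coercive) (rule that)
  have lb: "- C \<le> J f u" if "u \<in> bdry" for u
  proof -
    have "0 \<le> \<kappa> * (en (grad u) + en u)" using \<kappa>(1) by (intro mult_nonneg_nonneg add_nonneg_nonneg pint_nonneg) simp
    with \<kappa>(2)[OF f that] show ?thesis by linarith
  qed
  define m where "m = Inf (J f ` bdry)"
  have bdd: "bdd_below (J f ` bdry)" using lb by (intro bdd_belowI2)
  have ml: "m \<le> J f u" if "u \<in> bdry" for u unfolding m_def using bdd that by (intro cInf_lower) auto
  have "\<forall>k::nat. \<exists>u. u \<in> bdry \<and> J f u \<le> m + 1 / real (Suc k)"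
  proof
    fix k :: nat
    have "Inf (J f ` bdry) < m + 1 / real (Suc k)" by (simp add: m_def)
    from cInf_lessD[OF _ this] show "\<exists>u. u \<in> bdry \<and> J f u \<le> m + 1 / real (Suc k)" using \<phi>_bdry by (auto intro: less_imp_le)
  qed
  from choice[OF this] obtain us where us: "\<And>k. us k \<in> bdry" "\<And>k::nat. J f (us k) \<le> m + 1 / real (Suc k)" by blast
  have lim: "(\<lambda>k. m + 1 / real (Suc k)) \<longlonglongrightarrow> m"
    using tendsto_add[OF tendsto_const[of m] LIMSEQ_inverse_real_of_nat] by (simp add: inverse_eq_divide)
  obtain r u where "u \<in> bdry" "J f u \<le> m"
  proof (rule almost_minimizers_converge[where fs="\<lambda>_. f" and f=f, OF f us lim])
    fix r :: "nat \<Rightarrow> nat" and u s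
    assume u: "u \<in> bdry" "strongly (\<lambda>k. us (r k)) u" "\<And>k. Fi f (grad (us (r k))) \<le> s"
    show "Fi f (grad u) \<le> s" by (rule Fi_lsc[OF f bdry_wgrad[OF us(1)] u(3) bdry_wgrad[OF u(1)] u(2)])
  qed
  then show ?thesis using ml by (intro that[of u]) (auto simp: minimizes_def intro: order_trans)
qed

text \<open>The competitor equals \<open>u\<close> off the support of \<open>\<zeta>\<close> and the
  recovery sequence where \<open>\<zeta> = 1\<close>. The cut-off is fixed before the index, so the
  term with its gradient carries a fixed factor times the p-integral of \<open>us k - u\<close>,
  which vanishes in the limit.\<close>

lemma recovery:
  assumes fs: "\<And>k::nat. fs k \<in> cls" and f: "f \<in> cls" and u: "u \<in> bdry"
    and us: "Lp_converges \<Omega> p us u" "(\<lambda>k. X_functional X \<Omega> p (fs k) (us k)) \<longlonglongrightarrow> X_functional X \<Omega> p f u"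
    and e: "0 < e"
  shows "eventually (\<lambda>k. \<exists>w\<in>bdry. J (fs k) w \<le> J f u + e) sequentially"
proof -
  note gu = bdry_wgrad[OF u]
  \<comment> \<open>Five errors: convergence of the recovery energies, the region where
    \<open>\<zeta> < 1\<close>, the fraction \<open>t\<close> of the energies, the gradient of the
    cut-off, and the lower order term.\<close>
  define \<delta> where "\<delta> = e / 5"
  have \<delta>: "0 < \<delta>" using e by (simp add: \<delta>_def)
  let ?V = "grad u"
  let ?Vk = "\<lambda>k. grad (us k)"
  have usL: "\<And>k. us k \<in> LpV M p" "strongly us u" using us(1) by (simp_all add: Lp_converges_iff)
  have "X_functional X \<Omega> p f u < ereal (Fi f ?V + \<delta>)" using wgrad_W1p[OF gu] \<delta> by (simp add: X_functional_def)
  from order_tendstoD(2)[OF us(2) this]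
  have ev1: "eventually (\<lambda>k. us k \<in> W1p X \<Omega> p \<and> Fi (fs k) (?Vk k) \<le> Fi f ?V + \<delta>) sequentially"
    by (rule eventually_mono) (auto simp: X_functional_def split: if_splits)
  \<comment> \<open>Bound for the gradients of the recovery sequence, from its energies and the
    lower growth condition; it fixes \<open>T\<close>, hence \<open>t\<close>, independently of the
    index.\<close>
  define K where "K = (Fi f ?V + \<delta> + A0) / c0"
  let ?q = "\<lambda>x. c1 * norm (?V x) powr p + a0 x + a1 x"
  note IV = LpV_integrable[OF wgradD(2)[OF gu]]
  have q: "integrable M ?q" using IV integrable_ab by simp
  obtain \<zeta> where \<zeta>: "\<zeta> \<in> test_functions \<Omega>" "\<And>x. 0 \<le> \<zeta> x" "\<And>x. \<zeta> x \<le> 1" "(LINT x|M. (1 - \<zeta> x) * ?q x) < \<delta>"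
    by (rule test_function_cutoff[OF open_\<Omega> q \<delta>]) (rule that)
  have \<zeta>M: "\<zeta> \<in> borel_measurable M" by (rule measurable_lebesgue_on_borel[OF test_functionD(3)[OF \<zeta>(1)]])
  have \<zeta>b: "\<bar>\<zeta> x\<bar> \<le> 1" "\<bar>1 - \<zeta> x\<bar> \<le> 1" for x using \<zeta>(2,3)[of x] by auto
  have Iq: "integrable M (\<lambda>x. (1 - \<zeta> x) * ?q x)"
  proof (rule Bochner_Integration.integrable_bound[OF q])
    show "(\<lambda>x. (1 - \<zeta> x) * ?q x) \<in> borel_measurable M" using \<zeta>M q by (intro borel_measurable_times) auto
    show "AE x in M. norm ((1 - \<zeta> x) * ?q x) \<le> norm (?q x)"
      using \<zeta>b by (intro AE_I2) (simp add: abs_mult mult_left_le_one_le)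
  qed
  obtain B where B: "0 \<le> B" "\<And>x. norm (Xp \<zeta> x) \<le> B"
    by (rule X_pointwise_bounded[OF loc_lip test_functionD(1,2)[OF \<zeta>(1)]]) (rule that)
  define T where "T = A0 + A1 + c1 * (2 powr p * (en ?V + \<bar>K\<bar>))"
  have A: "0 \<le> A0" "0 \<le> A1" using AE_ab by (auto intro!: integral_nonneg_AE elim: eventually_mono)
  have T: "0 \<le> T" unfolding T_def using A c pint_nonneg[of M p ?V]
    by (intro add_nonneg_nonneg mult_nonneg_nonneg) auto
  define t where "t = min (1/2) (\<delta> / (T + 1))"
  have t: "0 < t" "t < 1" "t * T \<le> \<delta>"
  proof -
    show "0 < t" "t < 1" using \<delta> T by (auto simp: t_def)
    have "t * T \<le> \<delta> / (T + 1) * T" using T by (intro mult_right_mono) (auto simp: t_def)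
    also have "\<dots> \<le> \<delta>" using T \<delta> by (simp add: field_simps)
    finally show "t * T \<le> \<delta>" .
  qed
  \<comment> \<open>A negative power of \<open>t\<close> is hidden here; \<open>t\<close> is already
    fixed, so the factor is constant while the p-integral of \<open>us k - u\<close> tends to
    zero.\<close>
  define Q where "Q = t * (c1 * (2 powr p * ((1 / t) powr p * B powr p)))"
  have "(\<lambda>k. Q * en (\<lambda>x. us k x - u x)) \<longlonglongrightarrow> Q * 0" by (intro tendsto_mult tendsto_const usL(2))
  then have ev2: "eventually (\<lambda>k. Q * en (\<lambda>x. us k x - u x) < \<delta>) sequentially"
    using \<delta> by (intro order_tendstoD(2)) auto
  define w where "w k x = u x + \<zeta> x * (us k x - u x)" for k x
  have dL: "(\<lambda>x. us k x - u x) \<in> LpV M p" for k by (rule LpV_diff[OF usL(1) wgradD(1)[OF gu] p_bounds(2)])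
  have wL: "w k \<in> LpV M p" "en (\<lambda>x. w k x - u x) \<le> en (\<lambda>x. us k x - u x)" for k
  proof -
    note m = LpV_mult_bounded[OF dL \<zeta>M \<zeta>b(1), of k]
    show "w k \<in> LpV M p" using LpV_add[OF wgradD(1)[OF gu] m(1) p_bounds(2)] by (simp add: w_def[abs_def])
    show "en (\<lambda>x. w k x - u x) \<le> en (\<lambda>x. us k x - u x)" using m(2) by (simp add: w_def)
  qed
  have "strongly w u"
    by (rule tendsto_sandwich[OF _ _ tendsto_const usL(2)]) (simp_all add: wL(2) pint_nonneg always_eventually)
  from order_tendstoD(2)[OF Gi_tendsto[OF wL(1) wgradD(1)[OF gu] this], of "Gi u + \<delta>"]
  have ev3: "eventually (\<lambda>k. Gi (w k) < Gi u + \<delta>) sequentially" using \<delta> by simp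
  show ?thesis
    using ev1 ev2 ev3
  proof eventually_elim
    case (elim k)
    have gk: "wgrad (us k) (?Vk k)" using elim W1p_Xgrad by blast
    note gd = wgrad_diff[OF gk gu]
    let ?W = "\<lambda>x. ?V x + (\<zeta> x *\<^sub>R (?Vk k x - ?V x) + (us k x - u x) *\<^sub>R Xp \<zeta> x)"
    have gw: "wgrad (w k) ?W" unfolding w_def[abs_def] by (rule wgrad_add[OF gu wgrad_mult_test(1)[OF gd \<zeta>(1)]])
    have "(\<lambda>x. 1 * (u x - \<phi> x) + 1 * (\<zeta> x * (us k x - u x))) \<in> W0"
      by (rule W1p0_lincomb[OF u[unfolded bdry_iff] W1p0_mult_test[OF gd \<zeta>(1)]])
    then have wb: "w k \<in> bdry" by (simp add: bdry_iff w_def algebra_simps)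
    have Kk: "en (?Vk k) \<le> \<bar>K\<bar>"
    proof -
      have "c0 * en (?Vk k) \<le> Fi f ?V + \<delta> + A0"
        using integrand_integral(2)[OF fs[of k] wgradD(2)[OF gk]] elim by linarith
      then have "en (?Vk k) \<le> K" unfolding K_def using c(1) by (simp add: pos_le_divide_eq mult.commute)
      then show ?thesis by simp
    qed
    let ?R = "\<lambda>x. fs k x (?Vk k x) + (1 - \<zeta> x) * ?q x
      + t * (a0 x + a1 x + c1 * (2 powr p * (norm (?V x) powr p + norm (?Vk k x) powr p)))
      + Q * norm (us k x - u x) powr p"
    note I = integrand_integral(1)[OF fs[of k] wgradD(2)[OF gk]] Iq IV integrable_ab
      LpV_integrable[OF wgradD(2)[OF gk]] LpV_integrable[OF dL[of k]]
    have "Fi (fs k) ?W \<le> (LINT x|M. ?R x)"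
    proof (rule integral_mono_AE)
      show "integrable M (\<lambda>x. fs k x (?W x))" by (rule integrand_integral(1)[OF fs wgradD(2)[OF gw]])
      show "integrable M ?R"
        by (intro Bochner_Integration.integrable_add integrable_mult_right I)
      show "AE x in M. fs k x (?W x) \<le> ?R x"
        using integrand_AE[OF fs[of k]]
      proof eventually_elim
        case (elim x)
        let ?E = "(us k x - u x) *\<^sub>R Xp \<zeta> x"
        have h: "convex_on UNIV (fs k x)" "\<And>y. - a0 x \<le> fs k x y" "\<And>y. fs k x y \<le> c1 * norm y powr p + a1 x" "0 \<le> c1" "0 \<le> a0 x" "0 \<le> a1 x"
          using elim c by auto
        have "norm ?E powr p \<le> B powr p * norm (us k x - u x) powr p"
        proof -
          have "norm ?E \<le> B * norm (us k x - u x)" using B(2)[of x] by (simp add: mult.commute mult_right_mono)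
          then have "norm ?E powr p \<le> (B * norm (us k x - u x)) powr p" using p_bounds by (intro powr_mono2) auto
          then show ?thesis using B(1) by (simp add: powr_mult)
        qed
        then have "t * (c1 * (2 powr p * ((1 / t) powr p * norm ?E powr p))) \<le> t * (c1 * (2 powr p * ((1 / t) powr p * (B powr p * norm (us k x - u x) powr p))))"
          using t h(4) by (intro mult_left_mono) auto
        also have "\<dots> = Q * norm (us k x - u x) powr p" by (simp only: Q_def mult.assoc)
        finally have "t * (c1 * (2 powr p * ((1 / t) powr p * norm ?E powr p))) \<le> Q * norm (us k x - u x) powr p" .
        with convex_cutoff_bound[OF h \<zeta>(2)[of x] \<zeta>(3)[of x] t(1,2) p_bounds(3), of "?V x" "?Vk k x" ?E]
        show ?case by linarith
      qed
    qed
    also have "(LINT x|M. ?R x) = Fi (fs k) (?Vk k) + (LINT x|M. (1 - \<zeta> x) * ?q x)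
      + t * (A0 + A1 + c1 * (2 powr p * (en ?V + en (?Vk k)))) + Q * en (\<lambda>x. us k x - u x)"
    proof -
      have gen: "(LINT x|M. F x + H x + t * S x + Q * N x) = (LINT x|M. F x) + (LINT x|M. H x) + t * (LINT x|M. S x) + Q * (LINT x|M. N x)"
        if "integrable M F" "integrable M H" "integrable M S" "integrable M N" for F H S N :: "real^'n \<Rightarrow> real"
        using that by simp
      have "(LINT x|M. a0 x + a1 x + c1 * (2 powr p * (norm (?V x) powr p + norm (?Vk k x) powr p)))
        = A0 + A1 + c1 * (2 powr p * (en ?V + en (?Vk k)))"
        using I by (simp add: pint_def)
      moreover have "(LINT x|M. ?R x) = Fi (fs k) (?Vk k) + (LINT x|M. (1 - \<zeta> x) * ?q x)
        + t * (LINT x|M. a0 x + a1 x + c1 * (2 powr p * (norm (?V x) powr p + norm (?Vk k x) powr p)))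
        + Q * (LINT x|M. norm (us k x - u x) powr p)"
        by (rule gen) (intro Bochner_Integration.integrable_add integrable_mult_right I)+
      ultimately show ?thesis by (simp only: pint_def)
    qed
    also have "t * (A0 + A1 + c1 * (2 powr p * (en ?V + en (?Vk k)))) \<le> t * T"
      unfolding T_def using Kk t c by (intro mult_left_mono add_left_mono) auto
    finally have "Fi (fs k) ?W \<le> Fi (fs k) (?Vk k) + (LINT x|M. (1 - \<zeta> x) * ?q x) + t * T + Q * en (\<lambda>x. us k x - u x)"
      by simp
    then have "J (fs k) (w k) \<le> J f u + 5 * \<delta>"
      using Fi_grad[OF fs[of k] gw] elim \<zeta>(4) t(3) by linarith
    then show ?case using wb by (auto simp: \<delta>_def)
  qed
qed

section \<open>Minimization over L^p as minimization of a real functional over the boundary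
  class\<close>

lemma \<Xi>_eq: "\<Xi> X \<Omega> p f g \<phi> u = (if u \<in> bdry then ereal (J f u) else \<infinity>)"
  using wgrad_W1p[OF bdry_wgrad, of u]
  by (auto simp: \<Xi>_def X_functional_def lower_order_functional_def bdry_indicator_def)

lemma bdry_Lp: "u \<in> bdry \<Longrightarrow> u \<in> Lp \<Omega> p"
  using wgradD(1)[OF bdry_wgrad] by (simp add: Lp_eq_LpV)

lemma minimizer_Lp_iff: "minimizer_Lp \<Omega> p (\<Xi> X \<Omega> p f g \<phi>) u \<longleftrightarrow> minimizes f u"
proof
  assume m: "minimizer_Lp \<Omega> p (\<Xi> X \<Omega> p f g \<phi>) u"
  have le: "\<Xi> X \<Omega> p f g \<phi> u \<le> \<Xi> X \<Omega> p f g \<phi> v" if "v \<in> bdry" for v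
    using m bdry_Lp[OF that] by (auto simp: minimizer_Lp_def is_arg_min_def not_less)
  have "u \<in> bdry" using le[OF \<phi>_bdry] \<phi>_bdry by (auto simp: \<Xi>_eq split: if_splits)
  with le show "minimizes f u" by (auto simp: minimizes_def \<Xi>_eq)
next
  assume "minimizes f u"
  then show "minimizer_Lp \<Omega> p (\<Xi> X \<Omega> p f g \<phi>) u"
    using bdry_Lp by (auto simp: minimizes_def minimizer_Lp_def is_arg_min_def \<Xi>_eq not_less)
qed

lemma INF_\<Xi>:
  assumes "minimizes f u"
  shows "(INF v\<in>Lp \<Omega> p. \<Xi> X \<Omega> p f g \<phi> v) = ereal (J f u)"
proof (rule antisym)
  have u: "u \<in> bdry" using assms by (simp add: minimizes_def)
  show "(INF v\<in>Lp \<Omega> p. \<Xi> X \<Omega> p f g \<phi> v) \<le> ereal (J f u)"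
    by (rule INF_lower2[OF bdry_Lp[OF u]]) (simp add: \<Xi>_eq u)
  show "ereal (J f u) \<le> (INF v\<in>Lp \<Omega> p. \<Xi> X \<Omega> p f g \<phi> v)"
    using assms by (intro INF_greatest) (auto simp: \<Xi>_eq minimizes_def)
qed

text \<open>Gamma-convergence speaks about full sequences. The subsequence is completed by the
  constant value \<open>u\<close> at the missing indices, which preserves convergence, and the
  liminf of the full sequence is at most that along the subsequence.\<close>

lemma gamma_liminf_subseq:
  assumes \<Gamma>: "gamma_converges_Lp \<Omega> p (\<lambda>h. X_functional X \<Omega> p (fs h)) (X_functional X \<Omega> p f)"
    and r: "strict_mono (r :: nat \<Rightarrow> nat)" and u: "u \<in> bdry" and us: "\<And>k. us k \<in> bdry" "strongly us u"
    and le: "\<And>k. Fi (fs (r k)) (grad (us k)) \<le> s"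
  shows "Fi f (grad u) \<le> s"
proof -
  define v where "v h = (if h \<in> range r then us (inv r h) else u)" for h
  have vr: "v (r k) = us k" for k using strict_mono_imp_inj_on[OF r] by (simp add: v_def)
  have "strongly v u"
  proof (rule order_tendstoI)
    fix y :: real assume "y < 0"
    then show "eventually (\<lambda>h. y < en (\<lambda>x. v h x - u x)) sequentially"
      using pint_nonneg by (intro always_eventually allI) (rule less_le_trans)
  next
    fix y :: real assume y: "0 < y"
    obtain N where N: "\<And>k. N \<le> k \<Longrightarrow> en (\<lambda>x. us k x - u x) < y"
      using order_tendstoD(2)[OF us(2) y] by (auto simp: eventually_sequentially)
    have "en (\<lambda>x. v h x - u x) < y" if h: "r N \<le> h" for h
    proof (cases "h \<in> range r")
      case True
      then obtain k where k: "h = r k" by blast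
      with h r have "N \<le> k" by (simp add: strict_mono_less_eq)
      then show ?thesis using N vr k by simp
    next
      case False
      then show ?thesis using y p_bounds by (simp add: v_def pint_zero)
    qed
    then show "eventually (\<lambda>h. en (\<lambda>x. v h x - u x) < y) sequentially" by (auto simp: eventually_sequentially)
  qed
  then have conv: "Lp_converges \<Omega> p v u"
    using bdry_wgrad[OF us(1)] bdry_wgrad[OF u] by (auto simp: Lp_converges_iff v_def intro: wgradD(1))
  have "X_functional X \<Omega> p f u \<le> liminf (\<lambda>h. X_functional X \<Omega> p (fs h) (v h))"
    using \<Gamma> conv bdry_Lp[OF u] by (simp add: gamma_converges_Lp_def)
  also have "\<dots> \<le> liminf ((\<lambda>h. X_functional X \<Omega> p (fs h) (v h)) \<circ> r)" by (rule liminf_subseq_mono[OF r])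
  also have "\<dots> \<le> liminf (\<lambda>k. ereal s)"
    using le wgrad_W1p[OF bdry_wgrad[OF us(1)]] by (intro Liminf_mono always_eventually allI) (simp add: vr X_functional_def)
  also have "\<dots> = ereal s" by (simp add: Liminf_const)
  finally show ?thesis using wgrad_W1p[OF bdry_wgrad[OF u]] by (simp add: X_functional_def)
qed

text \<open>Upper bound: minima lie below the energies of the recovery competitors. Lower bound: a
  subsequence of minima below a level \<open>y\<close> under the limit minimum would produce an
  element of the boundary class with energy at most \<open>y\<close>.\<close>

theorem minima_converge:
  assumes fs: "\<And>h. fs h \<in> cls" and f: "f \<in> cls"
    and \<Gamma>: "gamma_converges_Lp \<Omega> p (\<lambda>h. X_functional X \<Omega> p (fs h)) (X_functional X \<Omega> p f)"
    and us: "\<And>h. minimizes (fs h) (us h)" and u: "minimizes f u"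
  shows "(\<lambda>h. J (fs h) (us h)) \<longlonglongrightarrow> J f u"
    and "\<exists>ubar\<in>bdry. \<exists>r. strict_mono r \<and> W1p_converges_weakly X \<Omega> p (us \<circ> r) ubar \<and>
      Lp_converges \<Omega> p (us \<circ> r) ubar \<and> J f ubar = J f u"
proof -
  have usb: "\<And>h. us h \<in> bdry" and ub: "u \<in> bdry" using us u by (simp_all add: minimizes_def)
  have LI: "Fi f (grad v) \<le> s" if "strict_mono r" "v \<in> bdry" "strongly (\<lambda>k. us (r k)) v"
      "\<And>k. Fi (fs (r k)) (grad (us (r k))) \<le> s" for r :: "nat \<Rightarrow> nat" and v s
    by (rule gamma_liminf_subseq[OF \<Gamma> that(1,2) usb that(3,4)])
  show lim: "(\<lambda>h. J (fs h) (us h)) \<longlonglongrightarrow> J f u"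
  proof (rule order_tendstoI)
    fix y assume y: "y < J f u"
    show "eventually (\<lambda>h. y < J (fs h) (us h)) sequentially"
    proof (rule ccontr)
      assume n: "\<not> ?thesis"
      obtain r :: "nat \<Rightarrow> nat" where r: "strict_mono r" "\<And>k. \<not> y < J (fs (r k)) (us (r k))"
        by (rule not_eventually_subseq[OF n]) (rule that)
      have le: "J (fs (r k)) (us (r k)) \<le> y" for k using r(2)[of k] by simp
      obtain r' v where "v \<in> bdry" "J f v \<le> y"
      proof (rule almost_minimizers_converge[where fs="\<lambda>k. fs (r k)" and f=f and us="\<lambda>k. us (r k)", OF fs usb le tendsto_const])
        fix r' :: "nat \<Rightarrow> nat" and v s
        assume a: "strict_mono r'" "v \<in> bdry" "(\<lambda>k. en (\<lambda>x. us (r (r' k)) x - v x)) \<longlonglongrightarrow> 0"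
          "\<And>k. Fi (fs (r (r' k))) (grad (us (r (r' k)))) \<le> s"
        show "Fi f (grad v) \<le> s"
          by (rule LI[of "\<lambda>k. r (r' k)"]) (use a strict_mono_o[OF r(1) a(1)] in \<open>simp_all add: o_def\<close>)
      qed
      then show False using u y by (auto simp: minimizes_def)
    qed
  next
    fix y assume y: "J f u < y"
    obtain ws where ws: "Lp_converges \<Omega> p ws u" "(\<lambda>k. X_functional X \<Omega> p (fs k) (ws k)) \<longlonglongrightarrow> X_functional X \<Omega> p f u"
      using \<Gamma> bdry_Lp[OF ub] unfolding gamma_converges_Lp_def by blast
    have e: "0 < (y - J f u) / 2" using y by simp
    show "eventually (\<lambda>h. J (fs h) (us h) < y) sequentially"
      using recovery[OF fs f ub ws e]
    proof eventually_elim
      case (elim h)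
      then obtain w where "w \<in> bdry" "J (fs h) w \<le> J f u + (y - J f u) / 2" by blast
      moreover have "J (fs h) (us h) \<le> J (fs h) w" using us[of h] \<open>w \<in> bdry\<close> by (simp add: minimizes_def)
      ultimately show ?case using y by (simp add: field_simps)
    qed
  qed
  obtain r v where "strict_mono r" "v \<in> bdry" "W1p_converges_weakly X \<Omega> p (us \<circ> r) v" "Lp_converges \<Omega> p (us \<circ> r) v" "J f v \<le> J f u"
    by (rule almost_minimizers_converge[where f=f, OF fs usb order_refl lim LI]) (assumption | rule that)+
  moreover have "J f u \<le> J f v" using u \<open>v \<in> bdry\<close> by (simp add: minimizes_def)
  ultimately show "\<exists>ubar\<in>bdry. \<exists>r. strict_mono r \<and> W1p_converges_weakly X \<Omega> p (us \<circ> r) ubar \<and>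
      Lp_converges \<Omega> p (us \<circ> r) ubar \<and> J f ubar = J f u"
    by (intro bexI[of _ v] exI[of _ r]) auto
qed

end

theorem theorem1p2:
  fixes X :: "real^'n::finite \<Rightarrow> real^'n^'m::finite"
    and \<Omega> \<Omega>0 :: "(real^'n) set"
    and p c0 c1 d0 d1 :: real
    and a0 a1 b0 b1 \<phi> :: "real^'n \<Rightarrow> real"
    and fh :: "nat \<Rightarrow> real^'n \<Rightarrow> real^'m \<Rightarrow> real"
    and f :: "real^'n \<Rightarrow> real^'m \<Rightarrow> real"
    and g :: "real^'n \<Rightarrow> real \<Rightarrow> real"
  assumes "open \<Omega>" "bounded \<Omega>" "connected \<Omega>"
    and "1 < p"
    and "open \<Omega>0" "closure \<Omega> \<subseteq> \<Omega>0"
    and "\<exists>L. L-lipschitz_on \<Omega>0 X" "loc_lipschitz X"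
    and "LIC X \<Omega>"
    and "H1 X \<Omega>0" "H2 X \<Omega>0" "H3 X \<Omega>0"
    and "0 < c0" "c0 \<le> c1" "nonneg_L1 \<Omega> a0" "nonneg_L1 \<Omega> a1"
    and "\<And>h. fh h \<in> integrands \<Omega> p c0 c1 a0 a1"
    and "f \<in> integrands \<Omega> p c0 c1 a0 a1"
    and "caratheodory \<Omega> g" "nonneg_L1 \<Omega> b0" "nonneg_L1 \<Omega> b1"
    and "AE x in lebesgue_on \<Omega>. \<forall>s. d0 * \<bar>s\<bar> powr p - b0 x \<le> g x s \<and> g x s \<le> d1 * \<bar>s\<bar> powr p + b1 x"
    and "0 < d1" "- (ereal c0 * poincare_const X \<Omega> p) < ereal d0" "d0 \<le> d1"
    and "\<phi> \<in> W1p X \<Omega> p"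
    and "gamma_converges_Lp \<Omega> p (\<lambda>h. X_functional X \<Omega> p (fh h)) (X_functional X \<Omega> p f)"
  shows "((\<forall>h. \<exists>u. minimizer_Lp \<Omega> p (\<Xi> X \<Omega> p (fh h) g \<phi>) u) \<and>
          (\<exists>u. minimizer_Lp \<Omega> p (\<Xi> X \<Omega> p f g \<phi>) u) \<and>
          (\<lambda>h. INF u\<in>Lp \<Omega> p. \<Xi> X \<Omega> p (fh h) g \<phi> u) \<longlonglongrightarrow> (INF u\<in>Lp \<Omega> p. \<Xi> X \<Omega> p f g \<phi> u)) \<and>
         (\<forall>us. (\<forall>h. minimizer_Lp \<Omega> p (\<Xi> X \<Omega> p (fh h) g \<phi>) (us h)) \<longrightarrow>
           (\<exists>ubar\<in>W1p_bdry X \<Omega> p \<phi>. \<exists>r. strict_mono r \<and>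
              W1p_converges_weakly X \<Omega> p (us \<circ> r) ubar \<and>
              Lp_converges \<Omega> p (us \<circ> r) ubar \<and>
              \<Xi> X \<Omega> p f g \<phi> ubar = (INF u\<in>Lp \<Omega> p. \<Xi> X \<Omega> p f g \<phi> u)))"
proof -
  interpret variational X \<Omega> p \<Omega>0 c0 c1 d0 d1 a0 a1 b0 b1 \<phi> g
    by unfold_locales (fact assms)+
  have f: "f \<in> cls" and fh: "\<And>h. fh h \<in> cls" by (fact assms)+
  obtain u where u: "minimizes f u" by (rule minimizer_exists[OF f]) (rule that)
  have "\<forall>h. \<exists>u. minimizes (fh h) u" using minimizer_exists[OF fh] by blast
  from choice[OF this] obtain us where us: "\<And>h. minimizes (fh h) (us h)" by blast
  \<comment> \<open>The sequence of minimizers stays open: a chosen one gives the limit of the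
    minima, an arbitrary one gives the second claim.\<close>
  note conv = minima_converge[OF fh f assms(27) _ u]
  have "(\<lambda>h. ereal (J (fh h) (us h))) \<longlonglongrightarrow> ereal (J f u)"
    by (rule tendsto_ereal[OF conv(1)[OF us]])
  then have lim: "(\<lambda>h. INF u\<in>Lp \<Omega> p. \<Xi> X \<Omega> p (fh h) g \<phi> u) \<longlonglongrightarrow> (INF u\<in>Lp \<Omega> p. \<Xi> X \<Omega> p f g \<phi> u)"
    by (simp only: INF_\<Xi>[OF us] INF_\<Xi>[OF u])
  have "\<exists>ubar\<in>bdry. \<exists>r. strict_mono r \<and> W1p_converges_weakly X \<Omega> p (vs \<circ> r) ubar \<and> Lp_converges \<Omega> p (vs \<circ> r) ubar \<and>
      \<Xi> X \<Omega> p f g \<phi> ubar = (INF u\<in>Lp \<Omega> p. \<Xi> X \<Omega> p f g \<phi> u)" if vs: "\<And>h. minimizes (fh h) (vs h)" for vs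
  proof -
    obtain ubar r where "ubar \<in> bdry" "strict_mono r" "W1p_converges_weakly X \<Omega> p (vs \<circ> r) ubar" "Lp_converges \<Omega> p (vs \<circ> r) ubar"
      "J f ubar = J f u" using conv(2)[OF vs] by blast
    moreover from this have "\<Xi> X \<Omega> p f g \<phi> ubar = ereal (J f u)" by (simp add: \<Xi>_eq)
    then have "\<Xi> X \<Omega> p f g \<phi> ubar = (INF u\<in>Lp \<Omega> p. \<Xi> X \<Omega> p f g \<phi> u)" by (simp only: INF_\<Xi>[OF u])
    ultimately show ?thesis by blast
  qed
  with lim us u show ?thesis unfolding minimizer_Lp_iff by blast
qed

end
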